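(* The following assertions hold for the system $$\begin{aligned} \partial_t v + v\cdot\nabla v +(\dot a -\dot\omega)\times x + 2(a-\omega)\times v-\nu \Delta v +\nabla p & =0 &&\text{in } \Omega\times(0,\infty), \\ \operatorname{div} v &= 0 &&\text{in } \Omega\times(0,\infty), \\ v &=0 &&\text{on } \partial\Omega\times(0,\infty), \\ \mathbb I\, \dot a + (a-\omega)\times\mathbb I a &=0 &&\text{in }\mathbb R^3\times(0,\infty),\\ (v(0),a(0))&= (v_0, a_0). \end{aligned}$$ (a) The total angular momentum is conserved: $|\mathbb I a(t)|=|\mathbb I a_0|$ for all times. (b) The energy $\mathsf E(v,a)=\frac12\big[|v|_{L_2(\Omega)}^2-(\mathbb I\omega|\omega)+(\mathbb I a|a)\big]$ is a strict Lyapunov functional, i.e. the function $t\mapsto \mathsf E(v(t),a(t))$ is strictly decreasing along non-constant (sufficiently smooth) solutions. (c) The set of equilibria is $$\mathcal E=\{(0,a_* ): a_*\in \mathsf N(\lambda_*-\mathbb I),\ \lambda_*\in\{\lambda_1,\lambda_2,\lambda_3\}\},$$ (the nontrivial equilibria being those with $a_*\neq0$), with constant pressure $p$ in each case. More precisely: (i) if $\lambda_1=\lambda_2=\lambda_3$, then $\mathcal E=\{0\}\times\mathbb R^3$; (ii) if $\lambda_i\ne\lambda_j=\lambda_k$ with $\{i,j,k\}=\{1,2,3\}$, then $\mathcal E=\bigcup_{\ell=i,j}\{0\}\times\mathsf N(\lambda_\ell-\mathbb I)$; (iii) if $\lambda_1,\lambda_2,\lambda_3$ are pairwise distinct, then $\mathcal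 E=\bigcup_{j=1}^3\{0\}\times\mathsf N(\lambda_j-\mathbb I)$. (d) The critical points of the energy $\mathsf E$ with prescribed total momentum, i.e. under a constraint $\mathsf M(a):=\frac12(\mathbb I a|\mathbb I a)=\mathsf M_0$, are precisely the equilibria of the system (with that total momentum). (e) If the energy $\mathsf E$ with prescribed nonzero total momentum ($\mathsf M=\mathsf M_0\neq0$) has a local minimum at a critical point $(0,a_* )$, where $\mathbb I a_*=\lambda_*a_*$, then necessarily $\lambda_*=\max\{\lambda_1,\lambda_2,\lambda_3\}$.
   Context: $\Omega\subset\mathbb R^3$ is a bounded domain with boundary of class $C^3$: the cavity of a rigid body, completely filled by a viscous incompressible fluid of density $1$ and kinematic viscosity $\nu>0$. The frame is attached to the body, with origin at the center of mass $G$ of the whole system (body plus fluid) and axes along the principal axes of inertia of the whole system. $\mathbb I=\mathrm{diag}[\lambda_1,\lambda_2,\lambda_3]$ is the inertia tensor of the whole system with respect to $G$, that is $\mathbb I=\mathbb I_B+\int_\Omega(|x|^2\,\mathrm{Id}-x\otimes x)\,dx$, with $\mathbb I_B$ the (symmetric, positive definite) inertia tensor of the solid body with respect to $G$; in particular $\lambda_j>0$. $v$ is the fluid velocity relative to the body, $p$ the pressure, $a\in\mathbb R^3$, $\mathbb I a$ is the total angular momentum, and $$\omega:=\mathbb I^{-1}\int_\Omega x\times v\,dx .$$ It is known that there is a constant $c\in(0,1]$ with $c|v|^2_{L_2(\Omega)}\le |v|^2_{L_2(\Omega)}-(\mathbb I\omega|\omega)\le|v|^2_{L_2(\Omega)}$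 for all $v\in L_2(\Omega)$. $(\cdot|\cdot)$ and $|\cdot|$ are the Euclidean inner product and norm on $\mathbb R^3$; $\mathsf N(\cdot)$ denotes the null space. $L_{2,\sigma}(\Omega)$ is the space of $v\in L_2(\Omega;\mathbb R^3)$ with $\operatorname{div}v=0$ and zero normal component on $\partial\Omega$; ${}_0H^2_{2,\sigma}(\Omega)=\{v\in H^2_2(\Omega)\cap L_{2,\sigma}(\Omega): v=0\text{ on }\partial\Omega\}$. "Sufficiently smooth solutions" on $(0,T)$ means: $v\in H^1_2((0,T);L_{2,\sigma}(\Omega))\cap L_2((0,T);{}_0H^2_{2,\sigma}(\Omega))$, $a\in H^1_\infty((0,T))$, $p\in L_2((0,T);H^1_2(\Omega))$, satisfying the equations a.e. An equilibrium is a time-independent solution $(v,a)$. A critical point of $\mathsf E$ under the constraint $\mathsf M=\mathsf M_0$ is a point $(v_*,a_* )\in L_{2,\sigma}(\Omega)\times\mathbb R^3$ with $\mathsf M(a_* )=\mathsf M_0$ for which there is a Lagrange multiplier $\mu\in\mathbb R$ with $\mathsf E'(v_*,a_* )+\mu\,\mathsf M'(a_* )=0$. *)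

theory Defs
  imports "HOL-Analysis.Analysis"
begin

text \<open>
  Elements of Lebesgue and Sobolev spaces are represented by functions on the whole space; only
  the values on \<open>\<Omega>\<close> matter, up to null sets. The zero vector of \<open>L\<^sub>2(\<Omega>)\<close> thus is the following
  set of representatives.
\<close>

definition zero_L2 :: "(real^3) set \<Rightarrow> (real^3 \<Rightarrow> real^3) set" where
  "zero_L2 \<Omega> = {v. AE x in lebesgue_on \<Omega>. v x = 0}"


subsection \<open>Domains with boundary of class \<open>C\<^sup>3\<close>\<close>

fun Ck_on :: "nat \<Rightarrow> 'a::real_normed_vector set \<Rightarrow> ('a \<Rightarrow> 'b::real_normed_vector) \<Rightarrow> bool" where
  "Ck_on 0 S f \<longleftrightarrow> continuous_on S f"
| "Ck_on (Suc k) S f \<longleftrightarrow> (\<forall>x\<in>S. f differentiable (at x)) \<and>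
     (\<forall>h. Ck_on k S (\<lambda>x. frechet_derivative f (at x) h))"

text \<open>
  Near each boundary point, in suitable Cartesian coordinates, the domain is the region above the
  graph of a \<open>C\<^sup>3\<close> function of two variables.
\<close>

definition bounded_C3_domain :: "(real^3) set \<Rightarrow> bool" where
  "bounded_C3_domain \<Omega> \<longleftrightarrow> open \<Omega> \<and> connected \<Omega> \<and> \<Omega> \<noteq> {} \<and> bounded \<Omega> \<and>
     (\<forall>x0\<in>frontier \<Omega>. \<exists>r>0. \<exists>Q :: real^3 \<Rightarrow> real^3. \<exists>\<gamma> :: real^2 \<Rightarrow> real.
        orthogonal_transformation Q \<and> Ck_on 3 UNIV \<gamma> \<and>
        \<Omega> \<inter> ball x0 r =
          {x \<in> ball x0 r. \<gamma> (vector [Q (x - x0) $ 1, Q (x - x0) $ 2]) < Q (x - x0) $ 3})"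


subsection \<open>Lebesgue and Sobolev spaces on \<open>\<Omega>\<close>\<close>

definition L2 :: "(real^3) set \<Rightarrow> (real^3 \<Rightarrow> 'b::euclidean_space) set" where
  "L2 \<Omega> = {u. u \<in> borel_measurable (lebesgue_on \<Omega>) \<and>
               integrable (lebesgue_on \<Omega>) (\<lambda>x. (norm (u x))\<^sup>2)}"

definition inner_L2 ::
  "(real^3) set \<Rightarrow> (real^3 \<Rightarrow> 'b::euclidean_space) \<Rightarrow> (real^3 \<Rightarrow> 'b) \<Rightarrow> real" where
  "inner_L2 \<Omega> u w = (LINT x|lebesgue_on \<Omega>. u x \<bullet> w x)"

definition norm_L2 :: "(real^3) set \<Rightarrow> (real^3 \<Rightarrow> 'b::euclidean_space) \<Rightarrow> real" where
  "norm_L2 \<Omega> u = sqrt (inner_L2 \<Omega> u u)"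

definition test_function :: "(real^3) set \<Rightarrow> (real^3 \<Rightarrow> 'b::euclidean_space) \<Rightarrow> bool" where
  "test_function \<Omega> \<phi> \<longleftrightarrow> (\<forall>k. Ck_on k UNIV \<phi>) \<and>
     compact (closure {x. \<phi> x \<noteq> 0}) \<and> closure {x. \<phi> x \<noteq> 0} \<subseteq> \<Omega>"

definition partial :: "3 \<Rightarrow> (real^3 \<Rightarrow> 'b::real_normed_vector) \<Rightarrow> real^3 \<Rightarrow> 'b" where
  "partial i \<phi> x = frechet_derivative \<phi> (at x) (axis i 1)"

definition locally_integrable :: "(real^3) set \<Rightarrow> (real^3 \<Rightarrow> 'b::euclidean_space) \<Rightarrow> bool" where
  "locally_integrable \<Omega> u \<longleftrightarrow> (\<forall>K. compact K \<and> K \<subseteq> \<Omega> \<longrightarrow> integrable (lebesgue_on K) u)"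

definition has_weak_partial ::
  "(real^3) set \<Rightarrow> 3 \<Rightarrow> (real^3 \<Rightarrow> 'b::euclidean_space) \<Rightarrow> (real^3 \<Rightarrow> 'b) \<Rightarrow> bool" where
  "has_weak_partial \<Omega> i u g \<longleftrightarrow> locally_integrable \<Omega> u \<and> locally_integrable \<Omega> g \<and>
     (\<forall>\<phi> :: real^3 \<Rightarrow> real. test_function \<Omega> \<phi> \<longrightarrow>
        (LINT x|lebesgue_on \<Omega>. partial i \<phi> x *\<^sub>R u x) = - (LINT x|lebesgue_on \<Omega>. \<phi> x *\<^sub>R g x))"

text \<open>Weak derivatives are unique up to null sets, so the choice made here is immaterial.\<close>

definition weak_partial ::
  "(real^3) set \<Rightarrow> 3 \<Rightarrow> (real^3 \<Rightarrow> 'b::euclidean_space) \<Rightarrow> real^3 \<Rightarrow> 'b" where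
  "weak_partial \<Omega> i u = (SOME g. has_weak_partial \<Omega> i u g)"

definition weak_grad :: "(real^3) set \<Rightarrow> (real^3 \<Rightarrow> real) \<Rightarrow> real^3 \<Rightarrow> real^3" where
  "weak_grad \<Omega> p x = (\<chi> i. weak_partial \<Omega> i p x)"

definition weak_div :: "(real^3) set \<Rightarrow> (real^3 \<Rightarrow> real^3) \<Rightarrow> real^3 \<Rightarrow> real" where
  "weak_div \<Omega> v x = (\<Sum>i\<in>UNIV. weak_partial \<Omega> i v x $ i)"

definition weak_laplacian :: "(real^3) set \<Rightarrow> (real^3 \<Rightarrow> real^3) \<Rightarrow> real^3 \<Rightarrow> real^3" where
  "weak_laplacian \<Omega> v x = (\<Sum>i\<in>UNIV. weak_partial \<Omega> i (weak_partial \<Omega> i v) x)"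

text \<open>The convective term \<open>v \<cdot> \<nabla>v\<close>.\<close>

definition convection :: "(real^3) set \<Rightarrow> (real^3 \<Rightarrow> real^3) \<Rightarrow> real^3 \<Rightarrow> real^3" where
  "convection \<Omega> v x = (\<Sum>i\<in>UNIV. v x $ i *\<^sub>R weak_partial \<Omega> i v x)"

definition H1 :: "(real^3) set \<Rightarrow> (real^3 \<Rightarrow> 'b::euclidean_space) set" where
  "H1 \<Omega> = {u \<in> L2 \<Omega>. \<forall>i. \<exists>g\<in>L2 \<Omega>. has_weak_partial \<Omega> i u g}"

definition H2 :: "(real^3) set \<Rightarrow> (real^3 \<Rightarrow> 'b::euclidean_space) set" where
  "H2 \<Omega> = {u \<in> H1 \<Omega>. \<forall>i. weak_partial \<Omega> i u \<in> H1 \<Omega>}"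

definition norm_H1 :: "(real^3) set \<Rightarrow> (real^3 \<Rightarrow> 'b::euclidean_space) \<Rightarrow> real" where
  "norm_H1 \<Omega> u = sqrt ((norm_L2 \<Omega> u)\<^sup>2 + (\<Sum>i\<in>UNIV. (norm_L2 \<Omega> (weak_partial \<Omega> i u))\<^sup>2))"

definition norm_H2 :: "(real^3) set \<Rightarrow> (real^3 \<Rightarrow> 'b::euclidean_space) \<Rightarrow> real" where
  "norm_H2 \<Omega> u = sqrt ((norm_L2 \<Omega> u)\<^sup>2 + (\<Sum>i\<in>UNIV. (norm_H1 \<Omega> (weak_partial \<Omega> i u))\<^sup>2))"

text \<open>
  The boundary condition \<open>u = 0\<close> on \<open>\<partial>\<Omega>\<close> for \<open>u\<close> in \<open>H\<^sup>1(\<Omega>)\<close>: \<open>u\<close> is a limit of test functions.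
\<close>

definition H1_0 :: "(real^3) set \<Rightarrow> (real^3 \<Rightarrow> 'b::euclidean_space) set" where
  "H1_0 \<Omega> = {u \<in> H1 \<Omega>. \<exists>\<phi> :: nat \<Rightarrow> real^3 \<Rightarrow> 'b. (\<forall>n. test_function \<Omega> (\<phi> n)) \<and>
                 (\<lambda>n. norm_H1 \<Omega> (\<lambda>x. \<phi> n x - u x)) \<longlonglongrightarrow> 0}"

text \<open>
  For a field \<open>v\<close> in \<open>L\<^sub>2(\<Omega>)\<close> the divergence is understood in the sense of distributions. If it
  vanishes, the normal component of \<open>v\<close> on \<open>\<partial>\<Omega>\<close> is the functional sending the trace of
  \<open>\<phi>\<close> in \<open>H\<^sup>1(\<Omega>)\<close> to the integral of \<open>v \<cdot> \<nabla>\<phi> + \<phi> div v = v \<cdot> \<nabla>\<phi>\<close> over \<open>\<Omega>\<close>.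
\<close>

definition L2_sigma :: "(real^3) set \<Rightarrow> (real^3 \<Rightarrow> real^3) set" where
  "L2_sigma \<Omega> = {v \<in> L2 \<Omega>.
     (\<forall>\<phi>. test_function \<Omega> \<phi> \<longrightarrow> (LINT x|lebesgue_on \<Omega>. v x \<bullet> (\<chi> i. partial i \<phi> x)) = 0) \<and>
     (\<forall>\<phi>\<in>H1 \<Omega>. (LINT x|lebesgue_on \<Omega>. v x \<bullet> weak_grad \<Omega> \<phi> x) = 0)}"

definition H2_0_sigma :: "(real^3) set \<Rightarrow> (real^3 \<Rightarrow> real^3) set" where
  "H2_0_sigma \<Omega> = H2 \<Omega> \<inter> L2_sigma \<Omega> \<inter> H1_0 \<Omega>"


subsection \<open>Functions of time with values in a function space\<close>

text \<open>
  \<open>u\<close> belongs to \<open>L\<^sub>2((0,T);X)\<close>, where \<open>X\<close> is a function space with norm \<open>N\<close>: strong measurability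
  is approximability by simple functions, pointwise almost everywhere in the norm \<open>N\<close>.
\<close>

definition bochner_L2 :: "real \<Rightarrow> (real^3 \<Rightarrow> 'b::euclidean_space) set \<Rightarrow>
    ((real^3 \<Rightarrow> 'b) \<Rightarrow> real) \<Rightarrow> (real \<Rightarrow> real^3 \<Rightarrow> 'b) \<Rightarrow> bool" where
  "bochner_L2 T X N u \<longleftrightarrow>
     (AE t in lebesgue_on {0<..<T}. u t \<in> X) \<and>
     (\<exists>s. (\<forall>n. simple_function (lebesgue_on {0<..<T}) (s n)) \<and> (\<forall>n. \<forall>t\<in>{0<..<T}. s n t \<in> X) \<and>
        (AE t in lebesgue_on {0<..<T}. (\<lambda>n. N (\<lambda>x. s n t x - u t x)) \<longlonglongrightarrow> 0)) \<and>
     integrable (lebesgue_on {0<..<T}) (\<lambda>t. (N (u t))\<^sup>2)"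

text \<open>
  \<open>v\<close> is the continuous representative of an element of \<open>H\<^sup>1\<^sub>2((0,T);L\<^sub>2\<^sub>,\<^sub>\<sigma>(\<Omega>))\<close> and \<open>v'\<close> is its
  time derivative, i.e. \<open>v(t) - v(s)\<close> is the Bochner integral in \<open>L\<^sub>2(\<Omega>)\<close> of \<open>v'\<close> over \<open>(s,t)\<close>.
  As this space is a Hilbert space, the value of the integral is determined by its inner products
  with arbitrary \<open>h\<close>.
\<close>

definition H1_time_L2_sigma ::
  "(real^3) set \<Rightarrow> real \<Rightarrow> (real \<Rightarrow> real^3 \<Rightarrow> real^3) \<Rightarrow> (real \<Rightarrow> real^3 \<Rightarrow> real^3) \<Rightarrow> bool" where
  "H1_time_L2_sigma \<Omega> T v v' \<longleftrightarrow>
     (\<forall>t\<in>{0..T}. v t \<in> L2_sigma \<Omega>) \<and>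
     bochner_L2 T (L2_sigma \<Omega>) (norm_L2 \<Omega>) v \<and>
     bochner_L2 T (L2_sigma \<Omega>) (norm_L2 \<Omega>) v' \<and>
     (\<forall>s t. 0 \<le> s \<and> s \<le> t \<and> t \<le> T \<longrightarrow> (\<forall>h\<in>L2 \<Omega>.
        inner_L2 \<Omega> (\<lambda>x. v t x - v s x) h = (LINT \<tau>|lebesgue_on {s..t}. inner_L2 \<Omega> (v' \<tau>) h)))"

text \<open>
  \<open>f'\<close> is the weak derivative on \<open>(0,T)\<close> of \<open>f\<close>, \<open>f\<close> being the continuous representative.
\<close>

definition has_weak_time_deriv :: "real \<Rightarrow> (real \<Rightarrow> real^3) \<Rightarrow> (real \<Rightarrow> real^3) \<Rightarrow> bool" where
  "has_weak_time_deriv T f f' \<longleftrightarrow> integrable (lebesgue_on {0<..<T}) f' \<and>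
     (\<forall>s t. 0 \<le> s \<and> s \<le> t \<and> t \<le> T \<longrightarrow> f t - f s = (LINT \<tau>|lebesgue_on {s..t}. f' \<tau>))"

definition H1_infinity_time :: "real \<Rightarrow> (real \<Rightarrow> real^3) \<Rightarrow> (real \<Rightarrow> real^3) \<Rightarrow> bool" where
  "H1_infinity_time T a a' \<longleftrightarrow> has_weak_time_deriv T a a' \<and>
     (\<exists>C. AE t in lebesgue_on {0<..<T}. norm (a' t) \<le> C)"


subsection \<open>The fluid-filled rigid body\<close>

definition diag_matrix :: "real^3 \<Rightarrow> real^3^3" where
  "diag_matrix l = (\<chi> i j. if i = j then l $ i else 0)"

text \<open>The integral of \<open>|x|\<^sup>2 Id - x \<otimes> x\<close> over \<open>\<Omega>\<close> (the fluid has density 1).\<close>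

definition fluid_inertia :: "(real^3) set \<Rightarrow> real^3^3" where
  "fluid_inertia \<Omega> =
     (LINT x|lebesgue_on \<Omega>. mat ((norm x)\<^sup>2) - (\<chi> i j. x $ i * x $ j))"

definition omega :: "(real^3) set \<Rightarrow> real^3^3 \<Rightarrow> (real^3 \<Rightarrow> real^3) \<Rightarrow> real^3" where
  "omega \<Omega> I v = matrix_inv I *v (LINT x|lebesgue_on \<Omega>. cross3 x (v x))"

definition energy :: "(real^3) set \<Rightarrow> real^3^3 \<Rightarrow> (real^3 \<Rightarrow> real^3) \<Rightarrow> real^3 \<Rightarrow> real" where
  "energy \<Omega> I v a = 1/2 * ((norm_L2 \<Omega> v)\<^sup>2 - (I *v omega \<Omega> I v) \<bullet> omega \<Omega> I v + (I *v a) \<bullet> a)"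

definition momentum :: "real^3^3 \<Rightarrow> real^3 \<Rightarrow> real" where
  "momentum I a = 1/2 * ((I *v a) \<bullet> (I *v a))"

text \<open>
  Sufficiently smooth solutions on \<open>(0,T)\<close>; \<open>v'\<close>, \<open>a'\<close>, \<open>w'\<close> are the time derivatives of \<open>v\<close>, \<open>a\<close>,
  \<open>\<omega>\<close>. The no-slip condition is part of membership in \<open>H2_0_sigma\<close>.
\<close>

definition solution_on :: "(real^3) set \<Rightarrow> real \<Rightarrow> real^3^3 \<Rightarrow> real \<Rightarrow>
    (real \<Rightarrow> real^3 \<Rightarrow> real^3) \<Rightarrow> (real \<Rightarrow> real^3) \<Rightarrow> (real \<Rightarrow> real^3 \<Rightarrow> real) \<Rightarrow>
    (real^3 \<Rightarrow> real^3) \<Rightarrow> real^3 \<Rightarrow> bool" where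
  "solution_on \<Omega> \<nu> I T v a p v0 a0 \<longleftrightarrow>
     bochner_L2 T (H2_0_sigma \<Omega>) (norm_H2 \<Omega>) v \<and>
     bochner_L2 T (H1 \<Omega>) (norm_H1 \<Omega>) p \<and>
     (\<exists>v' a' w'.
        H1_time_L2_sigma \<Omega> T v v' \<and>
        H1_infinity_time T a a' \<and>
        has_weak_time_deriv T (\<lambda>t. omega \<Omega> I (v t)) w' \<and>
        (AE t in lebesgue_on {0<..<T}. AE x in lebesgue_on \<Omega>.
           v' t x + convection \<Omega> (v t) x + cross3 (a' t - w' t) x
             + 2 *\<^sub>R cross3 (a t - omega \<Omega> I (v t)) (v t x)
             - \<nu> *\<^sub>R weak_laplacian \<Omega> (v t) x + weak_grad \<Omega> (p t) x = 0) \<and>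
        (AE t in lebesgue_on {0<..<T}. AE x in lebesgue_on \<Omega>. weak_div \<Omega> (v t) x = 0) \<and>
        (AE t in lebesgue_on {0<..<T}.
           I *v a' t + cross3 (a t - omega \<Omega> I (v t)) (I *v a t) = 0)) \<and>
     (AE x in lebesgue_on \<Omega>. v 0 x = v0 x) \<and> a 0 = a0"

definition constant_on_time ::
  "(real^3) set \<Rightarrow> real \<Rightarrow> (real \<Rightarrow> real^3 \<Rightarrow> real^3) \<Rightarrow> (real \<Rightarrow> real^3) \<Rightarrow> bool" where
  "constant_on_time \<Omega> T v a \<longleftrightarrow>
     (\<exists>w b. \<forall>t\<in>{0..T}. (AE x in lebesgue_on \<Omega>. v t x = w x) \<and> a t = b)"

text \<open>The pressure belonging to a time-independent \<open>(v, a)\<close> is left unrestricted.\<close>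

definition equilibria :: "(real^3) set \<Rightarrow> real \<Rightarrow> real^3^3 \<Rightarrow> ((real^3 \<Rightarrow> real^3) \<times> (real^3)) set" where
  "equilibria \<Omega> \<nu> I =
     {(v, a). \<exists>p. \<forall>T>0. solution_on \<Omega> \<nu> I T (\<lambda>_. v) (\<lambda>_. a) p v a}"

definition null_space :: "real^3^3 \<Rightarrow> (real^3) set" where
  "null_space A = {a. A *v a = 0}"


subsection \<open>Critical points and local minima of the energy with prescribed momentum\<close>

text \<open>
  Frechet derivative of \<open>F\<close> at \<open>(v, a)\<close> in the Hilbert space \<open>L\<^sub>2\<^sub>,\<^sub>\<sigma>(\<Omega>) \<times> \<real>\<^sup>3\<close>. The norm
  of a pair \<open>(h, k)\<close> is that of the pair \<open>(norm_L2 \<Omega> h, k)\<close>.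
\<close>

definition has_frechet_deriv :: "(real^3) set \<Rightarrow> ((real^3 \<Rightarrow> real^3) \<Rightarrow> real^3 \<Rightarrow> real) \<Rightarrow>
    (real^3 \<Rightarrow> real^3) \<Rightarrow> real^3 \<Rightarrow> ((real^3 \<Rightarrow> real^3) \<Rightarrow> real^3 \<Rightarrow> real) \<Rightarrow> bool" where
  "has_frechet_deriv \<Omega> F v a D \<longleftrightarrow>
     (\<forall>h1\<in>L2_sigma \<Omega>. \<forall>h2\<in>L2_sigma \<Omega>. \<forall>k1 k2.
        D (\<lambda>x. h1 x + h2 x) (k1 + k2) = D h1 k1 + D h2 k2) \<and>
     (\<forall>c. \<forall>h\<in>L2_sigma \<Omega>. \<forall>k. D (\<lambda>x. c *\<^sub>R h x) (c *\<^sub>R k) = c * D h k) \<and>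
     (\<exists>C. \<forall>h\<in>L2_sigma \<Omega>. \<forall>k. \<bar>D h k\<bar> \<le> C * norm (norm_L2 \<Omega> h, k)) \<and>
     (\<forall>\<epsilon>>0. \<exists>\<delta>>0. \<forall>h\<in>L2_sigma \<Omega>. \<forall>k. norm (norm_L2 \<Omega> h, k) < \<delta> \<longrightarrow>
        \<bar>F (\<lambda>x. v x + h x) (a + k) - F v a - D h k\<bar> \<le> \<epsilon> * norm (norm_L2 \<Omega> h, k))"

definition critical_points ::
  "(real^3) set \<Rightarrow> real^3^3 \<Rightarrow> real \<Rightarrow> ((real^3 \<Rightarrow> real^3) \<times> (real^3)) set" where
  "critical_points \<Omega> I M0 = {(v, a). v \<in> L2_sigma \<Omega> \<and> momentum I a = M0 \<and>
     (\<exists>\<mu> DE DM. has_frechet_deriv \<Omega> (energy \<Omega> I) v a DE \<and>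
        (momentum I has_derivative DM) (at a) \<and>
        (\<forall>h\<in>L2_sigma \<Omega>. \<forall>k. DE h k + \<mu> * DM k = 0))}"

definition constrained_local_min ::
  "(real^3) set \<Rightarrow> real^3^3 \<Rightarrow> real \<Rightarrow> (real^3 \<Rightarrow> real^3) \<Rightarrow> real^3 \<Rightarrow> bool" where
  "constrained_local_min \<Omega> I M0 v a \<longleftrightarrow> v \<in> L2_sigma \<Omega> \<and> momentum I a = M0 \<and>
     (\<exists>\<delta>>0. \<forall>w\<in>L2_sigma \<Omega>. \<forall>b. momentum I b = M0 \<and>
        norm (norm_L2 \<Omega> (\<lambda>x. w x - v x), b - a) < \<delta> \<longrightarrow> energy \<Omega> I v a \<le> energy \<Omega> I w b)"

end

theory Submission
  imports Defs
begin

text \<open>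
  The energy is dissipated at the rate \<open>\<nu> |\<nabla>v|\<^sup>2\<close>, so it fails to decrease only on an interval where \<open>v\<close>
  vanishes. There the momentum equation says that \<open>a' \<times> x\<close> is a gradient, hence \<open>a' = 0\<close> and \<open>a = b\<close>
  with \<open>b \<times> I b = 0\<close>. Such a solution is constant throughout by uniqueness forward and
  backward in time: \<open>y = |v|\<^sup>2 - (I \<omega> | \<omega>) + |a - b|\<^sup>2\<close> satisfies \<open>y' = - 2 \<nu> |\<nabla>v|\<^sup>2 + O(y)\<close>, and the quotient
  \<open>\<nu> |\<nabla>v|\<^sup>2 / y\<close> stays bounded, so that \<open>y\<close> cannot reach zero. The convective term is controlled by
  \<open>|v \<cdot> \<nabla>v|\<^sup>2 \<le> C |\<Delta>v| |\<nabla>v|\<^sup>3\<close>, which needs no elliptic regularity: test \<open>\<Delta>v\<close> with \<open>|v|\<^sup>2 v\<close> and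
  use the Sobolev inequality. Equilibria and critical points are both characterised by
  \<open>v = 0\<close> and \<open>a \<times> I a = 0\<close>; turning \<open>I a\<close> towards the axis of the largest moment of inertia lowers the energy.
\<close>

text \<open>Strict decrease on the whole interval is the demanding claim: a solution that moves at
  first and reaches an equilibrium in finite time would have constant energy from then on, so such
  an arrival must be excluded. A lower bound for \<open>y\<close> requires \<nu> |\<nabla>v|^2 \<le>
  L y, and the quotient is followed in time as in the Dirichlet quotient method. Two obstacles shape
  the proof. And no sup bound on \<open>v\<close> is at hand, so the growth rate of the quotient has
  to be integrable in time: |\<Delta>v| |\<nabla>v|^3 \<le> |\<nabla>v|^2 (|\<Delta>v|^2 +
  |\<nabla>v|^2) supplies such a rate. That \<open>y\<close> is comparable to a squared distance
  rests on the positive inertia of the solid.\<close>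

lemmas HK_combine = Henstock_Kurzweil_Integration.integral_combine
lemmas integrable_dominated = Bochner_Integration.integrable_bound
lemmas HK_diff = Henstock_Kurzweil_Integration.integral_diff

subsection \<open>Smooth functions and cut-offs\<close>

lemma Ck_SucI:
  assumes "\<And>x. (f has_derivative D x) (at x)" and "\<And>h. Ck_on k UNIV (\<lambda>x. D x h)"
  shows "Ck_on (Suc k) UNIV f"
proof -
  have "frechet_derivative f (at x) = D x" for x
    using frechet_derivative_at[OF assms(1)] by simp
  then show ?thesis
    using assms by (auto simp: differentiable_def)
qed

lemma Ck_SucD:
  assumes "Ck_on (Suc k) UNIV f"
  shows "(f has_derivative frechet_derivative f (at x)) (at x)"
    and "Ck_on k UNIV (\<lambda>x. frechet_derivative f (at x) h)"
  using assms frechet_derivative_works by auto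

lemma Ck_mono: "Ck_on (Suc k) UNIV f \<Longrightarrow> Ck_on k UNIV f"
proof (induction k arbitrary: f)
  case 0
  then show ?case
    by (auto simp: continuous_at_imp_continuous_on differentiable_imp_continuous_within)
next
  case (Suc k)
  show ?case
    by (rule Ck_SucI[OF Ck_SucD(1)[OF Suc.prems]], rule Suc.IH[OF Ck_SucD(2)[OF Suc.prems]])
qed

lemma Ck_continuous: "Ck_on k UNIV f \<Longrightarrow> continuous_on UNIV f"
  by (induction k arbitrary: f) (auto simp: Ck_mono simp del: Ck_on.simps(2))

lemma Ck_const: "Ck_on k UNIV (\<lambda>x. c)"
proof (induction k arbitrary: c)
  case (Suc k)
  show ?case by (rule Ck_SucI[OF has_derivative_const]) (rule Suc)
qed simp

lemma Ck_linear:
  assumes L: "bounded_linear L" and "Ck_on k UNIV f"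
  shows "Ck_on k UNIV (\<lambda>x. L (f x))"
  using assms(2)
proof (induction k arbitrary: f)
  case 0
  then show ?case
    by (auto intro: bounded_linear.continuous_on[OF L])
next
  case (Suc k)
  show ?case
    by (rule Ck_SucI[OF bounded_linear.has_derivative[OF L Ck_SucD(1)[OF Suc.prems]]])
      (rule Suc.IH[OF Ck_SucD(2)[OF Suc.prems]])
qed

lemma Ck_add:
  assumes "Ck_on k UNIV f" "Ck_on k UNIV g"
  shows "Ck_on k UNIV (\<lambda>x. f x + g x)"
  using assms
proof (induction k arbitrary: f g)
  case 0
  then show ?case by (auto intro: continuous_on_add)
next
  case (Suc k)
  show ?case
    by (rule Ck_SucI[OF has_derivative_add[OF Ck_SucD(1)[OF Suc.prems(1)] Ck_SucD(1)[OF Suc.prems(2)]]])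
      (rule Suc.IH[OF Ck_SucD(2)[OF Suc.prems(1)] Ck_SucD(2)[OF Suc.prems(2)]])
qed

lemma Ck_bilinear:
  assumes B: "bounded_bilinear B" and "Ck_on k UNIV f" "Ck_on k UNIV g"
  shows "Ck_on k UNIV (\<lambda>x. B (f x) (g x))"
  using assms(2,3)
proof (induction k arbitrary: f g)
  case 0
  then show ?case by (auto intro: bounded_bilinear.continuous_on[OF B])
next
  case (Suc k)
  show ?case
    by (rule Ck_SucI[OF bounded_bilinear.FDERIV[OF B Ck_SucD(1)[OF Suc.prems(1)] Ck_SucD(1)[OF Suc.prems(2)]]])
      (intro Ck_add Suc.IH Ck_SucD(2) Ck_mono[OF Suc.prems(1)] Ck_mono[OF Suc.prems(2)] Suc.prems)
qed

lemma Ck_id: "Ck_on k UNIV (\<lambda>x. x)"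
proof (cases k)
  case (Suc m)
  show ?thesis unfolding Suc
    by (rule Ck_SucI[OF has_derivative_ident]) (rule Ck_const)
qed simp

lemma Ck_inverse:
  fixes f :: "'a::real_normed_vector \<Rightarrow> real"
  assumes "Ck_on k UNIV f" "\<And>x. f x \<noteq> 0"
  shows "Ck_on k UNIV (\<lambda>x. inverse (f x))"
  using assms
proof (induction k arbitrary: f)
  case 0
  then show ?case by (auto intro: continuous_on_inverse)
next
  case (Suc k)
  have i: "Ck_on k UNIV (\<lambda>x. inverse (f x))"
    by (rule Suc.IH[OF Ck_mono[OF Suc.prems(1)] Suc.prems(2)])
  have "Ck_on k UNIV (\<lambda>x. - (inverse (f x) * frechet_derivative f (at x) h * inverse (f x)))" for h
    by (intro Ck_linear[OF bounded_linear_minus[OF bounded_linear_ident]]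
        Ck_bilinear[OF bounded_bilinear_mult] i Ck_SucD(2) Suc.prems)
  then show ?case
    by (rule Ck_SucI[OF Deriv.has_derivative_inverse[OF Suc.prems(2) Ck_SucD(1)[OF Suc.prems(1)]]])
qed

lemma Ck_compose:
  fixes f :: "'a::real_normed_vector \<Rightarrow> real" and g :: "real \<Rightarrow> real"
  assumes "Ck_on k UNIV g" "Ck_on k UNIV f"
  shows "Ck_on k UNIV (\<lambda>x. g (f x))"
  using assms
proof (induction k arbitrary: f g)
  case 0
  then show ?case using continuous_on_compose2[of UNIV g UNIV f] by auto
next
  case (Suc k)
  \<comment> \<open>A derivative on the real line is multiplication by its value at 1. This turns
    the chain rule into a product, to which \<open>Ck_bilinear\<close> and the induction hypothesis
    apply.\<close>
  have lin: "frechet_derivative g (at y) s = s * frechet_derivative g (at y) 1" for y s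
    using linear_scale[OF has_derivative_linear[OF Ck_SucD(1)[OF Suc.prems(1)]], of y s 1] by simp
  have D: "((\<lambda>x. g (f x)) has_derivative
      (\<lambda>h. frechet_derivative g (at (f x)) (frechet_derivative f (at x) h))) (at x)" for x
    using diff_chain_at[OF Ck_SucD(1)[OF Suc.prems(2)] Ck_SucD(1)[OF Suc.prems(1)]]
    by (simp add: o_def)
  have "Ck_on k UNIV (\<lambda>x. frechet_derivative g (at (f x)) (frechet_derivative f (at x) h))" for h
    using Ck_bilinear[OF bounded_bilinear_mult Ck_SucD(2)[OF Suc.prems(2), of h]
        Suc.IH[OF Ck_SucD(2)[OF Suc.prems(1), of 1] Ck_mono[OF Suc.prems(2)]]]
    by (simp only: lin[symmetric])
  then show ?case by (rule Ck_SucI[OF D])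
qed

definition smooth :: "('a::real_normed_vector \<Rightarrow> 'b::real_normed_vector) \<Rightarrow> bool" where
  "smooth f \<longleftrightarrow> (\<forall>k. Ck_on k UNIV f)"

lemma smooth_const: "smooth (\<lambda>x. c)" by (simp add: smooth_def Ck_const)
lemma smooth_id: "smooth (\<lambda>x. x)" by (simp add: smooth_def Ck_id)
lemma smooth_linear: "bounded_linear L \<Longrightarrow> smooth f \<Longrightarrow> smooth (\<lambda>x. L (f x))"
  by (simp add: smooth_def Ck_linear)
lemma smooth_add: "smooth f \<Longrightarrow> smooth g \<Longrightarrow> smooth (\<lambda>x. f x + g x)"
  by (simp add: smooth_def Ck_add)
lemma smooth_bilinear: "bounded_bilinear B \<Longrightarrow> smooth f \<Longrightarrow> smooth g \<Longrightarrow> smooth (\<lambda>x. B (f x) (g x))"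
  by (simp add: smooth_def Ck_bilinear)
lemmas smooth_mult = smooth_bilinear[OF bounded_bilinear_mult]
lemmas smooth_scaleR = smooth_bilinear[OF bounded_bilinear_scaleR]
lemmas smooth_inner = smooth_bilinear[OF bounded_bilinear_inner]
lemma smooth_inverse: "smooth f \<Longrightarrow> (\<And>x. f x \<noteq> 0) \<Longrightarrow> smooth (\<lambda>x. inverse (f x :: real))"
  by (simp add: smooth_def Ck_inverse)
lemma smooth_compose: "smooth (g :: real \<Rightarrow> real) \<Longrightarrow> smooth f \<Longrightarrow> smooth (\<lambda>x. g (f x))"
  by (simp add: smooth_def Ck_compose)
lemma smooth_minus: "smooth f \<Longrightarrow> smooth (\<lambda>x. - f x)"
  by (rule smooth_linear[OF bounded_linear_minus[OF bounded_linear_ident]])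
lemma smooth_diff: "smooth f \<Longrightarrow> smooth g \<Longrightarrow> smooth (\<lambda>x. f x - g x)"
  using smooth_add[OF _ smooth_minus, of f g] by simp
lemma smooth_vec_nth: "smooth f \<Longrightarrow> smooth (\<lambda>x. f x $ i)"
  by (rule smooth_linear[OF bounded_linear_vec_nth])
lemma smooth_prod:
  fixes f :: "'i \<Rightarrow> 'a::real_normed_vector \<Rightarrow> real"
  shows "(\<And>i. i \<in> A \<Longrightarrow> smooth (f i)) \<Longrightarrow> smooth (\<lambda>x. \<Prod>i\<in>A. f i x)"
  by (induction A rule: infinite_finite_induct) (auto intro: smooth_const smooth_mult)
lemma smooth_continuous: "smooth f \<Longrightarrow> continuous_on A f"
  unfolding smooth_def using Ck_continuous continuous_on_subset by blast
lemma smooth_has_derivative: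
  "smooth f \<Longrightarrow> (f has_derivative frechet_derivative f (at x)) (at x)"
  unfolding smooth_def using Ck_SucD(1) by blast
lemma smooth_frechet: "smooth f \<Longrightarrow> smooth (\<lambda>x. frechet_derivative f (at x) h)"
  unfolding smooth_def using Ck_SucD(2) by blast

text \<open>For \<open>k = 0\<close> this is the classical function exp(-1/x), extended by zero. The
  powers of 1/x are included because the family is then closed under differentiation up to linear
  combinations (\<open>flat_deriv\<close>), so one induction gives smoothness of all
  members.\<close>

definition flat :: "nat \<Rightarrow> real \<Rightarrow> real" where
  "flat k x = (if x \<le> 0 then 0 else inverse x ^ k * exp (- inverse x))"

text \<open>The single term of index \<open>k + 2\<close> in the series of exp(1/x) beats
  \<open>inverse x ^ k\<close> by two powers of \<open>x\<close>. The quadratic bound makes the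
  difference quotient at 0 tend to 0.\<close>

lemma flat_le:
  assumes "x > 0" shows "flat k x \<le> fact (k + 2) * x\<^sup>2"
proof -
  define c :: real where "c = fact (k + 2)"
  have c: "c > 0" unfolding c_def by (rule fact_gt_zero)
  have "inverse x ^ (k+2) /\<^sub>R c \<le> exp (inverse x)"
    using sum_le_suminf[OF summable_exp_generic, of "{k+2}" "inverse x"] assms
    unfolding exp_def c_def by simp
  then have "inverse x ^ (k+2) \<le> c * exp (inverse x)"
    using c by (simp only: real_scaleR_def) (simp only: inverse_eq_divide[of c] mult_1_left times_divide_eq_left pos_divide_le_eq mult.commute)
  then have "inverse x ^ (k+2) * (x\<^sup>2 * exp (- inverse x)) \<le> (c * exp (inverse x)) * (x\<^sup>2 * exp (- inverse x))"
    by (intro mult_right_mono) auto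
  moreover have "inverse x ^ (k+2) * (x\<^sup>2 * exp (- inverse x)) = inverse x ^ k * exp (- inverse x)"
    using assms by (simp add: power_add field_simps power2_eq_square)
  moreover have "(c * exp (inverse x)) * (x\<^sup>2 * exp (- inverse x)) = c * x\<^sup>2"
    by (simp add: exp_minus)
  ultimately show ?thesis
    using assms by (simp only: c_def flat_def not_le[symmetric] if_False)
qed

lemma flat_nonneg: "flat k x \<ge> 0"
  by (simp add: flat_def)

lemma flat_pos: "flat k x > 0 \<longleftrightarrow> x > 0"
  by (simp add: flat_def)

lemma flat_deriv:
  "(flat k has_real_derivative (flat (k + 2) x - k * flat (k + 1) x)) (at x)"
proof -
  consider "x < 0" | "x = 0" | "x > 0" by linarith
  then show ?thesis
  proof cases
    case 1
    have "((\<lambda>x. 0) has_real_derivative 0) (at x)" by simp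
    moreover have "\<forall>\<^sub>F y in nhds x. flat k y = 0"
      using eventually_nhds_in_open[of "{..<0}" x] 1
      by (auto elim!: eventually_mono simp: flat_def)
    ultimately show ?thesis
      using 1 by (subst DERIV_cong_ev[OF refl _ refl]) (auto simp: flat_def)
  next
    case 2
    define c :: real where "c = fact (k + 2)"
    have c: "c > 0" unfolding c_def by (rule fact_gt_zero)
    have "((\<lambda>y. (flat k (0 + y) - flat k 0) / y) \<longlongrightarrow> 0) (at 0)"
    proof (rule Lim_null_comparison)
      show "((\<lambda>y. c * \<bar>y\<bar>) \<longlongrightarrow> 0) (at (0::real))"
        by (auto intro!: tendsto_eq_intros)
      have "norm ((flat k (0 + y) - flat k 0) / y) \<le> c * \<bar>y\<bar>" for y
      proof (cases "y > 0")
        case True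
        then show ?thesis using flat_le[OF True, of k, folded c_def] flat_nonneg[of k y]
          by (simp add: flat_def[of _ 0] field_simps power2_eq_square)
      next
        case False
        then have "flat k y = 0" "flat k 0 = 0" by (simp_all add: flat_def)
        then show ?thesis using c by (simp only: add_0 diff_self div_0 norm_zero) (intro mult_nonneg_nonneg; simp)
      qed
      then show "\<forall>\<^sub>F y in at 0. norm ((flat k (0 + y) - flat k 0) / y) \<le> c * \<bar>y\<bar>"
        by simp
    qed
    then show ?thesis
      unfolding 2 DERIV_def by (simp add: flat_def)
  next
    case 3
    have "((\<lambda>y. inverse y ^ k * exp (- inverse y)) has_real_derivative
        (flat (k + 2) x - k * flat (k + 1) x)) (at x)"
      using 3
      apply (auto intro!: derivative_eq_intros simp: flat_def)
      apply (cases k; simp add: field_simps power2_eq_square)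
      done
    moreover have "\<forall>\<^sub>F y in nhds x. flat k y = inverse y ^ k * exp (- inverse y)"
      using eventually_nhds_in_open[of "{0<..}" x] 3
      by (auto elim!: eventually_mono simp: flat_def)
    ultimately show ?thesis
      by (subst DERIV_cong_ev[OF refl _ refl])
  qed
qed

lemma smooth_flat: "smooth (flat k)"
proof -
  have "Ck_on m UNIV (flat k)" for m
  proof (induction m arbitrary: k)
    case 0
    show ?case
      using DERIV_isCont[OF flat_deriv] by (auto simp: continuous_on_eq_continuous_at)
  next
    case (Suc m)
    have "Ck_on m UNIV (\<lambda>x. flat (k + 2) x + (- real k) * flat (k + 1) x)"
      by (intro Ck_add Ck_bilinear[OF bounded_bilinear_mult] Ck_const Suc.IH)
    from Ck_bilinear[OF bounded_bilinear_mult this Ck_const]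
    show ?case
      by (intro Ck_SucI[OF flat_deriv[unfolded has_field_derivative_def]]) (simp add: algebra_simps)
  qed
  then show ?thesis by (simp add: smooth_def)
qed

section \<open>Test functions and their partial derivatives\<close>

lemma test_function_smooth: "test_function \<Omega> f \<Longrightarrow> smooth f"
  by (simp add: test_function_def smooth_def)

lemma test_functionI:
  assumes "smooth f" "compact K" "K \<subseteq> \<Omega>" "\<And>x. x \<notin> K \<Longrightarrow> f x = 0"
  shows "test_function \<Omega> f"
proof -
  have sub: "closure {x. f x \<noteq> 0} \<subseteq> K"
    using assms by (intro closure_minimal compact_imp_closed) auto
  then have "compact (closure {x. f x \<noteq> 0})"
    using compact_Int_closed[OF assms(2) closed_closure] by (metis inf.absorb2)
  then show ?thesis
    using assms(1,3) sub unfolding test_function_def smooth_def by blast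
qed

lemma test_functionE:
  assumes "test_function \<Omega> f"
  obtains K where "compact K" "K \<subseteq> \<Omega>" "\<And>x. x \<notin> K \<Longrightarrow> f x = 0"
  using assms closure_subset[of "{x. f x \<noteq> 0}"] unfolding test_function_def by blast

lemma test_function_mono:
  assumes "test_function \<Omega> f" "smooth k" "\<And>x. f x = 0 \<Longrightarrow> k x = 0"
  shows "test_function \<Omega> k"
proof -
  obtain K where "compact K" "K \<subseteq> \<Omega>" "\<And>x. x \<notin> K \<Longrightarrow> f x = 0"
    using test_functionE[OF assms(1)] by metis
  then show ?thesis using assms by (intro test_functionI[of k K]) auto
qed

lemma partial_line_derivative:
  assumes "smooth f"
  shows "((\<lambda>s. f (x + s *\<^sub>R axis i 1)) has_vector_derivative partial i f (x + t *\<^sub>R axis i 1)) (at t)"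
proof -
  have "((\<lambda>s. x + s *\<^sub>R axis i 1) has_derivative (\<lambda>s. s *\<^sub>R axis i 1)) (at t)"
    by (auto intro!: derivative_eq_intros)
  from has_derivative_compose[OF this smooth_has_derivative[OF assms]]
  show ?thesis
    unfolding has_vector_derivative_def partial_def
    by (subst (asm) linear_scale[OF has_derivative_linear[OF smooth_has_derivative[OF assms]]])
qed

lemma partial_eq:
  assumes "(f has_derivative D) (at x)" shows "partial i f x = D (axis i 1)"
  using frechet_derivative_at[OF assms] by (simp add: partial_def)

lemma smooth_partial: "smooth f \<Longrightarrow> smooth (partial i f)"
  unfolding partial_def by (rule smooth_frechet)

lemma partial_bilinear:
  assumes "bounded_bilinear B" "smooth f" "smooth g"
  shows "partial i (\<lambda>x. B (f x) (g x)) x = B (f x) (partial i g x) + B (partial i f x) (g x)"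
  unfolding partial_def[of i f] partial_def[of i g]
  by (rule partial_eq[OF bounded_bilinear.FDERIV[OF assms(1) smooth_has_derivative[OF assms(2)] smooth_has_derivative[OF assms(3)]]])

lemmas partial_scaleR = partial_bilinear[OF bounded_bilinear_scaleR]
lemmas partial_inner = partial_bilinear[OF bounded_bilinear_inner]
lemmas partial_mult = partial_bilinear[OF bounded_bilinear_mult]

lemma partial_linear:
  assumes "bounded_linear L" "smooth f"
  shows "partial i (\<lambda>x. L (f x)) x = L (partial i f x)"
  unfolding partial_def[of i f]
  by (rule partial_eq[OF bounded_linear.has_derivative[OF assms(1) smooth_has_derivative[OF assms(2)]]])

lemma partial_compose:
  assumes "smooth f" "(g has_real_derivative d) (at (f x))"
  shows "partial i (\<lambda>x. g (f x)) x = d * partial i f x"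
  unfolding partial_def[of i f]
  by (rule partial_eq[OF has_derivative_compose[OF smooth_has_derivative[OF assms(1)]
    assms(2)[unfolded has_field_derivative_def]]])

lemma partial_zero_outside:
  assumes "closed K" "\<And>x. x \<notin> K \<Longrightarrow> f x = 0" "x \<notin> K"
  shows "partial i f x = 0"
proof -
  have "((\<lambda>x. 0) has_derivative (\<lambda>x. 0)) (at x)" by simp
  moreover have "open (- K)" using assms(1) by (rule open_Compl)
  ultimately have "(f has_derivative (\<lambda>x. 0)) (at x)"
    by (rule has_derivative_transform_within_open) (use assms in auto)
  then show ?thesis by (rule partial_eq)
qed

lemma test_function_partial:
  assumes "test_function \<Omega> f" shows "test_function \<Omega> (partial i f)"
proof -
  obtain K where "compact K" "K \<subseteq> \<Omega>" "\<And>x. x \<notin> K \<Longrightarrow> f x = 0"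
    using test_functionE[OF assms] by metis
  then show ?thesis
    by (intro test_functionI[of _ K] smooth_partial[OF test_function_smooth[OF assms]]
        partial_zero_outside[of K]) (auto intro: compact_imp_closed)
qed

section \<open>Smooth approximations of the indicator of a box\<close>

definition box_bump :: "real^3 \<Rightarrow> real^3 \<Rightarrow> real^3 \<Rightarrow> real" where
  "box_bump a b x = (\<Prod>i\<in>UNIV. flat 0 (x $ i - a $ i) * flat 0 (b $ i - x $ i))"

lemma smooth_box_bump: "smooth (box_bump a b)"
  unfolding box_bump_def
  by (intro smooth_prod smooth_mult smooth_compose[OF smooth_flat] smooth_diff smooth_vec_nth
      smooth_id smooth_const)

lemma box_bump_pos: "x \<in> box a b \<Longrightarrow> box_bump a b x > 0"
  unfolding box_bump_def by (intro prod_pos ballI mult_pos_pos) (auto simp: flat_pos mem_box_cart)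

lemma box_bump_nonneg: "box_bump a b x \<ge> 0"
  unfolding box_bump_def by (intro prod_nonneg ballI mult_nonneg_nonneg flat_nonneg)

lemma box_bump_zero: "x \<notin> box a b \<Longrightarrow> box_bump a b x = 0"
  unfolding box_bump_def by (auto simp: mem_box_cart flat_def not_less)

text \<open>Dividing the bump by itself plus 1/(n+1) keeps smoothness and values in [0,1], and the
  limit is the indicator of the open box. The support stays in one closed box, and the construction
  commutes with translations, which later allows a test function to be moved through
  \<Omega>.\<close>

definition box_approx :: "real^3 \<Rightarrow> real^3 \<Rightarrow> nat \<Rightarrow> real^3 \<Rightarrow> real" where
  "box_approx a b n x = box_bump a b x * inverse (box_bump a b x + inverse (real (Suc n)))"

lemma box_approx_denom: "box_bump a b x + inverse (real (Suc n)) > 0"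
  by (rule add_nonneg_pos[OF box_bump_nonneg]) simp

lemma smooth_box_approx: "smooth (box_approx a b n)"
  unfolding box_approx_def
  by (intro smooth_mult smooth_inverse smooth_add smooth_box_bump smooth_const)
    (rule less_imp_neq[symmetric], rule box_approx_denom)

lemma box_approx_bounds: "0 \<le> box_approx a b n x" "box_approx a b n x \<le> 1"
proof -
  define c where "c = inverse (real (Suc n))"
  have "c > 0" by (simp add: c_def)
  then show "0 \<le> box_approx a b n x" "box_approx a b n x \<le> 1"
    unfolding box_approx_def c_def[symmetric] using box_bump_nonneg[of a b x]
    by (auto simp: field_simps)
qed

lemma box_approx_lim: "(\<lambda>n. box_approx a b n x) \<longlonglongrightarrow> indicator (box a b) x"
proof (cases "x \<in> box a b")
  case True
  have "(\<lambda>n. box_approx a b n x) \<longlonglongrightarrow> box_bump a b x * inverse (box_bump a b x + 0)"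
    unfolding box_approx_def using box_bump_pos[OF True]
    by (intro tendsto_intros LIMSEQ_inverse_real_of_nat) auto
  moreover have "box_bump a b x * inverse (box_bump a b x + 0) = indicator (box a b) x"
    using True box_bump_pos[OF True] by (simp add: indicator_def)
  ultimately show ?thesis by simp
qed (simp add: box_approx_def box_bump_zero)

lemma box_approx_test:
  assumes "cbox a b \<subseteq> \<Omega>" shows "test_function \<Omega> (box_approx a b n)"
proof (rule test_functionI[OF smooth_box_approx compact_cbox assms])
  fix x assume "x \<notin> cbox a b"
  then have "x \<notin> box a b" using box_subset_cbox[of a b] by auto
  then show "box_approx a b n x = 0" by (simp add: box_approx_def box_bump_zero)
qed

subsection \<open>The space \<open>L\<^sub>2(\<Omega>)\<close>\<close>

text \<open>Elements of the function spaces are functions fixed only up to null sets, and weak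
  derivatives are selected by choice, so measurability has to pass to any other representative;
  completeness of the measure permits this.\<close>

lemma borel_measurable_AE_complete:
  fixes f g :: "'a \<Rightarrow> 'b::topological_space"
  assumes M: "complete_measure M" and f: "f \<in> borel_measurable M" and eq: "AE x in M. f x = g x"
  shows "g \<in> borel_measurable M"
proof (rule borel_measurableI)
  fix S :: "'b set" assume "open S"
  then have "f -` S \<inter> space M \<in> sets M" using f by (auto intro: measurable_sets)
  then show "g -` S \<inter> space M \<in> sets M"
    by (rule complete_measure.in_sets_AE[OF M, rotated 1]) (use eq in auto)
qed

lemma complete_measure_lebesgue_on: "S \<in> sets lebesgue \<Longrightarrow> complete_measure (lebesgue_on S)"
  by (rule complete_measure.intro)
   (auto simp: null_sets_restrict_space sets_restrict_space_iff intro: completion.complete)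

lemmas borel_measurable_lebesgue_on_AE =
  borel_measurable_AE_complete[OF complete_measure_lebesgue_on]

text \<open>A quadratic polynomial that is nowhere negative has nonpositive discriminant; this is
  the source of the Cauchy-Schwarz inequality \<open>ip_bound\<close>.\<close>

lemma discriminant_bound:
  fixes A B C :: real
  assumes "\<And>t. 0 \<le> A + 2 * t * B + t\<^sup>2 * C" "A \<ge> 0" "C \<ge> 0"
  shows "\<bar>B\<bar> \<le> sqrt A * sqrt C"
proof -
  have "B\<^sup>2 \<le> A * C"
  proof (cases "C = 0")
    case True
    have "B = 0"
    proof (rule ccontr)
      assume "B \<noteq> 0"
      \<comment> \<open>For \<open>C = 0\<close> the expression is affine in \<open>t\<close>; at
        this \<open>t\<close> it equals -1.\<close>
      then show False using assms(1)[of "- (A + 1) / (2 * B)"] True by (simp add: field_simps)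
    qed
    then show ?thesis using assms by simp
  next
    case False
    then show ?thesis using assms(1)[of "- B / C"] assms(3)
      by (simp add: field_simps power2_eq_square)
  qed
  then have "sqrt (B\<^sup>2) \<le> sqrt (A * C)" by (rule real_sqrt_le_mono)
  then show ?thesis by (simp add: real_sqrt_mult)
qed

locale bounded_open =
  fixes \<Omega> :: "(real^3) set"
  assumes open_dom: "open \<Omega>" and bounded_dom: "bounded \<Omega>"
begin

abbreviation M where "M \<equiv> lebesgue_on \<Omega>"
abbreviation ip (infixl "\<cdot>" 70) where "ip \<equiv> inner_L2 \<Omega>"
abbreviation nm where "nm \<equiv> norm_L2 \<Omega>"
abbreviation lap where "lap \<equiv> weak_laplacian \<Omega>"

lemma lmeas_dom: "\<Omega> \<in> lmeasurable"
  using open_dom bounded_dom by (rule lmeasurable_open[rotated])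

lemma sets_dom [simp]: "\<Omega> \<in> sets lebesgue" "\<Omega> \<inter> space lebesgue \<in> sets lebesgue"
  using lmeas_dom by auto

sublocale finite_measure M
  by (rule finite_measure_lebesgue_on[OF lmeas_dom])

lemma meas_AE: "f \<in> borel_measurable M \<Longrightarrow> AE x in M. f x = g x \<Longrightarrow> g \<in> borel_measurable M"
  for f g :: "real^3 \<Rightarrow> 'b::topological_space"
  by (rule borel_measurable_lebesgue_on_AE[OF sets_dom(1)])

lemma L2_meas: "u \<in> L2 \<Omega> \<Longrightarrow> u \<in> borel_measurable M"
  and L2_sq: "u \<in> L2 \<Omega> \<Longrightarrow> integrable M (\<lambda>x. (norm (u x))\<^sup>2)"
  by (auto simp: L2_def)

context
  fixes u w :: "real^3 \<Rightarrow> 'b::euclidean_space"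
begin

lemma L2_inner_integrable:
  assumes "u \<in> L2 \<Omega>" "w \<in> L2 \<Omega>"
  shows "integrable M (\<lambda>x. u x \<bullet> w x)"
proof (rule integrable_dominated)
  show "integrable M (\<lambda>x. (norm (u x))\<^sup>2 + (norm (w x))\<^sup>2)"
    using assms by (intro Bochner_Integration.integrable_add L2_sq)
  show "(\<lambda>x. u x \<bullet> w x) \<in> borel_measurable M"
    using assms by (intro borel_measurable_inner L2_meas)
  have "\<bar>u x \<bullet> w x\<bar> \<le> (norm (u x))\<^sup>2 + (norm (w x))\<^sup>2" for x
  proof -
    have "\<bar>u x \<bullet> w x\<bar> \<le> norm (u x) * norm (w x)" by (rule Cauchy_Schwarz_ineq2)
    also have "\<dots> \<le> (norm (u x))\<^sup>2 + (norm (w x))\<^sup>2"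
      using sum_squares_bound[of "norm (u x)" "norm (w x)"]
        mult_nonneg_nonneg[OF norm_ge_zero norm_ge_zero, of "u x" "w x"] by linarith
    finally show ?thesis .
  qed
  then show "AE x in M. norm (u x \<bullet> w x) \<le> norm ((norm (u x))\<^sup>2 + (norm (w x))\<^sup>2)"
    by (auto intro!: AE_I2 order_trans[OF _ abs_ge_self])
qed

lemma L2_dominated:
  assumes "u \<in> L2 \<Omega>" "w \<in> borel_measurable M" "AE x in M. norm (w x) \<le> C * norm (u x)"
  shows "w \<in> L2 \<Omega>"
  unfolding L2_def
proof (safe)
  show "integrable M (\<lambda>x. (norm (w x))\<^sup>2)"
  proof (rule integrable_dominated)
    show "integrable M (\<lambda>x. C\<^sup>2 * (norm (u x))\<^sup>2)"
      using assms by (intro integrable_mult_right L2_sq)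
    show "(\<lambda>x. (norm (w x))\<^sup>2) \<in> borel_measurable M" using assms(2) by measurable
    show "AE x in M. norm ((norm (w x))\<^sup>2) \<le> norm (C\<^sup>2 * (norm (u x))\<^sup>2)"
      using assms(3)
    proof eventually_elim
      case (elim x)
      then have "(norm (w x))\<^sup>2 \<le> (C * norm (u x))\<^sup>2" by (intro power_mono) auto
      then show ?case by (simp add: power_mult_distrib)
    qed
  qed
qed (rule assms)

lemma L2_AE: "u \<in> L2 \<Omega> \<Longrightarrow> AE x in M. u x = w x \<Longrightarrow> w \<in> L2 \<Omega>"
  by (rule L2_dominated[of 1]) (auto intro: meas_AE L2_meas)

end

lemma L2_dominated':
  fixes u :: "real^3 \<Rightarrow> 'b::euclidean_space" and w :: "real^3 \<Rightarrow> 'c::euclidean_space"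
  assumes "u \<in> L2 \<Omega>" "w \<in> borel_measurable M" "\<And>x. x \<in> \<Omega> \<Longrightarrow> norm (w x) \<le> C * norm (u x)"
  shows "w \<in> L2 \<Omega>"
proof -
  \<comment> \<open>Carries the scalar \<open>norm (u x)\<close> into the codomain of
    \<open>w\<close>, since \<open>L2_dominated\<close> compares functions with a common
    codomain.\<close>
  obtain e :: 'c where e: "norm e = 1" using nonempty_Basis norm_Basis by blast
  have "(\<lambda>x. norm (u x) *\<^sub>R e) \<in> L2 \<Omega>"
    using L2_sq[OF assms(1)] L2_meas[OF assms(1)] e
    by (auto simp: L2_def intro!: borel_measurable_scaleR borel_measurable_norm)
  then show ?thesis
    by (rule L2_dominated[OF _ assms(2)]) (use assms(3) e in \<open>auto intro!: AE_I2\<close>)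
qed

lemma L2_bounded:
  assumes "w \<in> borel_measurable M" "\<And>x. x \<in> \<Omega> \<Longrightarrow> norm (w x) \<le> C"
  shows "w \<in> L2 \<Omega>"
proof -
  have "(\<lambda>x. 1::real) \<in> L2 \<Omega>" by (simp add: L2_def)
  then show ?thesis by (rule L2_dominated'[OF _ assms(1), of _ C]) (use assms in auto)
qed

lemma L2_zero [simp]: "(\<lambda>x. 0) \<in> L2 \<Omega>" by (simp add: L2_def)

lemma L2_scaleR: "u \<in> L2 \<Omega> \<Longrightarrow> (\<lambda>x. c *\<^sub>R u x) \<in> L2 \<Omega>"
  by (rule L2_dominated'[of u _ "\<bar>c\<bar>"]) (auto intro: borel_measurable_scaleR L2_meas)

lemma L2_add:
  assumes "u \<in> L2 \<Omega>" "w \<in> L2 \<Omega>" shows "(\<lambda>x. u x + w x) \<in> L2 \<Omega>"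
proof -
  have "(norm (u x + w x))\<^sup>2 = (norm (u x))\<^sup>2 + 2 * (u x \<bullet> w x) + (norm (w x))\<^sup>2" for x
    by (simp add: power2_norm_eq_inner inner_add_left inner_add_right inner_commute)
  then have "integrable M (\<lambda>x. (norm (u x + w x))\<^sup>2)"
    using assms by (auto intro!: L2_sq integrable_mult_right L2_inner_integrable)
  then show ?thesis using assms unfolding L2_def by auto
qed

lemma L2_minus: "u \<in> L2 \<Omega> \<Longrightarrow> (\<lambda>x. - u x) \<in> L2 \<Omega>"
  using L2_scaleR[of u "-1"] by simp

lemma L2_diff: "u \<in> L2 \<Omega> \<Longrightarrow> w \<in> L2 \<Omega> \<Longrightarrow> (\<lambda>x. u x - w x) \<in> L2 \<Omega>"
  using L2_add[OF _ L2_minus, of u w] by simp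

lemma L2_sum: "(\<And>i. i \<in> A \<Longrightarrow> f i \<in> L2 \<Omega>) \<Longrightarrow> (\<lambda>x. \<Sum>i\<in>A. f i x) \<in> L2 \<Omega>"
  for f :: "'i \<Rightarrow> real^3 \<Rightarrow> 'b::euclidean_space"
  by (induction A rule: infinite_finite_induct) (auto intro: L2_add)

lemma L2_integrable:
  assumes "u \<in> L2 \<Omega>" shows "integrable M u"
proof (rule integrable_dominated)
  show "integrable M (\<lambda>x. 1 + (norm (u x))\<^sup>2)" using L2_sq[OF assms] by simp
  show "AE x in M. norm (u x) \<le> norm (1 + (norm (u x))\<^sup>2)"
  proof (rule AE_I2)
    fix x
    have "2 * (norm (u x)) \<le> 1 + (norm (u x))\<^sup>2" using sum_squares_bound[of "norm (u x)" 1] by simp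
    moreover have "1 + (norm (u x))\<^sup>2 \<le> norm (1 + (norm (u x))\<^sup>2)" by simp
    ultimately show "norm (u x) \<le> norm (1 + (norm (u x))\<^sup>2)" using norm_ge_zero[of "u x"]
      by linarith
  qed
qed (rule L2_meas[OF assms])

lemma L2_inner_const: "u \<in> L2 \<Omega> \<Longrightarrow> (\<lambda>x. u x \<bullet> e) \<in> L2 \<Omega>"
  by (rule L2_dominated'[of u _ "norm e"])
    (auto intro: borel_measurable_inner L2_meas simp: Cauchy_Schwarz_ineq2 mult.commute[of "norm e"])

lemma ip_commute: "u \<cdot> w = w \<cdot> u"
  by (simp add: inner_L2_def inner_commute)

lemma ip_add_left: "u \<in> L2 \<Omega> \<Longrightarrow> u' \<in> L2 \<Omega> \<Longrightarrow> w \<in> L2 \<Omega> \<Longrightarrow> (\<lambda>x. u x + u' x) \<cdot> w = u \<cdot> w + u' \<cdot> w"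
  by (simp add: inner_L2_def inner_add_left L2_inner_integrable)

lemma ip_scaleR_left: "(\<lambda>x. c *\<^sub>R u x) \<cdot> w = c * (u \<cdot> w)"
  by (simp add: inner_L2_def)

lemma ip_diff_left: "u \<in> L2 \<Omega> \<Longrightarrow> u' \<in> L2 \<Omega> \<Longrightarrow> w \<in> L2 \<Omega> \<Longrightarrow> (\<lambda>x. u x - u' x) \<cdot> w = u \<cdot> w - u' \<cdot> w"
  by (simp add: inner_L2_def inner_diff_left L2_inner_integrable)

lemma ip_add_right: "u \<in> L2 \<Omega> \<Longrightarrow> u' \<in> L2 \<Omega> \<Longrightarrow> w \<in> L2 \<Omega> \<Longrightarrow> w \<cdot> (\<lambda>x. u x + u' x) = w \<cdot> u + w \<cdot> u'"
  by (simp add: inner_L2_def inner_add_right L2_inner_integrable)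

lemma ip_diff_right: "u \<in> L2 \<Omega> \<Longrightarrow> u' \<in> L2 \<Omega> \<Longrightarrow> w \<in> L2 \<Omega> \<Longrightarrow> w \<cdot> (\<lambda>x. u x - u' x) = w \<cdot> u - w \<cdot> u'"
  by (simp add: inner_L2_def inner_diff_right L2_inner_integrable)

lemma ip_scaleR_right: "w \<cdot> (\<lambda>x. c *\<^sub>R u x) = c * (w \<cdot> u)"
  by (simp add: inner_L2_def)

lemma ip_zero [simp]: "(\<lambda>x. 0) \<cdot> w = 0" "w \<cdot> (\<lambda>x. 0) = 0"
  by (simp_all add: inner_L2_def)

lemma ip_sum_left: "(\<And>i. i \<in> A \<Longrightarrow> f i \<in> L2 \<Omega>) \<Longrightarrow> w \<in> L2 \<Omega> \<Longrightarrow>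
    (\<lambda>x. \<Sum>i\<in>A. f i x) \<cdot> w = (\<Sum>i\<in>A. f i \<cdot> w)"
  for f :: "'i \<Rightarrow> real^3 \<Rightarrow> 'b::euclidean_space"
  by (induction A rule: infinite_finite_induct) (auto simp: ip_add_left L2_sum)

lemma ip_cong_AE:
  assumes "AE x in M. u x = u' x" "AE x in M. w x = w' x"
    "u \<in> L2 \<Omega>" "w \<in> L2 \<Omega>"
  shows "u \<cdot> w = u' \<cdot> w'"
proof -
  have "u' \<in> L2 \<Omega>" "w' \<in> L2 \<Omega>" using assms by (auto intro: L2_AE)
  then show ?thesis unfolding inner_L2_def
    using assms by (intro integral_cong_AE borel_measurable_inner L2_meas) (auto elim!: AE_mp)
qed

lemma ip_self_nonneg: "u \<cdot> u \<ge> 0"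
  unfolding inner_L2_def by (rule Bochner_Integration.integral_nonneg) simp

lemma nm_sq: "(nm u)\<^sup>2 = u \<cdot> u"
  using ip_self_nonneg by (simp add: norm_L2_def)

lemma nm_sq_integral: "(nm u)\<^sup>2 = (LINT x|M. (norm (u x))\<^sup>2)"
  unfolding nm_sq inner_L2_def by (simp add: power2_norm_eq_inner)

lemma nm_nonneg [simp]: "nm u \<ge> 0"
  using ip_self_nonneg by (simp add: norm_L2_def)

lemma ip_bound:
  assumes "u \<in> L2 \<Omega>" "w \<in> L2 \<Omega>"
  shows "\<bar>u \<cdot> w\<bar> \<le> nm u * nm w"
  unfolding norm_L2_def
proof (rule discriminant_bound[OF _ ip_self_nonneg ip_self_nonneg])
  fix t
  have "(\<lambda>x. u x + t *\<^sub>R w x) \<cdot> (\<lambda>x. u x + t *\<^sub>R w x) = u \<cdot> u + 2 * t * (u \<cdot> w) + t\<^sup>2 * (w \<cdot> w)"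
    using assms by (simp add: ip_add_left ip_add_right L2_scaleR L2_add ip_scaleR_left ip_scaleR_right
        ip_commute[of w u] power2_eq_square algebra_simps)
  then show "0 \<le> u \<cdot> u + 2 * t * (u \<cdot> w) + t\<^sup>2 * (w \<cdot> w)"
    using ip_self_nonneg[of "\<lambda>x. u x + t *\<^sub>R w x"] by simp
qed

lemma nm_add:
  assumes "u \<in> L2 \<Omega>" "w \<in> L2 \<Omega>"
  shows "nm (\<lambda>x. u x + w x) \<le> nm u + nm w"
proof (rule power2_le_imp_le)
  have "(nm (\<lambda>x. u x + w x))\<^sup>2 = (nm u)\<^sup>2 + 2 * (u \<cdot> w) + (nm w)\<^sup>2"
    using assms unfolding nm_sq by (simp add: ip_add_left ip_add_right L2_add ip_commute[of w u])
  also have "\<dots> \<le> (nm u + nm w)\<^sup>2"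
    using ip_bound[OF assms] by (simp add: power2_sum)
  finally show "(nm (\<lambda>x. u x + w x))\<^sup>2 \<le> (nm u + nm w)\<^sup>2" .
qed simp

lemma nm_scaleR: "nm (\<lambda>x. c *\<^sub>R u x) = \<bar>c\<bar> * nm u"
  unfolding norm_L2_def by (simp add: ip_scaleR_left ip_scaleR_right real_sqrt_mult mult.assoc[symmetric])

lemma nm_minus: "nm (\<lambda>x. - u x) = nm u"
  using nm_scaleR[of "-1" u] by simp

lemma nm_commute: "nm (\<lambda>x. u x - w x) = nm (\<lambda>x. w x - u x)"
  using nm_minus[of "\<lambda>x. u x - w x"] by simp

lemma nm_diff: "u \<in> L2 \<Omega> \<Longrightarrow> w \<in> L2 \<Omega> \<Longrightarrow> nm (\<lambda>x. u x - w x) \<le> nm u + nm w"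
  using nm_add[of u "\<lambda>x. - w x"] by (simp add: L2_minus nm_minus)

lemma nm_triangle: "u \<in> L2 \<Omega> \<Longrightarrow> w \<in> L2 \<Omega> \<Longrightarrow> nm u \<le> nm w + nm (\<lambda>x. u x - w x)"
  using nm_add[of w "\<lambda>x. u x - w x"] by (simp add: L2_diff)

lemma nm_sum: "(\<And>i. i \<in> A \<Longrightarrow> f i \<in> L2 \<Omega>) \<Longrightarrow> nm (\<lambda>x. \<Sum>i\<in>A. f i x) \<le> (\<Sum>i\<in>A. nm (f i))"
  for f :: "'i \<Rightarrow> real^3 \<Rightarrow> 'b::euclidean_space"
proof (induction A rule: infinite_finite_induct)
  case (insert i A)
  then have "nm (\<lambda>x. \<Sum>i\<in>insert i A. f i x) \<le> nm (f i) + nm (\<lambda>x. \<Sum>i\<in>A. f i x)"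
    using nm_add[of "f i" "\<lambda>x. \<Sum>i\<in>A. f i x"] by (simp add: L2_sum)
  then show ?case using insert by force
qed (auto simp: norm_L2_def)

lemma nm_zero [simp]: "nm (\<lambda>x. 0 :: 'b::euclidean_space) = 0"
  by (simp add: norm_L2_def)

lemma nm_cong_AE:
  "AE x in M. u x = u' x \<Longrightarrow> u \<in> L2 \<Omega> \<Longrightarrow> nm u = nm u'"
  unfolding norm_L2_def by (subst ip_cong_AE[of u u' u u']) simp_all

lemma nm_eq_0:
  assumes "u \<in> L2 \<Omega>" shows "nm u = 0 \<longleftrightarrow> (AE x in M. u x = 0)"
proof -
  have "nm u = 0 \<longleftrightarrow> (nm u)\<^sup>2 = 0" by simp
  also have "\<dots> \<longleftrightarrow> (AE x in M. (norm (u x))\<^sup>2 = 0)"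
    unfolding nm_sq_integral by (intro integral_nonneg_eq_0_iff_AE L2_sq assms) auto
  finally show ?thesis by simp
qed

lemma nm_mono:
  fixes u :: "real^3 \<Rightarrow> 'b::euclidean_space" and w :: "real^3 \<Rightarrow> 'c::euclidean_space"
  assumes "u \<in> L2 \<Omega>" "w \<in> L2 \<Omega>" "C \<ge> 0" "\<And>x. x \<in> \<Omega> \<Longrightarrow> norm (w x) \<le> C * norm (u x)"
  shows "nm w \<le> C * nm u"
proof (rule power2_le_imp_le)
  have "(LINT x|M. (norm (w x))\<^sup>2) \<le> (LINT x|M. C\<^sup>2 * (norm (u x))\<^sup>2)"
  proof (intro integral_mono integrable_mult_right L2_sq assms)
    fix x assume "x \<in> space M"
    then have "(norm (w x))\<^sup>2 \<le> (C * norm (u x))\<^sup>2" using assms by (intro power_mono) auto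
    then show "(norm (w x))\<^sup>2 \<le> C\<^sup>2 * (norm (u x))\<^sup>2" by (simp add: power_mult_distrib)
  qed
  then show "(nm w)\<^sup>2 \<le> (C * nm u)\<^sup>2"
    by (simp add: nm_sq_integral power_mult_distrib)
qed (use assms in auto)

lemma ip_tendsto:
  assumes "\<And>n. un n \<in> L2 \<Omega>" "\<And>n. wn n \<in> L2 \<Omega>" "u \<in> L2 \<Omega>" "w \<in> L2 \<Omega>"
    and "(\<lambda>n. nm (\<lambda>x. un n x - u x)) \<longlonglongrightarrow> 0" "(\<lambda>n. nm (\<lambda>x. wn n x - w x)) \<longlonglongrightarrow> 0"
  shows "(\<lambda>n. un n \<cdot> wn n) \<longlonglongrightarrow> u \<cdot> w"
proof -
  let ?a = "\<lambda>n. nm (\<lambda>x. un n x - u x)" and ?b = "\<lambda>n. nm (\<lambda>x. wn n x - w x)"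
  have "\<bar>un n \<cdot> wn n - u \<cdot> w\<bar> \<le> ?a n * (nm w + ?b n) + nm u * ?b n" for n
  proof -
    have "un n \<cdot> wn n - u \<cdot> w = (\<lambda>x. un n x - u x) \<cdot> wn n + u \<cdot> (\<lambda>x. wn n x - w x)"
      using assms by (simp add: ip_diff_left ip_diff_right)
    moreover have "\<bar>(\<lambda>x. un n x - u x) \<cdot> wn n\<bar> \<le> ?a n * nm (wn n)"
      using assms by (intro ip_bound L2_diff)
    moreover have "?a n * nm (wn n) \<le> ?a n * (nm w + ?b n)"
      using assms nm_triangle[of "wn n" w] by (intro mult_left_mono) auto
    moreover have "\<bar>u \<cdot> (\<lambda>x. wn n x - w x)\<bar> \<le> nm u * ?b n"
      using assms by (intro ip_bound L2_diff)
    ultimately show ?thesis by linarith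
  qed
  then have le: "\<forall>n. norm (un n \<cdot> wn n - u \<cdot> w) \<le> ?a n * (nm w + ?b n) + nm u * ?b n"
    by simp
  have "(\<lambda>n. ?a n * (nm w + ?b n) + nm u * ?b n) \<longlonglongrightarrow> 0 * (nm w + 0) + nm u * 0"
    by (intro tendsto_intros assms(5,6))
  then have lim: "(\<lambda>n. ?a n * (nm w + ?b n) + nm u * ?b n) \<longlonglongrightarrow> 0"
    by simp
  have "(\<lambda>n. un n \<cdot> wn n - u \<cdot> w) \<longlonglongrightarrow> 0"
    by (rule Lim_null_comparison[OF always_eventually[OF le] lim])
  then show ?thesis by (simp add: LIM_zero_iff)
qed

lemma nm_tendsto:
  assumes "\<And>n. un n \<in> L2 \<Omega>" "u \<in> L2 \<Omega>" "(\<lambda>n. nm (\<lambda>x. un n x - u x)) \<longlonglongrightarrow> 0"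
  shows "(\<lambda>n. nm (un n)) \<longlonglongrightarrow> nm u"
  unfolding norm_L2_def using ip_tendsto[OF assms(1,1,2,2,3,3)] by (rule tendsto_real_sqrt)

lemma AE_subseq:
  assumes "\<And>n. un n \<in> L2 \<Omega>" "u \<in> L2 \<Omega>" "(\<lambda>n. nm (\<lambda>x. un n x - u x)) \<longlonglongrightarrow> 0"
  obtains r where "strict_mono r" "AE x in M. (\<lambda>n. un (r n) x) \<longlonglongrightarrow> u x"
proof -
  have "(\<lambda>n. (nm (\<lambda>x. un n x - u x))\<^sup>2) \<longlonglongrightarrow> 0\<^sup>2"
    using assms(3) by (rule tendsto_power)
  then have lim: "(\<lambda>n. LINT x|M. norm ((norm (un n x - u x))\<^sup>2)) \<longlonglongrightarrow> 0"
    by (simp add: nm_sq_integral)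
  have int: "integrable M (\<lambda>x. (norm (un n x - u x))\<^sup>2)" for n
    using assms by (intro L2_sq L2_diff)
  obtain r :: "nat \<Rightarrow> nat" where r: "strict_mono r" "AE x in M. (\<lambda>n. (norm (un (r n) x - u x))\<^sup>2) \<longlonglongrightarrow> 0"
    using tendsto_L1_AE_subseq[OF int lim] by blast
  have "AE x in M. (\<lambda>n. un (r n) x) \<longlonglongrightarrow> u x"
    using r(2)
  proof eventually_elim
    case (elim x)
    from tendsto_real_sqrt[OF this] have "(\<lambda>n. norm (un (r n) x - u x)) \<longlonglongrightarrow> 0" by simp
    then show ?case by (simp add: tendsto_norm_zero_iff LIM_zero_iff)
  qed
  with r(1) show thesis by (rule that)
qed

end

subsection \<open>Weak derivatives\<close>

lemma bounded_compact_support: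
  fixes f :: "'a::real_normed_vector \<Rightarrow> 'b::real_normed_vector"
  assumes "continuous_on UNIV f" "compact K" "\<And>x. x \<notin> K \<Longrightarrow> f x = 0"
  obtains B where "B > 0" "\<And>x. norm (f x) \<le> B"
proof -
  have "bounded (f ` K)"
    using assms by (intro compact_imp_bounded compact_continuous_image) (auto intro: continuous_on_subset)
  then obtain B where B: "B > 0" "\<And>x. x \<in> K \<Longrightarrow> norm (f x) \<le> B"
    by (auto simp: bounded_pos)
  have "norm (f x) \<le> B" for x
    using B assms(3)[of x] by (cases "x \<in> K") auto
  with B(1) show thesis by (rule that)
qed

lemma integrable_compact_support:
  fixes f :: "'a::euclidean_space \<Rightarrow> 'b::euclidean_space"
  assumes "continuous_on UNIV f" "compact K" "\<And>x. x \<notin> K \<Longrightarrow> f x = 0"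
  shows "integrable lborel f"
proof -
  have "integrable lborel (\<lambda>x. indicator K x *\<^sub>R f x)"
    using borel_integrable_compact[OF assms(2) continuous_on_subset[OF assms(1)]] by simp
  moreover have "indicator K x *\<^sub>R f x = f x" for x
    using assms(3)[of x] by (auto simp: indicator_def)
  ultimately show ?thesis by simp
qed

lemma lborel_integral_shift:
  fixes f :: "'a::euclidean_space \<Rightarrow> 'b::euclidean_space"
  assumes "f \<in> borel_measurable borel"
  shows "(LINT x|lborel. f (x + c)) = (LINT x|lborel. f x)"
proof -
  have "(LINT x|lborel. f x) = (LINT x|distr lborel borel ((+) c). f x)"
    by (simp add: lborel_distr_plus)
  also have "\<dots> = (LINT x|lborel. f (c + x))"
    using assms by (intro integral_distr) auto
  finally show ?thesis by (simp add: add.commute)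
qed

lemma partial_bound:
  fixes f :: "real^3 \<Rightarrow> 'b::real_normed_vector"
  assumes f: "smooth f" and K: "compact K" "\<And>x. x \<notin> K \<Longrightarrow> f x = 0"
  obtains B where "B > 0" "\<And>x s. norm (f (x + s *\<^sub>R axis i 1) - f x) \<le> B * \<bar>s\<bar>"
proof -
  obtain B where B: "B > 0" "\<And>x. norm (partial i f x) \<le> B"
    using bounded_compact_support[of "partial i f" K] K smooth_continuous[OF smooth_partial[OF f]]
      partial_zero_outside[OF compact_imp_closed] by metis
  have "norm (f (x + s *\<^sub>R axis i 1) - f (x + 0 *\<^sub>R axis i 1)) \<le> B * norm (s - 0)" for x s
  proof (rule differentiable_bound[of UNIV "\<lambda>s. f (x + s *\<^sub>R axis i 1)" "\<lambda>t s. s *\<^sub>R partial i f (x + t *\<^sub>R axis i 1)"])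
    show "((\<lambda>s. f (x + s *\<^sub>R axis i 1)) has_derivative (\<lambda>s. s *\<^sub>R partial i f (x + t *\<^sub>R axis i 1))) (at t within UNIV)" for t
      using partial_line_derivative[OF f] by (simp add: has_vector_derivative_def)
    show "onorm (\<lambda>s. s *\<^sub>R partial i f (x + t *\<^sub>R axis i 1)) \<le> B" for t
      using B by (intro onorm_le) (auto simp: mult.commute[of B] intro: mult_left_mono)
  qed auto
  then show thesis using that[OF B(1)] by simp
qed

lemma vector_derivative_quotient:
  assumes "(f has_vector_derivative v) (at t)"
  shows "((\<lambda>s. (f (t + s) - f t) /\<^sub>R s) \<longlongrightarrow> v) (at 0)"
proof -
  have "((\<lambda>s. norm (f (t + s) - f t - s *\<^sub>R v) / norm s) \<longlongrightarrow> 0) (at 0)"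
    using assms by (simp add: has_vector_derivative_def has_derivative_at)
  moreover have "\<forall>\<^sub>F s in at 0. norm (f (t + s) - f t - s *\<^sub>R v) / norm s = norm ((f (t + s) - f t) /\<^sub>R s - v)"
  proof (rule eventually_at_topological[THEN iffD2], intro exI[of _ UNIV] conjI ballI impI)
    fix s :: real assume "s \<noteq> 0"
    then have "(f (t + s) - f t) /\<^sub>R s - v = (f (t + s) - f t - s *\<^sub>R v) /\<^sub>R s"
      by (simp add: scaleR_diff_right)
    then show "norm (f (t + s) - f t - s *\<^sub>R v) / norm s = norm ((f (t + s) - f t) /\<^sub>R s - v)"
      by (simp add: divide_inverse)
  qed auto
  ultimately have "((\<lambda>s. norm ((f (t + s) - f t) /\<^sub>R s - v)) \<longlongrightarrow> 0) (at 0)"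
    by (rule Lim_transform_eventually)
  then show ?thesis by (simp add: tendsto_norm_zero_iff LIM_zero_iff)
qed

text \<open>Translation invariance makes every difference quotient integrate to zero, and dominated
  convergence passes to the derivative: quotients with step at most 1 are bounded by a Lipschitz
  constant and supported in the ball of radius \<open>R + 1\<close>.\<close>

lemma integral_partial_zero:
  fixes f :: "real^3 \<Rightarrow> 'b::euclidean_space"
  assumes f: "smooth f" and K: "compact K" "\<And>x. x \<notin> K \<Longrightarrow> f x = 0"
  shows "(LINT x|lborel. partial i f x) = 0"
proof -
  define s where "s n = inverse (real (Suc n))" for n
  have s: "s n > 0" "s n \<le> 1" for n by (auto simp: s_def field_simps)
  have slim: "s \<longlonglongrightarrow> 0" unfolding s_def by (rule LIMSEQ_inverse_real_of_nat)
  let ?e = "axis i (1::real) :: real^3"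
  define q where "q n x = inverse (s n) *\<^sub>R (f (x + s n *\<^sub>R ?e) - f x)" for n x
  have cont: "continuous_on A f" for A using f by (rule smooth_continuous)
  have meas: "f \<in> borel_measurable borel" using cont by (rule borel_measurable_continuous_onI)
  obtain B where B: "B > 0" "\<And>x s. norm (f (x + s *\<^sub>R ?e) - f x) \<le> B * \<bar>s\<bar>"
    using partial_bound[OF f K] by metis
  obtain R where R: "\<And>x. x \<in> K \<Longrightarrow> norm x \<le> R"
    using compact_imp_bounded[OF K(1)] unfolding bounded_iff by blast
  have int: "integrable lborel f" by (rule integrable_compact_support[OF cont K])
  have q0: "(LINT x|lborel. q n x) = 0" for n
  proof -
    have "continuous_on UNIV (\<lambda>x. f (x + s n *\<^sub>R ?e))"
      by (intro continuous_on_compose2[OF cont[of UNIV]] continuous_intros) auto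
    then have "integrable lborel (\<lambda>x. f (x + s n *\<^sub>R ?e))"
    proof (rule integrable_compact_support)
      show "compact ((\<lambda>x. x - s n *\<^sub>R ?e) ` K)"
        by (intro compact_continuous_image K continuous_intros)
      show "f (x + s n *\<^sub>R ?e) = 0" if "x \<notin> (\<lambda>x. x - s n *\<^sub>R ?e) ` K" for x
        using that by (intro K(2)) (auto simp: image_iff algebra_simps)
    qed
    then show ?thesis
      unfolding q_def using lborel_integral_shift[OF meas] int by simp
  qed
  have "(\<lambda>n. LINT x|lborel. q n x) \<longlonglongrightarrow> (LINT x|lborel. partial i f x)"
  proof (rule integral_dominated_convergence[where w="\<lambda>x. B * indicator (cball 0 (R + 1)) x"])
    show "partial i f \<in> borel_measurable lborel"
      using smooth_continuous[OF smooth_partial[OF f], of UNIV]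
      by (simp add: borel_measurable_continuous_onI)
    show "q n \<in> borel_measurable lborel" for n
      unfolding q_def
      by (intro borel_measurable_scaleR borel_measurable_diff borel_measurable_const)
         (auto intro!: borel_measurable_continuous_onI continuous_on_compose2[OF cont[of UNIV]] continuous_intros meas)
    show "integrable lborel (\<lambda>x. B * indicator (cball (0::real^3) (R + 1)) x :: real)"
      by (intro integrable_mult_right integrable_real_indicator) (use emeasure_lborel_cball_finite in auto)
    show "AE x in lborel. (\<lambda>n. q n x) \<longlonglongrightarrow> partial i f x"
    proof (rule AE_I2)
      fix x
      have "((\<lambda>s. (f (x + s *\<^sub>R ?e) - f x) /\<^sub>R s) \<longlongrightarrow> partial i f x) (at 0)"
        using vector_derivative_quotient[OF partial_line_derivative[OF f, of x i 0]] by simp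
      moreover have "filterlim s (at 0) sequentially"
        using slim s by (auto simp: filterlim_at less_imp_neq[symmetric])
      ultimately show "(\<lambda>n. q n x) \<longlonglongrightarrow> partial i f x"
        unfolding q_def by (rule filterlim_compose)
    qed
    show "AE x in lborel. norm (q n x) \<le> B * indicator (cball 0 (R + 1)) x" for n
    proof (rule AE_I2)
      fix x
      show "norm (q n x) \<le> B * indicator (cball 0 (R + 1)) x"
      proof (cases "x \<in> cball 0 (R + 1)")
        case True
        have "norm (q n x) = inverse (s n) * norm (f (x + s n *\<^sub>R ?e) - f x)"
          using s[of n] by (simp add: q_def)
        also have "\<dots> \<le> inverse (s n) * (B * \<bar>s n\<bar>)"
          using s[of n] B(2)[of x "s n"] by (intro mult_left_mono) auto
        also have "\<dots> = B" using s[of n] by simp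
        finally show ?thesis using True by simp
      next
        case False
        then have "norm x > R + 1" by simp
        moreover have "norm x \<le> norm (x + s n *\<^sub>R ?e) + s n"
          using norm_triangle_ineq4[of "x + s n *\<^sub>R ?e" "s n *\<^sub>R ?e"] s[of n] by (simp add: norm_axis_1)
        ultimately have "x \<notin> K" "x + s n *\<^sub>R ?e \<notin> K" using R[of x] R[of "x + s n *\<^sub>R ?e"] s[of n] by auto
        then show ?thesis using B K by (simp add: q_def)
      qed
    qed
  qed
  then show ?thesis unfolding q0 by (simp add: LIMSEQ_const_iff)
qed

lemma integrable_lebesgue_on_subset:
  fixes f :: "'a::euclidean_space \<Rightarrow> 'b::euclidean_space"
  assumes "integrable (lebesgue_on S) f" "T \<subseteq> S" "S \<in> sets lebesgue" "T \<in> sets lebesgue"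
  shows "integrable (lebesgue_on T) f"
  using set_integrable_subset[of lebesgue S f T] assms
  by (simp add: set_integrable_def integrable_restrict_space)

lemma AE_lebesgue_on_iff:
  "S \<in> sets lebesgue \<Longrightarrow> (AE x in lebesgue_on S. P x) \<longleftrightarrow> negligible {x\<in>S. \<not> P x}"
  by (simp add: AE_restrict_space_iff completion.AE_iff_null_sets negligible_iff_null_sets conj_commute)

text \<open>Almost every value of \<open>g\<close> is a limit of averages over small cubes, and all
  these averages vanish. The question is local, so countably many closed boxes exhausting the open
  set suffice.\<close>

lemma negligible_of_box_integrals:
  fixes g :: "'a::euclidean_space \<Rightarrow> 'b::euclidean_space"
  assumes "open S" "\<And>a b. cbox a b \<subseteq> S \<Longrightarrow> (g has_integral 0) (cbox a b)"
  shows "negligible {x\<in>S. g x \<noteq> 0}"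
proof -
  have local: "negligible {x \<in> cbox c d. g x \<noteq> 0}" if cd: "cbox c d \<subseteq> S" for c d
  proof -
    \<comment> \<open>The differentiation theorem asks for integrability over every box, so
      \<open>g\<close> is cut off outside one box; the box integrals still vanish because two boxes
      meet in a box.\<close>
    define g0 where "g0 x = (if x \<in> cbox c d then g x else 0)" for x
    have I: "(g0 has_integral 0) (cbox a b)" for a b
    proof -
      obtain a' b' where ab: "cbox c d \<inter> cbox a b = cbox a' b'"
        using Int_interval[of c d a b] by blast
      have "(g has_integral 0) (cbox a' b')" using assms(2)[of a' b'] cd ab by blast
      then show ?thesis unfolding g0_def has_integral_restrict_Int ab .
    qed
    obtain N where N: "negligible N" "\<And>x e. \<lbrakk>x \<notin> N; 0 < e\<rbrakk> \<Longrightarrow> \<exists>k>0. \<forall>h. 0 < h \<and> h < k \<longrightarrow>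
        norm (integral (cbox x (x + h *\<^sub>R One)) g0 /\<^sub>R h ^ DIM('a) - g0 x) < e"
      using integrable_ccontinuous_explicit[of g0, OF has_integral_integrable[OF I]] by blast
    have "g0 x = 0" if "x \<notin> N" for x
    proof (rule ccontr)
      assume nz: "g0 x \<noteq> 0"
      then obtain k where "k > 0" "\<forall>h. 0 < h \<and> h < k \<longrightarrow>
          norm (integral (cbox x (x + h *\<^sub>R One)) g0 /\<^sub>R h ^ DIM('a) - g0 x) < norm (g0 x)"
        using N(2)[OF \<open>x \<notin> N\<close>, of "norm (g0 x)"] nz by auto
      then show False using integral_unique[OF I] by (auto dest!: spec[of _ "k/2"])
    qed
    then have "x \<in> N" if "x \<in> cbox c d" "g x \<noteq> 0" for x
      using that by (metis g0_def)
    then show ?thesis by (intro negligible_subset[OF N(1)]) blast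
  qed
  obtain \<D> where D: "countable \<D>" "\<D> \<subseteq> Pow S" "\<And>X. X \<in> \<D> \<Longrightarrow> \<exists>a b. X = cbox a b" "\<Union>\<D> = S"
    using open_countable_Union_open_cbox[OF assms(1)] by metis
  have "negligible (\<Union>X\<in>\<D>. {x\<in>X. g x \<noteq> 0})"
  proof (rule negligible_countable_Union)
    fix T assume "T \<in> (\<lambda>X. {x \<in> X. g x \<noteq> 0}) ` \<D>"
    then obtain X where X: "X \<in> \<D>" "T = {x \<in> X. g x \<noteq> 0}" by blast
    then obtain a b where "X = cbox a b" using D(3) by blast
    with X D(2) show "negligible T" using local[of a b] by blast
  qed (use D in auto)
  then show ?thesis by (rule negligible_subset) (use D(4) in auto)
qed

section \<open>Test functions against integrals over boxes\<close>

context bounded_open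
begin

lemma locally_integrableI: "integrable M u \<Longrightarrow> locally_integrable \<Omega> u"
  unfolding locally_integrable_def
  using integrable_lebesgue_on_subset[OF _ _ sets_dom(1) fmeasurableD[OF lmeasurable_compact]] by blast

lemma locally_integrable_test:
  assumes u: "locally_integrable \<Omega> u" and f: "test_function \<Omega> f"
  shows "integrable M (\<lambda>x. f x *\<^sub>R u x)"
proof -
  obtain K where K: "compact K" "K \<subseteq> \<Omega>" "\<And>x. x \<notin> K \<Longrightarrow> f x = 0"
    using test_functionE[OF f] by metis
  have cont: "continuous_on UNIV f" by (rule smooth_continuous[OF test_function_smooth[OF f]])
  obtain B where B: "\<And>x. norm (f x) \<le> B" using bounded_compact_support[OF cont K(1,3)] by metis
  have "K \<in> sets lebesgue" using K by (simp add: lmeasurable_compact fmeasurableD)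
  then have i: "integrable lebesgue (\<lambda>x. indicator K x *\<^sub>R u x)"
    using u K(1,2) by (simp add: locally_integrable_def integrable_restrict_space[symmetric])
  have "integrable lebesgue (\<lambda>x. indicator \<Omega> x *\<^sub>R (f x *\<^sub>R u x))"
  proof (rule integrable_dominated)
    show "integrable lebesgue (\<lambda>x. B *\<^sub>R (indicator K x *\<^sub>R u x))" using i by (rule integrable_scaleR_right)
    have "(\<lambda>x. f x *\<^sub>R (indicator K x *\<^sub>R u x)) \<in> borel_measurable lebesgue"
      by (intro borel_measurable_scaleR[of f] borel_measurable_integrable[OF i] measurable_completion)
        (use cont borel_measurable_continuous_onI in auto)
    moreover have "f x *\<^sub>R (indicator K x *\<^sub>R u x) = indicator \<Omega> x *\<^sub>R (f x *\<^sub>R u x)" for x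
      using K(2) K(3)[of x] by (auto simp: indicator_def)
    ultimately show "(\<lambda>x. indicator \<Omega> x *\<^sub>R (f x *\<^sub>R u x)) \<in> borel_measurable lebesgue" by (simp only:)
    have "norm (indicator \<Omega> x *\<^sub>R (f x *\<^sub>R u x)) \<le> norm (B *\<^sub>R (indicator K x *\<^sub>R u x))" for x
      using K(2) K(3)[of x] B[of x] by (auto simp: indicator_def intro!: mult_right_mono)
    then show "AE x in lebesgue. norm (indicator \<Omega> x *\<^sub>R (f x *\<^sub>R u x)) \<le> norm (B *\<^sub>R (indicator K x *\<^sub>R u x))"
      by auto
  qed
  then show ?thesis by (simp add: integrable_restrict_space)
qed

text \<open>As \<open>n\<close> grows the cut-offs see the open box, and its boundary is a null set.
  Integrability of \<open>u\<close> on the compact box supplies the dominating function.\<close>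

lemma box_test_integral:
  assumes u: "locally_integrable \<Omega> u" and ab: "cbox a b \<subseteq> \<Omega>"
  shows "(\<lambda>n. LINT x|M. box_approx a b n x *\<^sub>R u x) \<longlonglongrightarrow> integral (cbox a b) u"
    and "u integrable_on cbox a b"
proof -
  have i: "integrable (lebesgue_on (cbox a b)) u"
    using u ab by (auto simp: locally_integrable_def)
  then show int: "u integrable_on cbox a b" by (intro integrable_on_lebesgue_on) auto
  have i': "integrable lebesgue (\<lambda>x. indicator (cbox a b) x *\<^sub>R u x)"
    using i by (simp add: integrable_restrict_space)
  have m2: "(\<lambda>x. indicat_real (cbox a b) x *\<^sub>R u x) \<in> borel_measurable lebesgue"
    using i' by (rule borel_measurable_integrable)
  have m1: "(\<lambda>x. indicat_real (box a b) x *\<^sub>R indicat_real (cbox a b) x *\<^sub>R u x) \<in> borel_measurable lebesgue"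
    by (intro borel_measurable_scaleR[OF borel_measurable_indicator m2]) simp
  have eq: "(LINT x|M. box_approx a b n x *\<^sub>R u x) = (LINT x|lebesgue. box_approx a b n x *\<^sub>R (indicator (cbox a b) x *\<^sub>R u x))" for n
  proof -
    have "(LINT x|M. box_approx a b n x *\<^sub>R u x) = (LINT x|lebesgue. indicator \<Omega> x *\<^sub>R (box_approx a b n x *\<^sub>R u x))"
      by (simp add: integral_restrict_space)
    also have "\<dots> = (LINT x|lebesgue. box_approx a b n x *\<^sub>R (indicator (cbox a b) x *\<^sub>R u x))"
    proof (intro Bochner_Integration.integral_cong refl)
      fix x show "indicator \<Omega> x *\<^sub>R (box_approx a b n x *\<^sub>R u x) = box_approx a b n x *\<^sub>R (indicator (cbox a b) x *\<^sub>R u x)"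
        using ab box_subset_cbox[of a b] box_bump_zero[of x a b] by (auto simp: indicator_def box_approx_def)
    qed
    finally show ?thesis .
  qed
  have "(\<lambda>n. LINT x|lebesgue. box_approx a b n x *\<^sub>R (indicator (cbox a b) x *\<^sub>R u x))
      \<longlonglongrightarrow> (LINT x|lebesgue. indicator (box a b) x *\<^sub>R (indicator (cbox a b) x *\<^sub>R u x))"
  proof (rule integral_dominated_convergence[where w="\<lambda>x. norm (indicator (cbox a b) x *\<^sub>R u x)"])
    show "(\<lambda>x. box_approx a b n x *\<^sub>R indicat_real (cbox a b) x *\<^sub>R u x) \<in> borel_measurable lebesgue" for n
      using i' smooth_continuous[OF smooth_box_approx, of UNIV a b n]
      by (intro borel_measurable_scaleR[of "box_approx a b n"]) (auto intro!: measurable_completion borel_measurable_continuous_onI)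
    show "(\<lambda>x. indicat_real (box a b) x *\<^sub>R indicat_real (cbox a b) x *\<^sub>R u x) \<in> borel_measurable lebesgue"
      using i' by (intro borel_measurable_scaleR[of "indicat_real (box a b)"] borel_measurable_indicator) auto
    show "AE x in lebesgue. (\<lambda>n. box_approx a b n x *\<^sub>R indicat_real (cbox a b) x *\<^sub>R u x) \<longlonglongrightarrow>
        indicat_real (box a b) x *\<^sub>R indicat_real (cbox a b) x *\<^sub>R u x"
      by (intro AE_I2 tendsto_scaleR box_approx_lim tendsto_const)
    show "AE x in lebesgue. norm (box_approx a b n x *\<^sub>R indicat_real (cbox a b) x *\<^sub>R u x)
        \<le> norm (indicat_real (cbox a b) x *\<^sub>R u x)" for n
      using box_approx_bounds[of a b n] by (intro AE_I2) (auto simp: indicator_def mult_left_le_one_le)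
  qed (rule integrable_norm[OF i'])
  also have "(LINT x|lebesgue. indicator (box a b) x *\<^sub>R (indicator (cbox a b) x *\<^sub>R u x))
      = (LINT x|lebesgue. indicator (cbox a b) x *\<^sub>R u x)"
  proof (rule integral_cong_AE)
    have "negligible (cbox a b - box a b)" by (rule negligible_frontier_interval)
    then have "AE x in lebesgue. x \<notin> cbox a b - box a b"
      by (intro AE_not_in) (simp only: negligible_iff_null_sets)
    then show "AE x in lebesgue. indicat_real (box a b) x *\<^sub>R indicat_real (cbox a b) x *\<^sub>R u x =
        indicat_real (cbox a b) x *\<^sub>R u x"
      by eventually_elim (auto simp: indicator_def)
  qed (rule m1, rule m2)
  also have "\<dots> = integral (cbox a b) u"
    using lebesgue_integral_eq_integral[OF i] by (simp add: integral_restrict_space)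
  finally show "(\<lambda>n. LINT x|M. box_approx a b n x *\<^sub>R u x) \<longlonglongrightarrow> integral (cbox a b) u"
    unfolding eq .
qed

text \<open>Fundamental lemma of the calculus of variations: test functions determine the integrals
  over all closed boxes inside \<Omega>, and these determine \<open>g\<close> almost
  everywhere.\<close>

lemma AE_zero_of_test:
  assumes "locally_integrable \<Omega> g" "\<And>f. test_function \<Omega> f \<Longrightarrow> (LINT x|M. f x *\<^sub>R g x) = 0"
  shows "AE x in M. g x = 0"
proof -
  have "(g has_integral 0) (cbox a b)" if "cbox a b \<subseteq> \<Omega>" for a b
    using box_test_integral[OF assms(1) that] assms(2)[OF box_approx_test[OF that]]
    by (simp add: LIMSEQ_const_iff integrable_integral has_integral_integrable_integral)
  from negligible_of_box_integrals[OF open_dom this] show ?thesis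
    by (simp add: AE_lebesgue_on_iff)
qed


section \<open>Calculus of weak derivatives and the Sobolev spaces\<close>

abbreviation wp :: "3 \<Rightarrow> (real^3 \<Rightarrow> 'b::euclidean_space) \<Rightarrow> real^3 \<Rightarrow> 'b" where
  "wp \<equiv> weak_partial \<Omega>"

lemma integral_test:
  assumes "test_function \<Omega> f"
  shows "(LINT x|M. f x) = (LINT x|lborel. f x)" "integrable M f"
proof -
  obtain K where K: "compact K" "K \<subseteq> \<Omega>" "\<And>x. x \<notin> K \<Longrightarrow> f x = 0"
    using test_functionE[OF assms] by metis
  have cont: "continuous_on UNIV f" by (rule smooth_continuous[OF test_function_smooth[OF assms]])
  have int: "integrable lborel f" by (rule integrable_compact_support[OF cont K(1,3)])
  have "indicator \<Omega> x *\<^sub>R f x = f x" for x using K(2) K(3)[of x] by (auto simp: indicator_def)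
  then show "(LINT x|M. f x) = (LINT x|lborel. f x)" "integrable M f"
    using int by (simp_all add: integral_restrict_space integrable_restrict_space integral_completion integrable_completion)
qed

lemma test_L2: "test_function \<Omega> f \<Longrightarrow> f \<in> L2 \<Omega>"
proof -
  assume f: "test_function \<Omega> f"
  obtain K where K: "compact K" "K \<subseteq> \<Omega>" "\<And>x. x \<notin> K \<Longrightarrow> f x = 0"
    using test_functionE[OF f] by metis
  obtain B where "\<And>x. norm (f x) \<le> B"
    using bounded_compact_support[OF smooth_continuous[OF test_function_smooth[OF f]] K(1,3)] by metis
  then show ?thesis by (intro L2_bounded[of _ B] borel_measurable_integrable integral_test f)
qed

lemma has_weak_partial_test:
  assumes k: "test_function \<Omega> k"
  shows "has_weak_partial \<Omega> i k (partial i k)"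
  unfolding has_weak_partial_def
proof (intro conjI allI impI)
  show "locally_integrable \<Omega> k" "locally_integrable \<Omega> (partial i k)"
    by (intro locally_integrableI integral_test k test_function_partial)+
  fix f :: "real^3 \<Rightarrow> real" assume f: "test_function \<Omega> f"
  note s = test_function_smooth[OF f] test_function_smooth[OF k]
  have t: "test_function \<Omega> (\<lambda>x. f x *\<^sub>R k x)"
    by (rule test_function_mono[OF f smooth_scaleR[OF s]]) simp
  have t1: "test_function \<Omega> (\<lambda>x. f x *\<^sub>R partial i k x)"
    by (rule test_function_mono[OF f smooth_scaleR[OF s(1) smooth_partial[OF s(2)]]]) simp
  have t2: "test_function \<Omega> (\<lambda>x. partial i f x *\<^sub>R k x)"
    by (rule test_function_mono[OF k smooth_scaleR[OF smooth_partial[OF s(1)] s(2)]]) simp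
  obtain K where K: "compact K" "\<And>x. x \<notin> K \<Longrightarrow> f x *\<^sub>R k x = 0"
    using test_functionE[OF t] by metis
  have "(LINT x|M. f x *\<^sub>R partial i k x) + (LINT x|M. partial i f x *\<^sub>R k x)
      = (LINT x|M. partial i (\<lambda>x. f x *\<^sub>R k x) x)"
    using integral_test(2)[OF t1] integral_test(2)[OF t2] by (simp add: partial_scaleR[OF s])
  also have "\<dots> = (LINT x|lborel. partial i (\<lambda>x. f x *\<^sub>R k x) x)"
    by (rule integral_test(1)[OF test_function_partial[OF t]])
  also have "\<dots> = 0"
    by (rule integral_partial_zero[OF test_function_smooth[OF t] K])
  finally show "(LINT x|M. partial i f x *\<^sub>R k x) = - (LINT x|M. f x *\<^sub>R partial i k x)"
    by (simp add: eq_neg_iff_add_eq_0 add.commute)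
qed

lemma locally_integrable_add:
  shows "locally_integrable \<Omega> u \<Longrightarrow> locally_integrable \<Omega> w \<Longrightarrow> locally_integrable \<Omega> (\<lambda>x. u x + w x)"
  by (simp add: locally_integrable_def)

lemma locally_integrable_linear:
  fixes u :: "real^3 \<Rightarrow> 'b::euclidean_space" and L :: "'b \<Rightarrow> 'c::euclidean_space"
  shows "bounded_linear L \<Longrightarrow> locally_integrable \<Omega> u \<Longrightarrow> locally_integrable \<Omega> (\<lambda>x. L (u x))"
  by (simp add: locally_integrable_def integrable_bounded_linear)

lemma locally_integrable_AE:
  assumes u: "locally_integrable \<Omega> u" and eq: "AE x in M. u x = w x"
  shows "locally_integrable \<Omega> w"
  unfolding locally_integrable_def
proof (intro allI impI)
  fix K assume K: "compact K \<and> K \<subseteq> \<Omega>"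
  then have Km: "K \<in> sets lebesgue" by (simp add: fmeasurableD lmeasurable_compact)
  have i: "integrable (lebesgue_on K) u" using u K by (simp add: locally_integrable_def)
  have eq': "AE x in lebesgue_on K. u x = w x"
    using eq K Km by (auto simp: AE_lebesgue_on_iff elim!: negligible_subset)
  then have "w \<in> borel_measurable (lebesgue_on K)"
    using i borel_measurable_lebesgue_on_AE[OF Km] borel_measurable_integrable by blast
  then show "integrable (lebesgue_on K) w"
    using i eq' by (subst integrable_cong_AE[of w _ u]) auto
qed

lemma has_weak_partial_add:
  assumes "has_weak_partial \<Omega> i u g" "has_weak_partial \<Omega> i w h"
  shows "has_weak_partial \<Omega> i (\<lambda>x. u x + w x) (\<lambda>x. g x + h x)"
  using assms unfolding has_weak_partial_def
  by (auto simp: locally_integrable_add scaleR_add_right locally_integrable_test test_function_partial)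

lemma has_weak_partial_linear:
  fixes u :: "real^3 \<Rightarrow> 'b::euclidean_space" and L :: "'b \<Rightarrow> 'c::euclidean_space"
  assumes L: "bounded_linear L" and u: "has_weak_partial \<Omega> i u g"
  shows "has_weak_partial \<Omega> i (\<lambda>x. L (u x)) (\<lambda>x. L (g x))"
  unfolding has_weak_partial_def
proof (intro conjI allI impI)
  note lu = u[unfolded has_weak_partial_def, THEN conjunct1]
    and lg = u[unfolded has_weak_partial_def, THEN conjunct2, THEN conjunct1]
  show "locally_integrable \<Omega> (\<lambda>x. L (u x))" "locally_integrable \<Omega> (\<lambda>x. L (g x))"
    using lu lg by (auto intro: locally_integrable_linear[OF L])
  fix f :: "real^3 \<Rightarrow> real" assume f: "test_function \<Omega> f"
  have "(LINT x|M. partial i f x *\<^sub>R L (u x)) = L (LINT x|M. partial i f x *\<^sub>R u x)"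
    using integral_bounded_linear[OF L locally_integrable_test[OF lu test_function_partial[OF f]]]
    by (simp add: linear_scale[OF bounded_linear.linear[OF L]])
  also have "\<dots> = - L (LINT x|M. f x *\<^sub>R g x)"
    using u f by (simp add: has_weak_partial_def linear_neg[OF bounded_linear.linear[OF L]])
  also have "L (LINT x|M. f x *\<^sub>R g x) = (LINT x|M. f x *\<^sub>R L (g x))"
    using integral_bounded_linear[OF L locally_integrable_test[OF lg f]]
    by (simp add: linear_scale[OF bounded_linear.linear[OF L]])
  finally show "(LINT x|M. partial i f x *\<^sub>R L (u x)) = - (LINT x|M. f x *\<^sub>R L (g x))" .
qed

lemma has_weak_partial_diff:
  assumes "has_weak_partial \<Omega> i u g" "has_weak_partial \<Omega> i w h"
  shows "has_weak_partial \<Omega> i (\<lambda>x. u x - w x) (\<lambda>x. g x - h x)"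
  using has_weak_partial_add[OF assms(1) has_weak_partial_linear[OF bounded_linear_minus[OF bounded_linear_ident] assms(2)]]
  by simp

lemma has_weak_partial_zero: "has_weak_partial \<Omega> i (\<lambda>x. 0) (\<lambda>x. 0 :: 'b::euclidean_space)"
  by (simp add: has_weak_partial_def locally_integrable_def)

lemma has_weak_partial_AE:
  fixes u :: "real^3 \<Rightarrow> 'b::euclidean_space"
  assumes h: "has_weak_partial \<Omega> i u g" and eq: "AE x in M. u x = u' x" "AE x in M. g x = g' x"
  shows "has_weak_partial \<Omega> i u' g'"
proof -
  have l: "locally_integrable \<Omega> u" "locally_integrable \<Omega> g" using h by (auto simp: has_weak_partial_def)
  have l': "locally_integrable \<Omega> u'" "locally_integrable \<Omega> g'"
    using locally_integrable_AE[OF l(1) eq(1)] locally_integrable_AE[OF l(2) eq(2)] by auto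
  have "(LINT x|M. q x *\<^sub>R f x) = (LINT x|M. q x *\<^sub>R f' x)"
    if "test_function \<Omega> q" "AE x in M. f x = f' x" "locally_integrable \<Omega> f" "locally_integrable \<Omega> f'"
    for q and f f' :: "real^3 \<Rightarrow> 'b"
    using that by (intro integral_cong_AE borel_measurable_integrable[OF locally_integrable_test]) auto
  note e = this
  show ?thesis
    unfolding has_weak_partial_def
  proof (intro conjI allI impI l')
    fix q :: "real^3 \<Rightarrow> real" assume q: "test_function \<Omega> q"
    have "(LINT x|M. partial i q x *\<^sub>R u x) = - (LINT x|M. q x *\<^sub>R g x)"
      using h q by (simp add: has_weak_partial_def)
    then show "(LINT x|M. partial i q x *\<^sub>R u' x) = - (LINT x|M. q x *\<^sub>R g' x)"
      unfolding e[OF test_function_partial[OF q] eq(1) l(1) l'(1)] e[OF q eq(2) l(2) l'(2)] .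
  qed
qed

lemma weak_partial_unique:
  assumes "has_weak_partial \<Omega> i u g" "has_weak_partial \<Omega> i u h"
  shows "AE x in M. g x = h x"
proof -
  have "has_weak_partial \<Omega> i (\<lambda>x. 0) (\<lambda>x. g x - h x)"
    using has_weak_partial_diff[OF assms] by simp
  then have "AE x in M. g x - h x = 0"
    by (intro AE_zero_of_test) (auto simp: has_weak_partial_def)
  then show ?thesis by simp
qed

lemma weak_partial_works: "has_weak_partial \<Omega> i u g \<Longrightarrow> has_weak_partial \<Omega> i u (wp i u)"
  unfolding weak_partial_def by (rule someI[where P="has_weak_partial \<Omega> i u"])

lemma weak_partial_AE: "has_weak_partial \<Omega> i u g \<Longrightarrow> AE x in M. wp i u x = g x"
  using weak_partial_unique weak_partial_works by blast

text \<open>Functions that agree almost everywhere have the same set of weak derivatives, so the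
  choice operator picks literally the same function; the equality is exact and not just almost
  everywhere.\<close>

lemma weak_partial_cong:
  assumes "AE x in M. u x = u' x" shows "wp i u = wp i u'"
proof -
  have "AE x in M. u' x = u x" using assms by auto
  then have "has_weak_partial \<Omega> i u = has_weak_partial \<Omega> i u'"
    using assms by (intro ext iffI) (auto elim!: has_weak_partial_AE)
  then show ?thesis by (simp add: weak_partial_def)
qed

lemma H1_L2: "u \<in> H1 \<Omega> \<Longrightarrow> u \<in> L2 \<Omega>"
  by (simp add: H1_def)

lemma H1_weak: "u \<in> H1 \<Omega> \<Longrightarrow> has_weak_partial \<Omega> i u (wp i u)"
  unfolding H1_def using weak_partial_works by blast

lemma H1_wp_L2: "u \<in> H1 \<Omega> \<Longrightarrow> wp i u \<in> L2 \<Omega>"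
proof -
  assume "u \<in> H1 \<Omega>"
  then obtain g where g: "g \<in> L2 \<Omega>" "has_weak_partial \<Omega> i u g" by (auto simp: H1_def)
  have "AE x in M. g x = wp i u x" using weak_partial_AE[OF g(2)] by auto
  then show ?thesis by (rule L2_AE[OF g(1)])
qed

lemma H1I: "u \<in> L2 \<Omega> \<Longrightarrow> (\<And>i. g i \<in> L2 \<Omega>) \<Longrightarrow> (\<And>i. has_weak_partial \<Omega> i u (g i)) \<Longrightarrow> u \<in> H1 \<Omega>"
  unfolding H1_def by blast

lemma H1_diff:
  assumes "u \<in> H1 \<Omega>" "w \<in> H1 \<Omega>"
  shows "(\<lambda>x. u x - w x) \<in> H1 \<Omega>" "AE x in M. wp i (\<lambda>x. u x - w x) x = wp i u x - wp i w x"
proof -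
  note h = has_weak_partial_diff[OF H1_weak[OF assms(1)] H1_weak[OF assms(2)]]
  show "(\<lambda>x. u x - w x) \<in> H1 \<Omega>"
    by (rule H1I[OF _ _ h]) (auto intro: assms L2_diff H1_L2 H1_wp_L2)
  show "AE x in M. wp i (\<lambda>x. u x - w x) x = wp i u x - wp i w x"
    by (rule weak_partial_AE[OF h])
qed

lemma H1_test: "test_function \<Omega> k \<Longrightarrow> k \<in> H1 \<Omega>"
  by (rule H1I[OF test_L2 test_L2[OF test_function_partial] has_weak_partial_test])

lemma H1_zero_class:
  assumes "AE x in M. u x = 0"
  shows "u \<in> H1 \<Omega>" "AE x in M. wp i u x = 0"
proof -
  have eq: "AE x in M. 0 = u x" using assms by auto
  have h: "has_weak_partial \<Omega> i u (\<lambda>x. 0)" for i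
    by (rule has_weak_partial_AE[OF has_weak_partial_zero eq]) simp
  show "u \<in> H1 \<Omega>" by (rule H1I[OF L2_AE[OF L2_zero eq] L2_zero h])
  show "AE x in M. wp i u x = 0" by (rule weak_partial_AE[OF h])
qed

lemma norm_H1_ge:
  shows "nm u \<le> norm_H1 \<Omega> u" "nm (wp i u) \<le> norm_H1 \<Omega> u" "norm_H1 \<Omega> u \<ge> 0"
proof -
  have s: "(nm (wp i u))\<^sup>2 \<le> (\<Sum>i\<in>UNIV. (nm (wp i u))\<^sup>2)" for i
    by (rule member_le_sum) auto
  have p: "0 \<le> (\<Sum>i\<in>UNIV. (nm (wp i u))\<^sup>2)" by (intro sum_nonneg) auto
  show "nm u \<le> norm_H1 \<Omega> u" "nm (wp i u) \<le> norm_H1 \<Omega> u"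
    unfolding norm_H1_def using p s[of i] zero_le_power2[of "nm u"] by (intro real_le_rsqrt, linarith)+
  show "norm_H1 \<Omega> u \<ge> 0"
    unfolding norm_H1_def using p by simp
qed

lemma norm_H2_ge:
  shows "nm u \<le> norm_H2 \<Omega> u" "norm_H1 \<Omega> (wp i u) \<le> norm_H2 \<Omega> u"
proof -
  have s: "(norm_H1 \<Omega> (wp i u))\<^sup>2 \<le> (\<Sum>i\<in>UNIV. (norm_H1 \<Omega> (wp i u))\<^sup>2)" for i
    by (rule member_le_sum) auto
  have p: "0 \<le> (\<Sum>i\<in>UNIV. (norm_H1 \<Omega> (wp i u))\<^sup>2)" by (intro sum_nonneg) auto
  show "nm u \<le> norm_H2 \<Omega> u" "norm_H1 \<Omega> (wp i u) \<le> norm_H2 \<Omega> u"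
    unfolding norm_H2_def using p s[of i] zero_le_power2[of "nm u"] by (intro real_le_rsqrt, linarith)+
qed

lemma H1_0_approx:
  assumes "u \<in> H1_0 \<Omega>"
  obtains f where "\<And>n. test_function \<Omega> (f n)"
    "(\<lambda>n. nm (\<lambda>x. f n x - u x)) \<longlonglongrightarrow> 0"
    "\<And>i. (\<lambda>n. nm (\<lambda>x. partial i (f n) x - wp i u x)) \<longlonglongrightarrow> 0"
proof -
  obtain f where f: "\<And>n. test_function \<Omega> (f n)" "(\<lambda>n. norm_H1 \<Omega> (\<lambda>x. f n x - u x)) \<longlonglongrightarrow> 0"
    and u: "u \<in> H1 \<Omega>"
    using assms by (auto simp: H1_0_def)
  have "(\<lambda>n. nm (\<lambda>x. f n x - u x)) \<longlonglongrightarrow> 0"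
    by (rule real_tendsto_sandwich[OF always_eventually always_eventually tendsto_const f(2)])
      (auto intro: norm_H1_ge)
  moreover have "(\<lambda>n. nm (\<lambda>x. partial i (f n) x - wp i u x)) \<longlonglongrightarrow> 0" for i
  proof (rule real_tendsto_sandwich[OF always_eventually always_eventually tendsto_const f(2)]; intro allI)
    fix n
    have h: "has_weak_partial \<Omega> i (\<lambda>x. f n x - u x) (\<lambda>x. partial i (f n) x - wp i u x)"
      by (intro has_weak_partial_diff has_weak_partial_test f H1_weak u)
    have "(\<lambda>x. f n x - u x) \<in> H1 \<Omega>" by (intro H1_diff H1_test f u)
    then have "nm (wp i (\<lambda>x. f n x - u x)) = nm (\<lambda>x. partial i (f n) x - wp i u x)"
      by (intro nm_cong_AE weak_partial_AE[OF h] H1_wp_L2)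
    then show "nm (\<lambda>x. partial i (f n) x - wp i u x) \<le> norm_H1 \<Omega> (\<lambda>x. f n x - u x)"
      using norm_H1_ge(2) by metis
  qed simp
  ultimately show thesis by (rule that[OF f(1)])
qed

text \<open>Weak derivatives are defined by pairing with scalar test functions; the pairing with
  vector-valued ones is recovered coordinate by coordinate.\<close>

lemma weak_partial_test_inner:
  fixes g k :: "real^3 \<Rightarrow> 'b::euclidean_space"
  assumes g: "g \<in> H1 \<Omega>" and k: "test_function \<Omega> k"
  shows "wp i g \<cdot> k = - (g \<cdot> partial i k)"
proof -
  note sm = test_function_smooth[OF k]
  have tb: "test_function \<Omega> (\<lambda>x. k x \<bullet> b)" for b
    by (rule test_function_mono[OF k smooth_linear[OF bounded_linear_inner_left sm]]) simp
  have pb: "partial i (\<lambda>x. k x \<bullet> b) x = partial i k x \<bullet> b" for b x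
    by (rule partial_linear[OF bounded_linear_inner_left sm])
  have eb: "(LINT x|M. (partial i k x \<bullet> b) * (g x \<bullet> b)) = - (LINT x|M. (k x \<bullet> b) * (wp i g x \<bullet> b))" for b
    using has_weak_partial_linear[OF bounded_linear_inner_left[of b] H1_weak[OF g, of i]] tb[of b]
    by (auto simp: has_weak_partial_def pb)
  have int: "integrable M (\<lambda>x. (f x \<bullet> b) * (h x \<bullet> b))" if "f \<in> L2 \<Omega>" "h \<in> L2 \<Omega>" for f h :: "real^3 \<Rightarrow> 'b" and b
    using L2_inner_integrable[OF L2_inner_const[OF that(1)] L2_inner_const[OF that(2)]] by simp
  have e1: "(\<lambda>x. wp i g x \<bullet> k x) = (\<lambda>x. \<Sum>b\<in>Basis. (wp i g x \<bullet> b) * (k x \<bullet> b))"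
    by (rule ext, rule euclidean_inner)
  have e2: "(\<lambda>x. g x \<bullet> partial i k x) = (\<lambda>x. \<Sum>b\<in>Basis. (g x \<bullet> b) * (partial i k x \<bullet> b))"
    by (rule ext, rule euclidean_inner)
  have "wp i g \<cdot> k = (\<Sum>b\<in>Basis. LINT x|M. (k x \<bullet> b) * (wp i g x \<bullet> b))"
    unfolding inner_L2_def e1
    using int[OF test_L2[OF k] H1_wp_L2[OF g]] by (simp add: mult.commute)
  also have "\<dots> = - (\<Sum>b\<in>Basis. LINT x|M. (partial i k x \<bullet> b) * (g x \<bullet> b))"
    by (simp add: eb sum_negf)
  also have "(\<Sum>b\<in>Basis. LINT x|M. (partial i k x \<bullet> b) * (g x \<bullet> b)) = g \<cdot> partial i k"
    unfolding inner_L2_def e2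
    using int[OF test_L2[OF test_function_partial[OF k]] H1_L2[OF g]] by (simp add: mult.commute)
  finally show ?thesis .
qed

text \<open>Test functions approximate \<open>u\<close> in H^1, so the identity for test functions
  passes to the limit without a boundary term, whatever the boundary values of
  \<open>g\<close>.\<close>

lemma integration_by_parts_H1_0:
  assumes g: "g \<in> H1 \<Omega>" and u: "u \<in> H1_0 \<Omega>"
  shows "wp i g \<cdot> u = - (g \<cdot> wp i u)"
proof -
  have uH: "u \<in> H1 \<Omega>" using u by (simp add: H1_0_def)
  show ?thesis
  proof (rule H1_0_approx[OF u])
    fix f assume f: "\<And>n. test_function \<Omega> (f n)"
      "(\<lambda>n. nm (\<lambda>x. f n x - u x)) \<longlonglongrightarrow> 0"
      "\<And>i. (\<lambda>n. nm (\<lambda>x. partial i (f n) x - wp i u x)) \<longlonglongrightarrow> 0"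
    have 1: "(\<lambda>n. wp i g \<cdot> f n) \<longlonglongrightarrow> wp i g \<cdot> u"
      using f by (intro ip_tendsto H1_wp_L2[OF g] test_L2 H1_L2[OF uH]) auto
    have 2: "(\<lambda>n. - (g \<cdot> partial i (f n))) \<longlonglongrightarrow> - (g \<cdot> wp i u)"
      using f by (intro tendsto_minus ip_tendsto H1_L2[OF g] test_L2 test_function_partial H1_wp_L2[OF uH]) auto
    show ?thesis
      by (rule LIMSEQ_unique[OF 1 2[folded weak_partial_test_inner[OF g f(1)]]])
  qed
qed

lemma H2_H1: "u \<in> H2 \<Omega> \<Longrightarrow> u \<in> H1 \<Omega>" "u \<in> H2 \<Omega> \<Longrightarrow> wp i u \<in> H1 \<Omega>"
  by (auto simp: H2_def)

lemma laplacian_L2: "u \<in> H2 \<Omega> \<Longrightarrow> lap u \<in> L2 \<Omega>"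
  unfolding weak_laplacian_def by (intro L2_sum H1_wp_L2 H2_H1)

lemma Green_H1_0:
  assumes v: "v \<in> H2 \<Omega>" and u: "u \<in> H1_0 \<Omega>"
  shows "lap v \<cdot> u = - (\<Sum>i\<in>UNIV. wp i v \<cdot> wp i u)"
proof -
  have "u \<in> L2 \<Omega>" using u by (simp add: H1_0_def H1_def)
  then have "lap v \<cdot> u = (\<Sum>i\<in>UNIV. wp i (wp i v) \<cdot> u)"
    unfolding weak_laplacian_def using v by (intro ip_sum_left H1_wp_L2 H2_H1)
  also have "\<dots> = - (\<Sum>i\<in>UNIV. wp i v \<cdot> wp i u)"
    by (simp add: integration_by_parts_H1_0[OF H2_H1(2)[OF v] u] sum_negf)
  finally show ?thesis .
qed

end

subsection \<open>The Sobolev inequality and the convective term\<close>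

lemma prod_UNIV_3: "prod f (UNIV :: 3 set) = f 1 * f 2 * f 3"
  unfolding UNIV_3 by (simp add: ac_simps)

definition vec3 :: "real \<Rightarrow> real \<Rightarrow> real \<Rightarrow> real^3" where
  "vec3 x y z = x *\<^sub>R axis 1 1 + y *\<^sub>R axis 2 1 + z *\<^sub>R axis 3 1"

lemma vec3_nth [simp]: "vec3 x y z $ 1 = x" "vec3 x y z $ 2 = y" "vec3 x y z $ 3 = z"
  by (simp_all add: vec3_def axis_def)

lemma vec3_shift:
  "vec3 x y z + s *\<^sub>R axis 1 1 = vec3 (s + x) y z"
  "vec3 x y z + s *\<^sub>R axis 2 1 = vec3 x (s + y) z"
  "vec3 x y z + s *\<^sub>R axis 3 1 = vec3 x y (s + z)"
  by (simp_all add: vec3_def algebra_simps)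

lemma measurable_vec3 [measurable]:
  assumes [measurable]: "f \<in> borel_measurable N" "g \<in> borel_measurable N" "h \<in> borel_measurable N"
  shows "(\<lambda>x. vec3 (f x) (g x) (h x)) \<in> borel_measurable N"
  unfolding vec3_def by (intro borel_measurable_add borel_measurable_scaleR borel_measurable_const assms)

lemma sigma_finite_pair: "sigma_finite_measure (lborel \<Otimes>\<^sub>M lborel :: (real \<times> real) measure)"
  unfolding lborel_prod by (rule lborel.sigma_finite_measure_axioms)

text \<open>Lebesgue measure is characterised by its values on boxes; the product form turns
  integrals over \<open>real^3\<close> into iterated integrals along the coordinate axes.\<close>

lemma lborel_vec3:
  "lborel = distr (lborel \<Otimes>\<^sub>M (lborel \<Otimes>\<^sub>M lborel)) borel (\<lambda>p. vec3 (fst p) (fst (snd p)) (snd (snd p)))"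
proof (rule lborel_eqI)
  fix l u :: "real^3" assume lu: "\<And>b. b \<in> Basis \<Longrightarrow> l \<bullet> b \<le> u \<bullet> b"
  have le: "l $ i \<le> u $ i" for i using lu[of "axis i 1"] by (simp add: inner_axis axis_in_Basis_iff)
  have eq: "(\<lambda>p. vec3 (fst p) (fst (snd p)) (snd (snd p))) -` box l u \<inter> space (lborel \<Otimes>\<^sub>M (lborel \<Otimes>\<^sub>M lborel))
     = {l$1<..<u$1} \<times> ({l$2<..<u$2} \<times> {l$3<..<u$3})"
    by (auto simp: space_pair_measure mem_box_cart forall_3)
  have "emeasure (distr (lborel \<Otimes>\<^sub>M (lborel \<Otimes>\<^sub>M lborel)) borel (\<lambda>p. vec3 (fst p) (fst (snd p)) (snd (snd p)))) (box l u)
      = ennreal (u$1 - l$1) * (ennreal (u$2 - l$2) * ennreal (u$3 - l$3))"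
    using le by (subst emeasure_distr)
      (auto simp: eq lborel.emeasure_pair_measure_Times sigma_finite_measure.emeasure_pair_measure_Times[OF sigma_finite_pair] intro!: measurable_vec3)
  also have "\<dots> = ennreal ((u$1 - l$1) * ((u$2 - l$2) * (u$3 - l$3)))"
    using le by (simp add: ennreal_mult)
  also have "(u$1 - l$1) * ((u$2 - l$2) * (u$3 - l$3)) = (\<Prod>b\<in>Basis. (u - l) \<bullet> b)"
  proof -
    have "(\<Prod>b\<in>Basis. (u - l) \<bullet> b) = (\<Prod>i\<in>UNIV. (u - l) \<bullet> axis i 1)"
      unfolding Basis_vec_def
      by (subst prod.reindex_bij_betw[of "\<lambda>i. axis i 1", symmetric])
        (auto simp: bij_betw_def inj_on_def axis_eq_axis)
    also have "\<dots> = (\<Prod>i\<in>UNIV. (u - l) $ i)"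
      by (intro prod.cong refl) (simp add: inner_axis)
    finally show ?thesis by (simp add: prod_UNIV_3 mult.assoc)
  qed
  finally show "emeasure (distr (lborel \<Otimes>\<^sub>M (lborel \<Otimes>\<^sub>M lborel)) borel (\<lambda>p. vec3 (fst p) (fst (snd p)) (snd (snd p)))) (box l u)
      = ennreal (\<Prod>b\<in>Basis. (u - l) \<bullet> b)" .
qed simp

lemma nn_integral_vec3:
  assumes [measurable]: "f \<in> borel_measurable borel"
  shows "(\<integral>\<^sup>+v. f v \<partial>lborel) = (\<integral>\<^sup>+x. \<integral>\<^sup>+y. \<integral>\<^sup>+z. f (vec3 x y z) \<partial>lborel \<partial>lborel \<partial>lborel)"
proof -
  have "(\<integral>\<^sup>+v. f v \<partial>lborel) = (\<integral>\<^sup>+p. f (vec3 (fst p) (fst (snd p)) (snd (snd p))) \<partial>(lborel \<Otimes>\<^sub>M (lborel \<Otimes>\<^sub>M lborel)))"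
    by (subst lborel_vec3, subst nn_integral_distr) auto
  also have "\<dots> = (\<integral>\<^sup>+x. \<integral>\<^sup>+q. f (vec3 x (fst q) (snd q)) \<partial>(lborel \<Otimes>\<^sub>M lborel) \<partial>lborel)"
    by (subst sigma_finite_measure.nn_integral_fst[OF sigma_finite_pair, symmetric]) auto
  also have "\<dots> = (\<integral>\<^sup>+x. \<integral>\<^sup>+y. \<integral>\<^sup>+z. f (vec3 x y z) \<partial>lborel \<partial>lborel \<partial>lborel)"
    by (subst lborel.nn_integral_fst[symmetric]) auto
  finally show ?thesis .
qed

text \<open>The value infinity at infinity makes the Cauchy-Schwarz inequality valid for all
  measurable functions, so the iterated estimates can be carried out before anything is known to be
  finite.\<close>

definition esqrt :: "ennreal \<Rightarrow> ennreal" where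
  "esqrt x = (if x = \<infinity> then \<infinity> else ennreal (sqrt (enn2real x)))"

lemma esqrt_power2 [simp]: "(esqrt x)\<^sup>2 = x"
  by (cases x) (auto simp: esqrt_def ennreal_power power2_eq_square ennreal_mult[symmetric] ennreal_mult_top ennreal_top_mult)

lemma ennreal_power2_le_imp_le: "a\<^sup>2 \<le> b\<^sup>2 \<Longrightarrow> a \<le> b" for a b :: ennreal
proof (cases a; cases b)
  fix r s assume *: "a\<^sup>2 \<le> b\<^sup>2" "a = ennreal r" "b = ennreal s" "r \<ge> 0" "s \<ge> 0"
  then have "r\<^sup>2 \<le> s\<^sup>2" by (simp add: ennreal_power)
  then show "a \<le> b" using * by (auto intro!: ennreal_leI power2_le_imp_le)
next
  fix s assume "a\<^sup>2 \<le> b\<^sup>2" "a = top" "b = ennreal s" "0 \<le> s"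
  then show "a \<le> b" by (simp add: power2_eq_square ennreal_mult[symmetric] ennreal_mult_top ennreal_top_mult top_unique)
qed auto

lemma measurable_esqrt [measurable]: "esqrt \<in> borel_measurable borel"
  unfolding esqrt_def by measurable

lemma nn_integral_Cauchy_Schwarz_esqrt:
  assumes "f \<in> borel_measurable N" "g \<in> borel_measurable N"
  shows "(\<integral>\<^sup>+x. f x * g x \<partial>N) \<le> esqrt (\<integral>\<^sup>+x. (f x)\<^sup>2 \<partial>N) * esqrt (\<integral>\<^sup>+x. (g x)\<^sup>2 \<partial>N)"
  by (rule ennreal_power2_le_imp_le)
    (use Cauchy_Schwarz_nn_integral[OF assms] in \<open>simp add: power_mult_distrib\<close>)

text \<open>Cauchy-Schwarz in z, then in y, then in x: each variable is missing from one of the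
  three factors, which can therefore be taken out of the corresponding integral.\<close>

lemma Loomis_Whitney:
  fixes A B C :: "real \<Rightarrow> real \<Rightarrow> ennreal"
  assumes [measurable]: "case_prod A \<in> borel_measurable (lborel \<Otimes>\<^sub>M lborel)"
    "case_prod B \<in> borel_measurable (lborel \<Otimes>\<^sub>M lborel)" "case_prod C \<in> borel_measurable (lborel \<Otimes>\<^sub>M lborel)"
  shows "(\<integral>\<^sup>+x. \<integral>\<^sup>+y. \<integral>\<^sup>+z. A y z * B x z * C x y \<partial>lborel \<partial>lborel \<partial>lborel)\<^sup>2
    \<le> (\<integral>\<^sup>+y. \<integral>\<^sup>+z. (A y z)\<^sup>2 \<partial>lborel \<partial>lborel) * (\<integral>\<^sup>+x. \<integral>\<^sup>+z. (B x z)\<^sup>2 \<partial>lborel \<partial>lborel)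
      * (\<integral>\<^sup>+x. \<integral>\<^sup>+y. (C x y)\<^sup>2 \<partial>lborel \<partial>lborel)"
proof -
  define a where "a y = (\<integral>\<^sup>+z. (A y z)\<^sup>2 \<partial>lborel)" for y
  define b where "b x = (\<integral>\<^sup>+z. (B x z)\<^sup>2 \<partial>lborel)" for x
  define c where "c x = (\<integral>\<^sup>+y. (C x y)\<^sup>2 \<partial>lborel)" for x
  have [measurable]: "a \<in> borel_measurable borel" "b \<in> borel_measurable borel" "c \<in> borel_measurable borel"
    unfolding a_def b_def c_def by measurable
  have z: "(\<integral>\<^sup>+z. A y z * B x z * C x y \<partial>lborel) \<le> C x y * esqrt (a y) * esqrt (b x)" for x y
  proof -
    have "(\<integral>\<^sup>+z. A y z * B x z * C x y \<partial>lborel) = C x y * (\<integral>\<^sup>+z. A y z * B x z \<partial>lborel)"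
      by (subst nn_integral_cmult[symmetric]) (auto simp: mult_ac)
    also have "\<dots> \<le> C x y * (esqrt (a y) * esqrt (b x))"
      unfolding a_def b_def by (intro mult_left_mono nn_integral_Cauchy_Schwarz_esqrt) auto
    finally show ?thesis by (simp add: mult_ac)
  qed
  have y: "(\<integral>\<^sup>+y. C x y * esqrt (a y) * esqrt (b x) \<partial>lborel) \<le> esqrt (\<integral>\<^sup>+y. a y \<partial>lborel) * (esqrt (b x) * esqrt (c x))" for x
  proof -
    have "(\<integral>\<^sup>+y. C x y * esqrt (a y) * esqrt (b x) \<partial>lborel) = esqrt (b x) * (\<integral>\<^sup>+y. C x y * esqrt (a y) \<partial>lborel)"
      by (subst nn_integral_cmult[symmetric]) (auto simp: mult_ac)
    also have "\<dots> \<le> esqrt (b x) * (esqrt (\<integral>\<^sup>+y. (C x y)\<^sup>2 \<partial>lborel) * esqrt (\<integral>\<^sup>+y. (esqrt (a y))\<^sup>2 \<partial>lborel))"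
      by (intro mult_left_mono nn_integral_Cauchy_Schwarz_esqrt) auto
    finally show ?thesis by (simp add: mult_ac c_def)
  qed
  have "(\<integral>\<^sup>+x. \<integral>\<^sup>+y. \<integral>\<^sup>+z. A y z * B x z * C x y \<partial>lborel \<partial>lborel \<partial>lborel)
      \<le> (\<integral>\<^sup>+x. esqrt (\<integral>\<^sup>+y. a y \<partial>lborel) * (esqrt (b x) * esqrt (c x)) \<partial>lborel)"
    by (intro nn_integral_mono order_trans[OF nn_integral_mono y] z)
  also have "\<dots> = esqrt (\<integral>\<^sup>+y. a y \<partial>lborel) * (\<integral>\<^sup>+x. esqrt (b x) * esqrt (c x) \<partial>lborel)"
    by (rule nn_integral_cmult) measurable
  also have "\<dots> \<le> esqrt (\<integral>\<^sup>+y. a y \<partial>lborel) * (esqrt (\<integral>\<^sup>+x. (esqrt (b x))\<^sup>2 \<partial>lborel) * esqrt (\<integral>\<^sup>+x. (esqrt (c x))\<^sup>2 \<partial>lborel))"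
    by (intro mult_left_mono nn_integral_Cauchy_Schwarz_esqrt) auto
  finally have "(\<integral>\<^sup>+x. \<integral>\<^sup>+y. \<integral>\<^sup>+z. A y z * B x z * C x y \<partial>lborel \<partial>lborel \<partial>lborel)
      \<le> esqrt (\<integral>\<^sup>+y. a y \<partial>lborel) * (esqrt (\<integral>\<^sup>+x. b x \<partial>lborel) * esqrt (\<integral>\<^sup>+x. c x \<partial>lborel))" by simp
  from power_mono[OF this, of 2] show ?thesis
    by (simp add: power_mult_distrib a_def b_def c_def mult_ac)
qed

lemma FTC_compact_support_bound:
  fixes f f' :: "real \<Rightarrow> real"
  assumes d: "\<And>s. (f has_vector_derivative f' s) (at s)" and c: "continuous_on UNIV f'"
    and R: "\<And>s. \<bar>s\<bar> > R \<Longrightarrow> f s = 0"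
  shows "ennreal \<bar>f t\<bar> \<le> (\<integral>\<^sup>+s. ennreal \<bar>f' s\<bar> \<partial>lborel)"
proof -
  \<comment> \<open>Lies left of \<open>t\<close> and outside the support, whatever the sign of
    \<open>R\<close>.\<close>
  define a where "a = min t (- \<bar>R\<bar> - 1)"
  have a: "a \<le> t" "f a = 0" by (auto simp: a_def intro!: R)
  have i: "(f' has_integral (f t - f a)) {a..t}"
    by (rule fundamental_theorem_of_calculus[OF a(1)]) (rule has_vector_derivative_at_within[OF d])
  have ca: "continuous_on {a..t} (\<lambda>s. \<bar>f' s\<bar>)" by (intro continuous_intros continuous_on_subset[OF c]) auto
  have i2: "((\<lambda>s. \<bar>f' s\<bar>) has_integral integral {a..t} (\<lambda>s. \<bar>f' s\<bar>)) {a..t}"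
    by (rule integrable_integral[OF integrable_continuous_real[OF ca]])
  have "\<bar>f t\<bar> \<le> integral {a..t} (\<lambda>s. \<bar>f' s\<bar>)"
    using integral_norm_bound_integral[OF has_integral_integrable[OF i] has_integral_integrable[OF i2]] integral_unique[OF i] a by simp
  then have "ennreal \<bar>f t\<bar> \<le> ennreal (integral {a..t} (\<lambda>s. \<bar>f' s\<bar>))" by (rule ennreal_leI)
  also have "\<dots> = (\<integral>\<^sup>+s. ennreal (indicator {a..t} s * \<bar>f' s\<bar>) \<partial>lborel)"
    by (rule nn_integral_has_integral_lebesgue[OF _ i2, symmetric]) simp
  also have "\<dots> \<le> (\<integral>\<^sup>+s. ennreal \<bar>f' s\<bar> \<partial>lborel)"
    by (intro nn_integral_mono ennreal_leI) (auto simp: indicator_def)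
  finally show ?thesis .
qed

lemma nn_integral_shift:
  fixes f :: "real \<Rightarrow> ennreal"
  assumes [measurable]: "f \<in> borel_measurable borel"
  shows "(\<integral>\<^sup>+s. f (s + c) \<partial>lborel) = (\<integral>\<^sup>+s. f s \<partial>lborel)"
  using nn_integral_real_affine[of f 1 c] by (simp add: add.commute)

text \<open>The Gagliardo-Nirenberg inequality for the exponent 3/2. At each point |w| is at most
  the integral of \<open>\<bar>partial i w\<bar>\<close> over the line through it in direction
  \<open>i\<close>. The three line integrals \<open>H1\<close>, \<open>H2\<close>, \<open>H3\<close>
  each miss one coordinate, so \<open>Loomis_Whitney\<close> applies to their square roots.\<close>

lemma nn_integral_W11_bound:
  fixes w :: "real^3 \<Rightarrow> real"
  assumes w: "smooth w" and K: "compact K" "\<And>x. x \<notin> K \<Longrightarrow> w x = 0"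
  shows "(\<integral>\<^sup>+v. esqrt (ennreal \<bar>w v\<bar> ^ 3) \<partial>lborel)\<^sup>2 \<le> (\<Prod>i\<in>UNIV. \<integral>\<^sup>+v. ennreal \<bar>partial i w v\<bar> \<partial>lborel)"
proof -
  define h where "h i v = ennreal \<bar>partial i w v\<bar>" for i v
  have cont: "continuous_on UNIV (partial i w)" for i by (rule smooth_continuous[OF smooth_partial[OF w]])
  have [measurable]: "h i \<in> borel_measurable borel" for i
    unfolding h_def using borel_measurable_continuous_onI[OF cont[of i]] by measurable
  have [measurable]: "w \<in> borel_measurable borel"
    by (rule borel_measurable_continuous_onI[OF smooth_continuous[OF w]])
  have esqrt_m [measurable]: "(\<lambda>v. esqrt (ennreal \<bar>w v\<bar> ^ 3)) \<in> borel_measurable borel" by measurable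
  obtain R where R: "\<And>x. x \<in> K \<Longrightarrow> norm x \<le> R" "R \<ge> 0"
    using compact_imp_bounded[OF K(1)] unfolding bounded_pos by (meson less_imp_le)
  have bound: "ennreal \<bar>w v\<bar> \<le> (\<integral>\<^sup>+s. h i (v + s *\<^sub>R axis i 1) \<partial>lborel)" for v i
  proof -
    have "w (v + s *\<^sub>R axis i 1) = 0" if "\<bar>s\<bar> > R + norm v" for s
    proof (rule K(2), rule notI)
      assume "v + s *\<^sub>R axis i 1 \<in> K"
      then have "norm (v + s *\<^sub>R axis i 1) \<le> R" by (rule R)
      moreover have "norm (s *\<^sub>R axis i 1 :: real^3) \<le> norm (v + s *\<^sub>R axis i 1) + norm v"
        using norm_triangle_ineq4[of "v + s *\<^sub>R axis i 1" v] by simp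
      ultimately show False using that by (simp add: norm_axis_1)
    qed
    moreover have "continuous_on UNIV (\<lambda>s. partial i w (v + s *\<^sub>R axis i 1))"
      by (intro continuous_on_compose2[OF cont] continuous_intros) auto
    ultimately show ?thesis
      using FTC_compact_support_bound[OF partial_line_derivative[OF w, of v i], of "R + norm v" 0] by (simp add: h_def)
  qed
  define H1 where "H1 y z = (\<integral>\<^sup>+s. h 1 (vec3 s y z) \<partial>lborel)" for y z
  define H2 where "H2 x z = (\<integral>\<^sup>+s. h 2 (vec3 x s z) \<partial>lborel)" for x z
  define H3 where "H3 x y = (\<integral>\<^sup>+s. h 3 (vec3 x y s) \<partial>lborel)" for x y
  have [measurable]: "case_prod H1 \<in> borel_measurable (lborel \<Otimes>\<^sub>M lborel)"
    "case_prod H2 \<in> borel_measurable (lborel \<Otimes>\<^sub>M lborel)" "case_prod H3 \<in> borel_measurable (lborel \<Otimes>\<^sub>M lborel)"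
    unfolding H1_def H2_def H3_def by measurable
  have b: "ennreal \<bar>w (vec3 x y z)\<bar> \<le> H1 y z" "ennreal \<bar>w (vec3 x y z)\<bar> \<le> H2 x z" "ennreal \<bar>w (vec3 x y z)\<bar> \<le> H3 x y" for x y z
    using bound[of "vec3 x y z" 1] bound[of "vec3 x y z" 2] bound[of "vec3 x y z" 3]
    unfolding vec3_shift H1_def H2_def H3_def
    using nn_integral_shift[of "\<lambda>s. h 1 (vec3 s y z)" x] nn_integral_shift[of "\<lambda>s. h 2 (vec3 x s z)" y]
      nn_integral_shift[of "\<lambda>s. h 3 (vec3 x y s)" z] by simp_all
  have le: "esqrt (ennreal \<bar>w (vec3 x y z)\<bar> ^ 3) \<le> esqrt (H1 y z) * esqrt (H2 x z) * esqrt (H3 x y)" for x y z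
  proof (rule ennreal_power2_le_imp_le)
    have "ennreal \<bar>w (vec3 x y z)\<bar> * ennreal \<bar>w (vec3 x y z)\<bar> * ennreal \<bar>w (vec3 x y z)\<bar> \<le> H1 y z * H2 x z * H3 x y"
      by (intro mult_mono b) auto
    then show "(esqrt (ennreal \<bar>w (vec3 x y z)\<bar> ^ 3))\<^sup>2 \<le> (esqrt (H1 y z) * esqrt (H2 x z) * esqrt (H3 x y))\<^sup>2"
      by (simp only: esqrt_power2 power_mult_distrib power3_eq_cube)
  qed
  have "(\<integral>\<^sup>+v. esqrt (ennreal \<bar>w v\<bar> ^ 3) \<partial>lborel)
      = (\<integral>\<^sup>+x. \<integral>\<^sup>+y. \<integral>\<^sup>+z. esqrt (ennreal \<bar>w (vec3 x y z)\<bar> ^ 3) \<partial>lborel \<partial>lborel \<partial>lborel)"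
    by (rule nn_integral_vec3[OF esqrt_m])
  also have "\<dots> \<le> (\<integral>\<^sup>+x. \<integral>\<^sup>+y. \<integral>\<^sup>+z. esqrt (H1 y z) * esqrt (H2 x z) * esqrt (H3 x y) \<partial>lborel \<partial>lborel \<partial>lborel)"
    by (intro nn_integral_mono le)
  finally have "(\<integral>\<^sup>+v. esqrt (ennreal \<bar>w v\<bar> ^ 3) \<partial>lborel)\<^sup>2
      \<le> (\<integral>\<^sup>+x. \<integral>\<^sup>+y. \<integral>\<^sup>+z. esqrt (H1 y z) * esqrt (H2 x z) * esqrt (H3 x y) \<partial>lborel \<partial>lborel \<partial>lborel)\<^sup>2"
    by (intro power_mono) auto
  also have "\<dots> \<le> (\<integral>\<^sup>+y. \<integral>\<^sup>+z. (esqrt (H1 y z))\<^sup>2 \<partial>lborel \<partial>lborel) * (\<integral>\<^sup>+x. \<integral>\<^sup>+z. (esqrt (H2 x z))\<^sup>2 \<partial>lborel \<partial>lborel)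
      * (\<integral>\<^sup>+x. \<integral>\<^sup>+y. (esqrt (H3 x y))\<^sup>2 \<partial>lborel \<partial>lborel)"
    by (rule Loomis_Whitney) measurable
  also have "(\<integral>\<^sup>+y. \<integral>\<^sup>+z. (esqrt (H1 y z))\<^sup>2 \<partial>lborel \<partial>lborel) = (\<integral>\<^sup>+v. h 1 v \<partial>lborel)"
  proof -
    have "(\<integral>\<^sup>+v. h 1 v \<partial>lborel) = (\<integral>\<^sup>+y. \<integral>\<^sup>+x. \<integral>\<^sup>+z. h 1 (vec3 x y z) \<partial>lborel \<partial>lborel \<partial>lborel)"
      unfolding nn_integral_vec3[of "h 1", OF \<open>h 1 \<in> borel_measurable borel\<close>] by (rule lborel_pair.Fubini') measurable
    also have "\<dots> = (\<integral>\<^sup>+y. \<integral>\<^sup>+z. \<integral>\<^sup>+x. h 1 (vec3 x y z) \<partial>lborel \<partial>lborel \<partial>lborel)"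
      by (intro nn_integral_cong lborel_pair.Fubini') measurable
    finally show ?thesis by (simp add: H1_def)
  qed
  also have "(\<integral>\<^sup>+x. \<integral>\<^sup>+z. (esqrt (H2 x z))\<^sup>2 \<partial>lborel \<partial>lborel) = (\<integral>\<^sup>+v. h 2 v \<partial>lborel)"
  proof -
    have "(\<integral>\<^sup>+v. h 2 v \<partial>lborel) = (\<integral>\<^sup>+x. \<integral>\<^sup>+z. \<integral>\<^sup>+y. h 2 (vec3 x y z) \<partial>lborel \<partial>lborel \<partial>lborel)"
      unfolding nn_integral_vec3[of "h 2", OF \<open>h 2 \<in> borel_measurable borel\<close>]
      by (intro nn_integral_cong lborel_pair.Fubini') measurable
    then show ?thesis by (simp add: H2_def)
  qed
  also have "(\<integral>\<^sup>+x. \<integral>\<^sup>+y. (esqrt (H3 x y))\<^sup>2 \<partial>lborel \<partial>lborel) = (\<integral>\<^sup>+v. h 3 v \<partial>lborel)"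
    unfolding nn_integral_vec3[of "h 3", OF \<open>h 3 \<in> borel_measurable borel\<close>] by (simp add: H3_def)
  finally show ?thesis unfolding prod_UNIV_3 h_def .
qed

text \<open>The preceding inequality is applied to w = |f|^4, whose derivatives are at most 4 |f|^3
  times those of f. With X the integral of |f|^6 and D_i that of the squared derivatives,
  Cauchy-Schwarz bounds X^2 by the product of the three terms 4 sqrt(X D_i). Squaring gives X^4
  \<le> 16^3 X^3 D_1 D_2 D_3, hence 4096 after cancelling X^3, and the product of the D_i is at most
  the cube of their sum.\<close>

lemma Sobolev_L6:
  fixes f :: "real^3 \<Rightarrow> 'b::euclidean_space"
  assumes f: "smooth f" and K: "compact K" "\<And>x. x \<notin> K \<Longrightarrow> f x = 0"
  shows "(LINT x|lborel. norm (f x) ^ 6) \<le> 4096 * (\<Sum>i\<in>UNIV. LINT x|lborel. (norm (partial i f x))\<^sup>2) ^ 3"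
proof -
  define X where "X = (LINT x|lborel. norm (f x) ^ 6)"
  define D where "D i = (LINT x|lborel. (norm (partial i f x))\<^sup>2)" for i
  have cont: "continuous_on UNIV f" "continuous_on UNIV (partial i f)" for i
    by (intro smooth_continuous smooth_partial f)+
  have pz: "partial i f x = 0" if "x \<notin> K" for i x
    by (rule partial_zero_outside[OF compact_imp_closed[OF K(1)] K(2) that])
  have iX: "integrable lborel (\<lambda>x. norm (f x) ^ 6)"
    by (rule integrable_compact_support[OF _ K(1)]) (auto intro!: continuous_intros cont simp: K)
  have iD: "integrable lborel (\<lambda>x. (norm (partial i f x))\<^sup>2)" for i
    by (rule integrable_compact_support[OF _ K(1)]) (auto intro!: continuous_intros cont simp: pz)
  have X0: "X \<ge> 0" and D0: "D i \<ge> 0" for i unfolding X_def D_def by simp_all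
  define w where "w x = (f x \<bullet> f x) * (f x \<bullet> f x)" for x
  have w: "smooth w" unfolding w_def by (intro smooth_mult smooth_inner f)
  have wz: "w x = 0" if "x \<notin> K" for x using K(2)[OF that] by (simp add: w_def)
  have pw: "\<bar>partial i w x\<bar> \<le> 4 * (norm (f x) ^ 3 * norm (partial i f x))" for i x
  proof -
    have "partial i w x = 4 * (f x \<bullet> f x) * (f x \<bullet> partial i f x)"
      unfolding w_def by (simp add: partial_mult[OF smooth_inner[OF f f] smooth_inner[OF f f]] partial_inner[OF f f] inner_commute)
    then have "\<bar>partial i w x\<bar> = 4 * (norm (f x))\<^sup>2 * \<bar>f x \<bullet> partial i f x\<bar>"
      by (simp add: abs_mult power2_norm_eq_inner)
    also have "\<dots> \<le> 4 * (norm (f x))\<^sup>2 * (norm (f x) * norm (partial i f x))"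
      by (intro mult_left_mono Cauchy_Schwarz_ineq2) auto
    finally show ?thesis by (simp add: power3_eq_cube power2_eq_square mult_ac)
  qed
  have mm: "(\<lambda>x. ennreal (norm (f x) ^ 3)) \<in> borel_measurable lborel" "(\<lambda>x. ennreal (norm (partial i f x))) \<in> borel_measurable lborel" for i
    using borel_measurable_continuous_onI[OF cont(1)] borel_measurable_continuous_onI[OF cont(2)[of i]] by measurable
  have Hi: "(\<integral>\<^sup>+v. ennreal \<bar>partial i w v\<bar> \<partial>lborel) \<le> ennreal (4 * sqrt (X * D i))" for i
  proof -
    have "(\<integral>\<^sup>+v. ennreal \<bar>partial i w v\<bar> \<partial>lborel) \<le> (\<integral>\<^sup>+v. 4 * (ennreal (norm (f v) ^ 3) * ennreal (norm (partial i f v))) \<partial>lborel)"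
      using pw[of i] by (intro nn_integral_mono) (simp add: ennreal_mult[symmetric] ennreal_numeral[symmetric] del: ennreal_numeral)
    also have "\<dots> = 4 * (\<integral>\<^sup>+v. ennreal (norm (f v) ^ 3) * ennreal (norm (partial i f v)) \<partial>lborel)"
      by (intro nn_integral_cmult borel_measurable_times_ennreal mm)
    also have "\<dots> \<le> 4 * (esqrt (\<integral>\<^sup>+v. (ennreal (norm (f v) ^ 3))\<^sup>2 \<partial>lborel) * esqrt (\<integral>\<^sup>+v. (ennreal (norm (partial i f v)))\<^sup>2 \<partial>lborel))"
      by (intro mult_left_mono nn_integral_Cauchy_Schwarz_esqrt mm) auto
    also have "(\<integral>\<^sup>+v. (ennreal (norm (f v) ^ 3))\<^sup>2 \<partial>lborel) = ennreal X"
      unfolding X_def using nn_integral_eq_integral[OF iX] by (simp add: ennreal_power power_mult[symmetric])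
    also have "(\<integral>\<^sup>+v. (ennreal (norm (partial i f v)))\<^sup>2 \<partial>lborel) = ennreal (D i)"
      unfolding D_def using nn_integral_eq_integral[OF iD[of i]] by (simp add: ennreal_power)
    also have "4 * (esqrt (ennreal X) * esqrt (ennreal (D i))) = ennreal (4 * sqrt (X * D i))"
      using X0 D0 by (simp add: esqrt_def ennreal_mult real_sqrt_mult)
    finally show ?thesis .
  qed
  have "(\<integral>\<^sup>+v. esqrt (ennreal \<bar>w v\<bar> ^ 3) \<partial>lborel) = ennreal X"
  proof -
    have "esqrt (ennreal \<bar>w v\<bar> ^ 3) = ennreal (norm (f v) ^ 6)" for v
    proof -
      have "\<bar>w v\<bar> = norm (f v) ^ 4"
        by (simp add: w_def power2_norm_eq_inner[symmetric] flip: power_add)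
      then have e: "\<bar>w v\<bar> ^ 3 = (norm (f v) ^ 6)\<^sup>2" by (simp add: power_mult[symmetric])
      have "esqrt (ennreal (r\<^sup>2)) = ennreal r" if "r \<ge> 0" for r
        using that by (simp add: esqrt_def)
      from this[of "norm (f v) ^ 6"] show ?thesis
        by (simp only: ennreal_power[OF abs_ge_zero] e zero_le_power[OF norm_ge_zero] simp_thms)
    qed
    then show ?thesis unfolding X_def using nn_integral_eq_integral[OF iX] by simp
  qed
  then have "ennreal X ^ 2 \<le> (\<Prod>i\<in>UNIV. \<integral>\<^sup>+v. ennreal \<bar>partial i w v\<bar> \<partial>lborel)"
    using nn_integral_W11_bound[OF w K(1) wz] by simp
  also have "\<dots> \<le> (\<Prod>i\<in>UNIV. ennreal (4 * sqrt (X * D i)))"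
    unfolding prod_UNIV_3 by (intro mult_mono Hi) auto
  also have "\<dots> = ennreal (\<Prod>i\<in>UNIV. 4 * sqrt (X * D i))"
    using X0 D0 by (intro prod_ennreal) auto
  finally have "ennreal (X ^ 2) \<le> ennreal (\<Prod>i\<in>UNIV. 4 * sqrt (X * D i))" using X0 by (simp add: ennreal_power)
  then have "X ^ 2 \<le> (\<Prod>i\<in>UNIV. 4 * sqrt (X * D i))"
    using X0 D0 by (subst (asm) ennreal_le_iff) (auto intro!: prod_nonneg)
  then have "(X ^ 2)\<^sup>2 \<le> (\<Prod>i\<in>UNIV. 4 * sqrt (X * D i))\<^sup>2"
    by (intro power_mono) auto
  also have "\<dots> = (\<Prod>i\<in>UNIV. 16 * (X * D i))"
    using X0 D0 by (simp add: prod_UNIV_3 power_mult_distrib)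
  also have "\<dots> = 4096 * X ^ 3 * (D 1 * D 2 * D 3)"
    by (simp add: prod_UNIV_3 power3_eq_cube)
  finally have e: "X * X ^ 3 \<le> (4096 * (D 1 * D 2 * D 3)) * X ^ 3" by (simp add: power2_eq_square power3_eq_cube mult_ac)
  have s: "D 1 * D 2 * D 3 \<le> (\<Sum>i\<in>UNIV. D i) ^ 3"
    unfolding power3_eq_cube using D0 by (intro mult_mono) (auto simp: sum_3 intro!: add_nonneg_nonneg mult_nonneg_nonneg)
  show ?thesis
  proof (cases "X = 0")
    case True
    then show ?thesis using D0 by (auto simp flip: X_def D_def intro!: zero_le_power sum_nonneg)
  next
    case False
    then have "X ^ 3 > 0" using X0 by simp
    with e have "X \<le> 4096 * (D 1 * D 2 * D 3)" by (rule mult_right_le_imp_le)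
    with s show ?thesis unfolding X_def[symmetric] D_def[symmetric] by linarith
  qed
qed

text \<open>For use where a bound is known along an approximation but integrability of the limit is
  not: Fatou's lemma for extended nonnegative integrals yields both at once.\<close>

lemma Fatou_integrable:
  fixes f :: "'a \<Rightarrow> real"
  assumes f: "\<And>n. integrable N (fn n)" "\<And>n x. fn n x \<ge> 0" "f \<in> borel_measurable N"
    and lim: "AE x in N. (\<lambda>n. fn n x) \<longlonglongrightarrow> f x"
    and b: "\<And>n. (LINT x|N. fn n x) \<le> c n" "c \<longlonglongrightarrow> C"
  shows "integrable N f" "(LINT x|N. f x) \<le> C"
proof -
  have pos: "AE x in N. f x \<ge> 0"
    using lim by eventually_elim (rule LIMSEQ_le_const, auto simp: f)
  have c0: "c n \<ge> 0" for n
    by (rule order_trans[OF Bochner_Integration.integral_nonneg b(1)]) (rule f(2))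
  have "(\<integral>\<^sup>+x. ennreal (f x) \<partial>N) = (\<integral>\<^sup>+x. liminf (\<lambda>n. ennreal (fn n x)) \<partial>N)"
    using lim by (intro nn_integral_cong_AE) (auto elim!: eventually_mono intro!: lim_imp_Liminf[symmetric] tendsto_ennrealI)
  also have "\<dots> \<le> liminf (\<lambda>n. \<integral>\<^sup>+x. ennreal (fn n x) \<partial>N)"
    using f(1) by (intro nn_integral_liminf) auto
  also have "\<dots> \<le> liminf (\<lambda>n. ennreal (c n))"
    using f b(1) by (intro Liminf_mono always_eventually allI) (simp add: nn_integral_eq_integral ennreal_leI)
  also have "\<dots> = ennreal C"
    using b(2) by (intro lim_imp_Liminf tendsto_ennrealI) auto
  finally have le: "(\<integral>\<^sup>+x. ennreal (f x) \<partial>N) \<le> ennreal C" .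
  show int: "integrable N f"
  proof (rule integrableI_bounded[OF f(3)])
    have "(\<integral>\<^sup>+x. ennreal (norm (f x)) \<partial>N) = (\<integral>\<^sup>+x. ennreal (f x) \<partial>N)"
      using pos by (intro nn_integral_cong_AE) auto
    then show "(\<integral>\<^sup>+x. ennreal (norm (f x)) \<partial>N) < \<infinity>" using le by (simp add: le_less_trans)
  qed
  have "C \<ge> 0" using LIMSEQ_le_const[OF b(2), of 0] c0 by blast
  with le show "(LINT x|N. f x) \<le> C"
    unfolding nn_integral_eq_integral[OF int pos] by simp
qed

section \<open>Sobolev inequality and convective term on the domain\<close>

context bounded_open
begin

definition grad_sq :: "(real^3 \<Rightarrow> 'b::euclidean_space) \<Rightarrow> real" where
  "grad_sq u = (\<Sum>i\<in>UNIV. (nm (wp i u))\<^sup>2)"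

lemma grad_sq_nonneg: "grad_sq u \<ge> 0"
  unfolding grad_sq_def by (intro sum_nonneg) auto

lemma H1_0_approx_AE:
  assumes "u \<in> H1_0 \<Omega>"
  obtains f where "\<And>n. test_function \<Omega> (f n)"
    "(\<lambda>n. nm (\<lambda>x. f n x - u x)) \<longlonglongrightarrow> 0"
    "\<And>i. (\<lambda>n. nm (\<lambda>x. partial i (f n) x - wp i u x)) \<longlonglongrightarrow> 0"
    "AE x in M. (\<lambda>n. f n x) \<longlonglongrightarrow> u x"
proof (rule H1_0_approx[OF assms])
  fix f assume f: "\<And>n. test_function \<Omega> (f n)"
    "(\<lambda>n. nm (\<lambda>x. f n x - u x)) \<longlonglongrightarrow> 0"
    "\<And>i. (\<lambda>n. nm (\<lambda>x. partial i (f n) x - wp i u x)) \<longlonglongrightarrow> 0"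
  have u: "u \<in> L2 \<Omega>" using assms by (simp add: H1_0_def H1_def)
  show thesis
  proof (rule AE_subseq[OF test_L2[OF f(1)] u f(2)])
    fix r :: "nat \<Rightarrow> nat" assume r: "strict_mono r" "AE x in M. (\<lambda>n. f (r n) x) \<longlonglongrightarrow> u x"
    show thesis
      by (rule that[of "\<lambda>n. f (r n)"])
        (use f r LIMSEQ_subseq_LIMSEQ[OF f(2) r(1)] LIMSEQ_subseq_LIMSEQ[OF f(3) r(1)] in \<open>auto simp: o_def\<close>)
  qed
qed

lemma H1_0_H1: "u \<in> H1_0 \<Omega> \<Longrightarrow> u \<in> H1 \<Omega>"
  by (simp add: H1_0_def)

lemma Sobolev_test:
  assumes "test_function \<Omega> f"
  shows "integrable M (\<lambda>x. norm (f x) ^ 6)"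
    "(LINT x|M. norm (f x) ^ 6) \<le> 4096 * (\<Sum>i\<in>UNIV. (nm (partial i f))\<^sup>2) ^ 3"
proof -
  have t6: "test_function \<Omega> (\<lambda>x. (f x \<bullet> f x) * (f x \<bullet> f x) * (f x \<bullet> f x))"
    using test_function_smooth[OF assms] by (intro test_function_mono[OF assms] smooth_mult smooth_inner) auto
  have e6: "(f x \<bullet> f x) * (f x \<bullet> f x) * (f x \<bullet> f x) = norm (f x) ^ 6" for x
    by (simp add: power2_norm_eq_inner[symmetric] flip: power_add)
  have t2: "test_function \<Omega> (\<lambda>x. partial i f x \<bullet> partial i f x)" for i
    using test_function_smooth[OF test_function_partial[OF assms]]
    by (intro test_function_mono[OF test_function_partial[OF assms, of i]] smooth_inner) auto
  have e2: "(nm (partial i f))\<^sup>2 = (LINT x|lborel. (norm (partial i f x))\<^sup>2)" for i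
    unfolding nm_sq_integral using integral_test(1)[OF t2] by (simp add: power2_norm_eq_inner)
  obtain K where K: "compact K" "\<And>x. x \<notin> K \<Longrightarrow> f x = 0"
    using test_functionE[OF assms] by metis
  show "integrable M (\<lambda>x. norm (f x) ^ 6)" using integral_test(2)[OF t6] unfolding e6 .
  show "(LINT x|M. norm (f x) ^ 6) \<le> 4096 * (\<Sum>i\<in>UNIV. (nm (partial i f))\<^sup>2) ^ 3"
    using Sobolev_L6[OF test_function_smooth[OF assms] K] integral_test(1)[OF t6] unfolding e6 e2 by simp
qed

lemma grad_sq_tendsto:
  assumes "\<And>n. test_function \<Omega> (f n)" "u \<in> H1 \<Omega>"
    "\<And>i. (\<lambda>n. nm (\<lambda>x. partial i (f n) x - wp i u x)) \<longlonglongrightarrow> 0"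
  shows "(\<lambda>n. \<Sum>i\<in>UNIV. (nm (partial i (f n)))\<^sup>2) \<longlonglongrightarrow> grad_sq u"
  unfolding grad_sq_def
  by (intro tendsto_sum tendsto_power nm_tendsto assms test_L2 test_function_partial H1_wp_L2)

lemma Sobolev_H1_0:
  assumes "u \<in> H1_0 \<Omega>"
  shows "integrable M (\<lambda>x. norm (u x) ^ 6)" "(LINT x|M. norm (u x) ^ 6) \<le> 4096 * (grad_sq u) ^ 3"
proof -
  obtain f where f: "\<And>n. test_function \<Omega> (f n)"
    "\<And>i. (\<lambda>n. nm (\<lambda>x. partial i (f n) x - wp i u x)) \<longlonglongrightarrow> 0"
    and ae: "AE x in M. (\<lambda>n. f n x) \<longlonglongrightarrow> u x"
    by (rule H1_0_approx_AE[OF assms]) (rule that)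
  have m: "(\<lambda>x. norm (u x) ^ 6) \<in> borel_measurable M"
    using L2_meas[OF H1_L2[OF H1_0_H1[OF assms]]] by measurable
  have ae': "AE x in M. (\<lambda>n. norm (f n x) ^ 6) \<longlonglongrightarrow> norm (u x) ^ 6"
    using ae by eventually_elim (intro tendsto_power tendsto_norm)
  note F = Fatou_integrable[OF Sobolev_test(1)[OF f(1)] _ m ae' Sobolev_test(2)[OF f(1)]
    tendsto_mult[OF tendsto_const tendsto_power[OF grad_sq_tendsto[OF f(1) H1_0_H1[OF assms] f(2)]]]]
  show "integrable M (\<lambda>x. norm (u x) ^ 6)" "(LINT x|M. norm (u x) ^ 6) \<le> 4096 * (grad_sq u) ^ 3"
    using F by auto
qed

text \<open>The Sobolev inequality takes the place of Poincare's: the integral of |u|^6 is bounded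
  by a power of the Dirichlet integral.\<close>

lemma H1_0_grad_zero:
  assumes "u \<in> H1_0 \<Omega>" "grad_sq u = 0"
  shows "AE x in M. u x = 0"
proof -
  have "(LINT x|M. norm (u x) ^ 6) = 0"
    using Sobolev_H1_0(2)[OF assms(1)] assms(2) by (intro antisym Bochner_Integration.integral_nonneg) auto
  then have "AE x in M. norm (u x) ^ 6 = 0"
    using integral_nonneg_eq_0_iff_AE[OF Sobolev_H1_0(1)[OF assms(1)]] by auto
  then show ?thesis by simp
qed

text \<open>\<open>Q\<close> is additive in its second argument, with a coefficient depending on the
  first. In Q(z_n, d_n) = Q(z_n, d_n - d) + Q(z_n, d) the first part is small in L_2 by the bound
  that is uniform in z; the second converges by dominated convergence, although z_n converges only
  almost everywhere.\<close>

lemma multiplier_limit: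
  fixes Q :: "'b::euclidean_space \<Rightarrow> 'd::euclidean_space \<Rightarrow> 'c::euclidean_space"
  assumes Q: "\<And>z d. norm (Q z d) \<le> C * norm d" "\<And>z d d'. Q z (d - d') = Q z d - Q z d'"
      "continuous_on UNIV (\<lambda>p. Q (fst p) (snd p))"
    and z: "\<And>n. zn n \<in> borel_measurable M" "z \<in> borel_measurable M" "AE x in M. (\<lambda>n. zn n x) \<longlonglongrightarrow> z x"
    and d: "\<And>n. dn n \<in> L2 \<Omega>" "d \<in> L2 \<Omega>" "(\<lambda>n. nm (\<lambda>x. dn n x - d x)) \<longlonglongrightarrow> 0"
    and h: "h \<in> L2 \<Omega>"
  shows "(\<lambda>n. h \<cdot> (\<lambda>x. Q (zn n x) (dn n x))) \<longlonglongrightarrow> h \<cdot> (\<lambda>x. Q (z x) (d x))"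
    and "\<And>w e. w \<in> borel_measurable M \<Longrightarrow> e \<in> L2 \<Omega> \<Longrightarrow> (\<lambda>x. Q (w x) (e x)) \<in> L2 \<Omega>"
proof -
  obtain b :: 'd where "norm b = 1" using nonempty_Basis norm_Basis by blast
  then have C: "C \<ge> 0" using order_trans[OF norm_ge_zero Q(1)[of 0 b]] by simp
  have Qm: "(\<lambda>x. Q (w x) (e x)) \<in> borel_measurable M" if "w \<in> borel_measurable M" "e \<in> borel_measurable M" for w e
    using that Q(3) by (intro borel_measurable_continuous_Pair[where H=Q])
  show QL: "(\<lambda>x. Q (w x) (e x)) \<in> L2 \<Omega>" if "w \<in> borel_measurable M" "e \<in> L2 \<Omega>" for w e
    by (rule L2_dominated'[OF that(2) Qm[OF that(1) L2_meas[OF that(2)]] Q(1)])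
  have 1: "(\<lambda>n. h \<cdot> (\<lambda>x. Q (zn n x) (dn n x - d x))) \<longlonglongrightarrow> 0"
  proof (rule Lim_null_comparison[OF always_eventually])
    show "\<forall>n. norm (h \<cdot> (\<lambda>x. Q (zn n x) (dn n x - d x))) \<le> nm h * (C * nm (\<lambda>x. dn n x - d x))"
    proof
      fix n
      have dd: "(\<lambda>x. dn n x - d x) \<in> L2 \<Omega>" by (intro L2_diff d)
      have "norm (h \<cdot> (\<lambda>x. Q (zn n x) (dn n x - d x))) \<le> nm h * nm (\<lambda>x. Q (zn n x) (dn n x - d x))"
        using ip_bound[OF h QL[OF z(1) dd]] by simp
      also have "\<dots> \<le> nm h * (C * nm (\<lambda>x. dn n x - d x))"
        by (intro mult_left_mono nm_mono dd QL z C Q(1)) simp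
      finally show "norm (h \<cdot> (\<lambda>x. Q (zn n x) (dn n x - d x))) \<le> nm h * (C * nm (\<lambda>x. dn n x - d x))" .
    qed
    show "(\<lambda>n. nm h * (C * nm (\<lambda>x. dn n x - d x))) \<longlonglongrightarrow> 0"
      using tendsto_mult[OF tendsto_const[of "nm h"] tendsto_mult[OF tendsto_const[of C] d(3)]] by simp
  qed
  have 2: "(\<lambda>n. h \<cdot> (\<lambda>x. Q (zn n x) (d x))) \<longlonglongrightarrow> h \<cdot> (\<lambda>x. Q (z x) (d x))"
    unfolding inner_L2_def
  proof (rule integral_dominated_convergence[where w="\<lambda>x. C * ((norm (h x))\<^sup>2 + (norm (d x))\<^sup>2)"])
    show "(\<lambda>x. h x \<bullet> Q (z x) (d x)) \<in> borel_measurable M" "\<And>n. (\<lambda>x. h x \<bullet> Q (zn n x) (d x)) \<in> borel_measurable M"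
      by (intro borel_measurable_inner Qm L2_meas h d z)+
    show "integrable M (\<lambda>x. C * ((norm (h x))\<^sup>2 + (norm (d x))\<^sup>2))"
      by (intro integrable_mult_right Bochner_Integration.integrable_add L2_sq h d)
    show "AE x in M. (\<lambda>n. h x \<bullet> Q (zn n x) (d x)) \<longlonglongrightarrow> h x \<bullet> Q (z x) (d x)"
      using z(3)
    proof eventually_elim
      case (elim x)
      have "isCont (\<lambda>p. Q (fst p) (snd p)) (z x, d x)" using Q(3) by (simp add: continuous_on_eq_continuous_at)
      from isCont_tendsto_compose[OF this tendsto_Pair[OF elim tendsto_const[of "d x"]]]
      show ?case by (intro tendsto_inner tendsto_const) simp
    qed
    show "AE x in M. norm (h x \<bullet> Q (zn n x) (d x)) \<le> C * ((norm (h x))\<^sup>2 + (norm (d x))\<^sup>2)" for n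
    proof (rule AE_I2)
      fix x
      have "norm (h x \<bullet> Q (zn n x) (d x)) \<le> norm (h x) * norm (Q (zn n x) (d x))"
        using Cauchy_Schwarz_ineq2 by simp
      also have "\<dots> \<le> norm (h x) * (C * norm (d x))" by (intro mult_left_mono Q) auto
      also have "\<dots> = C * (norm (h x) * norm (d x))" by simp
      also have "\<dots> \<le> C * ((norm (h x))\<^sup>2 + (norm (d x))\<^sup>2)"
        using sum_squares_bound[of "norm (h x)" "norm (d x)"] mult_nonneg_nonneg[OF norm_ge_zero norm_ge_zero, of "h x" "d x"]
        by (intro mult_left_mono C) linarith
      finally show "norm (h x \<bullet> Q (zn n x) (d x)) \<le> C * ((norm (h x))\<^sup>2 + (norm (d x))\<^sup>2)" .
    qed
  qed
  have "h \<cdot> (\<lambda>x. Q (zn n x) (dn n x)) = h \<cdot> (\<lambda>x. Q (zn n x) (dn n x - d x)) + h \<cdot> (\<lambda>x. Q (zn n x) (d x))" for n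
    using ip_add_right[OF QL[OF z(1)[of n] L2_diff[OF d(1)[of n] d(2)]] QL[OF z(1)[of n] d(2)] h] by (simp add: Q(2))
  with tendsto_add[OF 1 2] show "(\<lambda>n. h \<cdot> (\<lambda>x. Q (zn n x) (dn n x))) \<longlonglongrightarrow> h \<cdot> (\<lambda>x. Q (z x) (d x))"
    by simp
qed

text \<open>Makes \<open>|v|\<^sup>2 v\<close> an admissible test function; removed by Fatou's lemma as \<open>\<epsilon> \<rightarrow> 0\<close>.\<close>

definition damp :: "real \<Rightarrow> 'b::euclidean_space \<Rightarrow> real" where
  "damp \<epsilon> z = inverse (1 + \<epsilon> * (z \<bullet> z))"

lemma damp_pos: "\<eta> > 0 \<Longrightarrow> damp \<eta> z > 0" "\<eta> > 0 \<Longrightarrow> damp \<eta> z \<le> 1"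
  "\<eta> > 0 \<Longrightarrow> (z \<bullet> z) * damp \<eta> z \<le> inverse \<eta>" "\<eta> > 0 \<Longrightarrow> 1 + \<eta> * (z \<bullet> z) > 0"
proof -
  assume e: "\<eta> > 0"
  show p: "1 + \<eta> * (z \<bullet> z) > 0" using e by (intro add_pos_nonneg mult_nonneg_nonneg) auto
  then show "damp \<eta> z > 0" by (simp add: damp_def)
  have "0 \<le> \<eta> * (z \<bullet> z)" using e by simp
  then show "damp \<eta> z \<le> 1" unfolding damp_def by (intro inverse_le_1_iff[THEN iffD2]) linarith
  show "(z \<bullet> z) * damp \<eta> z \<le> inverse \<eta>" unfolding damp_def using p e by (simp add: field_simps)
qed

lemma damp_denom: "e > 0 \<Longrightarrow> 1 + e * (z \<bullet> z) \<noteq> 0" for z :: "'b::euclidean_space"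
  using damp_pos(4)[of e z] by simp

text \<open>With s = z . z this expresses that s / (1 + e s) has derivative 1 / (1 + e s)^2: the
  loss from differentiating the damping recombines into a square.\<close>

lemma damp_identity:
  assumes "e > 0" shows "damp e z - e * (z \<bullet> z) * (damp e z)\<^sup>2 = (damp e z)\<^sup>2"
proof -
  have h: "damp e z * (1 + e * (z \<bullet> z)) = 1" using damp_denom[OF assms, of z] by (simp add: damp_def)
  have "damp e z = damp e z * (damp e z * (1 + e * (z \<bullet> z)))" unfolding h by simp
  also have "\<dots> = (damp e z)\<^sup>2 + e * (z \<bullet> z) * (damp e z)\<^sup>2" by (simp add: power2_eq_square algebra_simps)
  finally show ?thesis by linarith
qed

lemma smooth_damp: "e > 0 \<Longrightarrow> smooth f \<Longrightarrow> smooth (\<lambda>x. damp e (f x))"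
  unfolding damp_def
  by (intro smooth_inverse smooth_add smooth_mult smooth_const smooth_inner damp_denom)

lemma partial_damp:
  assumes "e > 0" "smooth f"
  shows "partial i (\<lambda>x. damp e (f x)) x = - 2 * e * (f x \<bullet> partial i f x) * (damp e (f x))\<^sup>2"
proof -
  have "((\<lambda>s. inverse (1 + e * s)) has_real_derivative - e * (damp e (f x))\<^sup>2) (at (f x \<bullet> f x))"
    unfolding damp_def using damp_pos(4)[OF assms(1), of "f x"]
    by (auto intro!: derivative_eq_intros simp: power2_eq_square)
  from partial_compose[OF smooth_inner[OF assms(2,2)] this, of i] show ?thesis
    unfolding damp_def partial_inner[OF assms(2,2)] by (simp add: inner_commute algebra_simps)
qed

lemma damp_continuous: "e > 0 \<Longrightarrow> continuous_on UNIV (damp e)"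
  unfolding damp_def by (intro continuous_intros ballI damp_denom)

lemma damp_tendsto: "(\<lambda>n. damp (inverse (real (Suc n))) z) \<longlonglongrightarrow> 1"
proof -
  have "(\<lambda>n. inverse (1 + inverse (real (Suc n)) * (z \<bullet> z))) \<longlonglongrightarrow> inverse (1 + 0 * (z \<bullet> z))"
    by (intro tendsto_intros LIMSEQ_inverse_real_of_nat) auto
  then show ?thesis by (simp add: damp_def)
qed

text \<open>-\<Delta>v is tested with |v|^2 \<open>damp \<eta> v\<close> v, approximated by the test
  functions \<open>\<psi> n\<close>. The gradient side produces the damped |v|^2 |\<nabla>v|^2 plus
  a nonnegative square. On the other side \<open>\<psi> n\<close> is at most |f_n|^3 in norm, so by
  the Sobolev inequality its L_2 norm is at most 64 times the cube of the gradient norm, 64 being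
  the root of 4096. The bound is uniform in \<eta>.\<close>

lemma sq_grad_bound_damped:
  assumes v: "v \<in> H2 \<Omega>" "v \<in> H1_0 \<Omega>" and e: "\<eta> > 0"
  shows "(\<Sum>i\<in>UNIV. LINT x|M. (v x \<bullet> v x) * damp \<eta> (v x) * (norm (wp i v x))\<^sup>2)
      \<le> 64 * nm (lap v) * sqrt (grad_sq v ^ 3)"
    and "integrable M (\<lambda>x. (v x \<bullet> v x) * damp \<eta> (v x) * (norm (wp i v x))\<^sup>2)"
proof -
  \<comment> \<open>The derivative of z \<mapsto> (z . z) \<open>damp \<eta> z\<close> z in
    direction d; the damping bounds it by a multiple of |d|, uniformly in z.\<close>
  define Q :: "real^3 \<Rightarrow> real^3 \<Rightarrow> real^3" where
    "Q z d = (2 * (z \<bullet> d) * (damp \<eta> z)\<^sup>2) *\<^sub>R z + ((z \<bullet> z) * damp \<eta> z) *\<^sub>R d" for z d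
  have Qb: "norm (Q z d) \<le> (3 * inverse \<eta>) * norm d" for z d
  proof -
    note p = damp_pos[OF e, of z]
    have "norm (Q z d) \<le> 2 * \<bar>z \<bullet> d\<bar> * (damp \<eta> z)\<^sup>2 * norm z + (z \<bullet> z) * damp \<eta> z * norm d"
      unfolding Q_def by (rule order_trans[OF norm_triangle_ineq]) (use p in \<open>simp add: abs_mult\<close>)
    also have "2 * \<bar>z \<bullet> d\<bar> * (damp \<eta> z)\<^sup>2 * norm z \<le> 2 * (norm z * norm d) * (damp \<eta> z)\<^sup>2 * norm z"
      by (intro mult_right_mono mult_left_mono Cauchy_Schwarz_ineq2) auto
    also have "\<dots> = 2 * ((z \<bullet> z) * damp \<eta> z) * norm d * damp \<eta> z"
      by (simp add: power2_norm_eq_inner[symmetric] power2_eq_square mult_ac)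
    also have "\<dots> \<le> 2 * ((z \<bullet> z) * damp \<eta> z) * norm d * 1"
      using p by (intro mult_left_mono) (auto intro!: mult_nonneg_nonneg)
    finally have "norm (Q z d) \<le> 3 * ((z \<bullet> z) * damp \<eta> z) * norm d" by (simp add: algebra_simps)
    also have "\<dots> \<le> 3 * inverse \<eta> * norm d" using p by (intro mult_right_mono mult_left_mono) auto
    finally show ?thesis .
  qed
  have Qd: "Q z (d - d') = Q z d - Q z d'" for z d d'
    by (simp add: Q_def inner_diff_right algebra_simps scaleR_diff_left scaleR_diff_right)
  have Qc: "continuous_on UNIV (\<lambda>p. Q (fst p) (snd p))"
    unfolding Q_def by (intro continuous_intros continuous_on_compose2[OF damp_continuous[OF e]]) auto
  have vH: "v \<in> H1 \<Omega>" using v by (simp add: H1_0_def)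
  have vm: "v \<in> borel_measurable M" by (rule L2_meas[OF H1_L2[OF vH]])
  obtain f where f: "\<And>n. test_function \<Omega> (f n)"
    "\<And>i. (\<lambda>n. nm (\<lambda>x. partial i (f n) x - wp i v x)) \<longlonglongrightarrow> 0"
    "AE x in M. (\<lambda>n. f n x) \<longlonglongrightarrow> v x"
    by (rule H1_0_approx_AE[OF v(2)]) (rule that)
  define \<psi> where "\<psi> n x = ((f n x \<bullet> f n x) * damp \<eta> (f n x)) *\<^sub>R f n x" for n x
  note sm = test_function_smooth[OF f(1)]
  have t: "test_function \<Omega> (\<psi> n)" for n
    unfolding \<psi>_def
    by (intro test_function_mono[OF f(1)[of n]] smooth_scaleR smooth_mult smooth_inner smooth_damp e sm) simp
  have p\<psi>: "partial i (\<psi> n) x = Q (f n x) (partial i (f n) x)" for i n x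
  proof -
    let ?z = "f n x" let ?d = "partial i (f n) x" let ?g = "damp \<eta> ?z"
    have "partial i (\<psi> n) x = ((?z \<bullet> ?z) * ?g) *\<^sub>R ?d + ((?z \<bullet> ?z) * (- 2 * \<eta> * (?z \<bullet> ?d) * ?g\<^sup>2) + (?z \<bullet> ?d + ?d \<bullet> ?z) * ?g) *\<^sub>R ?z"
      unfolding \<psi>_def
      by (simp add: partial_scaleR[OF smooth_mult[OF smooth_inner[OF sm sm] smooth_damp[OF e sm]] sm]
          partial_mult[OF smooth_inner[OF sm sm] smooth_damp[OF e sm]] partial_inner[OF sm sm] partial_damp[OF e sm])
    also have "(?z \<bullet> ?z) * (- 2 * \<eta> * (?z \<bullet> ?d) * ?g\<^sup>2) + (?z \<bullet> ?d + ?d \<bullet> ?z) * ?g = 2 * (?z \<bullet> ?d) * (?g - \<eta> * (?z \<bullet> ?z) * ?g\<^sup>2)"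
      by (simp add: inner_commute[of ?d ?z] algebra_simps)
    also have "?g - \<eta> * (?z \<bullet> ?z) * ?g\<^sup>2 = ?g\<^sup>2" by (rule damp_identity[OF e])
    finally show ?thesis by (simp add: Q_def add.commute)
  qed
  note ml = multiplier_limit[OF Qb Qd Qc L2_meas[OF test_L2[OF f(1)]] vm f(3) test_L2[OF test_function_partial[OF f(1)]] H1_wp_L2[OF vH] f(2) H1_wp_L2[OF vH]]
  have L: "lap v \<cdot> \<psi> n = - (\<Sum>i\<in>UNIV. wp i v \<cdot> partial i (\<psi> n))" for n
  proof -
    have "lap v \<cdot> \<psi> n = (\<Sum>i\<in>UNIV. wp i (wp i v) \<cdot> \<psi> n)"
      unfolding weak_laplacian_def by (intro ip_sum_left H1_wp_L2 H2_H1 v test_L2 t)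
    then show ?thesis by (simp add: weak_partial_test_inner[OF H2_H1(2)[OF v(1)] t] sum_negf)
  qed
  have lim: "(\<lambda>n. \<Sum>i\<in>UNIV. wp i v \<cdot> partial i (\<psi> n)) \<longlonglongrightarrow> (\<Sum>i\<in>UNIV. wp i v \<cdot> (\<lambda>x. Q (v x) (wp i v x)))"
    unfolding p\<psi>[abs_def] by (intro tendsto_sum ml(1))
  have bnd: "(\<Sum>i\<in>UNIV. wp i v \<cdot> partial i (\<psi> n)) \<le> nm (lap v) * (64 * sqrt ((\<Sum>i\<in>UNIV. (nm (partial i (f n)))\<^sup>2) ^ 3))" for n
  proof -
    have "(\<Sum>i\<in>UNIV. wp i v \<cdot> partial i (\<psi> n)) = - (lap v \<cdot> \<psi> n)" using L by simp
    also have "\<dots> \<le> nm (lap v) * nm (\<psi> n)"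
      using ip_bound[OF laplacian_L2[OF v(1)] test_L2[OF t[of n]]] by linarith
    also have "nm (\<psi> n) \<le> 64 * sqrt ((\<Sum>i\<in>UNIV. (nm (partial i (f n)))\<^sup>2) ^ 3)"
    proof (rule power2_le_imp_le)
      have "(nm (\<psi> n))\<^sup>2 \<le> (LINT x|M. norm (f n x) ^ 6)"
        unfolding nm_sq_integral
      proof (intro integral_mono L2_sq test_L2 t Sobolev_test f)
        fix x
        have "norm (\<psi> n x) = (norm (f n x))\<^sup>2 * norm (f n x) * damp \<eta> (f n x)"
          unfolding \<psi>_def using damp_pos(1)[OF e, of "f n x"] by (simp add: abs_mult power2_norm_eq_inner)
        also have "\<dots> \<le> (norm (f n x))\<^sup>2 * norm (f n x) * 1"
          using damp_pos(2)[OF e] by (intro mult_left_mono) auto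
        finally have "(norm (\<psi> n x))\<^sup>2 \<le> ((norm (f n x)) ^ 3)\<^sup>2"
          by (intro power_mono) (auto simp: power2_eq_square power3_eq_cube)
        then show "(norm (\<psi> n x))\<^sup>2 \<le> norm (f n x) ^ 6" by (simp flip: power_mult)
      qed
      also have "\<dots> \<le> 4096 * (\<Sum>i\<in>UNIV. (nm (partial i (f n)))\<^sup>2) ^ 3" by (rule Sobolev_test[OF f(1)])
      also have "\<dots> = (64 * sqrt ((\<Sum>i\<in>UNIV. (nm (partial i (f n)))\<^sup>2) ^ 3))\<^sup>2"
        by (simp add: power_mult_distrib sum_nonneg)
      finally show "(nm (\<psi> n))\<^sup>2 \<le> (64 * sqrt ((\<Sum>i\<in>UNIV. (nm (partial i (f n)))\<^sup>2) ^ 3))\<^sup>2" .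
    qed (simp add: sum_nonneg)
    finally show ?thesis by (simp add: mult_left_mono)
  qed
  have "(\<Sum>i\<in>UNIV. wp i v \<cdot> (\<lambda>x. Q (v x) (wp i v x))) \<le> nm (lap v) * (64 * sqrt (grad_sq v ^ 3))"
  proof (rule LIMSEQ_le[OF lim])
    show "(\<lambda>n. nm (lap v) * (64 * sqrt ((\<Sum>i\<in>UNIV. (nm (partial i (f n)))\<^sup>2) ^ 3)))
        \<longlonglongrightarrow> nm (lap v) * (64 * sqrt (grad_sq v ^ 3))"
      by (intro tendsto_mult tendsto_const tendsto_real_sqrt tendsto_power grad_sq_tendsto f vH)
  qed (use bnd in blast)
  moreover have int: "integrable M (\<lambda>x. (v x \<bullet> v x) * damp \<eta> (v x) * (norm (wp i v x))\<^sup>2)" for i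
  proof (rule integrable_dominated)
    show "integrable M (\<lambda>x. inverse \<eta> * (norm (wp i v x))\<^sup>2)"
      by (intro integrable_mult_right L2_sq H1_wp_L2 vH)
    have "damp \<eta> \<in> borel_measurable borel" by (rule borel_measurable_continuous_onI[OF damp_continuous[OF e]])
    then show "(\<lambda>x. (v x \<bullet> v x) * damp \<eta> (v x) * (norm (wp i v x))\<^sup>2) \<in> borel_measurable M"
      using vm L2_meas[OF H1_wp_L2[OF vH, of i]] by measurable
    show "AE x in M. norm ((v x \<bullet> v x) * damp \<eta> (v x) * (norm (wp i v x))\<^sup>2) \<le> norm (inverse \<eta> * (norm (wp i v x))\<^sup>2)"
    proof (rule AE_I2)
      fix x
      show "norm ((v x \<bullet> v x) * damp \<eta> (v x) * (norm (wp i v x))\<^sup>2) \<le> norm (inverse \<eta> * (norm (wp i v x))\<^sup>2)"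
        using damp_pos[OF e, of "v x"] e by (simp add: abs_mult) (intro mult_right_mono, auto)
    qed
  qed
  moreover have "(LINT x|M. (v x \<bullet> v x) * damp \<eta> (v x) * (norm (wp i v x))\<^sup>2) \<le> wp i v \<cdot> (\<lambda>x. Q (v x) (wp i v x))" for i
    unfolding inner_L2_def
  proof (intro integral_mono int)
    show "integrable M (\<lambda>x. wp i v x \<bullet> Q (v x) (wp i v x))"
      by (intro L2_inner_integrable ml(2) H1_wp_L2 vH vm)
    fix x
    \<comment> \<open>The square of \<open>v x \<bullet> wp i v x\<close> has a favourable sign and
      is dropped.\<close>
    have "wp i v x \<bullet> Q (v x) (wp i v x) = 2 * (v x \<bullet> wp i v x)\<^sup>2 * (damp \<eta> (v x))\<^sup>2 + (v x \<bullet> v x) * damp \<eta> (v x) * (norm (wp i v x))\<^sup>2"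
      by (simp add: Q_def inner_add_right inner_commute dot_square_norm power2_eq_square)
    then show "(v x \<bullet> v x) * damp \<eta> (v x) * (norm (wp i v x))\<^sup>2 \<le> wp i v x \<bullet> Q (v x) (wp i v x)"
      by simp
  qed
  then have "(\<Sum>i\<in>UNIV. LINT x|M. (v x \<bullet> v x) * damp \<eta> (v x) * (norm (wp i v x))\<^sup>2) \<le> (\<Sum>i\<in>UNIV. wp i v \<cdot> (\<lambda>x. Q (v x) (wp i v x)))"
    by (rule sum_mono)
  ultimately show "(\<Sum>i\<in>UNIV. LINT x|M. (v x \<bullet> v x) * damp \<eta> (v x) * (norm (wp i v x))\<^sup>2)
      \<le> 64 * nm (lap v) * sqrt (grad_sq v ^ 3)"
    and "integrable M (\<lambda>x. (v x \<bullet> v x) * damp \<eta> (v x) * (norm (wp i v x))\<^sup>2)" by auto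
qed

lemma sq_grad_bound:
  assumes v: "v \<in> H2 \<Omega>" "v \<in> H1_0 \<Omega>"
  shows "integrable M (\<lambda>x. \<Sum>i\<in>UNIV. (v x \<bullet> v x) * (norm (wp i v x))\<^sup>2)" (is ?I)
    "(LINT x|M. (\<Sum>i\<in>UNIV. (v x \<bullet> v x) * (norm (wp i v x))\<^sup>2)) \<le> 64 * nm (lap v) * sqrt (grad_sq v ^ 3)" (is ?B)
proof -
  define e where "e n = inverse (real (Suc n))" for n
  have e: "e n > 0" for n by (simp add: e_def)
  have vH: "v \<in> H1 \<Omega>" using v by (simp add: H1_0_def)
  have m: "(\<lambda>x. \<Sum>i\<in>UNIV. (v x \<bullet> v x) * (norm (wp i v x))\<^sup>2) \<in> borel_measurable M"
    using L2_meas[OF H1_wp_L2[OF vH]] L2_meas[OF H1_L2[OF vH]] by measurable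
  define f where "f n x = (\<Sum>i\<in>UNIV. (v x \<bullet> v x) * damp (e n) (v x) * (norm (wp i v x))\<^sup>2)" for n x
  have 1: "integrable M (f n)" for n
    unfolding f_def by (intro Bochner_Integration.integrable_sum sq_grad_bound_damped v e)
  have 2: "f n x \<ge> 0" for n x
    unfolding f_def by (intro sum_nonneg mult_nonneg_nonneg less_imp_le[OF damp_pos(1)[OF e]]) auto
  have "(\<lambda>n. f n x) \<longlonglongrightarrow> (\<Sum>i\<in>UNIV. (v x \<bullet> v x) * 1 * (norm (wp i v x))\<^sup>2)" for x
    unfolding f_def e_def by (intro tendsto_sum tendsto_mult tendsto_const damp_tendsto)
  then have 3: "AE x in M. (\<lambda>n. f n x) \<longlonglongrightarrow> (\<Sum>i\<in>UNIV. (v x \<bullet> v x) * (norm (wp i v x))\<^sup>2)"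
    by (intro AE_I2) simp
  have 4: "(LINT x|M. f n x) \<le> 64 * nm (lap v) * sqrt (grad_sq v ^ 3)" for n
    unfolding f_def using sq_grad_bound_damped[OF v e] by (subst Bochner_Integration.integral_sum) auto
  show ?I ?B using Fatou_integrable[OF 1 2 m 3 4 tendsto_const] by auto
qed

lemma convection_pointwise: "(norm (convection \<Omega> v x))\<^sup>2 \<le> 3 * (\<Sum>i\<in>UNIV. (v x \<bullet> v x) * (norm (wp i v x))\<^sup>2)"
proof -
  have sq: "(a + b + c)\<^sup>2 \<le> 3 * (a\<^sup>2 + b\<^sup>2 + c\<^sup>2)" for a b c :: real
  proof -
    have "3 * (a\<^sup>2 + b\<^sup>2 + c\<^sup>2) - (a + b + c)\<^sup>2 = (a - b)\<^sup>2 + (b - c)\<^sup>2 + (a - c)\<^sup>2"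
      by (simp add: power2_eq_square algebra_simps)
    then show ?thesis using zero_le_power2[of "a - b"] zero_le_power2[of "b - c"] zero_le_power2[of "a - c"] by linarith
  qed
  have n: "norm (v x $ i *\<^sub>R wp i v x) \<le> norm (v x) * norm (wp i v x)" for i
    by (simp add: component_le_norm_cart mult_right_mono)
  have "norm (convection \<Omega> v x) \<le> (\<Sum>i\<in>UNIV. norm (v x) * norm (wp i v x))"
    unfolding convection_def by (rule order_trans[OF norm_sum sum_mono[OF n]])
  then have "(norm (convection \<Omega> v x))\<^sup>2 \<le> (\<Sum>i\<in>UNIV. norm (v x) * norm (wp i v x))\<^sup>2"
    by (intro power_mono) auto
  also have "\<dots> \<le> 3 * (\<Sum>i\<in>UNIV. (norm (v x) * norm (wp i v x))\<^sup>2)"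
    using sq by (simp add: sum_3)
  finally show ?thesis by (simp add: power_mult_distrib power2_norm_eq_inner)
qed

text \<open>192 = 3 * 64: the 3 comes from the three summands of the convective term, the 64 from
  the damped estimate.\<close>

lemma convection_bound:
  assumes v: "v \<in> H2 \<Omega>" "v \<in> H1_0 \<Omega>"
  shows "convection \<Omega> v \<in> L2 \<Omega>"
    "(nm (convection \<Omega> v))\<^sup>2 \<le> 192 * nm (lap v) * sqrt (grad_sq v ^ 3)"
proof -
  have vH: "v \<in> H1 \<Omega>" using v by (simp add: H1_0_def)
  have "(\<lambda>x. v x $ i) \<in> borel_measurable M" for i
    unfolding cart_eq_inner_axis
    by (intro borel_measurable_inner L2_meas[OF H1_L2[OF vH]] borel_measurable_const)
  then have m: "convection \<Omega> v \<in> borel_measurable M"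
    unfolding convection_def
    by (intro borel_measurable_sum borel_measurable_scaleR L2_meas[OF H1_wp_L2[OF vH]])
  have "integrable M (\<lambda>x. (norm (convection \<Omega> v x))\<^sup>2)"
  proof (rule integrable_dominated)
    show "integrable M (\<lambda>x. 3 * (\<Sum>i\<in>UNIV. (v x \<bullet> v x) * (norm (wp i v x))\<^sup>2))"
      by (intro integrable_mult_right sq_grad_bound v)
    show "AE x in M. norm ((norm (convection \<Omega> v x))\<^sup>2) \<le> norm (3 * (\<Sum>i\<in>UNIV. (v x \<bullet> v x) * (norm (wp i v x))\<^sup>2))"
      unfolding real_norm_def
      by (rule AE_I2, subst abs_of_nonneg[OF zero_le_power2], rule order_trans[OF convection_pointwise abs_ge_self])
  qed (use m in measurable)
  then show L: "convection \<Omega> v \<in> L2 \<Omega>" using m by (simp add: L2_def)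
  have "(nm (convection \<Omega> v))\<^sup>2 \<le> (LINT x|M. 3 * (\<Sum>i\<in>UNIV. (v x \<bullet> v x) * (norm (wp i v x))\<^sup>2))"
    unfolding nm_sq_integral
    by (intro integral_mono L2_sq L integrable_mult_right sq_grad_bound v convection_pointwise)
  with sq_grad_bound(2)[OF v] show "(nm (convection \<Omega> v))\<^sup>2 \<le> 192 * nm (lap v) * sqrt (grad_sq v ^ 3)"
    by simp
qed

text \<open>(v . \<nabla>v | v) damp^2 is the pairing of v with the gradient of |v|^2 damp / 2, and
  solenoidal fields are orthogonal to gradients. The damping bounds that gradient by a multiple of
  |\<nabla>v|, so it is an L_2 limit-compatible object that test functions approximate against the
  square integrable v. It is removed by dominated convergence, the convective term being in L_2
  already.\<close>

lemma convection_orthogonal: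
  assumes v: "v \<in> H2 \<Omega>" "v \<in> H1_0 \<Omega>" "v \<in> L2_sigma \<Omega>"
  shows "convection \<Omega> v \<cdot> v = 0"
proof -
  have vH: "v \<in> H1 \<Omega>" using v by (simp add: H1_0_def)
  have vL: "v \<in> L2 \<Omega>" by (rule H1_L2[OF vH])
  have vm: "v \<in> borel_measurable M" by (rule L2_meas[OF vL])
  have viL: "(\<lambda>x. v x $ i) \<in> L2 \<Omega>" for i
    using L2_inner_const[OF vL, of "axis i 1"] by (simp add: inner_axis)
  have damped: "(LINT x|M. (convection \<Omega> v x \<bullet> v x) * (damp \<eta> (v x))\<^sup>2) = 0" if e: "\<eta> > 0" for \<eta>
  proof -
    \<comment> \<open>By \<open>damp_identity\<close>, the derivative of z \<mapsto> (z . z)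
      \<open>damp \<eta> z\<close> / 2 in direction d.\<close>
    define Q :: "real^3 \<Rightarrow> real^3 \<Rightarrow> real" where "Q z d = (z \<bullet> d) * (damp \<eta> z)\<^sup>2" for z d
    have Qb: "norm (Q z d) \<le> (1 + inverse \<eta>) * norm d" for z d
    proof -
      note p = damp_pos[OF e, of z]
      have zb: "norm z \<le> 1 + norm z * norm z"
        using sum_squares_bound[of "norm z" 1] by (simp add: power2_eq_square) (smt (verit) norm_ge_zero)
      have "norm z * (damp \<eta> z)\<^sup>2 \<le> (1 + (z \<bullet> z)) * (damp \<eta> z)\<^sup>2"
        using zb by (intro mult_right_mono) (auto simp: power2_norm_eq_inner[symmetric] power2_eq_square)
      also have "\<dots> \<le> (1 + (z \<bullet> z)) * damp \<eta> z"
        using p by (intro mult_left_mono) (auto simp: power2_eq_square mult_left_le_one_le)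
      also have "\<dots> \<le> 1 + inverse \<eta>" using p by (simp add: distrib_right)
      finally have nz: "norm z * (damp \<eta> z)\<^sup>2 \<le> 1 + inverse \<eta>" .
      have "norm (Q z d) = \<bar>z \<bullet> d\<bar> * (damp \<eta> z)\<^sup>2" by (simp add: Q_def abs_mult)
      also have "\<dots> \<le> norm z * norm d * (damp \<eta> z)\<^sup>2" by (intro mult_right_mono Cauchy_Schwarz_ineq2) auto
      also have "\<dots> = (norm z * (damp \<eta> z)\<^sup>2) * norm d" by simp
      also have "\<dots> \<le> (1 + inverse \<eta>) * norm d" by (intro mult_right_mono nz) auto
      finally show ?thesis .
    qed
    have Qd: "Q z (d - d') = Q z d - Q z d'" for z d d'
      by (simp add: Q_def inner_diff_right algebra_simps)
    have Qc: "continuous_on UNIV (\<lambda>p. Q (fst p) (snd p))"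
      unfolding Q_def by (intro continuous_intros continuous_on_compose2[OF damp_continuous[OF e]]) auto
    obtain f where f: "\<And>n. test_function \<Omega> (f n)"
      "\<And>i. (\<lambda>n. nm (\<lambda>x. partial i (f n) x - wp i v x)) \<longlonglongrightarrow> 0"
      "AE x in M. (\<lambda>n. f n x) \<longlonglongrightarrow> v x"
      by (rule H1_0_approx_AE[OF v(2)]) (rule that)
    note ml = multiplier_limit[OF Qb Qd Qc L2_meas[OF test_L2[OF f(1)]] vm f(3) test_L2[OF test_function_partial[OF f(1)]] H1_wp_L2[OF vH] f(2) viL]
    note sm = test_function_smooth[OF f(1)]
    define G where "G n x = (1/2) * ((f n x \<bullet> f n x) * damp \<eta> (f n x))" for n x
    have t: "test_function \<Omega> (G n)" for n
      unfolding G_def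
      by (intro test_function_mono[OF f(1)[of n]] smooth_mult smooth_inner smooth_damp smooth_const e sm) simp
    have pG: "partial i (G n) x = Q (f n x) (partial i (f n) x)" for i n x
    proof -
      let ?z = "f n x" let ?d = "partial i (f n) x" let ?g = "damp \<eta> ?z"
      have "partial i (G n) x = (1/2) * ((?z \<bullet> ?z) * (- 2 * \<eta> * (?z \<bullet> ?d) * ?g\<^sup>2) + (?z \<bullet> ?d + ?d \<bullet> ?z) * ?g)"
        unfolding G_def
        by (subst partial_linear[OF bounded_linear_mult_right[of "1/2"] smooth_mult[OF smooth_inner[OF sm sm] smooth_damp[OF e sm]]])
          (simp add: partial_mult[OF smooth_inner[OF sm sm] smooth_damp[OF e sm]] partial_inner[OF sm sm] partial_damp[OF e sm])
      also have "\<dots> = (?z \<bullet> ?d) * (?g - \<eta> * (?z \<bullet> ?z) * ?g\<^sup>2)"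
        by (simp add: inner_commute[of ?d ?z] algebra_simps)
      also have "?g - \<eta> * (?z \<bullet> ?z) * ?g\<^sup>2 = ?g\<^sup>2" by (rule damp_identity[OF e])
      finally show ?thesis by (simp add: Q_def)
    qed
    have "(\<Sum>i\<in>UNIV. (\<lambda>x. v x $ i) \<cdot> partial i (G n)) = 0" for n
    proof -
      have "(\<Sum>i\<in>UNIV. (\<lambda>x. v x $ i) \<cdot> partial i (G n)) = (LINT x|M. v x \<bullet> (\<chi> i. partial i (G n) x))"
        unfolding inner_L2_def inner_vec_def
        using L2_inner_integrable[OF viL test_L2[OF test_function_partial[OF t]]]
        by (subst Bochner_Integration.integral_sum[symmetric]) auto
      then show ?thesis using v(3) t by (simp add: L2_sigma_def)
    qed
    moreover have "(\<lambda>n. \<Sum>i\<in>UNIV. (\<lambda>x. v x $ i) \<cdot> partial i (G n)) \<longlonglongrightarrow> (\<Sum>i\<in>UNIV. (\<lambda>x. v x $ i) \<cdot> (\<lambda>x. Q (v x) (wp i v x)))"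
      unfolding pG[abs_def] by (intro tendsto_sum ml(1))
    ultimately have "(\<Sum>i\<in>UNIV. (\<lambda>x. v x $ i) \<cdot> (\<lambda>x. Q (v x) (wp i v x))) = 0"
      by (simp add: LIMSEQ_const_iff)
    also have "(\<Sum>i\<in>UNIV. (\<lambda>x. v x $ i) \<cdot> (\<lambda>x. Q (v x) (wp i v x))) = (LINT x|M. (\<Sum>i\<in>UNIV. v x $ i * Q (v x) (wp i v x)))"
      unfolding inner_L2_def
      using L2_inner_integrable[OF viL ml(2)[OF vm H1_wp_L2[OF vH]]]
      by (subst Bochner_Integration.integral_sum[symmetric]) auto
    also have "\<dots> = (LINT x|M. (convection \<Omega> v x \<bullet> v x) * (damp \<eta> (v x))\<^sup>2)"
      by (intro Bochner_Integration.integral_cong refl)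
        (simp add: convection_def Q_def inner_sum_left sum_distrib_right inner_commute[of _ "v _"] inner_sum_right mult.assoc)
    finally show ?thesis by simp
  qed
  define e where "e n = inverse (real (Suc n))" for n
  have e: "e n > 0" for n by (simp add: e_def)
  have cv: "integrable M (\<lambda>x. convection \<Omega> v x \<bullet> v x)"
    by (intro L2_inner_integrable convection_bound v vL)
  have "(\<lambda>n. LINT x|M. (convection \<Omega> v x \<bullet> v x) * (damp (e n) (v x))\<^sup>2) \<longlonglongrightarrow> (LINT x|M. convection \<Omega> v x \<bullet> v x)"
  proof (rule integral_dominated_convergence[where w="\<lambda>x. norm (convection \<Omega> v x \<bullet> v x)"])
    show "(\<lambda>x. (convection \<Omega> v x \<bullet> v x) * (damp (e n) (v x))\<^sup>2) \<in> borel_measurable M" for n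
    proof -
      have "damp (e n) \<in> borel_measurable (borel :: (real^3) measure)" by (rule borel_measurable_continuous_onI[OF damp_continuous[OF e]])
      then have "(\<lambda>x. damp (e n) (v x)) \<in> borel_measurable M" by (rule measurable_compose[OF vm])
      then show ?thesis by (intro borel_measurable_times borel_measurable_power borel_measurable_integrable[OF cv])
    qed
    show "AE x in M. (\<lambda>n. (convection \<Omega> v x \<bullet> v x) * (damp (e n) (v x))\<^sup>2) \<longlonglongrightarrow> convection \<Omega> v x \<bullet> v x"
    proof (rule AE_I2)
      fix x
      have "(\<lambda>n. (convection \<Omega> v x \<bullet> v x) * (damp (e n) (v x))\<^sup>2) \<longlonglongrightarrow> (convection \<Omega> v x \<bullet> v x) * 1\<^sup>2"
        unfolding e_def by (intro tendsto_mult tendsto_power tendsto_const damp_tendsto)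
      then show "(\<lambda>n. (convection \<Omega> v x \<bullet> v x) * (damp (e n) (v x))\<^sup>2) \<longlonglongrightarrow> convection \<Omega> v x \<bullet> v x" by simp
    qed
    show "AE x in M. norm ((convection \<Omega> v x \<bullet> v x) * (damp (e n) (v x))\<^sup>2) \<le> norm (convection \<Omega> v x \<bullet> v x)" for n
      using less_imp_le[OF damp_pos(1)[OF e]] damp_pos(2)[OF e] by (intro AE_I2) (auto simp: abs_mult intro!: mult_right_le_one_le power_le_one)
  qed (use cv in auto)
  then show ?thesis unfolding damped[OF e] inner_L2_def by (simp add: LIMSEQ_const_iff)
qed

end

subsection \<open>Gradients\<close>

text \<open>Only the smooth factor is moved, so \<open>P\<close> may be merely integrable; the
  difference quotients of \<open>z\<close> obey a Lipschitz bound and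
  \<open>B * \<bar>P x\<bar>\<close> dominates.\<close>

lemma shift_integral_derivative:
  fixes z P :: "real^3 \<Rightarrow> real"
  assumes P: "integrable lebesgue P" and z: "smooth z" and K: "compact K" "\<And>x. x \<notin> K \<Longrightarrow> z x = 0"
  shows "((\<lambda>s. LINT x|lebesgue. z (x - s *\<^sub>R axis i 1) * P x) has_real_derivative
      - (LINT x|lebesgue. partial i z (x - t *\<^sub>R axis i 1) * P x)) (at t)"
proof -
  let ?e = "axis i (1::real) :: real^3"
  obtain B where B: "B > 0" "\<And>x s. norm (z (x + s *\<^sub>R ?e) - z x) \<le> B * \<bar>s\<bar>"
    using partial_bound[OF z K] by metis
  have cont: "continuous_on UNIV z" "continuous_on UNIV (partial i z)"
    by (intro smooth_continuous smooth_partial z)+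
  have m: "(\<lambda>x. f (x - s *\<^sub>R ?e)) \<in> borel_measurable lebesgue" if "continuous_on UNIV f" for f :: "real^3 \<Rightarrow> real" and s
  proof -
    have "continuous_on UNIV (\<lambda>x. f (x - s *\<^sub>R ?e))"
      by (intro continuous_on_compose2[OF that] continuous_intros) auto
    then show ?thesis by (intro measurable_completion) (simp add: borel_measurable_continuous_onI)
  qed
  have mP: "P \<in> borel_measurable lebesgue" using P by (rule borel_measurable_integrable)
  obtain B0 where B0: "\<And>x. norm (z x) \<le> B0" using bounded_compact_support[OF cont(1) K] by metis
  have int: "integrable lebesgue (\<lambda>x. z (x - s *\<^sub>R ?e) * P x)" for s
  proof (rule integrable_dominated)
    show "integrable lebesgue (\<lambda>x. B0 * P x)" using P by simp
    show "(\<lambda>x. z (x - s *\<^sub>R ?e) * P x) \<in> borel_measurable lebesgue" by (intro borel_measurable_times m cont mP)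
    have "norm (z (x - s *\<^sub>R ?e) * P x) \<le> norm (B0 * P x)" for x
      using B0[of "x - s *\<^sub>R ?e"] by (auto simp: abs_mult intro!: mult_right_mono)
    then show "AE x in lebesgue. norm (z (x - s *\<^sub>R ?e) * P x) \<le> norm (B0 * P x)" by (intro AE_I2)
  qed
  let ?F = "\<lambda>s. LINT x|lebesgue. z (x - s *\<^sub>R ?e) * P x"
  have "((\<lambda>h. (?F (t + h) - ?F t) / h) \<longlongrightarrow> - (LINT x|lebesgue. partial i z (x - t *\<^sub>R ?e) * P x)) (at 0)"
    unfolding tendsto_at_iff_sequentially
  proof (intro allI impI)
    fix X :: "nat \<Rightarrow> real" assume X: "\<forall>n. X n \<in> UNIV - {0}" "X \<longlonglongrightarrow> 0"
    then have X0: "X n \<noteq> 0" for n by auto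
    let ?q = "\<lambda>n x. (z (x - (t + X n) *\<^sub>R ?e) - z (x - t *\<^sub>R ?e)) / X n"
    have lim: "(\<lambda>n. LINT x|lebesgue. ?q n x * P x) \<longlonglongrightarrow> (LINT x|lebesgue. - partial i z (x - t *\<^sub>R ?e) * P x)"
    proof (rule integral_dominated_convergence[where w="\<lambda>x. B * \<bar>P x\<bar>"])
      show "(\<lambda>x. - partial i z (x - t *\<^sub>R ?e) * P x) \<in> borel_measurable lebesgue"
        by (intro borel_measurable_times borel_measurable_uminus m cont mP)
      show "(\<lambda>x. ?q n x * P x) \<in> borel_measurable lebesgue" for n
        by (intro borel_measurable_times borel_measurable_divide borel_measurable_diff m cont mP borel_measurable_const)
      show "integrable lebesgue (\<lambda>x. B * \<bar>P x\<bar>)" using P by (intro integrable_mult_right integrable_abs)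
      show "AE x in lebesgue. (\<lambda>n. ?q n x * P x) \<longlonglongrightarrow> - partial i z (x - t *\<^sub>R ?e) * P x"
      proof (intro AE_I2 tendsto_mult tendsto_const)
        fix x
        let ?y = "x - t *\<^sub>R ?e"
        have "((\<lambda>s. (z (?y + (0 + s) *\<^sub>R ?e) - z (?y + 0 *\<^sub>R ?e)) /\<^sub>R s) \<longlongrightarrow> partial i z (?y + 0 *\<^sub>R ?e)) (at 0)"
          by (rule vector_derivative_quotient[OF partial_line_derivative[OF z]])
        moreover have "filterlim (\<lambda>n. - X n) (at 0) sequentially"
          using X0 tendsto_minus[OF X(2)] by (simp add: filterlim_at)
        ultimately have "(\<lambda>n. (z (?y + (0 + - X n) *\<^sub>R ?e) - z (?y + 0 *\<^sub>R ?e)) /\<^sub>R (- X n)) \<longlonglongrightarrow> partial i z (?y + 0 *\<^sub>R ?e)"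
          by (rule filterlim_compose)
        from tendsto_minus[OF this] show "(\<lambda>n. ?q n x) \<longlonglongrightarrow> - partial i z ?y"
          by (simp add: algebra_simps divide_inverse)
      qed
      show "AE x in lebesgue. norm (?q n x * P x) \<le> B * \<bar>P x\<bar>" for n
      proof (rule AE_I2)
        fix x
        have "\<bar>z (x - (t + X n) *\<^sub>R ?e) - z (x - t *\<^sub>R ?e)\<bar> \<le> B * \<bar>X n\<bar>"
          using B(2)[of "x - t *\<^sub>R ?e" "- X n"] by (simp add: algebra_simps)
        then have "\<bar>?q n x\<bar> \<le> B" using X0[of n] by (simp add: divide_le_eq)
        then show "norm (?q n x * P x) \<le> B * \<bar>P x\<bar>"
          unfolding real_norm_def abs_mult by (rule mult_right_mono) simp
      qed
    qed
    have eq: "(LINT x|lebesgue. ?q n x * P x) = (?F (t + X n) - ?F t) / X n" for n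
    proof -
      have "(?F (t + X n) - ?F t) / X n = (LINT x|lebesgue. (z (x - (t + X n) *\<^sub>R ?e) * P x - z (x - t *\<^sub>R ?e) * P x) / X n)"
        using int[of "t + X n"] int[of t] by simp
      then show ?thesis by (simp add: diff_divide_distrib left_diff_distrib)
    qed
    show "((\<lambda>h. (?F (t + h) - ?F t) / h) \<circ> X) \<longlonglongrightarrow> - (LINT x|lebesgue. partial i z (x - t *\<^sub>R axis i 1) * P x)"
      using lim unfolding o_def eq by (simp only: mult_minus_left Bochner_Integration.integral_minus)
  qed
  then show ?thesis by (simp add: DERIV_def)
qed

lemma box_approx_shift: "box_approx (a + c) (b + c) n x = box_approx a b n (x - c)"
  by (simp add: box_approx_def box_bump_def algebra_simps)

lemma partial_shift:
  assumes "smooth f" shows "partial i (\<lambda>x. f (x - c)) x = partial i f (x - c)"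
proof -
  have "((\<lambda>x. x - c) has_derivative (\<lambda>h. h)) (at x)" by (auto intro!: derivative_eq_intros)
  from partial_eq[OF has_derivative_compose[OF this smooth_has_derivative[OF assms]]]
  show ?thesis by (simp add: partial_def)
qed

lemma cbox_subset_cbox_cart:
  fixes a b c d :: "real^'n"
  assumes "\<And>j. a $ j \<le> b $ j"
  shows "cbox a b \<subseteq> cbox c d \<longleftrightarrow> (\<forall>j. c $ j \<le> a $ j \<and> b $ j \<le> d $ j)"
proof
  assume "cbox a b \<subseteq> cbox c d"
  moreover have "a \<in> cbox a b" "b \<in> cbox a b" using assms by (auto simp: mem_box_cart)
  ultimately have "a \<in> cbox c d" "b \<in> cbox c d" by auto
  then show "\<forall>j. c $ j \<le> a $ j \<and> b $ j \<le> d $ j" by (auto simp: mem_box_cart)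
next
  assume h: "\<forall>j. c $ j \<le> a $ j \<and> b $ j \<le> d $ j"
  show "cbox a b \<subseteq> cbox c d"
  proof
    fix x assume "x \<in> cbox a b"
    then have "c $ j \<le> x $ j \<and> x $ j \<le> d $ j" for j
      using h[rule_format, of j] by (auto simp: mem_box_cart intro: order_trans[of "c $ j"] order_trans[of "x $ j" "b $ j"])
    then show "x \<in> cbox c d" by (simp add: mem_box_cart)
  qed
qed

section \<open>Functions with vanishing weak gradient are constant\<close>

context bounded_open
begin

context
  fixes p :: "real^3 \<Rightarrow> real"
  assumes p: "integrable M p"
    and grad: "\<And>i \<phi>. test_function \<Omega> \<phi> \<Longrightarrow> (LINT x|M. partial i \<phi> x * p x) = 0"
begin

text \<open>Moving a test function along an axis changes its integral against \<open>p\<close> at a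
  rate that is minus the pairing of \<open>p\<close> with a partial derivative of a test function.
  This rate is zero as long as the moving box stays in \<Omega>, and the smooth cut-offs converge to
  the box integrals.\<close>

lemma box_integral_shift_pos:
  assumes s: "s \<ge> 0" and sub: "\<And>r. 0 \<le> r \<Longrightarrow> r \<le> s \<Longrightarrow> cbox (a + r *\<^sub>R axis i 1) (b + r *\<^sub>R axis i 1) \<subseteq> \<Omega>"
  shows "integral (cbox a b) p = integral (cbox (a + s *\<^sub>R axis i 1) (b + s *\<^sub>R axis i 1)) p"
proof -
  let ?e = "axis i (1::real) :: real^3"
  define P where "P x = indicator \<Omega> x *\<^sub>R p x" for x
  have P: "integrable lebesgue P" using p unfolding P_def[abs_def] by (simp add: integrable_restrict_space)
  have MP: "(LINT x|M. f x * p x) = (LINT x|lebesgue. f x * P x)" for f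
    by (simp add: integral_restrict_space P_def mult.left_commute)
  have eq: "(LINT x|M. box_approx a b n x * p x) = (LINT x|M. box_approx (a + s *\<^sub>R ?e) (b + s *\<^sub>R ?e) n x * p x)" for n
  proof -
    let ?q = "box_approx a b n"
    define F where "F r = (LINT x|lebesgue. ?q (x - r *\<^sub>R ?e) * P x)" for r
    have z: "?q x = 0" if "x \<notin> cbox a b" for x
      using that box_subset_cbox[of a b] by (auto simp: box_approx_def intro!: box_bump_zero)
    have D: "(F has_real_derivative - (LINT x|lebesgue. partial i ?q (x - t *\<^sub>R ?e) * P x)) (at t)" for t
      unfolding F_def[abs_def] by (rule shift_integral_derivative[OF P smooth_box_approx compact_cbox z])
    have D0: "(F has_real_derivative 0) (at t within {0..s})" if t: "t \<in> {0..s}" for t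
    proof -
      have tst: "test_function \<Omega> (box_approx (a + t *\<^sub>R ?e) (b + t *\<^sub>R ?e) n)"
        using t by (intro box_approx_test sub) auto
      have "(LINT x|lebesgue. partial i ?q (x - t *\<^sub>R ?e) * P x) = (LINT x|M. partial i (box_approx (a + t *\<^sub>R ?e) (b + t *\<^sub>R ?e) n) x * p x)"
        unfolding MP box_approx_shift[abs_def] partial_shift[OF smooth_box_approx] ..
      then show ?thesis using D[of t] grad[OF tst] by (simp add: has_field_derivative_at_within)
    qed
    have "\<exists>c. \<forall>t\<in>{0..s}. F t = c"
      using D0 by (intro has_field_derivative_zero_constant) auto
    then have "F 0 = F s" using s by auto
    then show ?thesis unfolding F_def MP box_approx_shift by simp
  qed
  have l: "locally_integrable \<Omega> p" by (rule locally_integrableI[OF p])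
  have "cbox a b \<subseteq> \<Omega>" using sub[of 0] s by simp
  from box_test_integral(1)[OF l this] box_test_integral(1)[OF l sub[OF s order_refl]]
  show ?thesis unfolding real_scaleR_def eq by (rule LIMSEQ_unique)
qed

lemma cbox_between:
  fixes a b c d :: "real^3"
  assumes "cbox a b \<subseteq> cbox c d" "cbox (a + s *\<^sub>R axis i 1) (b + s *\<^sub>R axis i 1) \<subseteq> cbox c d" "0 \<le> r" "r \<le> s"
    "\<And>j. a $ j \<le> b $ j"
  shows "cbox (a + r *\<^sub>R axis i 1) (b + r *\<^sub>R axis i 1) \<subseteq> cbox c d"
proof -
  have "\<forall>j. c $ j \<le> a $ j \<and> b $ j \<le> d $ j"
    using assms(1,5) by (simp add: cbox_subset_cbox_cart)
  moreover have "\<forall>j. c $ j \<le> a $ j + s * axis i 1 $ j \<and> b $ j + s * axis i 1 $ j \<le> d $ j"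
    using assms(2) by (subst (asm) cbox_subset_cbox_cart) (simp_all add: assms(5))
  ultimately have "c $ j \<le> a $ j + r * axis i 1 $ j \<and> b $ j + r * axis i 1 $ j \<le> d $ j" for j
    using assms(3,4) by (cases "j = i") (auto simp: axis_def intro: order_trans dest!: spec[of _ j])
  then show ?thesis by (subst cbox_subset_cbox_cart) (simp_all add: assms(5))
qed

lemma box_integral_shift:
  assumes C: "cbox c d \<subseteq> \<Omega>" and ab: "\<And>j. a $ j \<le> b $ j" "cbox a b \<subseteq> cbox c d"
    "cbox (a + s *\<^sub>R axis i 1) (b + s *\<^sub>R axis i 1) \<subseteq> cbox c d"
  shows "integral (cbox a b) p = integral (cbox (a + s *\<^sub>R axis i 1) (b + s *\<^sub>R axis i 1)) p"
proof (cases "s \<ge> 0")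
  case True
  show ?thesis
    by (rule box_integral_shift_pos[OF True], rule order_trans[OF cbox_between[OF ab(2,3)] C]) (use ab in auto)
next
  case False
  let ?a = "a + s *\<^sub>R axis i 1" and ?b = "b + s *\<^sub>R axis i 1"
  have s: "0 \<le> - s" using False by simp
  have e: "?a + (- s) *\<^sub>R axis i 1 = a" "?b + (- s) *\<^sub>R axis i 1 = b" by simp_all
  have "integral (cbox ?a ?b) p = integral (cbox (?a + (- s) *\<^sub>R axis i 1) (?b + (- s) *\<^sub>R axis i 1)) p"
    by (rule box_integral_shift_pos[OF s], rule order_trans[OF cbox_between[of ?a ?b c d "- s" i, unfolded e, OF ab(3,2)] C])
      (use ab in auto)
  then show ?thesis unfolding e by simp
qed

text \<open>Averages of \<open>p\<close> over congruent small cubes at x and at y agree, since one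
  cube can be moved to the other parallel to the axes inside the box; outside the null set
  \<open>N\<close> these averages converge to p x and p y.\<close>

lemma locally_constant_of_zero_gradient:
  assumes C: "cbox c d \<subseteq> \<Omega>"
  shows "\<exists>k. negligible {x \<in> box c d. p x \<noteq> k}"
proof -
  define g where "g x = (if x \<in> cbox c d then p x else 0)" for x
  have pi: "p integrable_on cbox c d"
    by (rule integrable_on_lebesgue_on[OF integrable_lebesgue_on_subset[OF p C]]) auto
  have "g integrable_on UNIV" unfolding g_def by (simp add: integrable_restrict_UNIV pi)
  then have gi: "g integrable_on cbox a b" for a b by (rule integrable_on_subcbox) simp
  obtain N where N: "negligible N" "\<And>x e. \<lbrakk>x \<notin> N; 0 < e\<rbrakk> \<Longrightarrow> \<exists>\<delta>>0. \<forall>h. 0 < h \<and> h < \<delta> \<longrightarrow>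
      norm (integral (cbox x (x + h *\<^sub>R One)) g /\<^sub>R h ^ DIM(real^3) - g x) < e"
    using integrable_ccontinuous_explicit[of g, OF gi] by blast
  have "p x = p y" if x: "x \<in> box c d" "x \<notin> N" and y: "y \<in> box c d" "y \<notin> N" for x y
  proof (rule ccontr)
    assume ne: "p x \<noteq> p y"
    define e where "e = \<bar>p x - p y\<bar> / 2"
    have e: "e > 0" using ne by (simp add: e_def)
    obtain d1 where d1: "d1 > 0" "\<And>h. 0 < h \<Longrightarrow> h < d1 \<Longrightarrow> norm (integral (cbox x (x + h *\<^sub>R One)) g /\<^sub>R h ^ DIM(real^3) - g x) < e"
      using N(2)[OF x(2) e] by blast
    obtain d2 where d2: "d2 > 0" "\<And>h. 0 < h \<Longrightarrow> h < d2 \<Longrightarrow> norm (integral (cbox y (y + h *\<^sub>R One)) g /\<^sub>R h ^ DIM(real^3) - g y) < e"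
      using N(2)[OF y(2) e] by blast
    \<comment> \<open>The room between x or y and the upper faces of the box: cubes with lower
      corner x or y and edge below \<open>m\<close> stay inside.\<close>
    define m where "m = Min ((\<lambda>j. d $ j - x $ j) ` UNIV \<union> (\<lambda>j. d $ j - y $ j) ` UNIV)"
    have m: "m > 0" unfolding m_def using x(1) y(1) by (subst Min_gr_iff) (auto simp: mem_box_cart)
    have mx: "m \<le> d $ j - x $ j" "m \<le> d $ j - y $ j" for j
      unfolding m_def by (rule Min_le; force)+
    define h where "h = min (min d1 d2) m / 2"
    have h: "0 < h" "h < d1" "h < d2" "h < m" using d1(1) d2(1) m by (auto simp: h_def)
    have One: "(One :: real^3) $ j = 1" for j
      by (simp add: cart_eq_inner_axis inner_sum_left inner_Basis axis_in_Basis_iff)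
    have One': "(\<Sum>x\<in>Basis. (x :: real^3) $ j) = 1" for j
      using One[of j] by simp
    have sub: "cbox z (z + h *\<^sub>R One) \<subseteq> cbox c d" if "\<And>j. c $ j \<le> z $ j \<and> z $ j + h \<le> d $ j" for z
      using that h by (subst cbox_subset_cbox_cart) (simp_all add: One')
    have gp: "integral (cbox z (z + h *\<^sub>R One)) g = integral (cbox z (z + h *\<^sub>R One)) p" if "cbox z (z + h *\<^sub>R One) \<subseteq> cbox c d" for z
      using that by (intro integral_cong) (auto simp: g_def)
    have step: "integral (cbox z (z + h *\<^sub>R One)) p = integral (cbox z' (z' + h *\<^sub>R One)) p"
      if z: "\<And>j. c $ j \<le> z $ j \<and> z $ j + h \<le> d $ j" and z': "z' = z + r *\<^sub>R axis i 1" "\<And>j. c $ j \<le> z' $ j \<and> z' $ j + h \<le> d $ j" for z z' r i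
    proof -
      have e': "z' + h *\<^sub>R One = (z + h *\<^sub>R One) + r *\<^sub>R axis i 1" by (simp add: z'(1))
      show ?thesis unfolding e' unfolding z'(1)
      proof (rule box_integral_shift[OF C])
        show "cbox (z + r *\<^sub>R axis i 1) (z + h *\<^sub>R One + r *\<^sub>R axis i 1) \<subseteq> cbox c d"
          using sub[OF z'(2)] unfolding e' unfolding z'(1) .
      qed (use sub[OF z] h in \<open>auto simp: One'\<close>)
    qed
    have bx: "c $ j \<le> x $ j \<and> x $ j + h \<le> d $ j" "c $ j \<le> y $ j \<and> y $ j + h \<le> d $ j" for j
      using x(1) y(1) mx[of j] h by (auto simp: mem_box_cart less_imp_le)
    \<comment> \<open>Corners of a path from x to y that changes one coordinate at a time.\<close>
    define z1 where "z1 = vec3 (y$1) (x$2) (x$3)"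
    define z2 where "z2 = vec3 (y$1) (y$2) (x$3)"
    have z1: "z1 = x + (y$1 - x$1) *\<^sub>R axis 1 1" "z2 = z1 + (y$2 - x$2) *\<^sub>R axis 2 1" "y = z2 + (y$3 - x$3) *\<^sub>R axis 3 1"
      by (simp_all add: z1_def z2_def vec_eq_iff forall_3 axis_def)
    have b1: "c $ j \<le> z1 $ j \<and> z1 $ j + h \<le> d $ j" "c $ j \<le> z2 $ j \<and> z2 $ j + h \<le> d $ j" for j
      using bx exhaust_3[of j] by (auto simp: z1_def z2_def)
    have "integral (cbox x (x + h *\<^sub>R One)) p = integral (cbox y (y + h *\<^sub>R One)) p"
      using step[OF bx(1) z1(1) b1(1)] step[OF b1(1) z1(2) b1(2)] step[OF b1(2) z1(3) bx(2)] by simp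
    then have "integral (cbox x (x + h *\<^sub>R One)) g = integral (cbox y (y + h *\<^sub>R One)) g"
      using gp sub bx by simp
    moreover have "g x = p x" "g y = p y" using x y box_subset_cbox[of c d] by (auto simp: g_def)
    \<comment> \<open>One common average cannot be closer to both values than half their
      distance.\<close>
    moreover have False if "\<bar>A - u\<bar> < \<bar>u - w\<bar> / 2" "\<bar>A - w\<bar> < \<bar>u - w\<bar> / 2" for A u w :: real
      using that abs_triangle_ineq4[of "A - w" "A - u"] by (simp add: abs_minus_commute)
    ultimately show False
      using d1(2)[OF h(1,2)] d2(2)[OF h(1,3)] unfolding e_def real_norm_def by metis
  qed
  then show ?thesis
  proof (cases "box c d - N = {}")
    case True
    then show ?thesis by (intro exI[of _ 0] negligible_subset[OF N(1)]) auto
  next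
    case False
    then obtain y where "y \<in> box c d" "y \<notin> N" by auto
    then show ?thesis using \<open>\<And>x y. x \<in> box c d \<Longrightarrow> x \<notin> N \<Longrightarrow> y \<in> box c d \<Longrightarrow> y \<notin> N \<Longrightarrow> p x = p y\<close>
      by (intro exI[of _ "p y"] negligible_subset[OF N(1)]) blast
  qed
qed

text \<open>Every point has a neighbourhood on which \<open>p\<close> equals a constant almost
  everywhere. Two such neighbourhoods that meet share a nonempty open set, which is not negligible,
  so the constants agree locally and connectedness makes them equal. A locally negligible
  exceptional set is negligible.\<close>

lemma constant_of_zero_gradient:
  assumes conn: "connected \<Omega>" and ne: "\<Omega> \<noteq> {}"
  shows "\<exists>k. AE x in M. p x = k"
proof -
  have "\<exists>U k. open U \<and> z \<in> U \<and> U \<subseteq> \<Omega> \<and> negligible {x \<in> U. p x \<noteq> k}" if z: "z \<in> \<Omega>" for z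
  proof -
    obtain a b where ab: "z \<in> box a b" "cbox a b \<subseteq> \<Omega>"
    proof -
      obtain e where e: "e > 0" "cball z e \<subseteq> \<Omega>" using open_dom z open_contains_cball by blast
      obtain a b where "z \<in> box a b" "cbox a b \<subseteq> cball z e"
      proof -
        have "\<exists>a b. (\<forall>i\<in>Basis. a \<bullet> i \<in> \<rat> \<and> b \<bullet> i \<in> \<rat>) \<and> z \<in> box a b \<and> box a b \<subseteq> ball z e"
          by (rule rational_boxes[OF e(1)])
        then obtain a b where ab: "z \<in> box a b" "box a b \<subseteq> ball z e" by blast
        then have "cbox a b = closure (box a b)" by (intro closure_box[symmetric]) auto
        also have "\<dots> \<subseteq> cball z e"
          using ab(2) ball_subset_cball[of z e] by (intro closure_minimal closed_cball) blast
        finally show thesis using that ab(1) by blast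
      qed
      then show thesis using that e(2) by blast
    qed
    obtain k where "negligible {x \<in> box a b. p x \<noteq> k}"
      using locally_constant_of_zero_gradient[OF ab(2)] by blast
    moreover have "box a b \<subseteq> \<Omega>" using ab(2) box_subset_cbox[of a b] by (rule order_trans[rotated])
    ultimately show ?thesis using ab(1) open_box[of a b] by blast
  qed
  then have "\<forall>z. \<exists>U k. z \<in> \<Omega> \<longrightarrow> open U \<and> z \<in> U \<and> U \<subseteq> \<Omega> \<and> negligible {x \<in> U. p x \<noteq> k}" by blast
  then obtain U where "\<forall>z. \<exists>k. z \<in> \<Omega> \<longrightarrow> open (U z) \<and> z \<in> U z \<and> U z \<subseteq> \<Omega> \<and> negligible {x \<in> U z. p x \<noteq> k}"
    by (rule choice[THEN exE])
  then obtain k where "\<forall>z. z \<in> \<Omega> \<longrightarrow> open (U z) \<and> z \<in> U z \<and> U z \<subseteq> \<Omega> \<and> negligible {x \<in> U z. p x \<noteq> k z}"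
    by (rule choice[THEN exE])
  then have U: "\<And>z. z \<in> \<Omega> \<Longrightarrow> open (U z) \<and> z \<in> U z \<and> U z \<subseteq> \<Omega> \<and> negligible {x \<in> U z. p x \<noteq> k z}"
    by blast
  have loc: "k z = k w" if z: "z \<in> \<Omega>" "w \<in> U z" for z w
  proof (rule ccontr)
    assume ne: "k z \<noteq> k w"
    have w: "w \<in> \<Omega>" using U[OF z(1)] z(2) by blast
    have "negligible ({x \<in> U z. p x \<noteq> k z} \<union> {x \<in> U w. p x \<noteq> k w})"
      using U[OF z(1)] U[OF w] by (intro negligible_Un) auto
    then have "negligible (U z \<inter> U w)" by (rule negligible_subset) (use ne in auto)
    moreover have "open (U z \<inter> U w)" "w \<in> U z \<inter> U w" using U[OF z(1)] U[OF w] z(2) by auto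
    ultimately show False using open_not_negligible by blast
  qed
  obtain z0 where z0: "z0 \<in> \<Omega>" using ne by blast
  have kc: "k z0 = k z" if "z \<in> \<Omega>" for z
  proof (rule connected_local_const[OF conn z0 that])
    show "\<forall>a\<in>\<Omega>. eventually (\<lambda>b. k a = k b) (at a within \<Omega>)"
    proof
      fix a assume a: "a \<in> \<Omega>"
      show "eventually (\<lambda>b. k a = k b) (at a within \<Omega>)"
        unfolding eventually_at_topological using U[OF a] loc[OF a] by blast
    qed
  qed
  have "negligible {x \<in> \<Omega>. p x \<noteq> k z0}"
  proof (rule locally_negligible_alt[THEN iffD2], rule ballI)
    fix x assume x: "x \<in> {x \<in> \<Omega>. p x \<noteq> k z0}"
    then have xO: "x \<in> \<Omega>" by simp
    let ?V = "{x \<in> \<Omega>. p x \<noteq> k z0} \<inter> U x"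
    have "openin (top_of_set {x \<in> \<Omega>. p x \<noteq> k z0}) ?V"
      by (rule openin_open_Int) (use U[OF xO] in blast)
    moreover have "negligible ?V"
      by (rule negligible_subset[of "{y \<in> U x. p y \<noteq> k x}"]) (use U[OF xO] kc[OF xO] in auto)
    moreover have "x \<in> ?V" using x U[OF xO] by blast
    ultimately show "\<exists>V. openin (top_of_set {x \<in> \<Omega>. p x \<noteq> k z0}) V \<and> x \<in> V \<and> negligible V"
      by (intro exI[of _ ?V] conjI)
  qed
  then show ?thesis by (auto simp: AE_lebesgue_on_iff)
qed

end

lemma pressure_constant:
  assumes conn: "connected \<Omega>" "\<Omega> \<noteq> {}" and p: "p \<in> H1 \<Omega>" and z: "AE x in M. weak_grad \<Omega> p x = 0"
  shows "\<exists>k. AE x in M. p x = k"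
proof (rule constant_of_zero_gradient[OF L2_integrable[OF H1_L2[OF p]] _ conn])
  fix i and f :: "real^3 \<Rightarrow> real" assume f: "test_function \<Omega> f"
  have "AE x in M. wp i p x = 0"
    using z by eventually_elim (auto simp: weak_grad_def vec_eq_iff)
  then have "(LINT x|M. f x *\<^sub>R wp i p x) = (LINT x|M. 0)"
    by (intro integral_cong_AE borel_measurable_integrable[OF locally_integrable_test[OF _ f]])
       (use H1_weak[OF p, of i] in \<open>auto simp: has_weak_partial_def\<close>)
  then show "(LINT x|M. partial i f x * p x) = 0"
    using H1_weak[OF p, of i] f by (simp add: has_weak_partial_def)
qed

end

section \<open>Rigid rotations are not gradients\<close>

lemma lborel_integral_reflect:
  fixes f :: "real^3 \<Rightarrow> real"
  assumes f: "f \<in> borel_measurable borel" and odd: "\<And>x. f (2 *\<^sub>R c - x) = - f x"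
  shows "(LINT x|lborel. f x) = 0"
proof -
  have "(lborel :: (real^3) measure) = density (distr lborel borel (\<lambda>x. 2 *\<^sub>R c + (-1) *\<^sub>R x)) (\<lambda>_. ennreal (\<bar>-1\<bar> ^ DIM(real^3)))"
    by (rule lborel_affine) simp
  then have l: "(lborel :: (real^3) measure) = distr lborel borel (\<lambda>x. 2 *\<^sub>R c - x)"
    by (simp add: density_1)
  have "(LINT x|lborel. f x) = (LINT x|distr lborel borel (\<lambda>x. 2 *\<^sub>R c - x). f x)"
    using l by simp
  also have "\<dots> = (LINT x|lborel. f (2 *\<^sub>R c - x))"
    using f by (intro integral_distr) auto
  finally show ?thesis by (simp add: odd)
qed

context bounded_open
begin

text \<open>Tested with a divergence-free field \<open>\<rho>(x) \<alpha> \<times> (x - x0)\<close>, where \<open>\<rho>\<close> is radial about \<open>x0\<close>.\<close>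

lemma rigid_rotation_not_gradient:
  assumes ne: "\<Omega> \<noteq> {}" and p: "p \<in> H1 \<Omega>" and eq: "AE x in M. cross3 \<alpha> x + weak_grad \<Omega> p x = 0"
  shows "\<alpha> = 0"
proof (rule ccontr)
  assume \<alpha>: "\<alpha> \<noteq> 0"
  obtain x0 r where r: "r > 0" "cball x0 r \<subseteq> \<Omega>"
    using ne open_dom open_contains_cball by blast
  \<comment> \<open>Smooth, zero outside the ball of radius \<open>r\<close> about
    \<open>x0\<close>, and strictly positive in its interior.\<close>
  define \<rho> where "\<rho> x = flat 0 (r\<^sup>2 - (x - x0) \<bullet> (x - x0))" for x :: "real^3"
  have sm0: "smooth (\<lambda>x. r\<^sup>2 - (x - x0) \<bullet> (x - x0))"
    by (intro smooth_diff smooth_const smooth_inner smooth_id)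
  have sm: "smooth \<rho>" unfolding \<rho>_def by (rule smooth_compose[OF smooth_flat sm0])
  have \<rho>0: "\<rho> x = 0" if "x \<notin> cball x0 r" for x
  proof -
    have "norm (x - x0) > r" using that by (simp add: dist_norm norm_minus_commute)
    then have "r\<^sup>2 < (norm (x - x0))\<^sup>2" using r(1) by (intro power_strict_mono) auto
    then show ?thesis by (simp add: \<rho>_def flat_def power2_norm_eq_inner)
  qed
  define h where "h i x = \<rho> x * cross3 \<alpha> (x - x0) $ i" for i x
  have bl: "bounded_linear (\<lambda>x. cross3 \<alpha> x $ i)" for i
    by (intro bounded_linear_compose[OF bounded_linear_vec_nth]) (auto intro!: linear_conv_bounded_linear[THEN iffD1] linearI simp: cross_add_right cross_mult_right)
  have sc: "smooth (\<lambda>x. cross3 \<alpha> (x - x0) $ i)" for i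
    by (rule smooth_linear[OF bl smooth_diff[OF smooth_id smooth_const]])
  have th: "test_function \<Omega> (h i)" for i
    unfolding h_def using \<rho>0 r(2) by (intro test_functionI[of _ "cball x0 r"] smooth_mult sm sc) auto
  define d where "d x = - 2 * flat 2 (r\<^sup>2 - (x - x0) \<bullet> (x - x0))" for x
  have flat2: "flat (Suc (Suc 0)) = flat 2" by (simp add: numeral_2_eq_2)
  have p\<rho>: "partial i \<rho> x = d x * (x - x0) $ i" for i x
  proof -
    have id: "partial i (\<lambda>x. x - x0) x = axis i 1"
      by (rule partial_eq) (auto intro!: derivative_eq_intros)
    have "partial i (\<lambda>x. r\<^sup>2 - (x - x0) \<bullet> (x - x0)) x = - (2 * (x - x0) $ i)"
    proof -
      have "((\<lambda>x. r\<^sup>2 - (x - x0) \<bullet> (x - x0)) has_derivative (\<lambda>h. - (2 * ((x - x0) \<bullet> h)))) (at x)"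
        by (auto intro!: derivative_eq_intros simp: inner_commute)
      from partial_eq[OF this, of i] show ?thesis by (simp add: inner_axis)
    qed
    then show ?thesis
      unfolding \<rho>_def using partial_compose[OF sm0 flat_deriv[of 0], of i x]
      by (simp add: d_def flat2 left_diff_distrib right_diff_distrib mult_ac)
  qed
  have pc: "partial i (\<lambda>x. cross3 \<alpha> (x - x0) $ i) x = 0" for i x
  proof -
    have "partial i (\<lambda>x. cross3 \<alpha> (x - x0) $ i) x = cross3 \<alpha> (partial i (\<lambda>x. x - x0) x) $ i"
      by (rule partial_linear[OF bl smooth_diff[OF smooth_id smooth_const]])
    also have "partial i (\<lambda>x. x - x0) x = axis i 1"
      by (rule partial_eq) (auto intro!: derivative_eq_intros)
    finally show ?thesis using exhaust_3[of i] by (auto simp: cross3_def axis_def vector_def)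
  qed
  \<comment> \<open>The gradient of the radial profile is parallel to x - x0 and hence orthogonal to
    the rotation, while the i-th component of the rotation does not depend on the i-th
    coordinate.\<close>
  have div: "(\<Sum>i\<in>UNIV. partial i (h i) x) = 0" for x
  proof -
    have "(\<Sum>i\<in>UNIV. partial i (h i) x) = (\<Sum>i\<in>UNIV. d x * ((x - x0) $ i * cross3 \<alpha> (x - x0) $ i))"
      unfolding h_def by (intro sum.cong refl) (simp add: partial_mult[OF sm sc] p\<rho> pc)
    also have "\<dots> = d x * ((x - x0) \<bullet> cross3 \<alpha> (x - x0))"
      by (simp add: inner_vec_def sum_distrib_left)
    finally show ?thesis by (simp add: dot_cross_self)
  qed
  have int: "integrable M (\<lambda>x. h i x * wp i p x)" "integrable M (\<lambda>x. partial i (h i) x * p x)" for i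
    using L2_inner_integrable[OF test_L2[OF th] H1_wp_L2[OF p]]
      L2_inner_integrable[OF test_L2[OF test_function_partial[OF th]] H1_L2[OF p]] by auto
  have "(LINT x|M. (\<Sum>i\<in>UNIV. h i x * wp i p x)) = (\<Sum>i\<in>UNIV. LINT x|M. h i x * wp i p x)"
    by (rule Bochner_Integration.integral_sum) (rule int)
  also have "\<dots> = - (\<Sum>i\<in>UNIV. LINT x|M. partial i (h i) x * p x)"
    using H1_weak[OF p] th by (simp add: has_weak_partial_def sum_negf)
  also have "(\<Sum>i\<in>UNIV. LINT x|M. partial i (h i) x * p x) = (LINT x|M. (\<Sum>i\<in>UNIV. partial i (h i) x * p x))"
    by (rule Bochner_Integration.integral_sum[symmetric]) (rule int)
  also have "\<dots> = 0" unfolding sum_distrib_right[symmetric] div by simp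
  finally have A: "(LINT x|M. (\<Sum>i\<in>UNIV. h i x * wp i p x)) = 0" by simp
  \<comment> \<open>Splitting \<alpha> \<times> x at \<open>x0\<close> leaves a nonnegative
    integrand \<open>f\<close> and an integrand \<open>g\<close> that is odd about \<open>x0\<close>
    and integrates to zero; hence \<open>f\<close> integrates to zero as well.\<close>
  define f where "f x = \<rho> x * (norm (cross3 \<alpha> (x - x0)))\<^sup>2" for x
  define g where "g x = \<rho> x * (cross3 \<alpha> (x - x0) \<bullet> cross3 \<alpha> x0)" for x
  have scc: "smooth (\<lambda>x. cross3 \<alpha> (x - x0))"
    by (rule smooth_linear[OF _ smooth_diff[OF smooth_id smooth_const]])
      (auto intro!: linear_conv_bounded_linear[THEN iffD1] linearI simp: cross_add_right cross_mult_right)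
  have tf: "test_function \<Omega> f" "test_function \<Omega> g"
    unfolding f_def g_def power2_norm_eq_inner using \<rho>0 r(2)
    by (intro test_functionI[of _ "cball x0 r"] smooth_mult sm smooth_inner scc smooth_const; auto)+
  have pw: "AE x in M. (\<Sum>i\<in>UNIV. h i x * wp i p x) = - (f x + g x)"
    using eq
  proof eventually_elim
    case (elim x)
    have "wp i p x = - cross3 \<alpha> x $ i" for i
      using elim by (simp add: vec_eq_iff weak_grad_def eq_neg_iff_add_eq_0 add.commute)
    then have "(\<Sum>i\<in>UNIV. h i x * wp i p x) = - (\<rho> x * (cross3 \<alpha> (x - x0) \<bullet> cross3 \<alpha> x))"
      by (simp add: h_def inner_vec_def sum_distrib_left sum_negf mult.assoc)
    also have "cross3 \<alpha> x = cross3 \<alpha> (x - x0) + cross3 \<alpha> x0" by (simp flip: cross_add_right)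
    finally show ?case by (simp add: f_def g_def inner_add_right power2_norm_eq_inner distrib_left)
  qed
  have "(LINT x|M. (\<Sum>i\<in>UNIV. h i x * wp i p x)) = (LINT x|M. - (f x + g x))"
  proof (rule integral_cong_AE[OF _ _ pw])
    show "(\<lambda>x. \<Sum>i\<in>UNIV. h i x * wp i p x) \<in> borel_measurable M"
      by (intro borel_measurable_sum borel_measurable_integrable int)
    show "(\<lambda>x. - (f x + g x)) \<in> borel_measurable M"
      by (intro borel_measurable_uminus borel_measurable_add borel_measurable_integrable integral_test tf)
  qed
  with A have "(LINT x|M. f x) + (LINT x|M. g x) = 0"
    using integral_test(2)[OF tf(1)] integral_test(2)[OF tf(2)] by simp
  moreover have "(LINT x|M. g x) = 0"
    unfolding integral_test(1)[OF tf(2)]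
  proof (rule lborel_integral_reflect[where c=x0])
    show "g \<in> borel_measurable borel"
      by (rule borel_measurable_continuous_onI[OF smooth_continuous[OF test_function_smooth[OF tf(2)]]])
    show "g (2 *\<^sub>R x0 - x) = - g x" for x
    proof -
      have e: "2 *\<^sub>R x0 - x - x0 = - (x - x0)" by (simp add: scaleR_2)
      show ?thesis
        unfolding g_def \<rho>_def e
        by (simp only: cross_minus_right inner_minus_left inner_minus_right minus_minus mult_minus_right)
    qed
  qed
  ultimately have f0: "(LINT x|lborel. f x) = 0" using integral_test(1)[OF tf(1)] by simp
  have cf: "continuous_on UNIV f" by (rule smooth_continuous[OF test_function_smooth[OF tf(1)]])
  have "integrable lborel f"
    by (rule integrable_compact_support[OF cf compact_cball[of x0 r]]) (simp add: f_def \<rho>0)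
  then have "AE x in lborel. f x = 0"
    using f0 flat_nonneg by (subst (asm) integral_nonneg_eq_0_iff_AE) (auto simp: f_def \<rho>_def)
  then have "AE x in lebesgue. x \<in> {x. f x = 0}" by (simp add: AE_completion)
  moreover have "closed {x. f x = 0}" by (rule closed_Collect_eq[OF cf continuous_on_const])
  ultimately have all0: "f x = 0" for x using mem_closed_if_AE_lebesgue by blast
  \<comment> \<open>At distance r/2 from \<open>x0\<close> along an axis the profile is positive, so
    the vanishing of \<open>f\<close> makes \<alpha> collinear with every coordinate axis.\<close>
  have "cross3 \<alpha> (axis j 1) = 0" for j
  proof -
    have "\<rho> (x0 + (r/2) *\<^sub>R axis j 1) > 0"
      using r(1) by (simp add: \<rho>_def flat_pos inner_axis_axis power2_eq_square)
    then show ?thesis using all0[of "x0 + (r/2) *\<^sub>R axis j 1"] r(1) by (simp add: f_def cross_mult_right)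
  qed
  from this[of 1] this[of 2] have "\<alpha> = 0" by (auto simp: cross3_def vec_eq_iff forall_3 axis_def vector_def)
  with \<alpha> show False by simp
qed

end

subsection \<open>Absolutely continuous functions of time\<close>

lemma lebesgue_Icc [simp]: "{a..b::real} \<in> sets lebesgue"
  by (metis box_real(2) lmeasurable_cbox fmeasurableD)

lemma integrable_lebesgue_on_iff:
  fixes f :: "'a::euclidean_space \<Rightarrow> 'b::euclidean_space"
  shows "S \<in> sets lebesgue \<Longrightarrow> integrable (lebesgue_on S) f \<longleftrightarrow> f absolutely_integrable_on S"
  by (simp add: set_integrable_def integrable_restrict_space)

lemma subinterval_integrable:
  fixes f :: "real \<Rightarrow> 'b::euclidean_space"
  assumes "integrable (lebesgue_on {a..b}) f" "a \<le> s" "t \<le> b"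
  shows "f integrable_on {s..t}" "integrable (lebesgue_on {s..t}) f"
    "integral\<^sup>L (lebesgue_on {s..t}) f = integral {s..t} f"
proof -
  show i: "integrable (lebesgue_on {s..t}) f"
    by (rule integrable_lebesgue_on_subset[OF assms(1)]) (use assms in auto)
  then show "f integrable_on {s..t}" by (rule integrable_on_lebesgue_on) simp
  show "integral\<^sup>L (lebesgue_on {s..t}) f = integral {s..t} f"
    by (rule lebesgue_integral_eq_integral[OF i]) simp
qed

lemma continuous_integrable_Icc:
  fixes f :: "real \<Rightarrow> 'b::euclidean_space"
  shows "continuous_on {a..b} f \<Longrightarrow> integrable (lebesgue_on {a..b}) f"
  by (simp add: integrable_lebesgue_on_iff absolutely_integrable_continuous_real)

lemma integrable_bilinear_bounded:
  fixes f :: "real \<Rightarrow> 'b::euclidean_space" and g :: "real \<Rightarrow> 'c::euclidean_space"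
    and B :: "'b \<Rightarrow> 'c \<Rightarrow> 'd::euclidean_space"
  assumes B: "bounded_bilinear B" and f: "integrable (lebesgue_on {a..b}) f" and g: "continuous_on {a..b} g"
  shows "integrable (lebesgue_on {a..b}) (\<lambda>t. B (f t) (g t))"
proof -
  obtain K where K: "K > 0" "\<And>x y. norm (B x y) \<le> norm x * norm y * K"
    using bounded_bilinear.pos_bounded[OF B] by blast
  obtain C where C: "\<And>t. t \<in> {a..b} \<Longrightarrow> norm (g t) \<le> C"
    using compact_imp_bounded[OF compact_continuous_image[OF g compact_Icc]] unfolding bounded_iff by blast
  have gm: "g \<in> borel_measurable (lebesgue_on {a..b})"
    using continuous_integrable_Icc[OF g] by (rule borel_measurable_integrable)
  show ?thesis
  proof (rule integrable_dominated)
    show "integrable (lebesgue_on {a..b}) (\<lambda>t. (C * K) *\<^sub>R f t)" using f by simp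
    have "continuous_on UNIV (\<lambda>p. B (fst p) (snd p))"
      by (intro bounded_bilinear.continuous_on[OF B] continuous_intros)
    then show "(\<lambda>t. B (f t) (g t)) \<in> borel_measurable (lebesgue_on {a..b})"
      by (intro borel_measurable_continuous_Pair[where H=B] borel_measurable_integrable[OF f] gm)
    show "AE t in lebesgue_on {a..b}. norm (B (f t) (g t)) \<le> norm ((C * K) *\<^sub>R f t)"
    proof (rule AE_I2)
      fix t assume "t \<in> space (lebesgue_on {a..b})"
      then have t: "t \<in> {a..b}" by simp
      have "norm (B (f t) (g t)) \<le> norm (f t) * norm (g t) * K" by (rule K)
      also have "\<dots> \<le> norm (f t) * C * K"
        using K(1) C[OF t] by (intro mult_right_mono mult_left_mono) auto
      also have "\<dots> \<le> norm ((C * K) *\<^sub>R f t)"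
        using mult_right_mono[OF abs_ge_self[of "C * K"] norm_ge_zero[of "f t"]] by (simp add: mult_ac)
      finally show "norm (B (f t) (g t)) \<le> norm ((C * K) *\<^sub>R f t)" .
    qed
  qed
qed

lemma integral_le_AE:
  fixes f g :: "real \<Rightarrow> real"
  assumes "f integrable_on {a..b}" "g integrable_on {a..b}" "negligible Z"
    "\<And>t. t \<in> {a<..<b} - Z \<Longrightarrow> f t \<le> g t"
  shows "integral {a..b} f \<le> integral {a..b} g"
proof -
  let ?Z = "insert a (insert b Z)"
  define f' where "f' t = (if t \<in> ?Z then g t else f t)" for t
  have n: "negligible ?Z" using assms(3) by simp
  have "f' integrable_on {a..b}" by (rule integrable_spike[OF assms(1) n]) (simp add: f'_def)
  moreover have "integral {a..b} f = integral {a..b} f'" by (rule integral_spike[OF n]) (simp add: f'_def)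
  ultimately show ?thesis
    using assms(4) by (simp, intro integral_le assms(2)) (auto simp: f'_def)
qed

text \<open>Absolute continuity with the density carried along as data, determined up to null sets.
  Product and chain rules then become identities between integrals and do not go through pointwise
  differentiation.\<close>

definition ac_on :: "real \<Rightarrow> real \<Rightarrow> (real \<Rightarrow> 'a::euclidean_space) \<Rightarrow> (real \<Rightarrow> 'a) \<Rightarrow> bool" where
  "ac_on a b f f' \<longleftrightarrow> integrable (lebesgue_on {a..b}) f' \<and>
     (\<forall>s t. a \<le> s \<longrightarrow> s \<le> t \<longrightarrow> t \<le> b \<longrightarrow> f t - f s = integral {s..t} f')"

lemma ac_onD:
  assumes "ac_on a b f f'"
  shows "integrable (lebesgue_on {a..b}) f'"
    and "\<And>s t. a \<le> s \<Longrightarrow> s \<le> t \<Longrightarrow> t \<le> b \<Longrightarrow> f t - f s = integral {s..t} f'"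
    and "\<And>s t. a \<le> s \<Longrightarrow> t \<le> b \<Longrightarrow> f' integrable_on {s..t}"
  using assms subinterval_integrable(1) by (auto simp: ac_on_def)

lemma ac_on_subset: "ac_on a b f f' \<Longrightarrow> a \<le> c \<Longrightarrow> d \<le> b \<Longrightarrow> ac_on c d f f'"
  unfolding ac_on_def using subinterval_integrable(2) by fastforce

lemma ac_on_continuous:
  assumes "ac_on a b f f'" shows "continuous_on {a..b} f"
proof (rule continuous_on_eq)
  show "continuous_on {a..b} (\<lambda>t. f a + integral {a..t} f')"
    by (intro continuous_intros indefinite_integral_continuous_1 ac_onD[OF assms]) auto
  show "f a + integral {a..t} f' = f t" if "t \<in> {a..b}" for t
    using that by (subst ac_onD(2)[OF assms, symmetric]) auto
qed

lemma ac_on_uniform: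
  assumes "ac_on a b f f'" "e > 0"
  obtains d where "d > 0" "\<And>s t. s \<in> {a..b} \<Longrightarrow> t \<in> {a..b} \<Longrightarrow> \<bar>t - s\<bar> < d \<Longrightarrow> norm (f t - f s) < e"
proof -
  have "uniformly_continuous_on {a..b} f"
    by (intro compact_uniformly_continuous ac_on_continuous[OF assms(1)]) auto
  then show thesis using assms(2) that unfolding uniformly_continuous_on_def dist_norm real_norm_def
    by (metis abs_minus_commute)
qed

text \<open>An error bounded by \<open>e\<close> times an additive function of the interval adds up
  over a partition without growing. Cutting [s, t] into pieces shorter than \<open>d\<close> gives
  the same bound on the whole interval, and \<open>e\<close> is arbitrary. The product and chain
  rules reduce to this local comparison.\<close>

lemma ac_on_approx:
  fixes F :: "real \<Rightarrow> 'a::euclidean_space"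
  assumes \<psi>: "integrable (lebesgue_on {a..b}) \<psi>" and g: "integrable (lebesgue_on {a..b}) g"
    and approx: "\<And>e. e > 0 \<Longrightarrow> \<exists>d>0. \<forall>s t. a \<le> s \<longrightarrow> s \<le> t \<longrightarrow> t \<le> b \<longrightarrow> t - s < d \<longrightarrow>
        norm (F t - F s - integral {s..t} \<psi>) \<le> e * integral {s..t} g"
  shows "ac_on a b F \<psi>"
  unfolding ac_on_def
proof (intro conjI allI impI \<psi>)
  fix s t assume st: "a \<le> s" "s \<le> t" "t \<le> b"
  have bound: "norm (F t - F s - integral {s..t} \<psi>) \<le> e * integral {s..t} g" if e: "e > 0" for e
  proof -
    obtain d where d: "d > 0" "\<And>s t. a \<le> s \<Longrightarrow> s \<le> t \<Longrightarrow> t \<le> b \<Longrightarrow> t - s < d \<Longrightarrow>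
        norm (F t - F s - integral {s..t} \<psi>) \<le> e * integral {s..t} g"
      using approx[OF e] by blast
    obtain n :: nat where n: "(t - s) / d < real n" using reals_Archimedean2 by blast
    have n0: "n > 0" using n st d(1) by (cases n) (auto simp: divide_less_0_iff not_less dest: order.strict_trans1[rotated])
    define x where "x k = s + real k * ((t - s) / real n)" for k
    have xs: "x (Suc k) - x k = (t - s) / real n" for k
      by (simp only: x_def of_nat_Suc distrib_right mult_1_left)
    have step: "(t - s) / real n < d" "0 \<le> (t - s) / real n"
      using n n0 d(1) st by (auto simp: field_simps)
    have xt: "x n = t" using n0 by (simp add: x_def)
    have xm: "x k \<le> x (Suc k)" for k using xs[of k] step by linarith
    have mono: "i \<le> j \<Longrightarrow> x i \<le> x j" for i j by (rule lift_Suc_mono_le[of x]) (use xm in auto)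
    have x0: "x 0 = s" by (simp add: x_def)
    have "norm (F (x k) - F s - integral {s..x k} \<psi>) \<le> e * integral {s..x k} g" if "k \<le> n" for k
      using that
    proof (induction k)
      case 0
      show ?case by (simp add: x0)
    next
      case (Suc k)
      have b: "s \<le> x k" "x k \<le> x (Suc k)" "x (Suc k) \<le> b" "a \<le> x k"
        using mono[of 0 k] mono[of "Suc k" n] Suc.prems xm x0 xt st by auto
      have c\<psi>: "integral {s..x (Suc k)} \<psi> = integral {s..x k} \<psi> + integral {x k..x (Suc k)} \<psi>"
        using b st by (intro HK_combine[symmetric] subinterval_integrable(1)[OF \<psi>]) auto
      have cg: "integral {s..x (Suc k)} g = integral {s..x k} g + integral {x k..x (Suc k)} g"
        using b st by (intro HK_combine[symmetric] subinterval_integrable(1)[OF g]) auto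
      have "F (x (Suc k)) - F s - integral {s..x (Suc k)} \<psi> = (F (x k) - F s - integral {s..x k} \<psi>)
          + (F (x (Suc k)) - F (x k) - integral {x k..x (Suc k)} \<psi>)"
        by (simp add: c\<psi>)
      also have "norm \<dots> \<le> e * integral {s..x k} g + e * integral {x k..x (Suc k)} g"
      proof (rule order_trans[OF norm_triangle_ineq add_mono])
        show "norm (F (x k) - F s - integral {s..x k} \<psi>) \<le> e * integral {s..x k} g"
          using Suc.IH Suc.prems by simp
        show "norm (F (x (Suc k)) - F (x k) - integral {x k..x (Suc k)} \<psi>) \<le> e * integral {x k..x (Suc k)} g"
          using step xs[of k] by (intro d(2) b) simp
      qed
      finally show ?case by (simp add: cg algebra_simps)
    qed
    from this[of n] show ?thesis by (simp add: xt)
  qed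
  define c where "c = norm (F t - F s - integral {s..t} \<psi>)"
  define I where "I = integral {s..t} g"
  have "c \<le> 0"
  proof (rule ccontr)
    assume "\<not> c \<le> 0"
    then have c: "c > 0" by simp
    \<comment> \<open>With this choice of \<open>e\<close> the bound is at most c/2; the
      \<open>+ 1\<close> covers the case \<open>I = 0\<close>.\<close>
    have "c \<le> (c / (2 * (\<bar>I\<bar> + 1))) * I" using bound[of "c / (2 * (\<bar>I\<bar> + 1))"] c by (simp add: c_def I_def)
    also have "\<dots> \<le> (c / (2 * (\<bar>I\<bar> + 1))) * (\<bar>I\<bar> + 1)" using c by (intro mult_left_mono) auto
    also have "\<dots> = c / 2" by (simp add: field_simps)
    finally show False using c by simp
  qed
  then have "F t - F s - integral {s..t} \<psi> = 0" unfolding c_def by simp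
  then show "F t - F s = integral {s..t} \<psi>" by simp
qed

text \<open>On [s, t] the increment is exactly the integral of B (f' r) (g t) + B (f s) (g' r).
  Replacing g t and f s by the values at r costs at most the oscillation times |f'| + |g'|, an error
  of the kind \<open>ac_on_approx\<close> accepts.\<close>

lemma ac_on_bilinear:
  fixes f :: "real \<Rightarrow> 'b::euclidean_space" and g :: "real \<Rightarrow> 'c::euclidean_space"
    and B :: "'b \<Rightarrow> 'c \<Rightarrow> 'd::euclidean_space"
  assumes B: "bounded_bilinear B" and f: "ac_on a b f f'" and g: "ac_on a b g g'"
  shows "ac_on a b (\<lambda>t. B (f t) (g t)) (\<lambda>t. B (f' t) (g t) + B (f t) (g' t))"
proof (rule ac_on_approx[where g="\<lambda>t. norm (f' t) + norm (g' t)"])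
  interpret bounded_bilinear B by (rule B)
  obtain K where K: "K > 0" "\<And>x y. norm (B x y) \<le> norm x * norm y * K"
    using pos_bounded by blast
  note cf = ac_on_continuous[OF f] and cg = ac_on_continuous[OF g]
  have i1: "integrable (lebesgue_on {a..b}) (\<lambda>t. B (f' t) (g t))"
    by (rule integrable_bilinear_bounded[OF B ac_onD(1)[OF f] cg])
  have i2: "integrable (lebesgue_on {a..b}) (\<lambda>t. B (f t) (g' t))"
    by (rule integrable_bilinear_bounded[OF flip ac_onD(1)[OF g] cf])
  show "integrable (lebesgue_on {a..b}) (\<lambda>t. B (f' t) (g t) + B (f t) (g' t))"
    using i1 i2 by simp
  show ig: "integrable (lebesgue_on {a..b}) (\<lambda>t. norm (f' t) + norm (g' t))"
    using ac_onD(1)[OF f] ac_onD(1)[OF g] by simp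
  fix \<eta> :: real assume \<eta>: "\<eta> > 0"
  then have eK: "\<eta> / K > 0" using K(1) by simp
  obtain d1 where d1: "d1 > 0" "\<And>s t. s \<in> {a..b} \<Longrightarrow> t \<in> {a..b} \<Longrightarrow> \<bar>t - s\<bar> < d1 \<Longrightarrow> norm (f t - f s) < \<eta> / K"
    using ac_on_uniform[OF f eK] by blast
  obtain d2 where d2: "d2 > 0" "\<And>s t. s \<in> {a..b} \<Longrightarrow> t \<in> {a..b} \<Longrightarrow> \<bar>t - s\<bar> < d2 \<Longrightarrow> norm (g t - g s) < \<eta> / K"
    using ac_on_uniform[OF g eK] by blast
  show "\<exists>k>0. \<forall>s t. a \<le> s \<longrightarrow> s \<le> t \<longrightarrow> t \<le> b \<longrightarrow> t - s < k \<longrightarrow>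
      norm (B (f t) (g t) - B (f s) (g s) - integral {s..t} (\<lambda>t. B (f' t) (g t) + B (f t) (g' t)))
        \<le> \<eta> * integral {s..t} (\<lambda>t. norm (f' t) + norm (g' t))"
  proof (intro exI[of _ "min d1 d2"] conjI allI impI)
    show "min d1 d2 > 0" using d1 d2 by simp
    fix s t assume st: "a \<le> s" "s \<le> t" "t \<le> b" "t - s < min d1 d2"
    have if': "f' integrable_on {s..t}" "g' integrable_on {s..t}" using ac_onD(3)[OF f] ac_onD(3)[OF g] st by auto
    have e1: "B (f t - f s) (g t) = integral {s..t} (\<lambda>r. B (f' r) (g t))"
      using integral_linear[OF if'(1) bounded_linear_left[of "g t"]] ac_onD(2)[OF f] st by (simp add: o_def)
    have e2: "B (f s) (g t - g s) = integral {s..t} (\<lambda>r. B (f s) (g' r))"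
      using integral_linear[OF if'(2) bounded_linear_right[of "f s"]] ac_onD(2)[OF g] st by (simp add: o_def)
    have j1: "(\<lambda>r. B (f' r) (g t)) integrable_on {s..t}" "(\<lambda>r. B (f s) (g' r)) integrable_on {s..t}"
      using integrable_linear[OF if'(1) bounded_linear_left[of "g t"]] integrable_linear[OF if'(2) bounded_linear_right[of "f s"]]
      by (simp_all add: o_def)
    have j2: "(\<lambda>r. B (f' r) (g r)) integrable_on {s..t}" "(\<lambda>r. B (f r) (g' r)) integrable_on {s..t}"
      using subinterval_integrable(1)[OF i1] subinterval_integrable(1)[OF i2] st by auto
    have j3: "(\<lambda>t. norm (f' t) + norm (g' t)) integrable_on {s..t}"
      by (rule subinterval_integrable(1)[OF ig]) (use st in auto)
    have "B (f t) (g t) - B (f s) (g s) = B (f t - f s) (g t) + B (f s) (g t - g s)"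
      by (simp add: diff_left diff_right)
    also have "\<dots> = integral {s..t} (\<lambda>r. B (f' r) (g t) + B (f s) (g' r))"
      unfolding e1 e2 by (rule Henstock_Kurzweil_Integration.integral_add[OF j1, symmetric])
    finally have "B (f t) (g t) - B (f s) (g s) - integral {s..t} (\<lambda>t. B (f' t) (g t) + B (f t) (g' t))
        = integral {s..t} (\<lambda>r. (B (f' r) (g t) + B (f s) (g' r)) - (B (f' r) (g r) + B (f r) (g' r)))"
      using integrable_add[OF j1] integrable_add[OF j2] by (simp add: HK_diff)
    also have "norm \<dots> \<le> integral {s..t} (\<lambda>r. \<eta> * (norm (f' r) + norm (g' r)))"
    proof (rule integral_norm_bound_integral)
      show "(\<lambda>r. (B (f' r) (g t) + B (f s) (g' r)) - (B (f' r) (g r) + B (f r) (g' r))) integrable_on {s..t}"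
        by (intro integrable_diff integrable_add j1 j2)
      show "(\<lambda>r. \<eta> * (norm (f' r) + norm (g' r))) integrable_on {s..t}"
        using integrable_on_mult_right[OF j3] .
      fix r assume r: "r \<in> {s..t}"
      have "norm (g t - g r) \<le> \<eta> / K" "norm (f s - f r) \<le> \<eta> / K"
        using d2(2)[of r t] d1(2)[of r s] r st by auto
      then have "norm (B (f' r) (g t - g r)) \<le> norm (f' r) * (\<eta> / K) * K" "norm (B (f s - f r) (g' r)) \<le> (\<eta> / K) * norm (g' r) * K"
        by - (rule order_trans[OF K(2)], intro mult_right_mono mult_left_mono less_imp_le[OF K(1)] norm_ge_zero, assumption)+
      moreover have "(B (f' r) (g t) + B (f s) (g' r)) - (B (f' r) (g r) + B (f r) (g' r)) = B (f' r) (g t - g r) + B (f s - f r) (g' r)"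
        by (simp add: diff_left diff_right)
      ultimately show "norm ((B (f' r) (g t) + B (f s) (g' r)) - (B (f' r) (g r) + B (f r) (g' r))) \<le> \<eta> * (norm (f' r) + norm (g' r))"
        using K(1) norm_triangle_ineq[of "B (f' r) (g t - g r)" "B (f s - f r) (g' r)"] by (simp add: algebra_simps)
    qed
    finally show "norm (B (f t) (g t) - B (f s) (g s) - integral {s..t} (\<lambda>t. B (f' t) (g t) + B (f t) (g' t)))
        \<le> \<eta> * integral {s..t} (\<lambda>t. norm (f' t) + norm (g' t))" by simp
  qed
qed

text \<open>On a short interval the mean value theorem gives the increment as \<phi>'(\<xi>) times
  that of \<open>f\<close>; uniform continuity of \<phi>' on [lo, hi] allows \<phi>'(\<xi>) to be
  replaced by \<phi>'(f r) with error e |f'|.\<close>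

lemma ac_on_chain:
  fixes \<phi> \<phi>' f f' :: "real \<Rightarrow> real"
  assumes f: "ac_on a b f f'" and lh: "\<And>t. t \<in> {a..b} \<Longrightarrow> f t \<in> {lo..hi}"
    and \<phi>: "\<And>x. x \<in> {lo..hi} \<Longrightarrow> (\<phi> has_real_derivative \<phi>' x) (at x)" "continuous_on {lo..hi} \<phi>'"
  shows "ac_on a b (\<lambda>t. \<phi> (f t)) (\<lambda>t. \<phi>' (f t) * f' t)"
proof (rule ac_on_approx[where g="\<lambda>t. \<bar>f' t\<bar>"])
  note cf = ac_on_continuous[OF f]
  have c: "continuous_on {a..b} (\<lambda>t. \<phi>' (f t))"
    by (rule continuous_on_compose2[OF \<phi>(2) cf]) (use lh in auto)
  show i: "integrable (lebesgue_on {a..b}) (\<lambda>t. \<phi>' (f t) * f' t)"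
    using integrable_bilinear_bounded[OF bounded_bilinear_mult ac_onD(1)[OF f] c] by (simp add: mult.commute)
  show "integrable (lebesgue_on {a..b}) (\<lambda>t. \<bar>f' t\<bar>)" using ac_onD(1)[OF f] by simp
  fix e :: real assume e: "e > 0"
  have "uniformly_continuous_on {lo..hi} \<phi>'" by (intro compact_uniformly_continuous \<phi>) auto
  then obtain \<eta> where \<eta>: "\<eta> > 0" "\<forall>x\<in>{lo..hi}. \<forall>y\<in>{lo..hi}. \<bar>y - x\<bar> < \<eta> \<longrightarrow> \<bar>\<phi>' y - \<phi>' x\<bar> < e"
    using e unfolding uniformly_continuous_on_def dist_real_def by auto
  obtain d where d: "d > 0" "\<And>s t. s \<in> {a..b} \<Longrightarrow> t \<in> {a..b} \<Longrightarrow> \<bar>t - s\<bar> < d \<Longrightarrow> norm (f t - f s) < \<eta>"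
    using ac_on_uniform[OF f \<eta>(1)] by blast
  show "\<exists>d>0. \<forall>s t. a \<le> s \<longrightarrow> s \<le> t \<longrightarrow> t \<le> b \<longrightarrow> t - s < d \<longrightarrow>
      norm (\<phi> (f t) - \<phi> (f s) - integral {s..t} (\<lambda>t. \<phi>' (f t) * f' t)) \<le> e * integral {s..t} (\<lambda>t. \<bar>f' t\<bar>)"
  proof (intro exI[of _ d] conjI allI impI d(1))
    fix s t assume st: "a \<le> s" "s \<le> t" "t \<le> b" "t - s < d"
    have mem: "f s \<in> {lo..hi}" "f t \<in> {lo..hi}" using lh st by auto
    obtain \<xi> where \<xi>: "\<phi> (f t) - \<phi> (f s) = (f t - f s) * \<phi>' \<xi>" "\<xi> \<in> {min (f s) (f t)..max (f s) (f t)}"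
    proof (cases "f s = f t")
      case True
      then show thesis by (intro that[of "f s"]) auto
    next
      case False
      define p q where "p = min (f s) (f t)" and "q = max (f s) (f t)"
      have "p < q" "\<And>x. p \<le> x \<Longrightarrow> x \<le> q \<Longrightarrow> (\<phi> has_real_derivative \<phi>' x) (at x)"
        using False mem by (auto simp: p_def q_def intro!: \<phi>(1))
      from MVT2[OF this] obtain z where "p < z" "z < q" "\<phi> q - \<phi> p = (q - p) * \<phi>' z" by blast
      then show thesis
        by (intro that[of z]) (auto simp: p_def q_def min_def max_def algebra_simps split: if_splits)
    qed
    have if': "f' integrable_on {s..t}" using ac_onD(3)[OF f] st by auto
    have j1: "(\<lambda>r. \<phi>' \<xi> * f' r) integrable_on {s..t}" by (rule integrable_on_mult_right[OF if'])
    have j2: "(\<lambda>t. \<phi>' (f t) * f' t) integrable_on {s..t}" using subinterval_integrable(1)[OF i] st by auto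
    have j3: "(\<lambda>t. \<bar>f' t\<bar>) integrable_on {s..t}"
      using subinterval_integrable(1)[OF integrable_abs[OF ac_onD(1)[OF f]]] st by auto
    have "\<phi> (f t) - \<phi> (f s) = integral {s..t} (\<lambda>r. \<phi>' \<xi> * f' r)"
      using \<xi>(1) ac_onD(2)[OF f] st by (simp add: mult.commute)
    then have "\<phi> (f t) - \<phi> (f s) - integral {s..t} (\<lambda>t. \<phi>' (f t) * f' t) = integral {s..t} (\<lambda>r. \<phi>' \<xi> * f' r - \<phi>' (f r) * f' r)"
      using HK_diff[OF j1 j2] by simp
    also have "norm \<dots> \<le> integral {s..t} (\<lambda>r. e * \<bar>f' r\<bar>)"
    proof (rule integral_norm_bound_integral)
      show "(\<lambda>r. \<phi>' \<xi> * f' r - \<phi>' (f r) * f' r) integrable_on {s..t}" by (intro integrable_diff j1 j2)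
      show "(\<lambda>r. e * \<bar>f' r\<bar>) integrable_on {s..t}" by (rule integrable_on_mult_right[OF j3])
      fix r assume r: "r \<in> {s..t}"
      have "\<bar>f t - f r\<bar> < \<eta>" "\<bar>f s - f r\<bar> < \<eta>"
        using d(2)[of r t] d(2)[of r s] r st by auto
      then have "\<bar>\<xi> - f r\<bar> < \<eta>" using \<xi>(2) by (auto simp: min_def max_def split: if_splits)
      moreover have "\<xi> \<in> {lo..hi}" "f r \<in> {lo..hi}" using \<xi>(2) mem lh[of r] r st by (auto simp: min_def max_def split: if_splits)
      ultimately have "\<bar>\<phi>' \<xi> - \<phi>' (f r)\<bar> \<le> e" using \<eta>(2) by (meson less_imp_le)
      then show "norm (\<phi>' \<xi> * f' r - \<phi>' (f r) * f' r) \<le> e * \<bar>f' r\<bar>"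
        by (simp add: left_diff_distrib[symmetric] abs_mult mult_right_mono)
    qed
    finally show "norm (\<phi> (f t) - \<phi> (f s) - integral {s..t} (\<lambda>t. \<phi>' (f t) * f' t)) \<le> e * integral {s..t} (\<lambda>t. \<bar>f' t\<bar>)" by simp
  qed
qed

lemma ac_on_add:
  assumes "ac_on a b f f'" "ac_on a b g g'"
  shows "ac_on a b (\<lambda>t. f t + g t) (\<lambda>t. f' t + g' t)"
  unfolding ac_on_def
proof (intro conjI allI impI)
  show "integrable (lebesgue_on {a..b}) (\<lambda>t. f' t + g' t)"
    using ac_onD(1)[OF assms(1)] ac_onD(1)[OF assms(2)] by simp
  fix s t assume st: "a \<le> s" "s \<le> t" "t \<le> b"
  have "integral {s..t} (\<lambda>t. f' t + g' t) = (f t - f s) + (g t - g s)"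
    using ac_onD(2)[OF assms(1) st] ac_onD(2)[OF assms(2) st]
      Henstock_Kurzweil_Integration.integral_add[OF ac_onD(3)[OF assms(1) st(1,3)] ac_onD(3)[OF assms(2) st(1,3)]] by simp
  then show "f t + g t - (f s + g s) = integral {s..t} (\<lambda>t. f' t + g' t)" by simp
qed

lemma ac_on_linear:
  fixes f :: "real \<Rightarrow> 'a::euclidean_space" and L :: "'a \<Rightarrow> 'b::euclidean_space"
  assumes L: "bounded_linear L" and f: "ac_on a b f f'"
  shows "ac_on a b (\<lambda>t. L (f t)) (\<lambda>t. L (f' t))"
  unfolding ac_on_def
proof (intro conjI allI impI)
  show "integrable (lebesgue_on {a..b}) (\<lambda>t. L (f' t))"
    by (rule integrable_bounded_linear[OF L ac_onD(1)[OF f]])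
  fix s t assume st: "a \<le> s" "s \<le> t" "t \<le> b"
  show "L (f t) - L (f s) = integral {s..t} (\<lambda>t. L (f' t))"
    using integral_linear[OF ac_onD(3)[OF f st(1,3)] L] ac_onD(2)[OF f st]
    by (simp add: o_def linear_diff[OF bounded_linear.linear[OF L], symmetric])
qed

lemma ac_on_cong:
  assumes "ac_on a b f f'" "\<And>t. t \<in> {a..b} \<Longrightarrow> g t = f t" "\<And>t. t \<in> {a..b} \<Longrightarrow> g' t = f' t"
  shows "ac_on a b g g'"
  unfolding ac_on_def
proof (intro conjI allI impI)
  show "integrable (lebesgue_on {a..b}) g'"
    using ac_onD(1)[OF assms(1)] Bochner_Integration.integrable_cong[OF refl, of "lebesgue_on {a..b}" g' f'] assms(3)
    by simp
  fix s t assume st: "a \<le> s" "s \<le> t" "t \<le> b"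
  have "integral {s..t} g' = integral {s..t} f'" using assms(3) st by (intro integral_cong) auto
  then show "g t - g s = integral {s..t} g'" using ac_onD(2)[OF assms(1) st] assms(2) st by simp
qed

lemma ac_on_C1:
  fixes f f' :: "real \<Rightarrow> real"
  assumes "\<And>t. (f has_real_derivative f' t) (at t)" "continuous_on UNIV f'"
  shows "ac_on a b f f'"
  unfolding ac_on_def
proof (intro conjI allI impI)
  show "integrable (lebesgue_on {a..b}) f'"
    by (intro continuous_integrable_Icc continuous_on_subset[OF assms(2)]) auto
  fix s t assume st: "a \<le> s" "s \<le> t" "t \<le> b"
  have "(f' has_integral f t - f s) {s..t}"
    by (rule fundamental_theorem_of_calculus[OF st(2)], rule has_vector_derivative_at_within)
      (simp add: has_real_derivative_iff_has_vector_derivative[symmetric] assms(1))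
  then show "f t - f s = integral {s..t} f'" by (simp add: integral_unique)
qed

lemma ac_on_le:
  fixes f f' g' :: "real \<Rightarrow> real"
  assumes "ac_on a b f f'" "negligible Z" "\<And>t. t \<in> {a<..<b} - Z \<Longrightarrow> f' t \<le> g' t" "g' integrable_on {a..b}" "a \<le> b"
  shows "f b \<le> f a + integral {a..b} g'"
  using integral_le_AE[OF ac_onD(3)[OF assms(1)] assms(4,2)] assms(3,5) ac_onD(2)[OF assms(1), of a b] by simp

lemma ac_on_zero_derivative:
  fixes f :: "real \<Rightarrow> 'a::euclidean_space"
  assumes f: "ac_on a b f f'" and c: "\<And>s t. s \<in> {a<..<b} \<Longrightarrow> t \<in> {a<..<b} \<Longrightarrow> f s = f t"
  shows "negligible {t\<in>{a<..<b}. f' t \<noteq> 0}"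
proof (rule negligible_of_box_integrals)
  fix s t assume st: "cbox s t \<subseteq> {a<..<b}"
  show "(f' has_integral 0) (cbox s t)"
  proof (cases "s \<le> t")
    case True
    then have m: "s \<in> {a<..<b}" "t \<in> {a<..<b}" using st by auto
    then have "integral {s..t} f' = 0" using ac_onD(2)[OF f, of s t] c[of s t] True by simp
    moreover have "f' integrable_on {s..t}" using m by (intro ac_onD(3)[OF f]) auto
    ultimately show ?thesis by (metis box_real(2) integrable_integral)
  qed auto
qed simp

section \<open>Gronwall inequalities\<close>

lemma gronwall_upper:
  fixes y y' :: "real \<Rightarrow> real"
  assumes y: "ac_on a b y y'" and Z: "negligible Z" and le: "\<And>t. t \<in> {a<..<b} - Z \<Longrightarrow> y' t \<le> C * y t" and "a \<le> b"
  shows "y b \<le> y a * exp (C * (b - a))"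
proof -
  have e: "ac_on a b (\<lambda>t. exp (- C * t)) (\<lambda>t. - C * exp (- C * t))"
    by (rule ac_on_C1) (auto intro!: derivative_eq_intros continuous_intros)
  have "y b * exp (- C * b) \<le> y a * exp (- C * a) + integral {a..b} (\<lambda>t. 0)"
  proof (rule ac_on_le[OF ac_on_bilinear[OF bounded_bilinear_mult y e] Z])
    fix t assume "t \<in> {a<..<b} - Z"
    from mult_right_mono[OF le[OF this], of "exp (- C * t)"]
    show "y' t * exp (- C * t) + y t * (- C * exp (- C * t)) \<le> 0" by (simp add: algebra_simps)
  qed (use \<open>a \<le> b\<close> in auto)
  then have "y b * exp (- C * b) * exp (C * b) \<le> y a * exp (- C * a) * exp (C * b)"
    by (intro mult_right_mono) auto
  then show ?thesis by (simp add: mult.assoc exp_add[symmetric] algebra_simps)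
qed

lemma gronwall_lower:
  fixes y y' :: "real \<Rightarrow> real"
  assumes y: "ac_on a b y y'" and Z: "negligible Z" and ge: "\<And>t. t \<in> {a<..<b} - Z \<Longrightarrow> y' t \<ge> C * y t" and "a \<le> b"
  shows "y b \<ge> y a * exp (C * (b - a))"
proof -
  have "- y b \<le> - y a * exp (C * (b - a))"
    by (rule gronwall_upper[OF ac_on_linear[OF bounded_linear_minus[OF bounded_linear_ident] y] Z _ \<open>a \<le> b\<close>])
      (use ge in auto)
  then show ?thesis by simp
qed

section \<open>One-sided averages and Steklov averages\<close>

lemma negligible_uminus:
  fixes S :: "real set"
  assumes "negligible S" shows "negligible (uminus ` S)"
  unfolding negligible_def
proof (intro allI)
  fix a b :: real
  have "((indicator S :: real \<Rightarrow> real) has_integral 0) (cbox (-b) (-a))"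
    using assms by (simp add: negligible_def)
  then have "((\<lambda>x. indicator S (- x) :: real) has_integral 0) (cbox a b)"
    using has_integral_reflect[of "indicator S :: real \<Rightarrow> real" 0 "-a" "-b"] by simp
  moreover have "indicator S (- x) = (indicator (uminus ` S) x :: real)" for x
    by (auto simp: indicator_def image_iff)
  ultimately show "((indicator (uminus ` S) :: real \<Rightarrow> real) has_integral 0) (cbox a b)"
    by simp
qed

lemma lebesgue_differentiation_right:
  fixes g :: "real \<Rightarrow> real"
  assumes "\<And>a b. g integrable_on {a..b}"
  obtains Z where "negligible Z" "\<And>t. t \<notin> Z \<Longrightarrow> ((\<lambda>h. integral {t..t + h} g / h) \<longlongrightarrow> g t) (at_right 0)"
proof -
  have i: "g integrable_on cbox a b" for a b using assms by simp
  obtain N where N: "negligible N" "\<And>x e. \<lbrakk>x \<notin> N; 0 < e\<rbrakk> \<Longrightarrow> \<exists>d>0. \<forall>h. 0 < h \<and> h < d \<longrightarrow>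
      norm (integral (cbox x (x + h *\<^sub>R One)) g /\<^sub>R h ^ DIM(real) - g x) < e"
    using integrable_ccontinuous_explicit[of g, OF i] by blast
  have "((\<lambda>h. integral {t..t + h} g / h) \<longlongrightarrow> g t) (at_right 0)" if t: "t \<notin> N" for t
    unfolding tendsto_iff
  proof (intro allI impI)
    fix e :: real assume "e > 0"
    then obtain d where d: "d > 0" "\<forall>h. 0 < h \<and> h < d \<longrightarrow> norm (integral (cbox t (t + h *\<^sub>R One)) g /\<^sub>R h ^ DIM(real) - g t) < e"
      using N(2)[OF t] by blast
    show "\<forall>\<^sub>F h in at_right 0. dist (integral {t..t + h} g / h) (g t) < e"
      unfolding eventually_at_right_field
      by (intro exI[of _ d] conjI allI impI d(1)) (use d(2) in \<open>auto simp: dist_real_def divide_inverse mult.commute\<close>)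
  qed
  with N(1) show thesis by (rule that)
qed

text \<open>The right-hand averages come from the differentiation theorem on cubes applied to the
  extension by zero; the left-hand ones are right-hand averages of the reflected function.\<close>

lemma lebesgue_differentiation:
  fixes g :: "real \<Rightarrow> real"
  assumes g: "integrable (lebesgue_on {a..b}) g"
  obtains Z where "negligible Z"
    "\<And>t. t \<in> {a<..<b} - Z \<Longrightarrow> ((\<lambda>h. integral {t..t + h} g / h) \<longlongrightarrow> g t) (at_right 0)"
    "\<And>t. t \<in> {a<..<b} - Z \<Longrightarrow> ((\<lambda>h. integral {t - h..t} g / h) \<longlongrightarrow> g t) (at_right 0)"
proof -
  define g0 where "g0 t = (if t \<in> {a..b} then g t else 0)" for t
  have "g integrable_on {a..b}" by (rule integrable_on_lebesgue_on[OF g]) simp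
  then have "g0 integrable_on UNIV" unfolding g0_def by (simp only: integrable_restrict_UNIV)
  then have i: "g0 integrable_on {c..d}" for c d by (rule integrable_on_subinterval) simp
  have i': "(\<lambda>t. g0 (- t)) integrable_on {c..d}" for c d
    using i[of "-d" "-c"] Henstock_Kurzweil_Integration.integrable_reflect_real[where f=g0 and a="-d" and b="-c"] by simp
  obtain Z1 where Z1: "negligible Z1" "\<And>t. t \<notin> Z1 \<Longrightarrow> ((\<lambda>h. integral {t..t + h} g0 / h) \<longlongrightarrow> g0 t) (at_right 0)"
    by (rule lebesgue_differentiation_right[of g0, OF i]) (rule that)
  obtain Z2 where Z2: "negligible Z2" "\<And>t. t \<notin> Z2 \<Longrightarrow> ((\<lambda>h. integral {t..t + h} (\<lambda>t. g0 (- t)) / h) \<longlongrightarrow> g0 (- t)) (at_right 0)"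
    by (rule lebesgue_differentiation_right[of "\<lambda>t. g0 (- t)", OF i']) (rule that)
  show thesis
  proof (rule that[of "Z1 \<union> uminus ` Z2"])
    show "negligible (Z1 \<union> uminus ` Z2)" by (intro negligible_Un Z1 negligible_uminus Z2)
    fix t assume t: "t \<in> {a<..<b} - (Z1 \<union> uminus ` Z2)"
    have g0t: "g0 t = g t" using t by (simp add: g0_def)
    have "\<forall>\<^sub>F h in at_right 0. h < min (b - t) (t - a)"
      using t unfolding eventually_at_right_field by (intro exI[of _ "min (b - t) (t - a)"]) auto
    moreover have "\<forall>\<^sub>F h in at_right 0. (h::real) > 0" by (simp add: eventually_at_right_less)
    ultimately have ev: "\<forall>\<^sub>F h in at_right 0. 0 < h \<and> h < min (b - t) (t - a)" by eventually_elim auto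
    have "\<forall>\<^sub>F h in at_right 0. integral {t..t + h} g0 / h = integral {t..t + h} g / h"
      using ev t by (auto elim!: eventually_mono intro!: arg_cong[where f="\<lambda>x. x / _"] integral_cong simp: g0_def)
    with Z1(2)[of t] t g0t show "((\<lambda>h. integral {t..t + h} g / h) \<longlongrightarrow> g t) (at_right 0)"
      by (auto intro: Lim_transform_eventually)
    have "\<forall>\<^sub>F h in at_right 0. integral {- t..- t + h} (\<lambda>t. g0 (- t)) / h = integral {t - h..t} g / h"
      using ev
    proof eventually_elim
      case (elim h)
      have "integral {- t..- t + h} (\<lambda>t. g0 (- t)) = integral {t - h..t} g0"
        using Henstock_Kurzweil_Integration.integral_reflect_real[of t "t - h" g0] by simp
      also have "\<dots> = integral {t - h..t} g" using elim t by (intro integral_cong) (auto simp: g0_def)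
      finally show ?case by simp
    qed
    moreover have "- t \<notin> Z2" using t by (auto simp: image_iff)
    ultimately show "((\<lambda>h. integral {t - h..t} g / h) \<longlongrightarrow> g t) (at_right 0)"
      using Z2(2)[of "- t"] g0t by (auto intro: Lim_transform_eventually)
  qed
qed

text \<open>Integrating a difference quotient over [s, t] telescopes: the two shifted integrals
  overlap and leave only the averages over [t, t + h] and [s, s + h].\<close>

lemma integral_shift_quotient:
  fixes G :: "real \<Rightarrow> real"
  assumes G: "integrable (lebesgue_on {a..b}) G" and st: "a \<le> s" "s \<le> t" "0 < h" "t + h \<le> b"
  shows "integral {s..t} (\<lambda>r. (G (r + h) - G r) / h) = integral {t..t + h} G / h - integral {s..s + h} G / h"
    and "integrable (lebesgue_on {s..t}) (\<lambda>r. (G (r + h) - G r) / h)"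
proof -
  have i: "G integrable_on {c..d}" if "a \<le> c" "d \<le> b" for c d
    using subinterval_integrable(1)[OF G that] .
  have sh: "integral {s..t} (\<lambda>r. G (r + h)) = integral {s + h..t + h} G"
    using integral_shift_real_ivl[of "s + h" h "t + h" G] by simp
  have si: "(\<lambda>r. G (r + h)) absolutely_integrable_on {s..t}"
  proof -
    have "(\<lambda>r. G (r + h)) integrable_on {s..t}" "(\<lambda>r. norm (G (r + h))) integrable_on {s..t}"
      using i[of "s + h" "t + h"] subinterval_integrable(1)[OF integrable_norm[OF G], of "s + h" "t + h"] st
        integrable_shift_real_ivl_iff[of "\<lambda>x. G (x + h)" "s + h" h "t + h"]
        integrable_on_shift_cbox[of G h s t] integrable_on_shift_cbox[of "\<lambda>x. norm (G x)" h s t]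
      by (simp_all add: o_def add.commute)
    then show ?thesis by (simp add: absolutely_integrable_on_def)
  qed
  have Gi: "integrable (lebesgue_on {s..t}) G" by (rule subinterval_integrable(2)[OF G]) (use st in auto)
  have si': "integrable (lebesgue_on {s..t}) (\<lambda>r. G (r + h))" using si by (simp add: integrable_lebesgue_on_iff)
  show "integrable (lebesgue_on {s..t}) (\<lambda>r. (G (r + h) - G r) / h)"
    using si' Gi by simp
  have "integral {s..t} (\<lambda>r. (G (r + h) - G r) / h) = integral {s..t} (\<lambda>r. G (r + h) - G r) / h"
    by (rule integral_divide)
  also have "integral {s..t} (\<lambda>r. G (r + h) - G r) = integral {s + h..t + h} G - integral {s..t} G"
    using HK_diff[of "\<lambda>r. G (r + h)" "{s..t}" G] si i[of s t] st
    by (simp add: sh absolutely_integrable_on_def)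
  also have "\<dots> = integral {t..t + h} G - integral {s..s + h} G"
  proof -
    have "integral {s..t} G + integral {t..t + h} G = integral {s..t + h} G"
      using st by (intro HK_combine i) auto
    moreover have "integral {s..s + h} G + integral {s + h..t + h} G = integral {s..t + h} G"
      using st by (intro HK_combine i) auto
    ultimately show ?thesis by linarith
  qed
  finally show "integral {s..t} (\<lambda>r. (G (r + h) - G r) / h) = integral {t..t + h} G / h - integral {s..s + h} G / h"
    by (simp add: diff_divide_distrib)
qed

lemma continuous_average_right:
  fixes G :: "real \<Rightarrow> real"
  assumes "continuous_on {a..b} G" "t \<in> {a<..<b}"
  shows "((\<lambda>h. integral {t..t + h} G / h) \<longlongrightarrow> G t) (at_right 0)"
proof -
  have "((\<lambda>u. integral {t..u} G) has_vector_derivative G t) (at t within {t..b})"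
    by (rule integral_has_vector_derivative) (use assms in \<open>auto intro: continuous_on_subset\<close>)
  then have "((\<lambda>u. (integral {t..u} G - integral {t..t} G) / (u - t)) \<longlongrightarrow> G t) (at t within {t..b})"
    by (simp add: has_real_derivative_iff_has_vector_derivative[symmetric] has_field_derivative_iff)
  moreover have "at t within {t..b} = at_right t" using assms(2) by (intro at_within_Icc_at_right) auto
  ultimately have "((\<lambda>u. integral {t..u} G / (u - t)) \<longlongrightarrow> G t) (at_right t)" by simp
  then show ?thesis by (subst (asm) filterlim_at_right_to_0) (simp add: add.commute)
qed

text \<open>The functional \<open>N\<close> has the supporting affine functionals \<open>B r\<close>; averaging difference quotients over
  \<open>[s, t]\<close> (Steklov averages) requires no regularity of \<open>N\<close> in time.\<close>

lemma steklov_lower: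
  fixes N \<beta> F G g :: "real \<Rightarrow> real" and B :: "real \<Rightarrow> real \<Rightarrow> real"
  assumes N: "integrable (lebesgue_on {a..b}) N" and \<beta>: "integrable (lebesgue_on {a..b}) \<beta>"
    and F: "integrable (lebesgue_on {a..b}) F" and G: "ac_on a b G g" and Z: "negligible Z"
    and conv: "\<And>r z. r \<in> {a<..<b} - Z \<Longrightarrow> z \<in> {a<..<b} - Z \<Longrightarrow> B r z - B r r \<le> N z - N r"
    and deriv: "\<And>r. r \<in> {a<..<b} - Z \<Longrightarrow> ((\<lambda>h. (B r (r + h) - B r r) / h) \<longlongrightarrow> \<beta> r) (at_right 0)"
    and bound: "\<And>r z. r \<in> {a<..<b} - Z \<Longrightarrow> z \<in> {r..b} \<Longrightarrow> 2 * \<bar>B r z - B r r\<bar> \<le> (z - r) * F r + (G z - G r)"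
    and meas: "\<And>c d h. a < c \<Longrightarrow> d + h < b \<Longrightarrow> 0 < h \<Longrightarrow> (\<lambda>r. B r (r + h) - B r r) \<in> borel_measurable (lebesgue_on {c..d})"
  obtains Z' where "negligible Z'" "\<And>s t. s \<in> {a<..<b} - Z' \<Longrightarrow> t \<in> {a<..<b} - Z' \<Longrightarrow> s \<le> t \<Longrightarrow> integral {s..t} \<beta> \<le> N t - N s"
proof -
  obtain ZN where ZN: "negligible ZN" "\<And>t. t \<in> {a<..<b} - ZN \<Longrightarrow> ((\<lambda>h. integral {t..t + h} N / h) \<longlongrightarrow> N t) (at_right 0)"
    by (rule lebesgue_differentiation[OF N]) (rule that)
  obtain Zg where Zg: "negligible Zg" "\<And>t. t \<in> {a<..<b} - Zg \<Longrightarrow> ((\<lambda>h. integral {t..t + h} g / h) \<longlongrightarrow> g t) (at_right 0)"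
    by (rule lebesgue_differentiation[OF ac_onD(1)[OF G]]) (rule that)
  have main: "integral {s..t} \<beta> \<le> N t - N s" if s: "s \<in> {a<..<b} - ZN" and t: "t \<in> {a<..<b} - ZN" and "s \<le> t" for s t
  proof -
    define \<delta> where "\<delta> = (b - t) / 2"
    have \<delta>: "\<delta> > 0" "t + \<delta> < b" using t by (auto simp: \<delta>_def field_simps)
    define h where "h n = \<delta> * inverse (real (Suc n))" for n
    have h: "0 < h n" "h n \<le> \<delta>" for n using \<delta>(1) by (auto simp: h_def field_simps)
    have "h \<longlonglongrightarrow> \<delta> * 0" unfolding h_def by (intro tendsto_intros LIMSEQ_inverse_real_of_nat)
    then have hlim: "filterlim h (at_right 0) sequentially"
      using h by (auto simp: filterlim_at intro!: always_eventually simp: less_imp_neq[OF h(1), symmetric])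
    have st: "a \<le> s" "t + h n \<le> b" "a < s" "t + h n < b" for n using s \<delta>(2) h(2)[of n] by auto
    let ?M = "lebesgue_on {s..t}"
    define q where "q n r = (B r (r + h n) - B r r) / h n" for n r
    \<comment> \<open>Majorant of the quotient: \<open>bound\<close> gives |q| \<le> w off the null
      set. Since \<open>G\<close> is absolutely continuous, \<open>w\<close> converges almost
      everywhere and so do its integrals, to the integral of the limit.\<close>
    define w where "w n r = (F r + (G (r + h n) - G r) / h n) / 2" for n r
    have Gc: "continuous_on {a..b} G" by (rule ac_on_continuous[OF G])
    have Gi: "integrable (lebesgue_on {a..b}) G" by (rule continuous_integrable_Icc[OF Gc])
    have Fi: "integrable ?M F" and \<beta>i: "integrable ?M \<beta>" and gi: "integrable ?M g"
      using subinterval_integrable(2)[OF F, of s t] subinterval_integrable(2)[OF \<beta>, of s t]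
        subinterval_integrable(2)[OF ac_onD(1)[OF G], of s t] st(1) t by auto
    have wi: "integrable ?M (w n)" for n
      unfolding w_def using integral_shift_quotient(2)[OF Gi st(1) \<open>s \<le> t\<close> h(1) st(2)] Fi by simp
    have AEM: "AE r in ?M. P r" if "negligible S" "\<And>r. r \<in> {s..t} - S \<Longrightarrow> P r" for S P
      by (simp only: AE_lebesgue_on_iff[OF lebesgue_Icc]) (rule negligible_subset[OF that(1)], use that(2) in auto)
    have sub: "r \<in> {a<..<b}" if "r \<in> {s..t}" for r using that s t by auto
    have qw: "\<bar>q n r\<bar> \<le> w n r" if "r \<in> {s..t} - Z" for n r
    proof -
      have "2 * \<bar>B r (r + h n) - B r r\<bar> \<le> h n * F r + (G (r + h n) - G r)"
        using bound[of r "r + h n"] sub[of r] that st(2)[of n] h(1)[of n] by auto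
      then show ?thesis using h(1)[of n] by (simp add: q_def w_def field_simps)
    qed
    have qm: "q n \<in> borel_measurable ?M" for n
      unfolding q_def using meas[OF st(3,4) h(1)] by (intro borel_measurable_divide) auto
    have qi: "integrable ?M (q n)" for n
    proof (rule integrable_dominated[OF wi qm])
      show "AE r in ?M. norm (q n r) \<le> norm (w n r)"
        by (rule AEM[OF Z]) (use qw in \<open>fastforce intro: order_trans[OF _ abs_ge_self]\<close>)
    qed
    \<comment> \<open>Adding the majorant makes the quotients nonnegative, as Fatou's lemma demands;
      the maximum takes care of the exceptional null set.\<close>
    define f where "f n r = max 0 (q n r + w n r)" for n r
    have f_eq: "AE r in ?M. f n r = q n r + w n r" for n
      by (rule AEM[OF Z]) (use qw[of _ n] in \<open>fastforce simp: f_def\<close>)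
    have fi: "integrable ?M (f n)" for n unfolding f_def using qi wi by (intro integrable_max) auto
    have lim: "AE r in ?M. (\<lambda>n. f n r) \<longlonglongrightarrow> max 0 (\<beta> r + (F r + g r) / 2)"
    proof (rule AEM[of "Z \<union> Zg"])
      show "negligible (Z \<union> Zg)" by (intro negligible_Un Z Zg)
      fix r assume r: "r \<in> {s..t} - (Z \<union> Zg)"
      have 1: "(\<lambda>n. q n r) \<longlonglongrightarrow> \<beta> r"
        unfolding q_def using r sub by (intro filterlim_compose[OF deriv hlim]) auto
      have "(\<lambda>n. integral {r..r + h n} g / h n) \<longlonglongrightarrow> g r"
        using r sub by (intro filterlim_compose[OF Zg(2) hlim]) auto
      moreover have "integral {r..r + h n} g = G (r + h n) - G r" for n
        using ac_onD(2)[OF G, of r "r + h n"] r sub[of r] h(1)[of n] st(2)[of n] by auto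
      ultimately have 2: "(\<lambda>n. w n r) \<longlonglongrightarrow> (F r + g r) / 2"
        unfolding w_def by (intro tendsto_divide tendsto_add tendsto_const) auto
      show "(\<lambda>n. f n r) \<longlonglongrightarrow> max 0 (\<beta> r + (F r + g r) / 2)"
        unfolding f_def by (intro tendsto_max tendsto_const tendsto_add 1 2)
    qed
    define c where "c n = (integral {t..t + h n} N / h n - integral {s..s + h n} N / h n)
       + (integral {s..t} F + (integral {t..t + h n} G / h n - integral {s..s + h n} G / h n)) / 2" for n
    have fc: "(LINT r|?M. f n r) \<le> c n" for n
    proof -
      have "(LINT r|?M. f n r) = (LINT r|?M. q n r + w n r)"
        by (rule integral_cong_AE) (use f_eq fi qi wi in auto)
      also have "\<dots> = (LINT r|?M. q n r) + (LINT r|?M. w n r)" using qi wi by simp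
      \<comment> \<open>Here the supporting property enters: the increments of \<open>B r\<close>
        lie below those of \<open>N\<close>, whose quotient integrates to two boundary
        averages.\<close>
      also have "(LINT r|?M. q n r) \<le> (LINT r|?M. (N (r + h n) - N r) / h n)"
      proof (rule integral_mono_AE[OF qi])
        show "integrable ?M (\<lambda>r. (N (r + h n) - N r) / h n)"
          by (rule integral_shift_quotient(2)[OF N st(1) \<open>s \<le> t\<close> h(1) st(2)])
        have neg: "negligible (Z \<union> (+) (- h n) ` Z)" by (intro negligible_Un negligible_translation Z)
        show "AE r in ?M. q n r \<le> (N (r + h n) - N r) / h n"
        proof (rule AEM[OF neg])
          fix r assume r: "r \<in> {s..t} - (Z \<union> (+) (- h n) ` Z)"
          then have "r + h n \<notin> Z" by (auto simp: image_iff)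
          then have "B r (r + h n) - B r r \<le> N (r + h n) - N r"
            using r sub[of r] st(4)[of n] h(1)[of n] by (intro conv) auto
          then show "q n r \<le> (N (r + h n) - N r) / h n" using h(1)[of n] by (simp add: q_def divide_right_mono)
        qed
      qed
      also have "(LINT r|?M. (N (r + h n) - N r) / h n) = integral {t..t + h n} N / h n - integral {s..s + h n} N / h n"
        by (rule trans[OF lebesgue_integral_eq_integral[OF integral_shift_quotient(2)[OF N st(1) \<open>s \<le> t\<close> h(1) st(2)] lebesgue_Icc]
          integral_shift_quotient(1)[OF N st(1) \<open>s \<le> t\<close> h(1) st(2)]])
      also have "(LINT r|?M. w n r) = (integral {s..t} F + (integral {t..t + h n} G / h n - integral {s..s + h n} G / h n)) / 2"
      proof -
        note Gq = integral_shift_quotient[OF Gi st(1) \<open>s \<le> t\<close> h(1) st(2)]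
        have "(LINT r|?M. w n r) = ((LINT r|?M. F r) + (LINT r|?M. (G (r + h n) - G r) / h n)) / 2"
          unfolding w_def using Gq(2) Fi by simp
        then show ?thesis
          unfolding trans[OF lebesgue_integral_eq_integral[OF Gq(2) lebesgue_Icc] Gq(1)] lebesgue_integral_eq_integral[OF Fi lebesgue_Icc] .
      qed
      finally show ?thesis by (simp add: c_def)
    qed
    have clim: "c \<longlonglongrightarrow> (N t - N s) + (integral {s..t} F + (G t - G s)) / 2"
      unfolding c_def using s t
      by (intro tendsto_intros filterlim_compose[OF ZN(2) hlim] filterlim_compose[OF continuous_average_right[OF Gc] hlim]) auto
    have mm: "(\<lambda>r. max 0 (\<beta> r + (F r + g r) / 2)) \<in> borel_measurable ?M"
      using \<beta>i Fi gi by (intro borel_measurable_max borel_measurable_integrable) auto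
    note Fa = Fatou_integrable[OF fi _ mm lim fc clim]
    have "(LINT r|?M. \<beta> r + (F r + g r) / 2) \<le> (LINT r|?M. max 0 (\<beta> r + (F r + g r) / 2))"
      using Fa(1) \<beta>i Fi gi by (intro integral_mono) (auto simp: f_def)
    also have "\<dots> \<le> (N t - N s) + (integral {s..t} F + (G t - G s)) / 2"
      by (rule Fa(2)) (simp add: f_def)
    also have "(LINT r|?M. \<beta> r + (F r + g r) / 2) = integral {s..t} \<beta> + (integral {s..t} F + integral {s..t} g) / 2"
      using \<beta>i Fi gi by (simp add: lebesgue_integral_eq_integral)
    \<comment> \<open>The contributions of the majorant now agree on both sides and cancel.\<close>
    also have "integral {s..t} g = G t - G s" using ac_onD(2)[OF G, of s t] s t \<open>s \<le> t\<close> by auto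
    finally show "integral {s..t} \<beta> \<le> N t - N s" by simp
  qed
  show thesis by (rule that[OF ZN(1) main])
qed

lemma ac_on_reflect:
  fixes f :: "real \<Rightarrow> real"
  assumes f: "ac_on a b f f'" shows "ac_on (- b) (- a) (\<lambda>t. - f (- t)) (\<lambda>t. f' (- t))"
  unfolding ac_on_def
proof (intro conjI allI impI)
  show "integrable (lebesgue_on {- b..- a}) (\<lambda>t. f' (- t))"
    using ac_onD(1)[OF f] by (simp add: integrable_lebesgue_on_iff)
  fix s t assume "- b \<le> s" "s \<le> t" "t \<le> - a"
  then show "- f (- t) - - f (- s) = integral {s..t} (\<lambda>t. f' (- t))"
    using ac_onD(2)[OF f, of "- t" "- s"] Henstock_Kurzweil_Integration.integral_reflect_real[of "- s" "- t" f'] by simp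
qed

lemma integrable_reflect_lebesgue_on:
  fixes f :: "real \<Rightarrow> real"
  shows "integrable (lebesgue_on {a..b}) f \<Longrightarrow> integrable (lebesgue_on {- b..- a}) (\<lambda>t. f (- t))"
  by (simp add: integrable_lebesgue_on_iff)

text \<open>Reflection is available for integrable functions, so \<open>f\<close> is first
  compressed to a bounded function by arctan and recovered by tan.\<close>

lemma borel_measurable_reflect:
  fixes f :: "real \<Rightarrow> real"
  assumes "f \<in> borel_measurable (lebesgue_on {- d..- c})"
  shows "(\<lambda>t. f (- t)) \<in> borel_measurable (lebesgue_on {c..d})"
proof -
  define k where "k t = arctan (f t)" for t
  have km: "k \<in> borel_measurable (lebesgue_on {- d..- c})"
    unfolding k_def using assms by (rule measurable_compose) (simp add: borel_measurable_continuous_onI continuous_on_arctan)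
  have "integrable (lebesgue_on {- d..- c}) k"
  proof (rule integrable_dominated[OF _ km])
    show "integrable (lebesgue_on {- d..- c}) (\<lambda>t. pi)"
      by (intro continuous_integrable_Icc continuous_intros)
    show "AE t in lebesgue_on {- d..- c}. norm (k t) \<le> norm pi"
      using arctan_bounded by (intro AE_I2) (simp add: k_def abs_le_iff, smt (verit) pi_gt_zero field_sum_of_halves)
  qed
  then have "integrable (lebesgue_on {c..d}) (\<lambda>t. k (- t))"
    using integrable_reflect_lebesgue_on[of "-d" "-c" k] by simp
  then have "(\<lambda>t. tan (k (- t))) \<in> borel_measurable (lebesgue_on {c..d})"
    by (intro measurable_compose[of "\<lambda>t. k (- t)" _ borel tan]) (auto simp: tan_def)
  then show ?thesis by (simp add: k_def tan_arctan)
qed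

text \<open>\<open>steklov_lower\<close> gives one inequality. Reversing time turns \<beta>(t) into
  -\<beta>(-t) and G(t) into -G(-t), which increases again, while the supporting inequality keeps
  its form; the same lemma then gives the reverse inequality. A null set of times stays excluded
  because no continuity of \<open>N\<close> is assumed.\<close>

lemma steklov_ac:
  fixes N \<beta> F G g :: "real \<Rightarrow> real" and B :: "real \<Rightarrow> real \<Rightarrow> real"
  assumes N: "integrable (lebesgue_on {a..b}) N" and \<beta>: "integrable (lebesgue_on {a..b}) \<beta>"
    and F: "integrable (lebesgue_on {a..b}) F" and G: "ac_on a b G g" and Z: "negligible Z"
    and conv: "\<And>r q. r \<in> {a<..<b} - Z \<Longrightarrow> q \<in> {a<..<b} - Z \<Longrightarrow> B r q - B r r \<le> N q - N r"
    and deriv: "\<And>r. r \<in> {a<..<b} - Z \<Longrightarrow> ((\<lambda>h. (B r (r + h) - B r r) / h) \<longlongrightarrow> \<beta> r) (at_right 0)"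
    and deriv': "\<And>r. r \<in> {a<..<b} - Z \<Longrightarrow> ((\<lambda>h. (B r r - B r (r - h)) / h) \<longlongrightarrow> \<beta> r) (at_right 0)"
    and bound: "\<And>r q. r \<in> {a<..<b} - Z \<Longrightarrow> q \<in> {a..b} \<Longrightarrow> 2 * \<bar>B r q - B r r\<bar> \<le> \<bar>q - r\<bar> * F r + \<bar>G q - G r\<bar>"
    and mono: "\<And>s t. a \<le> s \<Longrightarrow> s \<le> t \<Longrightarrow> t \<le> b \<Longrightarrow> G s \<le> G t"
    and meas: "\<And>c d h. a < c \<Longrightarrow> d < b \<Longrightarrow> a < c + h \<Longrightarrow> d + h < b \<Longrightarrow> (\<lambda>r. B r (r + h) - B r r) \<in> borel_measurable (lebesgue_on {c..d})"
  obtains Z' where "negligible Z'" "\<And>s t. s \<in> {a<..<b} - Z' \<Longrightarrow> t \<in> {a<..<b} - Z' \<Longrightarrow> s \<le> t \<Longrightarrow> N t - N s = integral {s..t} \<beta>"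
proof -
  obtain Z1 where Z1: "negligible Z1" "\<And>s t. s \<in> {a<..<b} - Z1 \<Longrightarrow> t \<in> {a<..<b} - Z1 \<Longrightarrow> s \<le> t \<Longrightarrow> integral {s..t} \<beta> \<le> N t - N s"
  proof (rule steklov_lower[OF N \<beta> F G Z conv deriv])
    show "2 * \<bar>B r q - B r r\<bar> \<le> (q - r) * F r + (G q - G r)" if "r \<in> {a<..<b} - Z" "q \<in> {r..b}" for r q
      using bound[of r q] mono[of r q] that by auto
    show "(\<lambda>r. B r (r + h) - B r r) \<in> borel_measurable (lebesgue_on {c..d})" if "a < c" "d + h < b" "0 < h" for c d h
      using that by (intro meas) auto
  qed (use that in auto)
  let ?Z = "uminus ` Z"
  have mem: "- r \<in> {a<..<b} - Z" if "r \<in> {- b<..<- a} - ?Z" for r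
    using that by (auto simp: image_iff)
  obtain Z2 where Z2: "negligible Z2" "\<And>s t. s \<in> {- b<..<- a} - Z2 \<Longrightarrow> t \<in> {- b<..<- a} - Z2 \<Longrightarrow> s \<le> t \<Longrightarrow>
      integral {s..t} (\<lambda>t. - \<beta> (- t)) \<le> N (- t) - N (- s)"
  proof (rule steklov_lower[where a="-b" and b="-a" and N="\<lambda>t. N (- t)" and \<beta>="\<lambda>t. - \<beta> (- t)" and F="\<lambda>t. F (- t)"
        and G="\<lambda>t. - G (- t)" and g="\<lambda>t. g (- t)" and Z="?Z" and B="\<lambda>r q. B (- r) (- q)"])
    show "integrable (lebesgue_on {- b..- a}) (\<lambda>t. N (- t))" "integrable (lebesgue_on {- b..- a}) (\<lambda>t. F (- t))"
      by (intro integrable_reflect_lebesgue_on N F)+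
    show "integrable (lebesgue_on {- b..- a}) (\<lambda>t. - \<beta> (- t))"
      using integrable_reflect_lebesgue_on[OF \<beta>] by simp
    show "ac_on (- b) (- a) (\<lambda>t. - G (- t)) (\<lambda>t. g (- t))" by (rule ac_on_reflect[OF G])
    show "negligible ?Z" by (rule negligible_uminus[OF Z])
    show "B (- r) (- q) - B (- r) (- r) \<le> N (- q) - N (- r)" if "r \<in> {- b<..<- a} - ?Z" "q \<in> {- b<..<- a} - ?Z" for r q
      by (rule conv[OF mem[OF that(1)] mem[OF that(2)]])
    show "((\<lambda>h. (B (- r) (- (r + h)) - B (- r) (- r)) / h) \<longlongrightarrow> - \<beta> (- r)) (at_right 0)" if "r \<in> {- b<..<- a} - ?Z" for r
    proof -
      have "(\<lambda>h. (B (- r) (- (r + h)) - B (- r) (- r)) / h) = (\<lambda>h. - ((B (- r) (- r) - B (- r) (- r - h)) / h))"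
        by (simp add: fun_eq_iff minus_divide_left)
      then show ?thesis using tendsto_minus[OF deriv'[OF mem[OF that]]] by simp
    qed
    show "2 * \<bar>B (- r) (- q) - B (- r) (- r)\<bar> \<le> (q - r) * F (- r) + (- G (- q) - - G (- r))"
      if "r \<in> {- b<..<- a} - ?Z" "q \<in> {r..- a}" for r q
      using bound[OF mem[OF that(1)], of "- q"] mono[of "- q" "- r"] that by auto
    show "(\<lambda>r. B (- r) (- (r + h)) - B (- r) (- r)) \<in> borel_measurable (lebesgue_on {c..d})"
      if "- b < c" "d + h < - a" "0 < h" for c d h
      using borel_measurable_reflect[OF meas[of "- d" "- c" "- h"]] that by simp
  qed (use that in auto)
  show thesis
  proof (rule that[of "Z1 \<union> uminus ` Z2"])
    show "negligible (Z1 \<union> uminus ` Z2)" by (intro negligible_Un Z1 negligible_uminus Z2)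
    fix s t assume st: "s \<in> {a<..<b} - (Z1 \<union> uminus ` Z2)" "t \<in> {a<..<b} - (Z1 \<union> uminus ` Z2)" "s \<le> t"
    have "- s \<in> {- b<..<- a} - Z2" "- t \<in> {- b<..<- a} - Z2"
      using st by (auto simp: image_iff)
    from Z2(2)[OF this(2,1)] st(3) have "integral {- t..- s} (\<lambda>t. - \<beta> (- t)) \<le> N s - N t" by simp
    then have "N t - N s \<le> integral {s..t} \<beta>" by simp
    with Z1(2)[of s t] st show "N t - N s = integral {s..t} \<beta>" by auto
  qed
qed

subsection \<open>Paths in \<open>L\<^sub>2(\<Omega>)\<close>\<close>

lemma borel_measurable_AE_limit:
  fixes f :: "'a::euclidean_space \<Rightarrow> real"
  assumes S: "S \<in> sets lebesgue" and fn: "\<And>n. fn n \<in> borel_measurable (lebesgue_on S)"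
    and lim: "AE t in lebesgue_on S. (\<lambda>n. fn n t) \<longlonglongrightarrow> f t"
  shows "f \<in> borel_measurable (lebesgue_on S)"
proof (rule borel_measurable_lebesgue_on_AE[OF S])
  show "(\<lambda>t. lim (\<lambda>n. fn n t)) \<in> borel_measurable (lebesgue_on S)"
    by (rule borel_measurable_lim_metric[OF fn])
  show "AE t in lebesgue_on S. lim (\<lambda>n. fn n t) = f t"
    using lim by eventually_elim (rule limI)
qed

lemma lebesgue_Ioo [simp]: "{a<..<b::real} \<in> sets lebesgue"
  by (metis box_real(1) lmeasurable_box fmeasurableD)

lemma Ioo_Icc_integrable:
  fixes f :: "real \<Rightarrow> 'b::euclidean_space"
  shows "integrable (lebesgue_on {a<..<b}) f \<longleftrightarrow> integrable (lebesgue_on {a..b}) f"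
proof -
  have "f absolutely_integrable_on {a<..<b} \<longleftrightarrow> f absolutely_integrable_on {a..b}"
    by (rule absolutely_integrable_spike_set_eq) (rule negligible_subset[of "{a, b}"]; force)+
  then show ?thesis by (simp add: integrable_lebesgue_on_iff)
qed

lemma AE_Ioo_iff:
  fixes P :: "real \<Rightarrow> bool"
  shows "(AE t in lebesgue_on {a<..<b}. P t) \<longleftrightarrow> (\<exists>Z. negligible Z \<and> (\<forall>t\<in>{a<..<b} - Z. P t))" (is "_ \<longleftrightarrow> ?R")
proof -
  have "negligible {t \<in> {a<..<b}. \<not> P t} \<Longrightarrow> ?R"
    by (rule exI[of _ "{t \<in> {a<..<b}. \<not> P t}"]) simp
  moreover have "negligible {t \<in> {a<..<b}. \<not> P t}" if Z: "negligible Z" "\<forall>t\<in>{a<..<b} - Z. P t" for Z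
    by (rule negligible_subset[OF Z(1)]) (use Z(2) in auto)
  ultimately show ?thesis by (auto simp only: AE_lebesgue_on_iff[OF lebesgue_Ioo])
qed

context bounded_open
begin

text \<open>Bochner measurability with values in L_2, separated from the target space and the
  integrability in \<open>bochner_L2\<close>, so that it applies to \<open>v'\<close> and to
  \<Delta>v alike.\<close>

definition smeas :: "real \<Rightarrow> (real \<Rightarrow> real^3 \<Rightarrow> real^3) \<Rightarrow> bool" where
  "smeas T u \<longleftrightarrow> (\<exists>s. (\<forall>n. simple_function (lebesgue_on {0<..<T}) (s n)) \<and> (\<forall>n. \<forall>t\<in>{0<..<T}. s n t \<in> L2 \<Omega>) \<and>
     (AE t in lebesgue_on {0<..<T}. u t \<in> L2 \<Omega> \<and> (\<lambda>n. nm (\<lambda>x. s n t x - u t x)) \<longlonglongrightarrow> 0))"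

lemma smeas_AE_L2: "smeas T u \<Longrightarrow> AE t in lebesgue_on {0<..<T}. u t \<in> L2 \<Omega>"
  unfolding smeas_def by (auto elim: eventually_mono)

text \<open>A simple function takes finitely many values d, so its pairing with \<open>w\<close>
  reduces to the scalar functions d . w(t); the general pairing is an almost everywhere limit. Of
  \<open>w\<close> only weak measurability is asked.\<close>

lemma smeas_inner:
  assumes u: "smeas T u" and S: "S \<subseteq> {0<..<T}" "S \<in> sets lebesgue"
    and w: "\<And>t. t \<in> S \<Longrightarrow> w t \<in> L2 \<Omega>" "\<And>d :: real^3 \<Rightarrow> real^3. d \<in> L2 \<Omega> \<Longrightarrow> (\<lambda>t. d \<cdot> w t) \<in> borel_measurable (lebesgue_on S)"
  shows "(\<lambda>t. u t \<cdot> w t) \<in> borel_measurable (lebesgue_on S)"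
proof -
  obtain s where s: "\<And>n. simple_function (lebesgue_on {0<..<T}) (s n)" "\<And>n t. t \<in> {0<..<T} \<Longrightarrow> s n t \<in> L2 \<Omega>"
    and lim: "AE t in lebesgue_on {0<..<T}. u t \<in> L2 \<Omega> \<and> (\<lambda>n. nm (\<lambda>x. s n t x - u t x)) \<longlonglongrightarrow> 0"
    using u unfolding smeas_def by blast
  have lim': "AE t in lebesgue_on S. u t \<in> L2 \<Omega> \<and> (\<lambda>n. nm (\<lambda>x. s n t x - u t x)) \<longlonglongrightarrow> 0"
    using lim S unfolding AE_lebesgue_on_iff[OF lebesgue_Ioo] AE_lebesgue_on_iff[OF S(2)]
    by (elim negligible_subset) auto
  show ?thesis
  proof (rule borel_measurable_AE_limit[OF S(2)])
    fix n
    have fin: "finite (s n ` {0<..<T})" using s(1)[of n] by (simp add: simple_function_def)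
    have vs: "s n -` {d} \<inter> {0<..<T} \<in> sets (lebesgue_on {0<..<T})" if "d \<in> s n ` {0<..<T}" for d
      using s(1)[of n] that by (auto simp: simple_function_def)
    have m: "{t \<in> S. s n t = d} \<in> sets (lebesgue_on S)" if d: "d \<in> s n ` {0<..<T}" for d
    proof -
      have "s n -` {d} \<inter> {0<..<T} \<in> sets lebesgue" using vs[OF d] by (auto simp: sets_restrict_space_iff)
      then have "(s n -` {d} \<inter> {0<..<T}) \<inter> S \<in> sets lebesgue" using S(2) by auto
      moreover have "(s n -` {d} \<inter> {0<..<T}) \<inter> S = {t \<in> S. s n t = d}" using S(1) by auto
      ultimately show ?thesis using S(2) by (auto simp: sets_restrict_space_iff)
    qed
    have "(\<lambda>t. \<Sum>d\<in>s n ` {0<..<T}. indicator {t \<in> S. s n t = d} t * (d \<cdot> w t)) \<in> borel_measurable (lebesgue_on S)"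
    proof (intro borel_measurable_sum borel_measurable_times borel_measurable_indicator m w(2))
      fix d assume "d \<in> s n ` {0<..<T}" then show "d \<in> L2 \<Omega>" using s(2) by auto
    qed
    then show "(\<lambda>t. s n t \<cdot> w t) \<in> borel_measurable (lebesgue_on S)"
    proof (rule measurable_cong[THEN iffD1, rotated])
      fix t assume "t \<in> space (lebesgue_on S)"
      then have t: "t \<in> S" "s n t \<in> s n ` {0<..<T}" using S(1) by auto
      have "(\<Sum>d\<in>s n ` {0<..<T}. indicator {t \<in> S. s n t = d} t * (d \<cdot> w t))
          = (\<Sum>d\<in>s n ` {0<..<T}. if d = s n t then d \<cdot> w t else 0)"
        using t(1) by (intro sum.cong refl) (auto simp: indicator_def)
      then show "(\<Sum>d\<in>s n ` {0<..<T}. indicator {t \<in> S. s n t = d} t * (d \<cdot> w t)) = s n t \<cdot> w t"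
        using fin t(2) by simp
    qed
  next
    have "AE t in lebesgue_on S. t \<in> S" by (rule AE_I2) simp
    with lim' show "AE t in lebesgue_on S. (\<lambda>n. s n t \<cdot> w t) \<longlonglongrightarrow> u t \<cdot> w t"
    proof eventually_elim
      case (elim t)
      then show ?case using s(2) w(1) S(1) by (intro ip_tendsto) auto
    qed
  qed
qed

lemma smeas_weak:
  assumes w: "smeas T w" and d: "d \<in> L2 \<Omega>"
  shows "(\<lambda>t. w t \<cdot> d) \<in> borel_measurable (lebesgue_on {0<..<T})"
  by (rule smeas_inner[OF w]) (use d in auto)

lemma smeas_nm:
  assumes w: "smeas T w"
  shows "(\<lambda>t. nm (w t)) \<in> borel_measurable (lebesgue_on {0<..<T})"
proof -
  obtain s where s: "\<And>n. simple_function (lebesgue_on {0<..<T}) (s n)" "\<And>n t. t \<in> {0<..<T} \<Longrightarrow> s n t \<in> L2 \<Omega>"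
    and lim: "AE t in lebesgue_on {0<..<T}. w t \<in> L2 \<Omega> \<and> (\<lambda>n. nm (\<lambda>x. s n t x - w t x)) \<longlonglongrightarrow> 0"
    using w unfolding smeas_def by blast
  show ?thesis
  proof (rule borel_measurable_AE_limit[OF lebesgue_Ioo])
    show "(\<lambda>t. nm (s n t)) \<in> borel_measurable (lebesgue_on {0<..<T})" for n
      by (intro borel_measurable_simple_function simple_function_compose1[OF s(1)])
    have "AE t in lebesgue_on {0<..<T}. t \<in> {0<..<T}" by (rule AE_I2) simp
    with lim show "AE t in lebesgue_on {0<..<T}. (\<lambda>n. nm (s n t)) \<longlonglongrightarrow> nm (w t)"
    proof eventually_elim
      case (elim t)
      then show ?case using s(2) by (intro nm_tendsto) auto
    qed
  qed
qed

lemma bochner_smeas: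
  assumes "bochner_L2 T X N u" "X \<subseteq> L2 \<Omega>" "\<And>f. nm f \<le> N f"
  shows "smeas T u"
proof -
  obtain s where s: "\<And>n. simple_function (lebesgue_on {0<..<T}) (s n)" "\<And>n t. t \<in> {0<..<T} \<Longrightarrow> s n t \<in> X"
    and lim: "AE t in lebesgue_on {0<..<T}. (\<lambda>n. N (\<lambda>x. s n t x - u t x)) \<longlonglongrightarrow> 0"
    and X: "AE t in lebesgue_on {0<..<T}. u t \<in> X"
    using assms(1) unfolding bochner_L2_def by blast
  have "AE t in lebesgue_on {0<..<T}. u t \<in> L2 \<Omega> \<and> (\<lambda>n. nm (\<lambda>x. s n t x - u t x)) \<longlonglongrightarrow> 0"
    using X lim
  proof eventually_elim
    case (elim t)
    have "(\<lambda>n. nm (\<lambda>x. s n t x - u t x)) \<longlonglongrightarrow> 0"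
      by (rule real_tendsto_sandwich[OF always_eventually always_eventually tendsto_const elim(2)]) (auto intro: assms(3))
    then show ?case using elim(1) assms(2) by auto
  qed
  then show ?thesis unfolding smeas_def using s assms(2) by blast
qed

lemma nm_laplacian_le:
  assumes "u \<in> H2 \<Omega>" shows "nm (lap u) \<le> 3 * norm_H2 \<Omega> u"
proof -
  have "nm (lap u) \<le> (\<Sum>i\<in>UNIV. nm (wp i (wp i u)))"
    unfolding weak_laplacian_def by (rule nm_sum) (intro H1_wp_L2 H2_H1 assms)
  also have "\<dots> \<le> (\<Sum>i\<in>(UNIV::3 set). norm_H2 \<Omega> u)"
    by (intro sum_mono order_trans[OF norm_H1_ge(2) norm_H2_ge(2)])
  finally show ?thesis by simp
qed

text \<open>Weak derivatives are selected representatives, so linearity holds only almost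
  everywhere. Second derivatives are still manageable because \<open>weak_partial_cong\<close> lets
  the inner derivative be exchanged for an almost everywhere equal function without changing the
  outer one.\<close>

lemma H2_diff:
  assumes "u \<in> H2 \<Omega>" "w \<in> H2 \<Omega>"
  shows "(\<lambda>x. u x - w x) \<in> H2 \<Omega>"
    "AE x in M. lap (\<lambda>x. u x - w x) x = lap u x - lap w x"
proof -
  note d = H1_diff[OF H2_H1(1)[OF assms(1)] H2_H1(1)[OF assms(2)]]
  note dd = H1_diff[OF H2_H1(2)[OF assms(1)] H2_H1(2)[OF assms(2)]]
  have wpH1: "wp i (\<lambda>x. u x - w x) \<in> H1 \<Omega>" for i
  proof -
    have eq: "AE x in M. wp i u x - wp i w x = wp i (\<lambda>x. u x - w x) x" using d(2)[of i] by auto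
    have "has_weak_partial \<Omega> j (wp i (\<lambda>x. u x - w x)) (wp j (\<lambda>x. wp i u x - wp i w x))" for j
      by (rule has_weak_partial_AE[OF H1_weak[OF dd(1)] eq]) simp
    then show ?thesis
      by (rule H1I[OF L2_AE[OF H1_L2[OF dd(1)] eq] H1_wp_L2[OF dd(1)]])
  qed
  then show "(\<lambda>x. u x - w x) \<in> H2 \<Omega>" using d(1) by (simp add: H2_def)
  have "AE x in M. \<forall>i\<in>UNIV. wp i (wp i (\<lambda>x. u x - w x)) x = wp i (wp i u) x - wp i (wp i w) x"
  proof (rule AE_finite_allI)
    fix i
    show "AE x in M. wp i (wp i (\<lambda>x. u x - w x)) x = wp i (wp i u) x - wp i (wp i w) x"
      unfolding weak_partial_cong[OF d(2)[of i]] by (rule dd(2))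
  qed simp
  then show "AE x in M. lap (\<lambda>x. u x - w x) x = lap u x - lap w x"
    by eventually_elim (simp add: weak_laplacian_def sum_subtractf)
qed

text \<open>\<Delta> is Lipschitz from H^2 to L_2, so it carries simple approximations of
  \<open>u\<close> in the H^2 norm to simple approximations of \<Delta>u in L_2.\<close>

lemma smeas_laplacian:
  assumes "bochner_L2 T X (norm_H2 \<Omega>) u" "X \<subseteq> H2 \<Omega>"
  shows "smeas T (\<lambda>t. lap (u t))"
    "integrable (lebesgue_on {0<..<T}) (\<lambda>t. (nm (lap (u t)))\<^sup>2)"
proof -
  obtain s where s: "\<And>n. simple_function (lebesgue_on {0<..<T}) (s n)" "\<And>n t. t \<in> {0<..<T} \<Longrightarrow> s n t \<in> X"
    and lim: "AE t in lebesgue_on {0<..<T}. (\<lambda>n. norm_H2 \<Omega> (\<lambda>x. s n t x - u t x)) \<longlonglongrightarrow> 0"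
    and X: "AE t in lebesgue_on {0<..<T}. u t \<in> X"
    and int: "integrable (lebesgue_on {0<..<T}) (\<lambda>t. (norm_H2 \<Omega> (u t))\<^sup>2)"
    using assms(1) unfolding bochner_L2_def by blast
  have sH: "s n t \<in> H2 \<Omega>" if "t \<in> {0<..<T}" for n t using s(2)[OF that] assms(2) by blast
  have I: "AE t in lebesgue_on {0<..<T}. t \<in> {0<..<T}" by (rule AE_I2) simp
  have "AE t in lebesgue_on {0<..<T}. lap (u t) \<in> L2 \<Omega> \<and>
      (\<lambda>n. nm (\<lambda>x. lap (s n t) x - lap (u t) x)) \<longlonglongrightarrow> 0"
    using X lim I
  proof eventually_elim
    case (elim t)
    have uH: "u t \<in> H2 \<Omega>" using elim(1) assms(2) by blast
    have le: "nm (\<lambda>x. lap (s n t) x - lap (u t) x) \<le> 3 * norm_H2 \<Omega> (\<lambda>x. s n t x - u t x)" for n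
    proof -
      note hd = H2_diff[OF sH[OF elim(3)] uH, of n]
      have "nm (lap (\<lambda>x. s n t x - u t x)) = nm (\<lambda>x. lap (s n t) x - lap (u t) x)"
        by (rule nm_cong_AE[OF hd(2) laplacian_L2[OF hd(1)]])
      then show ?thesis using nm_laplacian_le[OF hd(1)] by simp
    qed
    have "(\<lambda>n. 3 * norm_H2 \<Omega> (\<lambda>x. s n t x - u t x)) \<longlonglongrightarrow> 3 * 0" by (intro tendsto_mult tendsto_const elim)
    then have l0: "(\<lambda>n. 3 * norm_H2 \<Omega> (\<lambda>x. s n t x - u t x)) \<longlonglongrightarrow> 0" by simp
    have "(\<lambda>n. nm (\<lambda>x. lap (s n t) x - lap (u t) x)) \<longlonglongrightarrow> 0"
      by (rule real_tendsto_sandwich[OF always_eventually always_eventually tendsto_const l0]) (auto intro: le)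
    then show ?case using laplacian_L2[OF uH] by blast
  qed
  moreover have "simple_function (lebesgue_on {0<..<T}) (\<lambda>t. lap (s n t))" for n
    by (rule simple_function_compose1[OF s(1)])
  moreover have "\<forall>n. \<forall>t\<in>{0<..<T}. lap (s n t) \<in> L2 \<Omega>" using laplacian_L2 sH by blast
  ultimately show sm: "smeas T (\<lambda>t. lap (u t))"
    unfolding smeas_def by (intro exI[of _ "\<lambda>n t. lap (s n t)"]) auto
  show "integrable (lebesgue_on {0<..<T}) (\<lambda>t. (nm (lap (u t)))\<^sup>2)"
  proof (rule integrable_dominated)
    show "integrable (lebesgue_on {0<..<T}) (\<lambda>t. 9 * (norm_H2 \<Omega> (u t))\<^sup>2)" using int by simp
    show "(\<lambda>t. (nm (lap (u t)))\<^sup>2) \<in> borel_measurable (lebesgue_on {0<..<T})"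
      by (intro borel_measurable_power smeas_nm sm)
    show "AE t in lebesgue_on {0<..<T}. norm ((nm (lap (u t)))\<^sup>2) \<le> norm (9 * (norm_H2 \<Omega> (u t))\<^sup>2)"
      using X
    proof eventually_elim
      case (elim t)
      then have "nm (lap (u t)) \<le> 3 * norm_H2 \<Omega> (u t)" using nm_laplacian_le assms(2) by blast
      then have "(nm (lap (u t)))\<^sup>2 \<le> (3 * norm_H2 \<Omega> (u t))\<^sup>2" by (intro power_mono) auto
      then show ?case by (simp add: power_mult_distrib)
    qed
  qed
qed

end

section \<open>Paths with square integrable velocity in L_2\<close>

locale L2_path = bounded_open +
  fixes T :: real and v v' :: "real \<Rightarrow> real^3 \<Rightarrow> real^3"
  assumes T: "T > 0"
    and v_L2: "\<And>t. t \<in> {0..T} \<Longrightarrow> v t \<in> L2 \<Omega>"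
    and v'_smeas: "smeas T v'"
    and v'_int: "integrable (lebesgue_on {0<..<T}) (\<lambda>t. (nm (v' t))\<^sup>2)"
    and v_incr: "\<And>s t h. 0 \<le> s \<Longrightarrow> s \<le> t \<Longrightarrow> t \<le> T \<Longrightarrow> h \<in> L2 \<Omega> \<Longrightarrow>
        (\<lambda>x. v t x - v s x) \<cdot> h = (LINT \<tau>|lebesgue_on {s..t}. v' \<tau> \<cdot> h)"
begin

lemma integrable_ip_bound:
  assumes u: "smeas T u" "integrable (lebesgue_on {0<..<T}) (\<lambda>t. (nm (u t))\<^sup>2)"
    and m: "(\<lambda>t. u t \<cdot> w t) \<in> borel_measurable (lebesgue_on {0<..<T})"
    and w: "AE t in lebesgue_on {0<..<T}. w t \<in> L2 \<Omega> \<and> nm (w t) \<le> k t" "integrable (lebesgue_on {0<..<T}) (\<lambda>t. (k t)\<^sup>2)"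
  shows "integrable (lebesgue_on {0..T}) (\<lambda>t. u t \<cdot> w t)"
  unfolding Ioo_Icc_integrable[symmetric]
proof (rule integrable_dominated[OF _ m])
  show "integrable (lebesgue_on {0<..<T}) (\<lambda>t. (nm (u t))\<^sup>2 + (k t)\<^sup>2)" using u w by simp
  show "AE t in lebesgue_on {0<..<T}. norm (u t \<cdot> w t) \<le> norm ((nm (u t))\<^sup>2 + (k t)\<^sup>2)"
    using smeas_AE_L2[OF u(1)] w(1)
  proof eventually_elim
    case (elim t)
    have "\<bar>u t \<cdot> w t\<bar> \<le> nm (u t) * nm (w t)" using elim by (intro ip_bound) auto
    also have "\<dots> \<le> nm (u t) * k t" using elim by (intro mult_left_mono) auto
    also have "\<dots> \<le> (nm (u t))\<^sup>2 + (k t)\<^sup>2"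
    proof -
      have "0 \<le> k t" using elim nm_nonneg[of "w t"] by linarith
      then have "0 \<le> nm (u t) * k t" by (intro mult_nonneg_nonneg) auto
      then show ?thesis using sum_squares_bound[of "nm (u t)" "k t"] by linarith
    qed
    finally show ?case by simp
  qed
qed

lemma v'_weak_int: "h \<in> L2 \<Omega> \<Longrightarrow> integrable (lebesgue_on {0..T}) (\<lambda>t. v' t \<cdot> h)"
  by (rule integrable_ip_bound[OF v'_smeas v'_int smeas_weak[OF v'_smeas], of h "\<lambda>t. nm h"])
    (auto simp: Ioo_Icc_integrable intro!: continuous_integrable_Icc)

lemma v_weak_ac:
  assumes h: "h \<in> L2 \<Omega>" shows "ac_on 0 T (\<lambda>t. v t \<cdot> h) (\<lambda>t. v' t \<cdot> h)"
  unfolding ac_on_def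
proof (intro conjI allI impI v'_weak_int h)
  fix s t assume st: "0 \<le> s" "s \<le> t" "t \<le> T"
  have "v t \<cdot> h - v s \<cdot> h = (\<lambda>x. v t x - v s x) \<cdot> h" using st h by (simp add: ip_diff_left v_L2)
  also have "\<dots> = integral {s..t} (\<lambda>t. v' t \<cdot> h)"
    using v_incr[OF st h] subinterval_integrable(3)[OF v'_weak_int[OF h] st(1,3)] by simp
  finally show "v t \<cdot> h - v s \<cdot> h = integral {s..t} (\<lambda>t. v' t \<cdot> h)" .
qed

definition g where "g t = (nm (v' t))\<^sup>2"
definition G where "G t = integral {0..t} g"

lemma g_int: "integrable (lebesgue_on {0..T}) g"
  using v'_int unfolding Ioo_Icc_integrable g_def .

lemma G_ac: "ac_on 0 T G g"
  unfolding ac_on_def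
proof (intro conjI allI impI g_int)
  fix s t assume st: "0 \<le> s" "s \<le> t" "t \<le> T"
  have "integral {0..s} g + integral {s..t} g = integral {0..t} g"
    by (rule HK_combine[OF st(1,2) subinterval_integrable(1)[OF g_int]]) (use st in auto)
  then show "G t - G s = integral {s..t} g" by (simp add: G_def)
qed

lemma G_mono: "0 \<le> s \<Longrightarrow> s \<le> t \<Longrightarrow> t \<le> T \<Longrightarrow> G s \<le> G t"
  using ac_onD(2)[OF G_ac, of s t] Henstock_Kurzweil_Integration.integral_nonneg[OF ac_onD(3)[OF G_ac, of s t]]
  by (simp add: g_def)

text \<open>What is known are the pairings of the increment w = v(t) - v(s) with fixed fields.
  Pairing with w itself and integrating Young's inequality 2 |v'| |w| \<le> (t - s) |v'|^2 + |w|^2 /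
  (t - s) over [s, t] leaves one |w|^2 on the right, which is absorbed.\<close>

lemma v_incr_norm:
  assumes st: "0 \<le> s" "s \<le> t" "t \<le> T"
  shows "(nm (\<lambda>x. v t x - v s x))\<^sup>2 \<le> (t - s) * (G t - G s)"
proof (cases "s = t")
  case True
  then show ?thesis by (simp add: norm_L2_def)
next
  case False
  then have d: "t - s > 0" using st by simp
  define w where "w x = v t x - v s x" for x
  have w: "w \<in> L2 \<Omega>" unfolding w_def using st by (intro L2_diff v_L2) auto
  obtain Z where Z: "negligible Z" "\<And>r. r \<in> {0<..<T} - Z \<Longrightarrow> v' r \<in> L2 \<Omega>"
    using smeas_AE_L2[OF v'_smeas] unfolding AE_Ioo_iff by blast
  have iw: "(\<lambda>r. v' r \<cdot> w) integrable_on {s..t}" by (rule subinterval_integrable(1)[OF v'_weak_int[OF w] st(1,3)])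
  have ig: "g integrable_on {s..t}" by (rule subinterval_integrable(1)[OF g_int st(1,3)])
  have "2 * (nm w)\<^sup>2 = integral {s..t} (\<lambda>r. 2 * (v' r \<cdot> w))"
    using v_incr[OF st w] subinterval_integrable(3)[OF v'_weak_int[OF w] st(1,3)]
    by (simp add: nm_sq w_def[symmetric] iw)
  also have "\<dots> \<le> integral {s..t} (\<lambda>r. (t - s) * g r + (nm w)\<^sup>2 / (t - s))"
  proof (rule integral_le_AE[OF _ _ Z(1)])
    show "(\<lambda>r. 2 * (v' r \<cdot> w)) integrable_on {s..t}" using iw by (rule integrable_on_mult_right)
    show "(\<lambda>r. (t - s) * g r + (nm w)\<^sup>2 / (t - s)) integrable_on {s..t}"
      by (intro integrable_add integrable_on_mult_right ig integrable_const_ivl)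
    fix r assume "r \<in> {s<..<t} - Z"
    then have "v' r \<in> L2 \<Omega>" using st by (intro Z) auto
    then have "v' r \<cdot> w \<le> nm (v' r) * nm w" using ip_bound[OF _ w, of "v' r"] by linarith
    moreover have "2 * (nm (v' r) * nm w) \<le> (t - s) * g r + (nm w)\<^sup>2 / (t - s)"
    proof -
      have "0 \<le> ((t - s) * nm (v' r) - nm w)\<^sup>2 / (t - s)" using d by simp
      also have "\<dots> = (t - s) * g r - 2 * (nm (v' r) * nm w) + (nm w)\<^sup>2 / (t - s)"
        using d by (simp add: g_def power2_eq_square field_simps)
      finally show ?thesis by simp
    qed
    ultimately show "2 * (v' r \<cdot> w) \<le> (t - s) * g r + (nm w)\<^sup>2 / (t - s)" by linarith
  qed
  also have "\<dots> = (t - s) * (G t - G s) + (nm w)\<^sup>2"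
    using d ac_onD(2)[OF G_ac st] by (subst Henstock_Kurzweil_Integration.integral_add) (auto intro: integrable_on_mult_right ig)
  finally show ?thesis unfolding w_def[symmetric] by simp
qed

lemma v_incr_norm':
  assumes "s \<in> {0..T}" "t \<in> {0..T}"
  shows "(nm (\<lambda>x. v t x - v s x))\<^sup>2 \<le> \<bar>t - s\<bar> * \<bar>G t - G s\<bar>"
proof (cases "s \<le> t")
  case True
  then show ?thesis using v_incr_norm[of s t] G_mono[of s t] assms by simp
next
  case False
  then have e: "\<bar>t - s\<bar> = s - t" "\<bar>G t - G s\<bar> = G s - G t" using G_mono[of t s] assms by auto
  show ?thesis unfolding e nm_commute[of "v t" "v s"] using v_incr_norm[of t s] False assms by simp
qed

lemma v_weak_continuous: "h \<in> L2 \<Omega> \<Longrightarrow> continuous_on {0..T} (\<lambda>t. v t \<cdot> h)"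
  by (rule ac_on_continuous[OF v_weak_ac])

lemma v_uniform:
  assumes "e > 0"
  obtains \<delta> where "\<delta> > 0" "\<And>s t. s \<in> {0..T} \<Longrightarrow> t \<in> {0..T} \<Longrightarrow> \<bar>t - s\<bar> < \<delta> \<Longrightarrow> nm (\<lambda>x. v t x - v s x) < e"
proof -
  have G0: "G T \<ge> 0" using G_mono[of 0 T] T by (simp add: G_def)
  \<comment> \<open>From |v(t) - v(s)|^2 \<le> |t - s| G(T); the \<open>+ 1\<close> avoids division
    by zero.\<close>
  define \<delta> where "\<delta> = e\<^sup>2 / (G T + 1)"
  have "\<delta> > 0" using assms G0 by (simp add: \<delta>_def)
  moreover have "nm (\<lambda>x. v t x - v s x) < e" if st: "s \<in> {0..T}" "t \<in> {0..T}" "\<bar>t - s\<bar> < \<delta>" for s t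
  proof (rule power2_less_imp_less)
    have "\<bar>G t - G s\<bar> \<le> G T"
      using G_mono[of 0 s] G_mono[of s T] G_mono[of 0 t] G_mono[of t T] st by (auto simp: G_def)
    then have "\<bar>t - s\<bar> * \<bar>G t - G s\<bar> \<le> \<bar>t - s\<bar> * (G T + 1)" by (intro mult_left_mono) auto
    also have "\<dots> < \<delta> * (G T + 1)" using st(3) G0 by (intro mult_strict_right_mono) auto
    also have "\<dots> = e\<^sup>2" using G0 by (simp add: \<delta>_def)
    finally show "(nm (\<lambda>x. v t x - v s x))\<^sup>2 < e\<^sup>2" using v_incr_norm'[OF st(1,2)] by linarith
  qed (use assms in simp)
  ultimately show thesis by (rule that)
qed

lemma v_bounded: obtains C where "\<And>t. t \<in> {0..T} \<Longrightarrow> nm (v t) \<le> C"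
proof -
  have "nm (v t) \<le> nm (v 0) + sqrt (T * G T)" if t: "t \<in> {0..T}" for t
  proof -
    have "(nm (\<lambda>x. v t x - v 0 x))\<^sup>2 \<le> t * G t" using v_incr_norm[of 0 t] t by (simp add: G_def)
    also have "\<dots> \<le> T * G T" using t G_mono[of t T] G_mono[of 0 t] by (intro mult_mono) (auto simp: G_def)
    finally have "nm (\<lambda>x. v t x - v 0 x) \<le> sqrt (T * G T)" by (rule real_le_rsqrt)
    moreover have "nm (v t) \<le> nm (v 0) + nm (\<lambda>x. v t x - v 0 x)" using t T by (intro nm_triangle v_L2) auto
    ultimately show ?thesis by linarith
  qed
  then show thesis by (rule that)
qed

lemma nm_v'_int: "integrable (lebesgue_on {0..T}) (\<lambda>t. nm (v' t))"
  unfolding Ioo_Icc_integrable[symmetric]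
proof (rule integrable_dominated[OF _ smeas_nm[OF v'_smeas]])
  show "integrable (lebesgue_on {0<..<T}) (\<lambda>t. 1 + (nm (v' t))\<^sup>2)"
    using v'_int by (auto simp: Ioo_Icc_integrable intro!: continuous_integrable_Icc)
  show "AE t in lebesgue_on {0<..<T}. norm (nm (v' t)) \<le> norm (1 + (nm (v' t))\<^sup>2)"
  proof (rule AE_I2)
    fix t
    have "nm (v' t) \<le> 1 + (nm (v' t))\<^sup>2" using sum_squares_bound[of "nm (v' t)" 1] nm_nonneg[of "v' t"] by (simp del: nm_nonneg)
    then show "norm (nm (v' t)) \<le> norm (1 + (nm (v' t))\<^sup>2)" by simp
  qed
qed

text \<open>\<open>ac_on_bilinear\<close> covers finite-dimensional values; here the path is
  differentiated only after pairing with a fixed field. By symmetry of \<open>P\<close> the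
  increment is the pairing of v(t) - v(s) with the two fixed fields P v(t) and P v(s), and uniform
  continuity of v in L_2 makes the deviation from 2 (v' | P v) acceptable to
  \<open>ac_on_approx\<close>.\<close>

lemma quadratic_ac:
  assumes P: "\<And>w. w \<in> L2 \<Omega> \<Longrightarrow> P w \<in> L2 \<Omega>" "\<And>u w. u \<in> L2 \<Omega> \<Longrightarrow> w \<in> L2 \<Omega> \<Longrightarrow> u \<cdot> P w = P u \<cdot> w"
    and K: "K \<ge> 0" "\<And>u. u \<in> L2 \<Omega> \<Longrightarrow> nm (P u) \<le> K * nm u"
  shows "ac_on 0 T (\<lambda>t. v t \<cdot> P (v t)) (\<lambda>t. 2 * (v' t \<cdot> P (v t)))"
proof (rule ac_on_approx[where g="\<lambda>t. nm (v' t)"])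
  obtain Z where Z: "negligible Z" "\<And>q. q \<in> {0<..<T} - Z \<Longrightarrow> v' q \<in> L2 \<Omega>"
    using smeas_AE_L2[OF v'_smeas] unfolding AE_Ioo_iff by blast
  obtain C where C: "\<And>t. t \<in> {0..T} \<Longrightarrow> nm (v t) \<le> C" by (rule v_bounded) (rule that)
  have m: "(\<lambda>t. v' t \<cdot> P (v t)) \<in> borel_measurable (lebesgue_on {0<..<T})"
  proof (rule smeas_inner[OF v'_smeas subset_refl lebesgue_Ioo])
    show "P (v t) \<in> L2 \<Omega>" if "t \<in> {0<..<T}" for t using that by (intro P v_L2) auto
    fix d :: "real^3 \<Rightarrow> real^3" assume d: "d \<in> L2 \<Omega>"
    have "integrable (lebesgue_on {0<..<T}) (\<lambda>t. v t \<cdot> P d)"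
      unfolding Ioo_Icc_integrable by (intro continuous_integrable_Icc v_weak_continuous P d)
    then have "(\<lambda>t. v t \<cdot> P d) \<in> borel_measurable (lebesgue_on {0<..<T})" by (rule borel_measurable_integrable)
    then show "(\<lambda>t. d \<cdot> P (v t)) \<in> borel_measurable (lebesgue_on {0<..<T})"
      by (rule measurable_cong[THEN iffD1, rotated]) (use d in \<open>auto simp: P(2) v_L2 ip_commute[of d]\<close>)
  qed
  have i: "integrable (lebesgue_on {0..T}) (\<lambda>t. v' t \<cdot> P (v t))"
  proof (rule integrable_ip_bound[OF v'_smeas v'_int m, of "\<lambda>t. K * C"])
    show "AE t in lebesgue_on {0<..<T}. P (v t) \<in> L2 \<Omega> \<and> nm (P (v t)) \<le> K * C"
    proof (rule AE_I2)
      fix t assume "t \<in> space (lebesgue_on {0<..<T})"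
      then have t: "t \<in> {0..T}" by simp
      show "P (v t) \<in> L2 \<Omega> \<and> nm (P (v t)) \<le> K * C"
        using order_trans[OF K(2)[OF v_L2[OF t]] mult_left_mono[OF C[OF t] K(1)]] P(1)[OF v_L2[OF t]] by blast
    qed
    show "integrable (lebesgue_on {0<..<T}) (\<lambda>t. (K * C)\<^sup>2)"
      unfolding Ioo_Icc_integrable by (intro continuous_integrable_Icc continuous_intros)
  qed
  then show i2: "integrable (lebesgue_on {0..T}) (\<lambda>t. 2 * (v' t \<cdot> P (v t)))" by simp
  show "integrable (lebesgue_on {0..T}) (\<lambda>t. nm (v' t))" by (rule nm_v'_int)
  fix e :: real assume "e > 0"
  \<comment> \<open>Two deviations, each weighted by \<open>K\<close>, must add up to at most
    \<open>e\<close>; \<open>K + 1\<close> avoids division by zero.\<close>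
  then have eK: "e / (2 * (K + 1)) > 0" using K(1) by simp
  obtain k where k: "k > 0" "\<And>s t. s \<in> {0..T} \<Longrightarrow> t \<in> {0..T} \<Longrightarrow> \<bar>t - s\<bar> < k \<Longrightarrow> nm (\<lambda>x. v t x - v s x) < e / (2 * (K + 1))"
    using v_uniform[OF eK] by blast
  show "\<exists>k>0. \<forall>s t. 0 \<le> s \<longrightarrow> s \<le> t \<longrightarrow> t \<le> T \<longrightarrow> t - s < k \<longrightarrow>
      norm (v t \<cdot> P (v t) - v s \<cdot> P (v s) - integral {s..t} (\<lambda>t. 2 * (v' t \<cdot> P (v t)))) \<le> e * integral {s..t} (\<lambda>t. nm (v' t))"
  proof (intro exI[of _ k] conjI allI impI k(1))
    fix s t assume st: "0 \<le> s" "s \<le> t" "t \<le> T" "t - s < k"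
    have vs: "v s \<in> L2 \<Omega>" "v t \<in> L2 \<Omega>" using st by (auto intro: v_L2)
    note Pv = P(1)[OF vs(1)] P(1)[OF vs(2)]
    have "v t \<cdot> P (v t) - v s \<cdot> P (v s) = (v t \<cdot> P (v t) - v s \<cdot> P (v t)) + (v t \<cdot> P (v s) - v s \<cdot> P (v s))"
      using P(2)[OF vs(1) vs(2)] by (simp add: ip_commute)
    also have "\<dots> = integral {s..t} (\<lambda>q. v' q \<cdot> P (v t)) + integral {s..t} (\<lambda>q. v' q \<cdot> P (v s))"
      using ac_onD(2)[OF v_weak_ac[OF Pv(2)] st(1-3)] ac_onD(2)[OF v_weak_ac[OF Pv(1)] st(1-3)] by simp
    also have "\<dots> = integral {s..t} (\<lambda>q. v' q \<cdot> P (v t) + v' q \<cdot> P (v s))"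
      using ac_onD(3)[OF v_weak_ac[OF Pv(2)] st(1,3)] ac_onD(3)[OF v_weak_ac[OF Pv(1)] st(1,3)]
      by (rule Henstock_Kurzweil_Integration.integral_add[symmetric])
    finally have "v t \<cdot> P (v t) - v s \<cdot> P (v s) - integral {s..t} (\<lambda>t. 2 * (v' t \<cdot> P (v t)))
        = integral {s..t} (\<lambda>q. v' q \<cdot> P (v t) + v' q \<cdot> P (v s) - 2 * (v' q \<cdot> P (v q)))"
      using integrable_add[OF ac_onD(3)[OF v_weak_ac[OF Pv(2)] st(1,3)] ac_onD(3)[OF v_weak_ac[OF Pv(1)] st(1,3)]]
        subinterval_integrable(1)[OF i2 st(1,3)]
      by (simp only: HK_diff)
    also have "norm \<dots> \<le> integral {s..t} (\<lambda>q. e * nm (v' q))"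
    proof -
      let ?f = "\<lambda>q. v' q \<cdot> P (v t) + v' q \<cdot> P (v s) - 2 * (v' q \<cdot> P (v q))"
      have fi: "?f integrable_on {s..t}"
        by (intro integrable_diff integrable_add ac_onD(3)[OF v_weak_ac[OF Pv(2)] st(1,3)] ac_onD(3)[OF v_weak_ac[OF Pv(1)] st(1,3)]
            subinterval_integrable(1)[OF i2 st(1,3)])
      have ri: "(\<lambda>q. e * nm (v' q)) integrable_on {s..t}"
        by (intro integrable_on_mult_right subinterval_integrable(1)[OF nm_v'_int st(1,3)])
      have b: "\<bar>?f q\<bar> \<le> e * nm (v' q)" if q: "q \<in> {s<..<t} - Z" for q
      proof -
        have v'L: "v' q \<in> L2 \<Omega>" using q st by (intro Z) auto
        have vt0: "v q \<in> L2 \<Omega>" using q st by (intro v_L2) auto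
        have each: "\<bar>v' q \<cdot> P (v r) - v' q \<cdot> P (v q)\<bar> \<le> K * nm (v' q) * (e / (2 * (K + 1)))" if r: "r \<in> {s, t}" for r
        proof -
          have vr: "v r \<in> L2 \<Omega>" using r vs by auto
          have "v' q \<cdot> P (v r) - v' q \<cdot> P (v q) = P (v' q) \<cdot> (\<lambda>x. v r x - v q x)"
            by (simp add: P(2)[OF v'L vr] P(2)[OF v'L vt0] ip_diff_right[OF vr vt0 P(1)[OF v'L]])
          also have "\<bar>\<dots>\<bar> \<le> nm (P (v' q)) * nm (\<lambda>x. v r x - v q x)"
            by (intro ip_bound P v'L L2_diff vr vt0)
          also have "\<dots> \<le> (K * nm (v' q)) * (e / (2 * (K + 1)))"
            using k(2)[of q r] q st r K(1) by (intro mult_mono K(2) v'L) (auto intro!: less_imp_le mult_nonneg_nonneg)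
          finally show ?thesis .
        qed
        have "?f q = (v' q \<cdot> P (v t) - v' q \<cdot> P (v q)) + (v' q \<cdot> P (v s) - v' q \<cdot> P (v q))" by simp
        also have "\<bar>\<dots>\<bar> \<le> 2 * (K * nm (v' q) * (e / (2 * (K + 1))))" using each[of t] each[of s] by auto
        also have "\<dots> = (K / (K + 1)) * (e * nm (v' q))" using K(1) by (simp add: field_simps)
        also have "\<dots> \<le> 1 * (e * nm (v' q))" using K(1) \<open>e > 0\<close> by (intro mult_right_mono) auto
        finally show ?thesis by simp
      qed
      have "integral {s..t} ?f \<le> integral {s..t} (\<lambda>q. e * nm (v' q))"
        by (rule integral_le_AE[OF fi ri Z(1)]) (use b in \<open>force simp: abs_le_iff\<close>)
      moreover have "integral {s..t} (\<lambda>q. - ?f q) \<le> integral {s..t} (\<lambda>q. e * nm (v' q))"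
        by (rule integral_le_AE[OF integrable_neg[OF fi] ri Z(1)]) (use b in \<open>force simp: abs_le_iff\<close>)
      ultimately show ?thesis
        unfolding Henstock_Kurzweil_Integration.integral_neg real_norm_def abs_le_iff by simp
    qed
    finally show "norm (v t \<cdot> P (v t) - v s \<cdot> P (v s) - integral {s..t} (\<lambda>t. 2 * (v' t \<cdot> P (v t)))) \<le> e * integral {s..t} (\<lambda>t. nm (v' t))"
      by simp
  qed
qed

end

section \<open>Difference quotients against time-dependent fields\<close>

lemma tendsto_uniform_approx:
  fixes q :: "real \<Rightarrow> real"
  assumes e: "e \<longlonglongrightarrow> (0::real)" and C: "C \<ge> 0"
    and q: "\<And>n. \<forall>\<^sub>F h in F. \<bar>q h - qn n h\<bar> \<le> C * e n"
    and qn: "\<And>n. (qn n \<longlongrightarrow> l n) F" and l: "\<And>n. \<bar>l n - l0\<bar> \<le> C * e n"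
  shows "(q \<longlongrightarrow> l0) F"
  unfolding tendsto_iff
proof (intro allI impI)
  fix \<eta> :: real assume \<eta>: "\<eta> > 0"
  have "(\<lambda>n. C * e n) \<longlonglongrightarrow> C * 0" by (intro tendsto_mult tendsto_const e)
  then have "\<forall>\<^sub>F n in sequentially. C * e n < \<eta> / 3" using \<eta> by (intro order_tendstoD) auto
  then obtain n where n: "C * e n < \<eta> / 3" unfolding eventually_sequentially by blast
  have "\<forall>\<^sub>F h in F. dist (qn n h) (l n) < \<eta> / 3" by (rule tendstoD[OF qn]) (use \<eta> in simp)
  with q[of n] show "\<forall>\<^sub>F h in F. dist (q h) l0 < \<eta>"
  proof eventually_elim
    case (elim h)
    then show ?case using n l[of n] unfolding dist_real_def by linarith
  qed
qed

context L2_path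
begin

text \<open>For a fixed field the limit holds outside a null set that depends on the field, whereas
  here the field f(r) changes with r. The simple approximations of \<open>f\<close> take only
  countably many values, whose exceptional sets can be united; a bound on the quotients of v at
  Lebesgue points of |v'|^2 then carries the limit over to f(r).\<close>

lemma weak_difference_quotient:
  assumes f: "smeas T f"
  obtains Z where "negligible Z"
    "\<And>r. r \<in> {0<..<T} - Z \<Longrightarrow> ((\<lambda>h. (f r \<cdot> v (r + h) - f r \<cdot> v r) / h) \<longlongrightarrow> f r \<cdot> v' r) (at_right 0)"
    "\<And>r. r \<in> {0<..<T} - Z \<Longrightarrow> ((\<lambda>h. (f r \<cdot> v r - f r \<cdot> v (r - h)) / h) \<longlongrightarrow> f r \<cdot> v' r) (at_right 0)"
proof -
  obtain s where s: "\<And>n. simple_function (lebesgue_on {0<..<T}) (s n)" "\<And>n t. t \<in> {0<..<T} \<Longrightarrow> s n t \<in> L2 \<Omega>"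
    and lim: "AE t in lebesgue_on {0<..<T}. f t \<in> L2 \<Omega> \<and> (\<lambda>n. nm (\<lambda>x. s n t x - f t x)) \<longlonglongrightarrow> 0"
    using f unfolding smeas_def by blast
  define D where "D = (\<Union>n. s n ` {0<..<T})"
  have "finite (s n ` {0<..<T})" for n using s(1)[of n] by (simp add: simple_function_def)
  then have Dc: "countable D" unfolding D_def by (intro countable_UN countableI_type countable_finite)
  have DL: "d \<in> L2 \<Omega>" if "d \<in> D" for d using that s(2) by (auto simp: D_def)
  define good where "good d Z \<longleftrightarrow> negligible Z \<and> (\<forall>t\<in>{0<..<T} - Z. ((\<lambda>h. integral {t..t + h} (\<lambda>r. v' r \<cdot> d) / h) \<longlongrightarrow> v' t \<cdot> d) (at_right 0) \<and>
      ((\<lambda>h. integral {t - h..t} (\<lambda>r. v' r \<cdot> d) / h) \<longlongrightarrow> v' t \<cdot> d) (at_right 0))" for d Z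
  define Zd where "Zd d = (SOME Z. good d Z)" for d
  have "good d (Zd d)" if d: "d \<in> D" for d
  proof -
    obtain Z where "good d Z" unfolding good_def
      by (rule lebesgue_differentiation[OF v'_weak_int[OF DL[OF d]]]) blast
    then show ?thesis unfolding Zd_def by (rule someI)
  qed
  then have Zd: "\<And>d. d \<in> D \<Longrightarrow> negligible (Zd d)"
    "\<And>d t. d \<in> D \<Longrightarrow> t \<in> {0<..<T} - Zd d \<Longrightarrow> ((\<lambda>h. integral {t..t + h} (\<lambda>r. v' r \<cdot> d) / h) \<longlongrightarrow> v' t \<cdot> d) (at_right 0)"
    "\<And>d t. d \<in> D \<Longrightarrow> t \<in> {0<..<T} - Zd d \<Longrightarrow> ((\<lambda>h. integral {t - h..t} (\<lambda>r. v' r \<cdot> d) / h) \<longlongrightarrow> v' t \<cdot> d) (at_right 0)"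
    unfolding good_def by (simp_all del: Diff_iff greaterThanLessThan_iff)
  obtain Zg where Zg: "negligible Zg"
    "\<And>t. t \<in> {0<..<T} - Zg \<Longrightarrow> ((\<lambda>h. integral {t..t + h} g / h) \<longlongrightarrow> g t) (at_right 0)"
    "\<And>t. t \<in> {0<..<T} - Zg \<Longrightarrow> ((\<lambda>h. integral {t - h..t} g / h) \<longlongrightarrow> g t) (at_right 0)"
    by (rule lebesgue_differentiation[OF g_int]) (rule that)
  obtain Z1 where Z1: "negligible Z1" "\<And>t. t \<in> {0<..<T} - Z1 \<Longrightarrow> f t \<in> L2 \<Omega> \<and> (\<lambda>n. nm (\<lambda>x. s n t x - f t x)) \<longlonglongrightarrow> 0"
    using lim unfolding AE_Ioo_iff by blast
  obtain Z2 where Z2: "negligible Z2" "\<And>r. r \<in> {0<..<T} - Z2 \<Longrightarrow> v' r \<in> L2 \<Omega>"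
    using smeas_AE_L2[OF v'_smeas] unfolding AE_Ioo_iff by blast
  let ?Z = "Z1 \<union> Z2 \<union> Zg \<union> \<Union>(Zd ` D)"
  have nZ: "negligible ?Z"
    using Dc Zd(1) by (intro negligible_Un Z1 Z2 Zg negligible_countable_Union) auto
  show thesis
  proof (rule that[OF nZ])
    fix r assume r: "r \<in> {0<..<T} - ?Z"
    have fL: "f r \<in> L2 \<Omega>" and e: "(\<lambda>n. nm (\<lambda>x. s n r x - f r x)) \<longlonglongrightarrow> 0" using Z1(2)[of r] r by auto
    have v'L: "v' r \<in> L2 \<Omega>" using Z2(2)[of r] r by auto
    have vt0: "v r \<in> L2 \<Omega>" using r by (intro v_L2) auto
    have sD: "s n r \<in> D" for n unfolding D_def by (rule UN_I[of n]) (use r in auto)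
    \<comment> \<open>Bounds |v'(r)| and, because averages of \<open>g\<close> near r are eventually
      below \<open>g r + 1\<close>, also the difference quotients of v at r for small h
      (\<open>v_incr_norm\<close>).\<close>
    define C where "C = sqrt (g r + 1)"
    have C: "C \<ge> 0" "nm (v' r) \<le> C" by (auto simp: C_def g_def real_le_rsqrt)
    have l: "\<bar>s n r \<cdot> v' r - f r \<cdot> v' r\<bar> \<le> C * nm (\<lambda>x. s n r x - f r x)" for n
    proof -
      have "\<bar>s n r \<cdot> v' r - f r \<cdot> v' r\<bar> \<le> nm (\<lambda>x. s n r x - f r x) * nm (v' r)"
        using ip_bound[OF L2_diff[OF DL[OF sD] fL] v'L, of n] by (simp add: ip_diff_left[OF DL[OF sD] fL v'L])
      also have "\<dots> \<le> nm (\<lambda>x. s n r x - f r x) * C" using C by (intro mult_left_mono) auto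
      finally show ?thesis by (simp add: mult.commute)
    qed
    have q: "\<bar>(f r \<cdot> w - f r \<cdot> v r) / h - (s n r \<cdot> w - s n r \<cdot> v r) / h\<bar> \<le> C * nm (\<lambda>x. s n r x - f r x)"
      if w: "w \<in> L2 \<Omega>" and h: "h > 0" and b: "(nm (\<lambda>x. w x - v r x))\<^sup>2 \<le> h\<^sup>2 * (g r + 1)" for w h n
    proof -
      have "nm (\<lambda>x. w x - v r x) \<le> sqrt (h\<^sup>2 * (g r + 1))" using b by (rule real_le_rsqrt)
      then have nb: "nm (\<lambda>x. w x - v r x) \<le> h * C" using h by (simp add: real_sqrt_mult C_def)
      have "(f r \<cdot> w - f r \<cdot> v r) / h - (s n r \<cdot> w - s n r \<cdot> v r) / h = - ((\<lambda>x. s n r x - f r x) \<cdot> (\<lambda>x. w x - v r x)) / h"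
        by (simp add: ip_diff_left[OF DL[OF sD] fL L2_diff[OF w vt0]] ip_diff_right[OF w vt0 fL] ip_diff_right[OF w vt0 DL[OF sD]]
            diff_divide_distrib[symmetric])
      also have "\<bar>\<dots>\<bar> \<le> (nm (\<lambda>x. s n r x - f r x) * nm (\<lambda>x. w x - v r x)) / h"
        using ip_bound[OF L2_diff[OF DL[OF sD] fL] L2_diff[OF w vt0], of n] h by (simp add: divide_right_mono)
      also have "\<dots> \<le> (nm (\<lambda>x. s n r x - f r x) * (h * C)) / h"
        using nb h by (intro divide_right_mono mult_left_mono) auto
      also have "\<dots> = C * nm (\<lambda>x. s n r x - f r x)" using h by simp
      finally show ?thesis .
    qed
    have small: "\<forall>\<^sub>F h in at_right 0. 0 < h \<and> 0 \<le> r - h \<and> r + h \<le> T"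
      using r unfolding eventually_at_right_field by (intro exI[of _ "min r (T - r)"]) auto
    have gR: "\<forall>\<^sub>F h in at_right 0. integral {r..r + h} g / h < g r + 1" "\<forall>\<^sub>F h in at_right 0. integral {r - h..r} g / h < g r + 1"
      using Zg(2,3)[of r] r by (auto intro!: order_tendstoD(2))
    show "((\<lambda>h. (f r \<cdot> v (r + h) - f r \<cdot> v r) / h) \<longlongrightarrow> f r \<cdot> v' r) (at_right 0)"
    proof (rule tendsto_uniform_approx[OF e C(1) _ _ l])
      fix n
      show "\<forall>\<^sub>F h in at_right 0. \<bar>(f r \<cdot> v (r + h) - f r \<cdot> v r) / h - (s n r \<cdot> v (r + h) - s n r \<cdot> v r) / h\<bar> \<le> C * nm (\<lambda>x. s n r x - f r x)"
        using small gR(1)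
      proof eventually_elim
        case (elim h)
        have b: "0 \<le> r" "r \<le> r + h" "r + h \<le> T" using elim r by auto
        have "(nm (\<lambda>x. v (r + h) x - v r x))\<^sup>2 \<le> h * integral {r..r + h} g"
          using v_incr_norm[OF b] ac_onD(2)[OF G_ac b] by simp
        also have "\<dots> = h\<^sup>2 * (integral {r..r + h} g / h)" using elim by (simp add: power2_eq_square)
        also have "\<dots> \<le> h\<^sup>2 * (g r + 1)" using elim by (intro mult_left_mono) auto
        finally show ?case using elim b by (intro q v_L2) auto
      qed
      have "\<forall>\<^sub>F h in at_right 0. integral {r..r + h} (\<lambda>z. v' z \<cdot> s n r) / h = (s n r \<cdot> v (r + h) - s n r \<cdot> v r) / h"
        using small
      proof eventually_elim
        case (elim h)
        then show ?case using ac_onD(2)[OF v_weak_ac[OF DL[OF sD[of n]]], of r "r + h"] r by (simp add: ip_commute[of "s n r"])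
      qed
      moreover have "((\<lambda>h. integral {r..r + h} (\<lambda>z. v' z \<cdot> s n r) / h) \<longlongrightarrow> s n r \<cdot> v' r) (at_right 0)"
        using Zd(2)[OF sD[of n], of r] r sD[of n] by (simp add: ip_commute[of "s n r"])
      ultimately show "((\<lambda>h. (s n r \<cdot> v (r + h) - s n r \<cdot> v r) / h) \<longlongrightarrow> s n r \<cdot> v' r) (at_right 0)"
        by (rule Lim_transform_eventually[rotated])
    qed
    show "((\<lambda>h. (f r \<cdot> v r - f r \<cdot> v (r - h)) / h) \<longlongrightarrow> f r \<cdot> v' r) (at_right 0)"
    proof (rule tendsto_uniform_approx[OF e C(1) _ _ l])
      fix n
      show "\<forall>\<^sub>F h in at_right 0. \<bar>(f r \<cdot> v r - f r \<cdot> v (r - h)) / h - (s n r \<cdot> v r - s n r \<cdot> v (r - h)) / h\<bar> \<le> C * nm (\<lambda>x. s n r x - f r x)"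
        using small gR(2)
      proof eventually_elim
        case (elim h)
        have b: "0 \<le> r - h" "r - h \<le> r" "r \<le> T" using elim r by auto
        have "(nm (\<lambda>x. v (r - h) x - v r x))\<^sup>2 \<le> h * integral {r - h..r} g"
          unfolding nm_commute[of "v (r - h)"] using v_incr_norm[OF b] ac_onD(2)[OF G_ac b] by simp
        also have "\<dots> = h\<^sup>2 * (integral {r - h..r} g / h)" using elim by (simp add: power2_eq_square)
        also have "\<dots> \<le> h\<^sup>2 * (g r + 1)" using elim by (intro mult_left_mono) auto
        finally have "\<bar>(f r \<cdot> v (r - h) - f r \<cdot> v r) / h - (s n r \<cdot> v (r - h) - s n r \<cdot> v r) / h\<bar> \<le> C * nm (\<lambda>x. s n r x - f r x)"
          using elim b by (intro q v_L2) auto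
        then show ?case by (simp only: diff_divide_distrib[symmetric]) (simp add: abs_minus_commute algebra_simps)
      qed
      have "\<forall>\<^sub>F h in at_right 0. integral {r - h..r} (\<lambda>z. v' z \<cdot> s n r) / h = (s n r \<cdot> v r - s n r \<cdot> v (r - h)) / h"
        using small
      proof eventually_elim
        case (elim h)
        then show ?case using ac_onD(2)[OF v_weak_ac[OF DL[OF sD[of n]]], of "r - h" r] r by (simp add: ip_commute[of "s n r"])
      qed
      moreover have "((\<lambda>h. integral {r - h..r} (\<lambda>z. v' z \<cdot> s n r) / h) \<longlongrightarrow> s n r \<cdot> v' r) (at_right 0)"
        using Zd(3)[OF sD[of n], of r] r sD[of n] by (simp add: ip_commute[of "s n r"])
      ultimately show "((\<lambda>h. (s n r \<cdot> v r - s n r \<cdot> v (r - h)) / h) \<longlongrightarrow> s n r \<cdot> v' r) (at_right 0)"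
        by (rule Lim_transform_eventually[rotated])
    qed
  qed
qed

lemma v_weak_measurable:
  assumes "S \<in> sets lebesgue" "\<And>t. t \<in> S \<Longrightarrow> t + h \<in> {0..T}" "d \<in> L2 \<Omega>" "S \<subseteq> {c..e}" "{c + h..e + h} \<subseteq> {0..T}"
  shows "(\<lambda>t. d \<cdot> v (t + h)) \<in> borel_measurable (lebesgue_on S)"
proof -
  have "continuous_on {c..e} (\<lambda>t. v (t + h) \<cdot> d)"
    by (rule continuous_on_compose2[OF v_weak_continuous[OF assms(3)]]) (use assms(5) in \<open>auto intro!: continuous_intros\<close>)
  then have "integrable (lebesgue_on {c..e}) (\<lambda>t. v (t + h) \<cdot> d)" by (rule continuous_integrable_Icc)
  then have "integrable (lebesgue_on S) (\<lambda>t. v (t + h) \<cdot> d)"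
    by (rule integrable_lebesgue_on_subset[OF _ assms(4) lebesgue_Icc assms(1)])
  then show ?thesis unfolding ip_commute[of d] by (rule borel_measurable_integrable)
qed

text \<open>The quotients of a constant path vanish; pairing them with v'(r) itself, which
  \<open>weak_difference_quotient\<close> permits, gives |v'(r)|^2 = 0.\<close>

lemma v'_zero_of_constant:
  assumes ab: "0 \<le> a" "b \<le> T" and c: "\<And>s t. s \<in> {a<..<b} \<Longrightarrow> t \<in> {a<..<b} \<Longrightarrow> nm (\<lambda>x. v t x - v s x) = 0"
  obtains Z where "negligible Z" "\<And>r. r \<in> {a<..<b} - Z \<Longrightarrow> nm (v' r) = 0"
proof -
  obtain Z1 where Z1: "negligible Z1"
    "\<And>r. r \<in> {0<..<T} - Z1 \<Longrightarrow> ((\<lambda>h. (v' r \<cdot> v (r + h) - v' r \<cdot> v r) / h) \<longlongrightarrow> v' r \<cdot> v' r) (at_right 0)"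
    by (rule weak_difference_quotient[OF v'_smeas]) (rule that)
  obtain Z2 where Z2: "negligible Z2" "\<And>r. r \<in> {0<..<T} - Z2 \<Longrightarrow> v' r \<in> L2 \<Omega>"
    using smeas_AE_L2[OF v'_smeas] unfolding AE_Ioo_iff by blast
  show thesis
  proof (rule that[of "Z1 \<union> Z2"])
    show "negligible (Z1 \<union> Z2)" by (intro negligible_Un Z1 Z2)
    fix r assume r: "r \<in> {a<..<b} - (Z1 \<union> Z2)"
    have v'L: "v' r \<in> L2 \<Omega>" using r ab by (intro Z2) auto
    have "\<forall>\<^sub>F h in at_right 0. r + h \<in> {a<..<b}"
      using r unfolding eventually_at_right_field by (intro exI[of _ "b - r"]) auto
    then have "\<forall>\<^sub>F h in at_right 0. (v' r \<cdot> v (r + h) - v' r \<cdot> v r) / h = 0"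
    proof eventually_elim
      case (elim h)
      have L: "v (r + h) \<in> L2 \<Omega>" "v r \<in> L2 \<Omega>" using elim r ab by (auto intro!: v_L2)
      have "\<bar>v' r \<cdot> (\<lambda>x. v (r + h) x - v r x)\<bar> \<le> nm (v' r) * nm (\<lambda>x. v (r + h) x - v r x)"
        by (intro ip_bound v'L L2_diff L)
      also have "nm (\<lambda>x. v (r + h) x - v r x) = 0" using elim r by (intro c) auto
      finally show ?case by (simp add: ip_diff_right[OF L v'L])
    qed
    then have "((\<lambda>h. (v' r \<cdot> v (r + h) - v' r \<cdot> v r) / h) \<longlongrightarrow> 0) (at_right 0)"
      by (rule tendsto_eventually)
    moreover have "((\<lambda>h. (v' r \<cdot> v (r + h) - v' r \<cdot> v r) / h) \<longlongrightarrow> v' r \<cdot> v' r) (at_right 0)"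
      using r ab by (intro Z1) auto
    ultimately have "v' r \<cdot> v' r = 0" by (intro tendsto_unique[OF trivial_limit_at_right_real])
    then show "nm (v' r) = 0" by (simp add: norm_L2_def)
  qed
qed

end

section \<open>The Dirichlet integral along a path\<close>

locale strong_path = L2_path +
  assumes v_reg: "AE t in lebesgue_on {0<..<T}. v t \<in> H2 \<Omega> \<and> v t \<in> H1_0 \<Omega>"
    and lap_smeas: "smeas T (\<lambda>t. lap (v t))"
    and lap_int: "integrable (lebesgue_on {0<..<T}) (\<lambda>t. (nm (lap (v t)))\<^sup>2)"
begin

lemma grad_sq_eq:
  assumes "u \<in> H2 \<Omega>" "u \<in> H1_0 \<Omega>" shows "lap u \<cdot> u = - grad_sq u"
  using Green_H1_0[OF assms] by (simp add: grad_sq_def nm_sq)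

text \<open>Green's formula rewrites |\<nabla>v|^2 as -(\<Delta>v | v), the pairing of a strongly
  measurable path with a weakly continuous one; measurability and integrability in time are obtained
  from this form.\<close>

lemma grad_sq_int: "integrable (lebesgue_on {0..T}) (\<lambda>t. grad_sq (v t))"
proof -
  obtain C where C: "\<And>t. t \<in> {0..T} \<Longrightarrow> nm (v t) \<le> C" by (rule v_bounded) (rule that)
  have m: "(\<lambda>t. lap (v t) \<cdot> v t) \<in> borel_measurable (lebesgue_on {0<..<T})"
  proof (rule smeas_inner[OF lap_smeas subset_refl lebesgue_Ioo])
    fix d :: "real^3 \<Rightarrow> real^3" assume "d \<in> L2 \<Omega>"
    then show "(\<lambda>t. d \<cdot> v t) \<in> borel_measurable (lebesgue_on {0<..<T})"
      using v_weak_measurable[of "{0<..<T}" 0 d 0 T] by (simp add: greaterThanLessThan_subseteq_atLeastAtMost_iff)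
  qed (auto intro: v_L2)
  have "integrable (lebesgue_on {0..T}) (\<lambda>t. lap (v t) \<cdot> v t)"
    by (rule integrable_ip_bound[OF lap_smeas lap_int m, of "\<lambda>t. C"])
      (auto simp: Ioo_Icc_integrable intro!: AE_I2 v_L2 C continuous_integrable_Icc)
  then have i: "integrable (lebesgue_on {0<..<T}) (\<lambda>t. - (lap (v t) \<cdot> v t))"
    unfolding Ioo_Icc_integrable by simp
  have eq: "AE t in lebesgue_on {0<..<T}. - (lap (v t) \<cdot> v t) = grad_sq (v t)"
    using v_reg by eventually_elim (simp add: grad_sq_eq)
  have "(\<lambda>t. grad_sq (v t)) \<in> borel_measurable (lebesgue_on {0<..<T})"
    by (rule borel_measurable_lebesgue_on_AE[OF lebesgue_Ioo borel_measurable_integrable[OF i] eq])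
  then show ?thesis
    unfolding Ioo_Icc_integrable[symmetric]
    using i eq by (subst integrable_cong_AE[of _ _ "\<lambda>t. - (lap (v t) \<cdot> v t)"]) auto
qed

text \<open>Both factors are merely strongly measurable. Replacing \<open>v'\<close> by its simple
  approximations makes \<open>smeas_inner\<close> applicable, and the pairing is their almost
  everywhere limit.\<close>

lemma lap_v'_int: "integrable (lebesgue_on {0..T}) (\<lambda>t. lap (v t) \<cdot> v' t)"
proof -
  have m: "(\<lambda>t. lap (v t) \<cdot> v' t) \<in> borel_measurable (lebesgue_on {0<..<T})"
  proof -
    obtain s where s: "\<And>n. simple_function (lebesgue_on {0<..<T}) (s n)" "\<And>n t. t \<in> {0<..<T} \<Longrightarrow> s n t \<in> L2 \<Omega>"
      and lim: "AE t in lebesgue_on {0<..<T}. v' t \<in> L2 \<Omega> \<and> (\<lambda>n. nm (\<lambda>x. s n t x - v' t x)) \<longlonglongrightarrow> 0"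
      using v'_smeas unfolding smeas_def by blast
    show ?thesis
    proof (rule borel_measurable_AE_limit[OF lebesgue_Ioo])
      show "(\<lambda>t. lap (v t) \<cdot> s n t) \<in> borel_measurable (lebesgue_on {0<..<T})" for n
        by (rule smeas_inner[OF lap_smeas subset_refl lebesgue_Ioo s(2)])
          (auto intro!: borel_measurable_simple_function simple_function_compose1[OF s(1)])
      have "AE t in lebesgue_on {0<..<T}. t \<in> {0<..<T}" by (rule AE_I2) simp
      with lim smeas_AE_L2[OF lap_smeas]
      show "AE t in lebesgue_on {0<..<T}. (\<lambda>n. lap (v t) \<cdot> s n t) \<longlonglongrightarrow> lap (v t) \<cdot> v' t"
      proof eventually_elim
        case (elim t)
        then show ?case using s(2)
          by (intro ip_tendsto[of "\<lambda>_. lap (v t)"]) auto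
      qed
    qed
  qed
  show ?thesis
    using smeas_AE_L2[OF v'_smeas] v'_int
    by (intro integrable_ip_bound[OF lap_smeas lap_int m, of "\<lambda>t. nm (v' t)"]) (auto elim: eventually_mono)
qed

text \<open>|\<nabla>v|^2 is a convex functional of v, and its tangent functional at v(q) is z
  \<mapsto> 2 (\<nabla>v(q) | \<nabla>z), which is -2 (\<Delta>v(q) | z) by Green's formula. In this
  form only \<Delta>v and v' occur, so \<open>steklov_ac\<close> differentiates |\<nabla>v|^2 in
  time. Times are taken outside a null set because v(t) lies in H^2 only for almost every t.\<close>

lemma grad_sq_ac:
  obtains Z where "negligible Z" "\<And>s t. s \<in> {0<..<T} - Z \<Longrightarrow> t \<in> {0<..<T} - Z \<Longrightarrow> s \<le> t \<Longrightarrow>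
      grad_sq (v t) - grad_sq (v s) = integral {s..t} (\<lambda>q. - 2 * (lap (v q) \<cdot> v' q))"
proof -
  obtain Z1 where Z1: "negligible Z1"
    "\<And>q. q \<in> {0<..<T} - Z1 \<Longrightarrow> ((\<lambda>h. (lap (v q) \<cdot> v (q + h) - lap (v q) \<cdot> v q) / h) \<longlongrightarrow> lap (v q) \<cdot> v' q) (at_right 0)"
    "\<And>q. q \<in> {0<..<T} - Z1 \<Longrightarrow> ((\<lambda>h. (lap (v q) \<cdot> v q - lap (v q) \<cdot> v (q - h)) / h) \<longlongrightarrow> lap (v q) \<cdot> v' q) (at_right 0)"
    by (rule weak_difference_quotient[OF lap_smeas]) (rule that)
  obtain Z2 where Z2: "negligible Z2" "\<And>q. q \<in> {0<..<T} - Z2 \<Longrightarrow> v q \<in> H2 \<Omega> \<and> v q \<in> H1_0 \<Omega>"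
    using v_reg unfolding AE_Ioo_iff by blast
  define B where "B q z = - 2 * (lap (v q) \<cdot> v z)" for q z
  have nZ: "negligible (Z1 \<union> Z2)" by (intro negligible_Un Z1 Z2)
  show thesis
  proof (rule steklov_ac[OF grad_sq_int _ _ G_ac nZ, where B=B and \<beta>="\<lambda>q. - 2 * (lap (v q) \<cdot> v' q)"
        and F="\<lambda>q. 4 * (nm (lap (v q)))\<^sup>2"])
    show "integrable (lebesgue_on {0..T}) (\<lambda>q. - 2 * (lap (v q) \<cdot> v' q))"
      using lap_v'_int by simp
    show "integrable (lebesgue_on {0..T}) (\<lambda>q. 4 * (nm (lap (v q)))\<^sup>2)"
      using lap_int unfolding Ioo_Icc_integrable by simp
    show "G s \<le> G t" if "0 \<le> s" "s \<le> t" "t \<le> T" for s t using G_mono that .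
    show "B q z - B q q \<le> grad_sq (v z) - grad_sq (v q)"
      if q: "q \<in> {0<..<T} - (Z1 \<union> Z2)" and z: "z \<in> {0<..<T} - (Z1 \<union> Z2)" for q z
    proof -
      have r: "v q \<in> H2 \<Omega>" "v q \<in> H1_0 \<Omega>" "v z \<in> H2 \<Omega>" "v z \<in> H1_0 \<Omega>" using Z2(2) q z by auto
      have L: "wp i (v q) \<in> L2 \<Omega>" "wp i (v z) \<in> L2 \<Omega>" for i using r by (auto intro: H1_wp_L2 H2_H1)
      have "B q z - B q q = (\<Sum>i\<in>UNIV. 2 * (wp i (v q) \<cdot> wp i (v z)) - 2 * (wp i (v q) \<cdot> wp i (v q)))"
        by (simp add: B_def Green_H1_0[OF r(1,2)] Green_H1_0[OF r(1,4)] sum_subtractf sum_distrib_left sum_negf)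
      also have "\<dots> \<le> (\<Sum>i\<in>UNIV. (nm (wp i (v z)))\<^sup>2 - (nm (wp i (v q)))\<^sup>2)"
      proof (rule sum_mono)
        fix i
        have "0 \<le> (\<lambda>x. wp i (v z) x - wp i (v q) x) \<cdot> (\<lambda>x. wp i (v z) x - wp i (v q) x)" by (rule ip_self_nonneg)
        also have "\<dots> = wp i (v z) \<cdot> wp i (v z) - 2 * (wp i (v q) \<cdot> wp i (v z)) + wp i (v q) \<cdot> wp i (v q)"
          using L[of i] by (simp add: ip_diff_left ip_diff_right L2_diff ip_commute[of "wp i (v z)" "wp i (v q)"])
        finally show "2 * (wp i (v q) \<cdot> wp i (v z)) - 2 * (wp i (v q) \<cdot> wp i (v q)) \<le> (nm (wp i (v z)))\<^sup>2 - (nm (wp i (v q)))\<^sup>2"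
          unfolding nm_sq by linarith
      qed
      finally show ?thesis by (simp add: grad_sq_def sum_subtractf)
    qed
    show "((\<lambda>h. (B q (q + h) - B q q) / h) \<longlongrightarrow> - 2 * (lap (v q) \<cdot> v' q)) (at_right 0)"
      if q: "q \<in> {0<..<T} - (Z1 \<union> Z2)" for q
    proof -
      have "((\<lambda>h. - 2 * ((lap (v q) \<cdot> v (q + h) - lap (v q) \<cdot> v q) / h)) \<longlongrightarrow> - 2 * (lap (v q) \<cdot> v' q)) (at_right 0)"
        using q by (intro tendsto_mult tendsto_const Z1(2)) auto
      moreover have "- 2 * ((lap (v q) \<cdot> v (q + h) - lap (v q) \<cdot> v q) / h) = (B q (q + h) - B q q) / h" for h
        by (simp add: B_def right_diff_distrib diff_divide_distrib)
      ultimately show ?thesis by (simp only:)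
    qed
    show "((\<lambda>h. (B q q - B q (q - h)) / h) \<longlongrightarrow> - 2 * (lap (v q) \<cdot> v' q)) (at_right 0)"
      if q: "q \<in> {0<..<T} - (Z1 \<union> Z2)" for q
    proof -
      have "((\<lambda>h. - 2 * ((lap (v q) \<cdot> v q - lap (v q) \<cdot> v (q - h)) / h)) \<longlongrightarrow> - 2 * (lap (v q) \<cdot> v' q)) (at_right 0)"
        using q by (intro tendsto_mult tendsto_const Z1(3)) auto
      moreover have "- 2 * ((lap (v q) \<cdot> v q - lap (v q) \<cdot> v (q - h)) / h) = (B q q - B q (q - h)) / h" for h
        by (simp add: B_def right_diff_distrib diff_divide_distrib)
      ultimately show ?thesis by (simp only:)
    qed
    show "2 * \<bar>B q z - B q q\<bar> \<le> \<bar>z - q\<bar> * (4 * (nm (lap (v q)))\<^sup>2) + \<bar>G z - G q\<bar>"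
      if q: "q \<in> {0<..<T} - (Z1 \<union> Z2)" and z: "z \<in> {0..T}" for q z
    proof (cases "z = q")
      case False
      define d where "d = nm (\<lambda>x. v z x - v q x)"
      define l where "l = nm (lap (v q))"
      define h where "h = \<bar>z - q\<bar>"
      have h: "h > 0" using False by (simp add: h_def)
      have L: "v z \<in> L2 \<Omega>" "v q \<in> L2 \<Omega>" using q z by (auto intro: v_L2)
      have lL: "lap (v q) \<in> L2 \<Omega>" using Z2(2) q by (intro laplacian_L2) auto
      have "\<bar>B q z - B q q\<bar> = 2 * \<bar>lap (v q) \<cdot> (\<lambda>x. v z x - v q x)\<bar>"
        unfolding B_def ip_diff_right[OF L lL] by (auto simp: abs_if)
      also have "\<dots> \<le> 2 * (l * d)" unfolding l_def d_def by (intro mult_left_mono ip_bound lL L2_diff L) auto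
      finally have 1: "\<bar>B q z - B q q\<bar> \<le> 2 * (l * d)" .
      \<comment> \<open>Young's inequality weighted by \<open>h\<close>, so that d^2 / h is
        controlled by the increment of \<open>G\<close>; the factor 4 in \<open>F\<close> originates
        here.\<close>
      have "0 \<le> (2 * h * l - d)\<^sup>2 / h" using h by simp
      also have "\<dots> = h * (4 * l\<^sup>2) - 4 * (l * d) + d\<^sup>2 / h" using h by (simp add: power2_eq_square field_simps)
      finally have 2: "4 * (l * d) \<le> h * (4 * l\<^sup>2) + d\<^sup>2 / h" by simp
      have "d\<^sup>2 \<le> h * \<bar>G z - G q\<bar>" unfolding d_def h_def using q z by (intro v_incr_norm') auto
      then have "d\<^sup>2 / h \<le> \<bar>G z - G q\<bar>" using h by (simp add: divide_le_eq mult.commute)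
      then have 3: "4 * (l * d) \<le> h * (4 * l\<^sup>2) + \<bar>G z - G q\<bar>" using 2 by linarith
      have "2 * \<bar>B q z - B q q\<bar> \<le> 2 * (2 * (l * d))" using 1 by (rule mult_left_mono) simp
      also have "2 * (2 * (l * d)) = 4 * (l * d)" by simp
      also note 3
      finally show ?thesis unfolding h_def[symmetric] l_def[symmetric] .
    qed simp
    show "(\<lambda>q. B q (q + h) - B q q) \<in> borel_measurable (lebesgue_on {c..d})"
      if "0 < c" "d < T" "0 < c + h" "d + h < T" for c d h
    proof -
      have m: "(\<lambda>q. lap (v q) \<cdot> v (q + k)) \<in> borel_measurable (lebesgue_on {c..d})" if k: "0 < c + k" "d + k < T" for k
      proof (rule smeas_inner[OF lap_smeas])
        show "{c..d} \<subseteq> {0<..<T}" using \<open>0 < c\<close> \<open>d < T\<close> by auto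
        show "v (t + k) \<in> L2 \<Omega>" if "t \<in> {c..d}" for t using that k by (intro v_L2) auto
        fix e :: "real^3 \<Rightarrow> real^3" assume e: "e \<in> L2 \<Omega>"
        show "(\<lambda>t. e \<cdot> v (t + k)) \<in> borel_measurable (lebesgue_on {c..d})"
          by (rule v_weak_measurable[of _ _ _ c d]) (use e k in auto)
      qed simp
      show ?thesis unfolding B_def
        using m[of h] m[of 0] that by (intro borel_measurable_diff borel_measurable_times borel_measurable_const) auto
    qed
  qed (rule that)
qed

end

subsection \<open>The fluid-filled body\<close>

lemma norm_cross_le: "norm (cross3 x y) \<le> norm x * norm y"
  by (rule power2_le_imp_le) (simp_all add: norm_cross power_mult_distrib)

locale fluid_body = bounded_open +
  fixes \<nu> :: real and I_B I :: "real^3^3" and lam :: "real^3"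
  assumes conn: "connected \<Omega>" and ne: "\<Omega> \<noteq> {}" and viscosity: "\<nu> > 0"
    and body_posdef: "\<And>y. y \<noteq> 0 \<Longrightarrow> (I_B *v y) \<bullet> y > 0"
    and total_inertia: "I = I_B + fluid_inertia \<Omega>"
    and principal_axes: "I = diag_matrix lam"
begin

abbreviation om where "om \<equiv> omega \<Omega> I"

lemma I_nth: "(I *v y) $ i = lam $ i * y $ i"
  by (simp add: principal_axes diag_matrix_def matrix_vector_mult_def if_distrib[of "\<lambda>z. z * _"] cong: if_cong)

lemma I_sym: "(I *v y) \<bullet> z = y \<bullet> (I *v z)"
  by (simp add: inner_vec_def I_nth algebra_simps)

lemma dom_bound: obtains B where "B \<ge> 0" "\<And>x. x \<in> \<Omega> \<Longrightarrow> norm x \<le> B"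
  using bounded_dom unfolding bounded_pos by (metis less_imp_le)

lemma id_measurable: "(\<lambda>x. x) \<in> borel_measurable M"
  by (intro continuous_imp_measurable_on_sets_lebesgue sets_dom continuous_intros)

lemma cross_measurable:
  assumes "f \<in> borel_measurable M" "g \<in> borel_measurable M"
  shows "(\<lambda>x. cross3 (f x) (g x)) \<in> borel_measurable M"
  using assms by (rule borel_measurable_continuous_Pair) (intro continuous_on_cross continuous_intros)

lemma rot_L2: "(\<lambda>x. cross3 e x) \<in> L2 \<Omega>"
proof -
  obtain B where B: "B \<ge> 0" "\<And>x. x \<in> \<Omega> \<Longrightarrow> norm x \<le> B" by (rule dom_bound) (rule that)
  show ?thesis
  proof (rule L2_bounded)
    show "(\<lambda>x. cross3 e x) \<in> borel_measurable M" by (intro cross_measurable id_measurable) simp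
    show "norm (cross3 e x) \<le> norm e * B" if "x \<in> \<Omega>" for x
      by (rule order_trans[OF norm_cross_le]) (use B that in \<open>auto intro: mult_left_mono\<close>)
  qed
qed

lemma cross_L2: "u \<in> L2 \<Omega> \<Longrightarrow> (\<lambda>x. cross3 e (u x)) \<in> L2 \<Omega>"
  by (rule L2_dominated'[where C="norm e"]) (assumption | intro cross_measurable borel_measurable_const L2_meas norm_cross_le)+

lemma S_inner:
  assumes u: "u \<in> L2 \<Omega>"
  shows "(LINT x|M. cross3 x (u x)) \<bullet> e = (\<lambda>x. cross3 e x) \<cdot> u"
proof -
  obtain B where B: "B \<ge> 0" "\<And>x. x \<in> \<Omega> \<Longrightarrow> norm x \<le> B" by (rule dom_bound) (rule that)
  have "(\<lambda>x. cross3 x (u x)) \<in> L2 \<Omega>"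
  proof (rule L2_dominated'[OF u])
    show "(\<lambda>x. cross3 x (u x)) \<in> borel_measurable M" by (intro cross_measurable id_measurable L2_meas u)
    show "norm (cross3 x (u x)) \<le> B * norm (u x)" if "x \<in> \<Omega>" for x
      by (rule order_trans[OF norm_cross_le]) (use B that in \<open>auto intro: mult_right_mono\<close>)
  qed
  then have "(LINT x|M. cross3 x (u x)) \<bullet> e = (LINT x|M. cross3 x (u x) \<bullet> e)"
    by (intro integral_inner_left[symmetric] L2_integrable)
  also have "\<dots> = (\<lambda>x. cross3 e x) \<cdot> u" unfolding inner_L2_def by (simp only: cross_triple[of e])
  finally show ?thesis .
qed

text \<open>Lagrange's identity |e|^2 |x|^2 - (e . x)^2 = |e \<times> x|^2 under the integral. It
  ties the fluid's share of the inertia to L_2 norms of rigid rotations.\<close>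

lemma fluid_inertia_form: "(fluid_inertia \<Omega> *v e) \<bullet> e = (\<lambda>x. cross3 e x) \<cdot> (\<lambda>x. cross3 e x)"
proof -
  define F :: "real^3 \<Rightarrow> real^3^3" where "F x = mat ((norm x)\<^sup>2) - (\<chi> i j. x $ i * x $ j)" for x
  have "continuous_on UNIV (\<lambda>x. F x $ i $ j)" for i j
    by (cases "i = j") (auto simp: F_def mat_def intro!: continuous_intros)
  then have cF: "continuous_on UNIV F"
    by (subst continuous_on_componentwise) (auto simp: Basis_vec_def inner_axis)
  have "bounded (F ` closure \<Omega>)"
    using bounded_dom by (intro compact_imp_bounded compact_continuous_image continuous_on_subset[OF cF]) auto
  then obtain B where B: "\<And>x. x \<in> closure \<Omega> \<Longrightarrow> norm (F x) \<le> B" unfolding bounded_iff by blast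
  have iF: "integrable M F"
  proof (rule integrable_const_bound)
    show "AE x in M. norm (F x) \<le> B"
      using B closure_subset by (intro AE_I2) auto
    show "F \<in> borel_measurable M"
      by (intro continuous_imp_measurable_on_sets_lebesgue sets_dom continuous_on_subset[OF cF]) auto
  qed
  have "linear (\<lambda>A::real^3^3. (A *v e) \<bullet> e)"
    by (rule linearI) (simp_all add: matrix_vector_mult_add_rdistrib inner_add_left scaleR_matrix_vector_assoc[symmetric])
  then have "bounded_linear (\<lambda>A::real^3^3. (A *v e) \<bullet> e)" by (simp add: linear_conv_bounded_linear)
  then have "(fluid_inertia \<Omega> *v e) \<bullet> e = (LINT x|M. (F x *v e) \<bullet> e)"
    unfolding fluid_inertia_def F_def[symmetric] by (rule integral_bounded_linear[OF _ iF, symmetric])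
  also have "(\<lambda>x. (F x *v e) \<bullet> e) = (\<lambda>x. cross3 e x \<bullet> cross3 e x)"
    by (rule ext, unfold dot_cross)
      (simp add: F_def mat_def matrix_vector_mult_def inner_vec_def sum_3 power2_norm_eq_inner algebra_simps)
  finally show ?thesis by (simp add: inner_L2_def)
qed

lemma I_posdef: "y \<noteq> 0 \<Longrightarrow> (I *v y) \<bullet> y > 0"
  using body_posdef[of y] ip_self_nonneg[of "\<lambda>x. cross3 y x"]
  by (simp add: total_inertia matrix_vector_mult_add_rdistrib inner_add_left fluid_inertia_form)

lemma lam_pos: "lam $ i > 0"
  using I_posdef[of "axis i 1"] by (simp add: inner_axis I_nth axis_eq_0_iff)

lemma I_inj: "I *v y = I *v z \<Longrightarrow> y = z"
  using lam_pos by (simp add: vec_eq_iff I_nth) (metis less_irrefl)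

lemma I_om: "I *v om u = (LINT x|M. cross3 x (u x))"
proof -
  have "invertible I"
    unfolding invertible_left_inverse matrix_left_invertible_injective by (auto intro: injI I_inj)
  then have "I ** matrix_inv I = mat 1" unfolding invertible_def matrix_inv_def by (rule someI2_ex) simp
  then show ?thesis by (simp add: omega_def matrix_vector_mul_assoc)
qed

lemma om_inner: "u \<in> L2 \<Omega> \<Longrightarrow> (I *v om u) \<bullet> e = (\<lambda>x. cross3 e x) \<cdot> u"
  unfolding I_om by (rule S_inner)

lemma om_lin:
  assumes "u \<in> L2 \<Omega>" "w \<in> L2 \<Omega>"
  shows "om (\<lambda>x. u x + w x) = om u + om w"
    "om (\<lambda>x. c *\<^sub>R u x) = c *\<^sub>R om u"
proof -
  have *: "om f = z" if "f \<in> L2 \<Omega>" "\<And>e. (I *v z) \<bullet> e = (\<lambda>x. cross3 e x) \<cdot> f" for f z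
  proof (rule I_inj, rule vector_eq_ldot[THEN iffD1], rule allI)
    show "e \<bullet> (I *v om f) = e \<bullet> (I *v z)" for e using that om_inner by (simp add: inner_commute)
  qed
  show "om (\<lambda>x. u x + w x) = om u + om w"
    by (rule *) (simp_all add: L2_add assms matrix_vector_right_distrib inner_add_left om_inner ip_add_right rot_L2)
  show "om (\<lambda>x. c *\<^sub>R u x) = c *\<^sub>R om u"
    by (rule *) (simp_all add: L2_scaleR assms matrix_vector_mult_scaleR om_inner ip_scaleR_right)
qed

text \<open>Polarisation of |v|^2 - (I \<omega> | \<omega>), the part of twice the energy that
  depends on v.\<close>

definition bil where "bil u w = u \<cdot> w - (I *v om u) \<bullet> om w"

lemma bil_sym: "bil u w = bil w u"
  unfolding bil_def by (metis I_sym inner_commute ip_commute)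

lemma bil_add_left: "u \<in> L2 \<Omega> \<Longrightarrow> u' \<in> L2 \<Omega> \<Longrightarrow> w \<in> L2 \<Omega> \<Longrightarrow> bil (\<lambda>x. u x + u' x) w = bil u w + bil u' w"
  by (simp add: bil_def ip_add_left om_lin matrix_vector_right_distrib inner_add_left)

lemma bil_scaleR_left: "u \<in> L2 \<Omega> \<Longrightarrow> bil (\<lambda>x. k *\<^sub>R u x) w = k * bil u w"
  by (simp add: bil_def ip_scaleR_left om_lin matrix_vector_mult_scaleR right_diff_distrib)

text \<open>Represents \<open>bil\<close> in the L_2 inner product (\<open>ip_kinetic\<close>),
  which brings it into the form required by \<open>quadratic_ac\<close>.\<close>

definition kinetic where "kinetic w x = w x - cross3 (om w) x"

lemma kinetic_L2: "w \<in> L2 \<Omega> \<Longrightarrow> kinetic w \<in> L2 \<Omega>"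
  unfolding kinetic_def by (intro L2_diff rot_L2)

lemma ip_kinetic: "u \<in> L2 \<Omega> \<Longrightarrow> w \<in> L2 \<Omega> \<Longrightarrow> u \<cdot> kinetic w = bil u w"
  unfolding kinetic_def bil_def
  by (subst ip_diff_right[OF _ rot_L2]) (simp_all only: om_inner ip_commute[of u])

text \<open>The inertia I_B of the solid is the reason. With \<omega> = \<omega>(u) and q = (I
  \<omega> | \<omega>) one has q = (\<omega> \<times> x | u) \<le> |\<omega> \<times> x| |u|, and
  |\<omega> \<times> x|^2 = q - (I_B \<omega> | \<omega>) \<le> (1 - c) q. Together these give q
  \<le> (1 - c) |u|^2.\<close>

lemma coercive:
  obtains c where "0 < c" "c \<le> 1" "\<And>u. u \<in> L2 \<Omega> \<Longrightarrow> bil u u \<ge> c * (nm u)\<^sup>2"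
proof -
  have "\<exists>e\<in>sphere 0 1. \<forall>e'\<in>sphere (0::real^3) 1. (I_B *v e) \<bullet> e \<le> (I_B *v e') \<bullet> e'"
    by (intro continuous_attains_inf) (auto intro!: continuous_intros matrix_vector_mult_linear_continuous_on)
  then obtain e0 where e0: "norm e0 = 1" "\<And>e. norm e = 1 \<Longrightarrow> (I_B *v e0) \<bullet> e0 \<le> (I_B *v e) \<bullet> e"
    by (auto simp: dist_norm)
  define \<beta> where "\<beta> = (I_B *v e0) \<bullet> e0"
  have \<beta>: "\<beta> > 0" unfolding \<beta>_def using e0 by (intro body_posdef) auto
  have bB: "\<beta> * (norm e)\<^sup>2 \<le> (I_B *v e) \<bullet> e" for e
  proof (cases "e = 0")
    case False
    have "\<beta> \<le> (I_B *v (e /\<^sub>R norm e)) \<bullet> (e /\<^sub>R norm e)" unfolding \<beta>_def using False by (intro e0) simp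
    also have "\<dots> = ((I_B *v e) \<bullet> e) / (norm e)\<^sup>2"
      by (simp add: matrix_vector_mult_scaleR power2_eq_square divide_inverse)
    finally show ?thesis using False by (simp add: field_simps)
  qed simp
  define \<Lambda> where "\<Lambda> = (\<Sum>i\<in>UNIV. lam $ i)"
  have \<Lambda>: "\<Lambda> > 0" unfolding \<Lambda>_def by (intro sum_pos lam_pos) auto
  have IL: "(I *v e) \<bullet> e \<le> \<Lambda> * (norm e)\<^sup>2" for e
  proof -
    have "(I *v e) \<bullet> e \<le> (\<Sum>i\<in>UNIV. \<Lambda> * (e $ i * e $ i))"
      unfolding inner_vec_def inner_real_def I_nth
    proof (rule sum_mono)
      fix i :: 3
      have "lam $ i \<le> \<Lambda>" unfolding \<Lambda>_def by (intro member_le_sum) (auto simp: lam_pos less_imp_le)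
      then show "lam $ i * e $ i * e $ i \<le> \<Lambda> * (e $ i * e $ i)" by (simp add: mult_right_mono mult.assoc)
    qed
    also have "\<dots> = \<Lambda> * (norm e)\<^sup>2" by (simp add: power2_norm_eq_inner inner_vec_def sum_distrib_left)
    finally show ?thesis .
  qed
  \<comment> \<open>\<beta> bounds the form of I_B on the unit sphere from below and the trace
    \<Lambda> bounds that of I from above, so c I \<le> I_B as quadratic forms; the minimum with 1
    keeps 1 - c nonnegative.\<close>
  define c where "c = min 1 (\<beta> / \<Lambda>)"
  have c: "0 < c" "c \<le> 1" using \<beta> \<Lambda> by (auto simp: c_def)
  have cI: "c * ((I *v e) \<bullet> e) \<le> (I_B *v e) \<bullet> e" for e
  proof -
    have "c * ((I *v e) \<bullet> e) \<le> c * (\<Lambda> * (norm e)\<^sup>2)" using c IL by (intro mult_left_mono) auto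
    also have "\<dots> \<le> (\<beta> / \<Lambda>) * (\<Lambda> * (norm e)\<^sup>2)" using \<Lambda> by (intro mult_right_mono) (auto simp: c_def)
    also have "\<dots> = \<beta> * (norm e)\<^sup>2" using \<Lambda> by simp
    also have "\<dots> \<le> (I_B *v e) \<bullet> e" by (rule bB)
    finally show ?thesis .
  qed
  show thesis
  proof (rule that[OF c])
    fix u :: "real^3 \<Rightarrow> real^3" assume u: "u \<in> L2 \<Omega>"
    define e where "e = om u"
    define q where "q = (I *v e) \<bullet> e"
    have q0: "q \<ge> 0" unfolding q_def using I_posdef[of e] by (cases "e = 0") auto
    have "(nm (\<lambda>x. cross3 e x))\<^sup>2 = q - (I_B *v e) \<bullet> e"
      by (simp add: nm_sq fluid_inertia_form[symmetric] q_def total_inertia matrix_vector_mult_add_rdistrib inner_add_left)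
    also have "\<dots> \<le> (1 - c) * q" using cI[of e] by (simp add: q_def algebra_simps)
    finally have 1: "(nm (\<lambda>x. cross3 e x))\<^sup>2 \<le> (1 - c) * q" .
    have "q \<le> nm (\<lambda>x. cross3 e x) * nm u"
      using ip_bound[OF rot_L2 u, of e] om_inner[OF u, of e] by (simp add: q_def e_def)
    then have "q\<^sup>2 \<le> (nm (\<lambda>x. cross3 e x))\<^sup>2 * (nm u)\<^sup>2"
      using q0 power_mono[of q "nm (\<lambda>x. cross3 e x) * nm u" 2] by (simp add: power_mult_distrib)
    also have "\<dots> \<le> (1 - c) * q * (nm u)\<^sup>2" by (intro mult_right_mono 1) simp
    finally have "q * q \<le> q * ((1 - c) * (nm u)\<^sup>2)" by (simp add: power2_eq_square mult_ac)
    then have "q \<le> (1 - c) * (nm u)\<^sup>2"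
      using q0 c by (cases "q = 0") auto
    then show "c * (nm u)\<^sup>2 \<le> bil u u"
      by (simp add: bil_def q_def e_def nm_sq algebra_simps)
  qed
qed

lemma om_bound:
  obtains K where "K \<ge> 0" "\<And>u. u \<in> L2 \<Omega> \<Longrightarrow> norm (om u) \<le> K * nm u"
proof (rule that)
  show "0 \<le> (\<Sum>i\<in>UNIV. nm (\<lambda>x. cross3 (axis i 1) x) / lam $ i)"
    by (intro sum_nonneg divide_nonneg_pos lam_pos nm_nonneg)
  fix u :: "real^3 \<Rightarrow> real^3" assume u: "u \<in> L2 \<Omega>"
  have "norm (om u) \<le> (\<Sum>i\<in>UNIV. \<bar>om u $ i\<bar>)" by (rule norm_le_l1_cart)
  also have "\<dots> \<le> (\<Sum>i\<in>UNIV. nm (\<lambda>x. cross3 (axis i 1) x) / lam $ i * nm u)"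
  proof (rule sum_mono)
    fix i :: 3
    have "lam $ i * om u $ i = (\<lambda>x. cross3 (axis i 1) x) \<cdot> u"
      using om_inner[OF u, of "axis i 1"] by (simp add: inner_axis I_nth)
    then have "\<bar>lam $ i * om u $ i\<bar> \<le> nm (\<lambda>x. cross3 (axis i 1) x) * nm u"
      by (simp only: ip_bound[OF rot_L2 u])
    then show "\<bar>om u $ i\<bar> \<le> nm (\<lambda>x. cross3 (axis i 1) x) / lam $ i * nm u"
      using lam_pos[of i] by (simp add: abs_mult pos_le_divide_eq mult.commute)
  qed
  finally show "norm (om u) \<le> (\<Sum>i\<in>UNIV. nm (\<lambda>x. cross3 (axis i 1) x) / lam $ i) * nm u"
    by (simp add: sum_distrib_right)
qed

lemma energy_eq: "v \<in> L2 \<Omega> \<Longrightarrow> energy \<Omega> I v a = 1/2 * (bil v v + (I *v a) \<bullet> a)"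
  by (simp add: energy_def bil_def nm_sq)

end

text \<open>Hypothesis \<open>N1\<close> bounds the derivative of N/y by k (N/y + 1), so W = (N/y +
  1) exp(-A), with A a primitive of k, does not increase. Hence N \<le> L y, and y' \<ge> -(2 L + C)
  y gives the exponential lower bound. It depends only on the data at \<open>a\<close>, on C, on the
  length of the interval and on the integral of k, so it does not degenerate when \<open>b\<close>
  approaches a zero of y.\<close>

lemma gronwall_quotient:
  fixes y y' N N' k :: "real \<Rightarrow> real"
  assumes y: "ac_on a b y y'" and N: "ac_on a b N N'" and k: "integrable (lebesgue_on {a..b}) k" and Z: "negligible Z"
    and ab: "a \<le> b" and C: "C \<ge> 0"
    and pos: "\<And>t. t \<in> {a..b} \<Longrightarrow> y t > 0" and k0: "\<And>t. t \<in> {a..b} \<Longrightarrow> k t \<ge> 0"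
    and N0: "\<And>t. t \<in> {a<..<b} - Z \<Longrightarrow> N t \<ge> 0" "N a \<ge> 0"
    and y1: "\<And>t. t \<in> {a<..<b} - Z \<Longrightarrow> y' t \<ge> - (2 * N t) - C * y t"
    and N1: "\<And>t. t \<in> {a<..<b} - Z \<Longrightarrow> y t * N' t - N t * y' t \<le> y t * (k t * (N t + y t))"
  shows "y b \<ge> y a * exp (- (2 * ((1 + N a / y a) * exp (integral {a..b} k)) + C) * (b - a))"
proof -
  define A where "A t = integral {a..t} k" for t
  have A: "ac_on a b A k"
    unfolding ac_on_def
  proof (intro conjI allI impI k)
    fix s t assume st: "a \<le> s" "s \<le> t" "t \<le> b"
    have "integral {a..s} k + integral {s..t} k = integral {a..t} k"
      by (rule HK_combine[OF st(1,2) subinterval_integrable(1)[OF k]]) (use st in auto)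
    then show "A t - A s = integral {s..t} k" by (simp add: A_def)
  qed
  have cy: "continuous_on {a..b} y" by (rule ac_on_continuous[OF y])
  have nE: "{a..b} \<noteq> {}" using ab by simp
  \<comment> \<open>\<open>ac_on_chain\<close> asks for a compact range on which the outer function
    is continuously differentiable; the extrema of y provide one that stays away from 0.\<close>
  obtain t1 where t1: "t1 \<in> {a..b}" "\<And>t. t \<in> {a..b} \<Longrightarrow> y t1 \<le> y t"
    using continuous_attains_inf[OF compact_Icc nE cy] by blast
  obtain t2 where t2: "\<And>t. t \<in> {a..b} \<Longrightarrow> y t \<le> y t2"
    using continuous_attains_sup[OF compact_Icc nE cy] by blast
  have inv: "ac_on a b (\<lambda>t. inverse (y t)) (\<lambda>t. - (inverse (y t) * inverse (y t)) * y' t)"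
    by (rule ac_on_chain[OF y, of "y t1" "y t2"])
      (use t1 t2 pos[OF t1(1)] in \<open>auto intro!: derivative_eq_intros continuous_intros simp: power2_eq_square\<close>)
  have cA: "continuous_on {a..b} A" by (rule ac_on_continuous[OF A])
  obtain t3 where t3: "\<And>t. t \<in> {a..b} \<Longrightarrow> A t3 \<le> A t"
    using continuous_attains_inf[OF compact_Icc nE cA] by blast
  obtain t4 where t4: "\<And>t. t \<in> {a..b} \<Longrightarrow> A t \<le> A t4"
    using continuous_attains_sup[OF compact_Icc nE cA] by blast
  have ex: "ac_on a b (\<lambda>t. exp (- A t)) (\<lambda>t. - exp (- A t) * k t)"
    by (rule ac_on_chain[OF A, of "A t3" "A t4"])
      (use t3 t4 in \<open>auto intro!: derivative_eq_intros continuous_intros\<close>)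
  define W where "W t = (N t + y t) * inverse (y t) * exp (- A t)" for t
  have W: "W t \<le> W a" if t: "t \<in> {a..b}" for t
  proof -
    have sub: "ac_on a b f f' \<Longrightarrow> ac_on a t f f'" for f f' :: "real \<Rightarrow> real" using t by (auto intro: ac_on_subset)
    have "W t \<le> W a + integral {a..t} (\<lambda>t. 0)"
      unfolding W_def
    proof (rule ac_on_le[OF ac_on_bilinear[OF bounded_bilinear_mult ac_on_bilinear[OF bounded_bilinear_mult ac_on_add[OF sub[OF N] sub[OF y]] sub[OF inv]] sub[OF ex]] Z])
      fix s assume s: "s \<in> {a<..<t} - Z"
      then have s': "s \<in> {a<..<b} - Z" "s \<in> {a..b}" using t by auto
      have ys: "y s > 0" by (rule pos[OF s'(2)])
      have "((N' s + y' s) * inverse (y s) + (N s + y s) * (- (inverse (y s) * inverse (y s)) * y' s)) * exp (- A s) +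
          (N s + y s) * inverse (y s) * (- exp (- A s) * k s)
        = exp (- A s) * inverse (y s) * inverse (y s) * ((y s * N' s - N s * y' s) - y s * (k s * (N s + y s)))"
        using ys by (simp add: field_simps)
      also have "\<dots> \<le> 0" using N1[OF s'(1)] ys by (intro mult_nonneg_nonpos) auto
      finally show "((N' s + y' s) * inverse (y s) + (N s + y s) * (- (inverse (y s) * inverse (y s)) * y' s)) * exp (- A s) +
          (N s + y s) * inverse (y s) * (- exp (- A s) * k s) \<le> 0" .
    qed (use t in auto)
    then show ?thesis by simp
  qed
  define L where "L = (1 + N a / y a) * exp (integral {a..b} k)"
  have ya: "y a > 0" using ab by (intro pos) auto
  have NL: "N t \<le> L * y t" if t: "t \<in> {a<..<b} - Z" for t
  proof -
    have tt: "t \<in> {a..b}" using t by auto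
    have yt: "y t > 0" by (rule pos[OF tt])
    have Wa: "W a = 1 + N a / y a" using ya by (simp add: W_def A_def field_simps)
    have "A t \<le> integral {a..b} k"
      unfolding A_def using tt k0 by (intro integral_subset_le subinterval_integrable(1)[OF k]) auto
    then have e: "exp (A t) \<le> exp (integral {a..b} k)" by simp
    have "(N t + y t) * inverse (y t) = W t * exp (A t)" by (simp add: W_def exp_minus)
    also have "\<dots> \<le> W a * exp (A t)" using W[OF tt] by (intro mult_right_mono) auto
    also have "\<dots> \<le> L" unfolding L_def Wa using e ya N0(2) by (intro mult_left_mono) auto
    finally have "N t + y t \<le> L * y t" using yt by (simp add: field_simps)
    then show ?thesis using yt by linarith
  qed
  show ?thesis unfolding L_def[symmetric]
  proof (rule gronwall_lower[OF y Z _ ab])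
    fix t assume t: "t \<in> {a<..<b} - Z"
    have "- (2 * L + C) * y t = - (2 * (L * y t)) - C * y t" by (simp add: algebra_simps)
    also have "\<dots> \<le> y' t" using y1[OF t] NL[OF t] by linarith
    finally show "- (2 * L + C) * y t \<le> y' t" .
  qed
qed

lemma ac_on_const:
  fixes f :: "real \<Rightarrow> 'a::euclidean_space"
  assumes f: "ac_on a b f f'" and Z: "negligible Z" and st: "a \<le> s" "s \<le> t" "t \<le> b"
    and z: "\<And>r. r \<in> {s<..<t} - Z \<Longrightarrow> f' r = 0"
  shows "f t = f s"
proof -
  have "integral {s..t} f' = integral {s..t} (\<lambda>_. 0)"
  proof (rule integral_spike)
    show "negligible (insert s (insert t Z))" using Z by simp
    show "0 = f' r" if "r \<in> {s..t} - insert s (insert t Z)" for r using z[of r] that by auto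
  qed
  then show ?thesis using ac_onD(2)[OF f st] by simp
qed

lemma has_weak_time_deriv_ac:
  assumes "has_weak_time_deriv T f f'" shows "ac_on 0 T f f'"
proof -
  have i: "integrable (lebesgue_on {0..T}) f'"
    using assms unfolding has_weak_time_deriv_def Ioo_Icc_integrable by simp
  show ?thesis
    unfolding ac_on_def
  proof (intro conjI allI impI i)
    fix s t assume st: "0 \<le> s" "s \<le> t" "t \<le> T"
    then show "f t - f s = integral {s..t} f'"
      using assms subinterval_integrable(3)[OF i st(1,3)] unfolding has_weak_time_deriv_def by simp
  qed
qed

lemma interval_diff_negligible:
  assumes "s < (t::real)" "negligible Z" obtains r where "r \<in> {s<..<t} - Z"
proof -
  have "\<not> negligible {s<..<t}" using assms(1) by (intro open_not_negligible) auto
  then have "\<not> {s<..<t} \<subseteq> Z" using assms(2) negligible_subset by blast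
  then show thesis using that by blast
qed

context bounded_open
begin

lemma L2_vec:
  fixes f :: "3 \<Rightarrow> real^3 \<Rightarrow> real"
  assumes "\<And>i. f i \<in> L2 \<Omega>" shows "(\<lambda>x. \<chi> i. f i x) \<in> L2 \<Omega>"
proof -
  have "(\<lambda>x. f i x *\<^sub>R axis i 1 :: real^3) \<in> L2 \<Omega>" for i
    by (rule L2_dominated'[OF assms[of i], where C=1]) (intro borel_measurable_scaleR borel_measurable_const L2_meas assms, simp)
  then have "(\<lambda>x. \<Sum>i\<in>UNIV. f i x *\<^sub>R axis i 1 :: real^3) \<in> L2 \<Omega>" by (intro L2_sum) auto
  moreover have "(\<Sum>i\<in>UNIV. f i x *\<^sub>R axis i 1 :: real^3) = (\<chi> i. f i x)" for x
    by (simp add: vec_eq_iff axis_def if_distrib[of "\<lambda>z. _ * z"] cong: if_cong)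
  ultimately show ?thesis by simp
qed

lemma weak_grad_L2: "q \<in> H1 \<Omega> \<Longrightarrow> weak_grad \<Omega> q \<in> L2 \<Omega>"
  unfolding weak_grad_def[abs_def] by (intro L2_vec H1_wp_L2)

lemma test_grad_L2: "test_function \<Omega> f \<Longrightarrow> (\<lambda>x. \<chi> i. partial i f x) \<in> L2 \<Omega>" for f :: "real^3 \<Rightarrow> real"
  by (intro L2_vec test_L2 test_function_partial)

lemma L2_sigma_iff: "u \<in> L2_sigma \<Omega> \<longleftrightarrow> u \<in> L2 \<Omega> \<and>
    (\<forall>f. test_function \<Omega> f \<longrightarrow> u \<cdot> (\<lambda>x. \<chi> i. partial i f x) = 0) \<and> (\<forall>f\<in>H1 \<Omega>. u \<cdot> weak_grad \<Omega> f = 0)"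
  by (simp add: L2_sigma_def inner_L2_def)

lemma L2_sigma_L2: "u \<in> L2_sigma \<Omega> \<Longrightarrow> u \<in> L2 \<Omega>"
  by (simp add: L2_sigma_def)

lemma L2_sigma_combine: "u \<in> L2_sigma \<Omega> \<Longrightarrow> w \<in> L2_sigma \<Omega> \<Longrightarrow> (\<lambda>x. u x + k *\<^sub>R w x) \<in> L2_sigma \<Omega>"
  unfolding L2_sigma_iff
  by (auto simp: ip_add_left ip_scaleR_left L2_scaleR test_grad_L2 weak_grad_L2 intro!: L2_add)

lemma L2_sigma_zero: "AE x in M. u x = 0 \<Longrightarrow> u \<in> L2_sigma \<Omega>"
proof -
  assume u: "AE x in M. u x = 0"
  then have uL: "u \<in> L2 \<Omega>" by (intro L2_AE[OF L2_zero]) (auto elim: eventually_mono)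
  have "u \<cdot> w = 0" if "w \<in> L2 \<Omega>" for w
    using ip_cong_AE[OF u _ uL that, of w] by simp
  then show ?thesis unfolding L2_sigma_iff using uL test_grad_L2 weak_grad_L2 by blast
qed

lemma zero_class_operators:
  assumes "AE x in M. u x = 0"
  shows "AE x in M. lap u x = 0" "AE x in M. convection \<Omega> u x = 0"
proof -
  have "AE x in M. wp i (wp i u) x = 0" for i
    by (intro H1_zero_class(2) H1_zero_class(2)[OF assms])
  then have "AE x in M. \<forall>i. wp i (wp i u) x = 0" by (simp add: AE_all_countable)
  then show "AE x in M. lap u x = 0" by eventually_elim (simp add: weak_laplacian_def)
  show "AE x in M. convection \<Omega> u x = 0" using assms by eventually_elim (simp add: convection_def)
qed

end

section \<open>Solutions: momentum, energy balance and rest\<close>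

locale fluid_solution = fluid_body +
  fixes T :: real and v v' :: "real \<Rightarrow> real^3 \<Rightarrow> real^3" and a a' w' :: "real \<Rightarrow> real^3"
    and p :: "real \<Rightarrow> real^3 \<Rightarrow> real"
  assumes T_pos: "T > 0"
    and v_space: "bochner_L2 T (H2_0_sigma \<Omega>) (norm_H2 \<Omega>) v"
    and p_space: "bochner_L2 T (H1 \<Omega>) (norm_H1 \<Omega>) p"
    and v_time: "H1_time_L2_sigma \<Omega> T v v'"
    and a_time: "has_weak_time_deriv T a a'"
    and w_time: "has_weak_time_deriv T (\<lambda>t. om (v t)) w'"
    and momentum_eq: "AE t in lebesgue_on {0<..<T}. AE x in lebesgue_on \<Omega>.
           v' t x + convection \<Omega> (v t) x + cross3 (a' t - w' t) x
             + 2 *\<^sub>R cross3 (a t - om (v t)) (v t x)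
             - \<nu> *\<^sub>R lap (v t) x + weak_grad \<Omega> (p t) x = 0"
    and angular_eq: "AE t in lebesgue_on {0<..<T}.
           I *v a' t + cross3 (a t - om (v t)) (I *v a t) = 0"

sublocale fluid_solution \<subseteq> strong_path \<Omega> T v v'
proof
  show "T > 0" by (rule T_pos)
  show "v t \<in> L2 \<Omega>" if "t \<in> {0..T}" for t
    using v_time that unfolding H1_time_L2_sigma_def by (auto intro: L2_sigma_L2)
  have b: "bochner_L2 T (L2_sigma \<Omega>) nm v'" using v_time unfolding H1_time_L2_sigma_def by simp
  then show "smeas T v'" by (rule bochner_smeas) (auto intro: L2_sigma_L2)
  show "integrable (lebesgue_on {0<..<T}) (\<lambda>t. (nm (v' t))\<^sup>2)" using b unfolding bochner_L2_def by simp
  show "(\<lambda>x. v t x - v s x) \<cdot> h = (LINT r|lebesgue_on {s..t}. v' r \<cdot> h)"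
    if "0 \<le> s" "s \<le> t" "t \<le> T" "h \<in> L2 \<Omega>" for s t h
    using v_time that unfolding H1_time_L2_sigma_def by simp
  have "AE t in lebesgue_on {0<..<T}. v t \<in> H2_0_sigma \<Omega>" using v_space unfolding bochner_L2_def by simp
  then show reg: "AE t in lebesgue_on {0<..<T}. v t \<in> H2 \<Omega> \<and> v t \<in> H1_0 \<Omega>"
    by eventually_elim (simp add: H2_0_sigma_def)
  show sm: "smeas T (\<lambda>t. lap (v t))"
    by (rule smeas_laplacian[OF v_space]) (auto simp: H2_0_sigma_def)
  show "integrable (lebesgue_on {0<..<T}) (\<lambda>t. (nm (lap (v t)))\<^sup>2)"
  proof (rule integrable_dominated)
    show "integrable (lebesgue_on {0<..<T}) (\<lambda>t. 9 * (norm_H2 \<Omega> (v t))\<^sup>2)"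
      using v_space unfolding bochner_L2_def by simp
    show "(\<lambda>t. (nm (lap (v t)))\<^sup>2) \<in> borel_measurable (lebesgue_on {0<..<T})"
      by (intro borel_measurable_power smeas_nm sm)
    show "AE t in lebesgue_on {0<..<T}. norm ((nm (lap (v t)))\<^sup>2) \<le> norm (9 * (norm_H2 \<Omega> (v t))\<^sup>2)"
      using reg
    proof eventually_elim
      case (elim t)
      then have "(nm (lap (v t)))\<^sup>2 \<le> (3 * norm_H2 \<Omega> (v t))\<^sup>2"
        by (intro power_mono nm_laplacian_le) auto
      then show ?case by (simp add: power_mult_distrib)
    qed
  qed
qed

context fluid_solution
begin

abbreviation Om where "Om t \<equiv> om (v t)"

lemma a_ac: "ac_on 0 T a a'"
  by (rule has_weak_time_deriv_ac[OF a_time])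

lemma Ia_ac: "ac_on 0 T (\<lambda>t. I *v a t) (\<lambda>t. I *v a' t)"
  by (rule ac_on_linear[OF _ a_ac]) simp

text \<open>A solution provides \<open>w'\<close> only as some weak derivative of \<omega>. Pairing
  with the rotations about the coordinate axes shows that the components of I w' and of I
  \<omega>(v') are densities of the same functions of time, hence agree almost everywhere.\<close>

lemma w'_eq: "AE t in lebesgue_on {0<..<T}. w' t = om (v' t)"
proof -
  define d where "d i t = v' t \<cdot> (\<lambda>x. cross3 (axis i 1) x) + - ((I *v w' t) \<bullet> axis i 1)" for i :: 3 and t
  have "negligible {t\<in>{0<..<T}. d i t \<noteq> 0}" for i
  proof (rule ac_on_zero_derivative)
    have "bounded_linear (\<lambda>y::real^3. - ((I *v y) \<bullet> axis i 1))"
      by (intro bounded_linear_minus bounded_linear_inner_left_comp) simp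
    from ac_on_add[OF v_weak_ac[OF rot_L2] ac_on_linear[OF this has_weak_time_deriv_ac[OF w_time]]]
    show "ac_on 0 T (\<lambda>t. v t \<cdot> (\<lambda>x. cross3 (axis i 1) x) + - ((I *v Om t) \<bullet> axis i 1)) (d i)"
      unfolding d_def .
    have "v t \<cdot> (\<lambda>x. cross3 (axis i 1) x) + - ((I *v Om t) \<bullet> axis i 1) = 0" if "t \<in> {0<..<T}" for t
      using that om_inner[OF v_L2, of t "axis i 1"] by (simp add: ip_commute)
    then show "v s \<cdot> (\<lambda>x. cross3 (axis i 1) x) + - ((I *v Om s) \<bullet> axis i 1) =
        v t \<cdot> (\<lambda>x. cross3 (axis i 1) x) + - ((I *v Om t) \<bullet> axis i 1)"
      if "s \<in> {0<..<T}" "t \<in> {0<..<T}" for s t using that by simp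
  qed
  then have "negligible (\<Union>i\<in>UNIV. {t\<in>{0<..<T}. d i t \<noteq> 0})" by (intro negligible_Union) auto
  then have "AE t in lebesgue_on {0<..<T}. \<forall>i. d i t = 0"
    unfolding AE_Ioo_iff by (intro exI[of _ "\<Union>i\<in>UNIV. {t\<in>{0<..<T}. d i t \<noteq> 0}"]) auto
  with smeas_AE_L2[OF v'_smeas] show ?thesis
  proof eventually_elim
    case (elim t)
    have "I *v w' t = I *v om (v' t)"
    proof (subst vec_eq_iff, rule allI)
      fix i
      have "(I *v w' t) \<bullet> axis i 1 = (I *v om (v' t)) \<bullet> axis i 1"
        using elim(2)[rule_format, of i] om_inner[OF elim(1), of "axis i 1"]
        by (simp add: d_def ip_commute)
      then show "(I *v w' t) $ i = (I *v om (v' t)) $ i" by (simp add: inner_axis)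
    qed
    then show ?case by (rule I_inj)
  qed
qed

text \<open>The times at which the required almost everywhere conditions hold together, so that
  later estimates can be carried out at one fixed time.\<close>

definition regular :: "real \<Rightarrow> bool" where
  "regular t \<longleftrightarrow> v t \<in> H2 \<Omega> \<and> v t \<in> H1_0 \<Omega> \<and> v t \<in> L2_sigma \<Omega> \<and> v' t \<in> L2_sigma \<Omega> \<and> p t \<in> H1 \<Omega> \<and>
     w' t = om (v' t) \<and>
     (AE x in M. v' t x + convection \<Omega> (v t) x + cross3 (a' t - w' t) x
             + 2 *\<^sub>R cross3 (a t - Om t) (v t x)
             - \<nu> *\<^sub>R lap (v t) x + weak_grad \<Omega> (p t) x = 0) \<and>
     I *v a' t + cross3 (a t - Om t) (I *v a t) = 0"

lemma AE_regular: obtains Z where "negligible Z" "\<And>t. t \<in> {0<..<T} - Z \<Longrightarrow> regular t"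
proof -
  have 1: "AE t in lebesgue_on {0<..<T}. v t \<in> H2_0_sigma \<Omega>" using v_space unfolding bochner_L2_def by simp
  have 2: "AE t in lebesgue_on {0<..<T}. v' t \<in> L2_sigma \<Omega>"
    using v_time unfolding H1_time_L2_sigma_def bochner_L2_def by simp
  have 3: "AE t in lebesgue_on {0<..<T}. p t \<in> H1 \<Omega>" using p_space unfolding bochner_L2_def by simp
  have "AE t in lebesgue_on {0<..<T}. regular t"
    using 1 2 3 w'_eq momentum_eq angular_eq
    by eventually_elim (simp add: regular_def H2_0_sigma_def)
  then obtain Z where "negligible Z" "\<forall>t\<in>{0<..<T} - Z. regular t" unfolding AE_Ioo_iff by blast
  then show thesis by (intro that[of Z]) auto
qed

text \<open>Fields in \<open>L2_sigma\<close> are orthogonal to gradients, which removes the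
  pressure. The term (a' - \<omega>') \<times> x pairs with r to (I a' | \<omega>(r)) - (I
  \<omega>(v') | \<omega>(r)); the second part completes the pairing of v' and r to
  \<open>bil\<close>.\<close>

lemma weak_eq:
  assumes reg: "regular t" and r: "r \<in> L2_sigma \<Omega>"
  shows "bil (v' t) r + (convection \<Omega> (v t) \<cdot> r + (I *v a' t) \<bullet> om r + 2 * ((\<lambda>x. cross3 (a t - Om t) (v t x)) \<cdot> r))
    = \<nu> * (lap (v t) \<cdot> r)"
proof -
  have L: "v t \<in> L2 \<Omega>" "v' t \<in> L2 \<Omega>" "r \<in> L2 \<Omega>" "convection \<Omega> (v t) \<in> L2 \<Omega>" "lap (v t) \<in> L2 \<Omega>"
    "weak_grad \<Omega> (p t) \<in> L2 \<Omega>"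
    using reg r by (auto simp: regular_def intro: L2_sigma_L2 convection_bound laplacian_L2 weak_grad_L2)
  define f1 where "f1 x = v' t x + convection \<Omega> (v t) x" for x
  define f2 where "f2 x = f1 x + cross3 (a' t - w' t) x" for x
  define f3 where "f3 x = f2 x + 2 *\<^sub>R cross3 (a t - Om t) (v t x)" for x
  define f4 where "f4 x = f3 x - \<nu> *\<^sub>R lap (v t) x" for x
  define f5 where "f5 x = f4 x + weak_grad \<Omega> (p t) x" for x
  have f1: "f1 \<in> L2 \<Omega>" unfolding f1_def[abs_def] by (intro L2_add L)
  have f2: "f2 \<in> L2 \<Omega>" unfolding f2_def[abs_def] by (intro L2_add f1 rot_L2)
  have f3: "f3 \<in> L2 \<Omega>" unfolding f3_def[abs_def] by (intro L2_add f2 L2_scaleR cross_L2 L)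
  have f4: "f4 \<in> L2 \<Omega>" unfolding f4_def[abs_def] by (intro L2_diff f3 L2_scaleR L)
  have f5: "f5 \<in> L2 \<Omega>" unfolding f5_def[abs_def] by (intro L2_add f4 L)
  have "AE x in M. f5 x = 0" using reg unfolding regular_def f5_def f4_def f3_def f2_def f1_def by (elim conjE)
  then have "f5 \<cdot> r = (\<lambda>x. 0) \<cdot> r" by (intro ip_cong_AE f5 L) auto
  moreover have "f5 \<cdot> r = f4 \<cdot> r + weak_grad \<Omega> (p t) \<cdot> r" unfolding f5_def[abs_def] by (intro ip_add_left f4 L)
  moreover have "weak_grad \<Omega> (p t) \<cdot> r = 0"
    using r reg unfolding L2_sigma_iff regular_def by (simp add: ip_commute[of _ r])
  moreover have "f4 \<cdot> r = f3 \<cdot> r - (\<lambda>x. \<nu> *\<^sub>R lap (v t) x) \<cdot> r"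
    unfolding f4_def[abs_def] by (intro ip_diff_left f3 L2_scaleR L)
  moreover have "f3 \<cdot> r = f2 \<cdot> r + (\<lambda>x. 2 *\<^sub>R cross3 (a t - Om t) (v t x)) \<cdot> r"
    unfolding f3_def[abs_def] by (intro ip_add_left f2 L2_scaleR cross_L2 L)
  moreover have "f2 \<cdot> r = f1 \<cdot> r + (\<lambda>x. cross3 (a' t - w' t) x) \<cdot> r"
    unfolding f2_def[abs_def] by (intro ip_add_left f1 rot_L2 L)
  moreover have "f1 \<cdot> r = v' t \<cdot> r + convection \<Omega> (v t) \<cdot> r"
    unfolding f1_def[abs_def] by (intro ip_add_left L)
  moreover have "(\<lambda>x. cross3 (a' t - w' t) x) \<cdot> r = (I *v a' t) \<bullet> om r - (I *v om (v' t)) \<bullet> om r"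
  proof -
    have w: "w' t = om (v' t)" using reg by (simp add: regular_def)
    show ?thesis
      unfolding om_inner[OF L(3), symmetric] I_sym[of "om r"] w matrix_vector_mult_diff_distrib inner_diff_right
      by (simp only: inner_commute[of "om r"])
  qed
  ultimately show ?thesis by (simp add: bil_def ip_scaleR_left)
qed

text \<open>I a' is minus the cross product of a - \<omega> and I a, hence orthogonal to both. The
  first relation gives conservation of momentum, the second the cancellation in the energy
  balance.\<close>

lemma angular_orthogonal:
  assumes "regular t"
  shows "(I *v a' t) \<bullet> (I *v a t) = 0" "(I *v a' t) \<bullet> Om t = (I *v a' t) \<bullet> a t"
proof -
  have eq: "I *v a' t = - cross3 (a t - Om t) (I *v a t)"
    using assms unfolding regular_def by (simp add: eq_neg_iff_add_eq_0)
  show "(I *v a' t) \<bullet> (I *v a t) = 0" by (simp add: eq dot_cross_self)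
  have "(I *v a' t) \<bullet> (a t - Om t) = 0" by (simp add: eq dot_cross_self)
  then show "(I *v a' t) \<bullet> Om t = (I *v a' t) \<bullet> a t" by (simp add: inner_diff_right)
qed

lemma momentum_conserved:
  assumes "t \<in> {0..T}" shows "norm (I *v a t) = norm (I *v a 0)"
proof -
  obtain Z where Z: "negligible Z" "\<And>t. t \<in> {0<..<T} - Z \<Longrightarrow> regular t" by (rule AE_regular) (rule that)
  have "(I *v a t) \<bullet> (I *v a t) = (I *v a 0) \<bullet> (I *v a 0)"
  proof (rule ac_on_const[OF ac_on_bilinear[OF bounded_bilinear_inner Ia_ac Ia_ac] Z(1)])
    fix r assume "r \<in> {0<..<t} - Z"
    then have "regular r" using assms by (intro Z) auto
    from angular_orthogonal(1)[OF this]
    show "(I *v a' r) \<bullet> (I *v a r) + (I *v a r) \<bullet> (I *v a' r) = 0" by (simp add: inner_commute)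
  qed (use assms in auto)
  then show ?thesis by (simp add: norm_eq)
qed

lemma bil_ac: "ac_on 0 T (\<lambda>t. bil (v t) (v t)) (\<lambda>t. 2 * (v' t \<cdot> kinetic (v t)))"
proof (rule ac_on_cong)
  have sym: "u \<cdot> kinetic w = kinetic u \<cdot> w" if "u \<in> L2 \<Omega>" "w \<in> L2 \<Omega>" for u w
    using that by (simp add: ip_kinetic ip_commute[of "kinetic u"] bil_sym[of u])
  obtain K where K: "K \<ge> 0" "\<And>u. u \<in> L2 \<Omega> \<Longrightarrow> norm (om u) \<le> K * nm u" by (rule om_bound) (rule that)
  \<comment> \<open>|\<omega> \<times> x|^2 \<le> (I \<omega> | \<omega>) = (\<omega> \<times> x |
    u) gives |\<omega> \<times> x| \<le> |u|, hence the factor 2.\<close>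
  have b: "nm (kinetic u) \<le> 2 * nm u" if u: "u \<in> L2 \<Omega>" for u
  proof -
    define e where "e = om u"
    have IB: "(I_B *v e) \<bullet> e \<ge> 0" using body_posdef[of e] by (cases "e = 0") auto
    have "(nm (\<lambda>x. cross3 e x))\<^sup>2 \<le> (I *v e) \<bullet> e"
      using IB by (simp add: nm_sq fluid_inertia_form[symmetric] total_inertia matrix_vector_mult_add_rdistrib inner_add_left)
    also have "\<dots> = (\<lambda>x. cross3 e x) \<cdot> u" unfolding e_def by (rule om_inner[OF u])
    also have "\<dots> \<le> nm (\<lambda>x. cross3 e x) * nm u" using ip_bound[OF rot_L2 u, of e] by linarith
    finally have "nm (\<lambda>x. cross3 e x) * nm (\<lambda>x. cross3 e x) \<le> nm (\<lambda>x. cross3 e x) * nm u"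
      by (simp add: power2_eq_square)
    then have "nm (\<lambda>x. cross3 e x) \<le> nm u"
      using nm_nonneg[of "\<lambda>x. cross3 e x"] nm_nonneg[of u] by (cases "nm (\<lambda>x. cross3 e x) = 0") (auto simp: mult_le_cancel_left)
    then show ?thesis
      using nm_diff[OF u rot_L2[of e]] unfolding kinetic_def[abs_def] e_def by linarith
  qed
  show "ac_on 0 T (\<lambda>t. v t \<cdot> kinetic (v t)) (\<lambda>t. 2 * (v' t \<cdot> kinetic (v t)))"
    by (rule quadratic_ac[OF kinetic_L2 sym _ b]) auto
  show "bil (v t) (v t) = v t \<cdot> kinetic (v t)" if "t \<in> {0..T}" for t using v_L2[OF that] by (simp add: ip_kinetic)
qed simp

text \<open>Tested with v itself, \<open>weak_eq\<close> loses the convective term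
  (\<open>convection_orthogonal\<close>) and the Coriolis term, a cross product with v.\<close>

lemma dissipation:
  assumes reg: "regular t"
  shows "v' t \<cdot> kinetic (v t) + (I *v a' t) \<bullet> Om t = - \<nu> * grad_sq (v t)"
    and "v' t \<cdot> kinetic (v t) = bil (v' t) (v t)"
proof -
  have r: "v t \<in> H2 \<Omega>" "v t \<in> H1_0 \<Omega>" "v t \<in> L2_sigma \<Omega>" "v' t \<in> L2_sigma \<Omega>" using reg by (auto simp: regular_def)
  show k: "v' t \<cdot> kinetic (v t) = bil (v' t) (v t)" by (intro ip_kinetic L2_sigma_L2 r)
  have "(\<lambda>x. cross3 (a t - Om t) (v t x)) \<cdot> v t = 0" by (simp add: inner_L2_def dot_cross_self)
  then show "v' t \<cdot> kinetic (v t) + (I *v a' t) \<bullet> Om t = - \<nu> * grad_sq (v t)"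
    using weak_eq[OF reg r(3)] unfolding k
    by (simp add: convection_orthogonal[OF r(1-3)] grad_sq_eq[OF r(1,2)])
qed

text \<open>Twice the energy along the solution (\<open>En_energy\<close>).\<close>

definition En where "En t = bil (v t) (v t) + (I *v a t) \<bullet> a t"

lemma En_ac: "ac_on 0 T En (\<lambda>t. 2 * (v' t \<cdot> kinetic (v t)) + ((I *v a' t) \<bullet> a t + (I *v a t) \<bullet> a' t))"
  unfolding En_def[abs_def] by (intro ac_on_add bil_ac ac_on_bilinear[OF bounded_bilinear_inner Ia_ac a_ac])

text \<open>The exchange term (I a' | \<omega>) in the balance of v equals (I a' | a), the term from
  the angular momentum equation, by \<open>angular_orthogonal\<close>; they cancel and only the
  viscous term remains.\<close>

lemma energy_inequality:
  assumes st: "0 \<le> s" "s \<le> t" "t \<le> T"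
  shows "En t \<le> En s + integral {s..t} (\<lambda>r. - (2 * \<nu>) * grad_sq (v r))"
proof -
  obtain Z where Z: "negligible Z" "\<And>t. t \<in> {0<..<T} - Z \<Longrightarrow> regular t" by (rule AE_regular) (rule that)
  show ?thesis
  proof (rule ac_on_le[OF ac_on_subset[OF En_ac st(1,3)] Z(1)])
    fix r assume "r \<in> {s<..<t} - Z"
    then have reg: "regular r" using st by (intro Z) auto
    have "(I *v a r) \<bullet> a' r = (I *v a' r) \<bullet> a r" by (simp only: I_sym[of "a r"] inner_commute[of "a r"])
    then show "2 * (v' r \<cdot> kinetic (v r)) + ((I *v a' r) \<bullet> a r + (I *v a r) \<bullet> a' r) \<le> - (2 * \<nu>) * grad_sq (v r)"
      using dissipation(1)[OF reg] angular_orthogonal(2)[OF reg] by simp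
  next
    show "(\<lambda>r. - (2 * \<nu>) * grad_sq (v r)) integrable_on {s..t}"
      using integrable_on_cmult_left[OF subinterval_integrable(1)[OF grad_sq_int st(1,3)], of "- (2 * \<nu>)"] by simp
  qed (rule st)
qed

lemma rest_of_constant_energy:
  assumes st: "0 \<le> s" "s < t" "t \<le> T" and E: "En s \<le> En t" and r: "r \<in> {s..t}"
  shows "nm (v r) = 0"
proof -
  have i: "integrable (lebesgue_on {s..t}) (\<lambda>r. grad_sq (v r))"
    by (rule subinterval_integrable(2)[OF grad_sq_int st(1,3)])
  have "integral {s..t} (\<lambda>r. - (2 * \<nu>) * grad_sq (v r)) = - (2 * \<nu>) * integral {s..t} (\<lambda>r. grad_sq (v r))"
    by (rule integral_mult_right)
  then have "2 * \<nu> * integral {s..t} (\<lambda>r. grad_sq (v r)) \<le> 0"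
    using energy_inequality[of s t] st E by simp
  then have "integral {s..t} (\<lambda>r. grad_sq (v r)) \<le> 0"
    using viscosity by (simp add: mult_le_0_iff)
  moreover have "integral {s..t} (\<lambda>r. grad_sq (v r)) \<ge> 0"
    by (intro Henstock_Kurzweil_Integration.integral_nonneg subinterval_integrable(1)[OF grad_sq_int st(1,3)] grad_sq_nonneg)
  ultimately have "(LINT r|lebesgue_on {s..t}. grad_sq (v r)) = 0"
    using subinterval_integrable(3)[OF grad_sq_int st(1,3)] by simp
  then have "AE r in lebesgue_on {s..t}. grad_sq (v r) = 0"
    using integral_nonneg_eq_0_iff_AE[OF i AE_I2[OF grad_sq_nonneg]] by simp
  then have "AE r in lebesgue_on {s<..<t}. grad_sq (v r) = 0"
    by (simp only: AE_lebesgue_on_iff lebesgue_Icc lebesgue_Ioo) (erule negligible_subset, auto)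
  then obtain Z1 where Z1: "negligible Z1" "\<And>r. r \<in> {s<..<t} - Z1 \<Longrightarrow> grad_sq (v r) = 0"
    unfolding AE_Ioo_iff by blast
  obtain Z where Z: "negligible Z" "\<And>t. t \<in> {0<..<T} - Z \<Longrightarrow> regular t" by (rule AE_regular) (rule that)
  \<comment> \<open>Vanishing at almost every time extends to every time: |v|^2 is continuous and
    nonnegative and has integral zero.\<close>
  define y where "y = (\<lambda>r. v r \<cdot> v r)"
  have cy: "continuous_on {s..t} y"
  proof -
    have "ac_on 0 T y (\<lambda>t. 2 * (v' t \<cdot> v t))" unfolding y_def by (rule quadratic_ac[of "\<lambda>w. w" 1]) auto
    then show ?thesis using st by (auto intro: continuous_on_subset ac_on_continuous)
  qed
  have "integral {s..t} y = integral {s..t} (\<lambda>_. 0)"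
  proof (rule integral_spike)
    show "negligible (insert s (insert t (Z \<union> Z1)))" using Z(1) Z1(1) by simp
    fix r assume r: "r \<in> {s..t} - insert s (insert t (Z \<union> Z1))"
    have "regular r" using r st by (intro Z) auto
    moreover have "grad_sq (v r) = 0" using r by (intro Z1) auto
    ultimately have "AE x in M. v r x = 0" by (intro H1_0_grad_zero) (auto simp: regular_def)
    moreover have "v r \<in> L2 \<Omega>" using r st by (intro v_L2) auto
    ultimately have "nm (v r) = 0" by (simp add: nm_eq_0)
    then show "0 = y r" by (simp add: y_def nm_sq[symmetric])
  qed
  then have "integral {s..t} y = 0" by simp
  moreover have "y q \<ge> 0" for q unfolding y_def by (rule ip_self_nonneg)
  ultimately have "\<forall>r\<in>{s..t}. y r = 0" by (simp only: integral_eq_0_iff[OF cy st(2)])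
  then show ?thesis using r by (simp add: y_def norm_L2_def)
qed

text \<open>Besides the equilibrium condition at the left end, it records that the pressure gradient
  vanishes at almost every time of rest; the constant pressure of an equilibrium comes from
  there.\<close>

lemma rest_imp_equilibrium:
  assumes st: "0 \<le> s" "s < t" "t \<le> T" and rest: "\<And>r. r \<in> {s..t} \<Longrightarrow> nm (v r) = 0"
  obtains Z where "negligible Z" "\<And>r. r \<in> {s<..<t} - Z \<Longrightarrow> AE x in M. weak_grad \<Omega> (p r) x = 0"
    "\<And>r. r \<in> {s<..<t} - Z \<Longrightarrow> p r \<in> H1 \<Omega>"
    "cross3 (a s) (I *v a s) = 0"
proof -
  have vz: "AE x in M. v r x = 0" if "r \<in> {s..t}" for r
    using rest[OF that] v_L2[of r] that st by (simp add: nm_eq_0)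
  obtain K where K: "K \<ge> 0" "\<And>u. u \<in> L2 \<Omega> \<Longrightarrow> norm (om u) \<le> K * nm u" by (rule om_bound) (rule that)
  have Om0: "om u = 0" if "u \<in> L2 \<Omega>" "nm u = 0" for u using K(2)[OF that(1)] that(2) by simp
  obtain Z where Z: "negligible Z" "\<And>t. t \<in> {0<..<T} - Z \<Longrightarrow> regular t" by (rule AE_regular) (rule that)
  have "nm (\<lambda>x. v q x - v r x) = 0" if "r \<in> {s<..<t}" "q \<in> {s<..<t}" for r q
  proof -
    have L: "v q \<in> L2 \<Omega>" "v r \<in> L2 \<Omega>" using that st by (auto intro: v_L2)
    have "nm (\<lambda>x. v q x - v r x) \<le> 0" using nm_diff[OF L] rest[of q] rest[of r] that by simp
    then show ?thesis using nm_nonneg[of "\<lambda>x. v q x - v r x"] by (rule antisym)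
  qed
  from v'_zero_of_constant[OF st(1,3) this]
  obtain Z1 where Z1: "negligible Z1" "\<And>r. r \<in> {s<..<t} - Z1 \<Longrightarrow> nm (v' r) = 0" by blast
  have key: "a' r = 0 \<and> (AE x in M. weak_grad \<Omega> (p r) x = 0) \<and> Om r = 0 \<and> regular r" if r: "r \<in> {s<..<t} - (Z \<union> Z1)" for r
  proof -
    have reg: "regular r" using r st by (intro Z) auto
    have L: "v r \<in> L2 \<Omega>" "v' r \<in> L2 \<Omega>" using reg by (auto simp: regular_def L2_sigma_L2)
    have n: "nm (v r) = 0" "nm (v' r) = 0" using r by (auto intro: rest Z1)
    have v0: "AE x in M. v r x = 0" "AE x in M. v' r x = 0" using n L by (simp_all add: nm_eq_0)
    have o: "Om r = 0" "w' r = 0" using reg Om0[OF L(1) n(1)] Om0[OF L(2) n(2)] by (auto simp: regular_def)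
    have "AE x in M. v' r x + convection \<Omega> (v r) x + cross3 (a' r - w' r) x
             + 2 *\<^sub>R cross3 (a r - Om r) (v r x)
             - \<nu> *\<^sub>R lap (v r) x + weak_grad \<Omega> (p r) x = 0"
      using reg unfolding regular_def by (elim conjE)
    with v0 zero_class_operators[OF v0(1)]
    have eq: "AE x in M. cross3 (a' r) x + weak_grad \<Omega> (p r) x = 0"
      by eventually_elim (simp add: o)
    have "a' r = 0" using ne _ eq by (rule rigid_rotation_not_gradient) (use reg in \<open>simp add: regular_def\<close>)
    then show ?thesis using eq o reg by simp
  qed
  have nZ: "negligible (Z \<union> Z1)" by (intro negligible_Un Z Z1)
  obtain r where r: "r \<in> {s<..<t} - (Z \<union> Z1)" by (rule interval_diff_negligible[OF st(2) nZ]) (rule that)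
  have "a r = a s"
    by (rule ac_on_const[OF a_ac nZ]) (use r st key in auto)
  moreover have "I *v a' r + cross3 (a r - Om r) (I *v a r) = 0" "a' r = 0" "Om r = 0"
    using key[OF r] unfolding regular_def by blast+
  ultimately have "cross3 (a s) (I *v a s) = 0" by simp
  then show thesis using key by (intro that[OF nZ]) (auto simp: regular_def)
qed

end

subsection \<open>Uniqueness near an equilibrium\<close>

lemma ac_on_shift: "ac_on a b f f' \<Longrightarrow> ac_on a b (\<lambda>t. f t - c) f'"
  by (simp add: ac_on_def)

context fluid_body
begin

lemma nm_cross_le: "u \<in> L2 \<Omega> \<Longrightarrow> nm (\<lambda>x. cross3 e (u x)) \<le> norm e * nm u"
  by (rule nm_mono) (simp_all add: cross_L2 norm_cross_le)

lemma I_bounds: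
  obtains K B where "K \<ge> 0" "B > 0" "\<And>x. norm (I *v x) \<le> K * norm x" "\<And>x. B * norm x \<le> norm (I *v x)"
proof -
  obtain K where K: "\<And>x. norm (I *v x) \<le> norm x * K"
    using bounded_linear.nonneg_bounded[OF matrix_vector_mul_bounded_linear, of I] by blast
  have "linear ((*v) I)" "inj ((*v) I)" by (auto intro: injI I_inj)
  then obtain B where B: "B > 0" "\<And>x. B * norm x \<le> norm (I *v x)" by (rule linear_inj_bounded_below_pos) (rule that)
  have "norm (I *v x) \<le> \<bar>K\<bar> * norm x" for x
    by (rule order_trans[OF K[of x]]) (simp add: mult.commute mult_right_mono)
  then show thesis by (intro that[of "\<bar>K\<bar>" B] B) auto
qed

end

text \<open>Two separate completions: 2 c s^2 - 2 g s + g^2 / (2 c) and 2 |\<Lambda> d + e/2|^2 are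
  both nonnegative. In the application \<rho> is \<open>bil r r\<close>, s the norm of the test
  field r, F the forcing paired with r, d = a - b and e = a'.\<close>

lemma completed_squares:
  fixes \<rho> g s c \<Lambda> F :: real and d e :: "real^3"
  assumes c: "c > 0" and \<rho>: "\<rho> \<ge> c * s\<^sup>2" and F: "\<bar>F\<bar> \<le> g * s"
  shows "- 2 * \<rho> - 2 * F - 2 * \<Lambda>\<^sup>2 * (d \<bullet> d) - 2 * \<Lambda> * (d \<bullet> e) \<le> g\<^sup>2 / (2 * c) + (norm e)\<^sup>2 / 2"
proof -
  have "0 \<le> (2 * c * s - g)\<^sup>2 / (2 * c)" using c by simp
  also have "\<dots> = 2 * (c * s\<^sup>2) - 2 * (g * s) + g\<^sup>2 / (2 * c)" using c by (simp add: power2_eq_square field_simps)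
  finally have 1: "- 2 * \<rho> - 2 * F \<le> g\<^sup>2 / (2 * c)" using \<rho> F by linarith
  have "0 \<le> 2 * ((\<Lambda> *\<^sub>R d + (1/2) *\<^sub>R e) \<bullet> (\<Lambda> *\<^sub>R d + (1/2) *\<^sub>R e))" by simp
  also have "\<dots> = 2 * \<Lambda>\<^sup>2 * (d \<bullet> d) + 2 * \<Lambda> * (d \<bullet> e) + (norm e)\<^sup>2 / 2"
    by (simp add: inner_add_left inner_add_right inner_commute[of e d] power2_norm_eq_inner power2_eq_square[of \<Lambda>] algebra_simps)
  finally show ?thesis using 1 by linarith
qed

locale fluid_near_equilibrium = fluid_solution +
  fixes b :: "real^3"
  assumes b: "cross3 b (I *v b) = 0"
begin

text \<open>Measures the squared distance from the equilibrium (0, b), by \<open>bil\<close> in v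
  and by the Euclidean norm in a; \<open>y'\<close> is its density in the sense of
  \<open>ac_on\<close> (\<open>y_ac\<close>).\<close>

definition y where "y t = bil (v t) (v t) + (a t - b) \<bullet> (a t - b)"
definition y' where "y' t = 2 * (v' t \<cdot> kinetic (v t)) + (a' t \<bullet> (a t - b) + (a t - b) \<bullet> a' t)"

lemma y_ac: "ac_on 0 T y y'"
  unfolding y_def[abs_def] y'_def[abs_def]
  by (intro ac_on_add bil_ac ac_on_bilinear[OF bounded_bilinear_inner] ac_on_shift a_ac)

text \<open>Subtracting b \<times> I b = 0 leaves only terms containing a - b or \<omega>, so that I
  a' is small together with the distance to the equilibrium.\<close>

lemma angular_decomposition:
  assumes "regular t"
  shows "I *v a' t = - (cross3 b (I *v (a t - b)) + cross3 (a t - b - Om t) (I *v a t))"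
proof -
  have "I *v a' t = - cross3 (a t - Om t) (I *v a t)"
    using assms unfolding regular_def by (simp add: eq_neg_iff_add_eq_0)
  also have "cross3 (a t - Om t) (I *v a t) = cross3 b (I *v a t) + cross3 (a t - b - Om t) (I *v a t)"
    by (simp add: cross_add_left[symmetric])
  also have "cross3 b (I *v a t) = cross3 b (I *v (a t - b))"
    by (simp add: matrix_vector_mult_diff_distrib Cross3.right_diff_distrib b)
  finally show ?thesis .
qed

text \<open>Coercivity makes y dominate |v|^2 and |a - b|^2. The bounds on I a' follow from
  \<open>angular_decomposition\<close> with |I a| fixed by momentum conservation, and those on a'
  from the lower bound \<open>B\<close> of I.\<close>

lemma y_bounds:
  obtains C where "C \<ge> 1" "\<And>t. t \<in> {0..T} \<Longrightarrow> (nm (v t))\<^sup>2 \<le> C * y t" "\<And>t. t \<in> {0..T} \<Longrightarrow> (norm (a t - b))\<^sup>2 \<le> C * y t"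
    "\<And>t. t \<in> {0..T} \<Longrightarrow> y t \<ge> 0"
    "\<And>t. t \<in> {0..T} \<Longrightarrow> regular t \<Longrightarrow> (norm (I *v a' t))\<^sup>2 \<le> C * y t"
    "\<And>t. t \<in> {0..T} \<Longrightarrow> regular t \<Longrightarrow> (norm (a' t))\<^sup>2 \<le> C * y t"
proof -
  obtain c where c: "0 < c" "c \<le> 1" "\<And>u. u \<in> L2 \<Omega> \<Longrightarrow> bil u u \<ge> c * (nm u)\<^sup>2" by (rule coercive) (rule that)
  obtain K where K: "K \<ge> 0" "\<And>u. u \<in> L2 \<Omega> \<Longrightarrow> norm (om u) \<le> K * nm u" by (rule om_bound) (rule that)
  obtain KI B where KI: "KI \<ge> 0" "B > 0" "\<And>x. norm (I *v x) \<le> KI * norm x" "\<And>x. B * norm x \<le> norm (I *v x)"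
    by (rule I_bounds) (rule that)
  define m where "m = norm (I *v a 0)"
  define C1 where "C1 = norm b * KI + m + K * m"
  have C1: "C1 \<ge> 0" unfolding C1_def m_def using KI K by simp
  define C2 where "C2 = 2 * C1\<^sup>2 * (1 / c)"
  have C2: "C2 \<ge> 0" unfolding C2_def using c by simp
  define C where "C = 1 / c + C2 + C2 / B\<^sup>2"
  have cb: "c * (nm (v t))\<^sup>2 + (norm (a t - b))\<^sup>2 \<le> y t" if "t \<in> {0..T}" for t
    using c(3)[OF v_L2[OF that]] by (simp add: y_def power2_norm_eq_inner)
  have y0: "y t \<ge> 0" if "t \<in> {0..T}" for t
    by (rule order_trans[OF _ cb[OF that]]) (use c in simp)
  have sum: "(nm (v t))\<^sup>2 + (norm (a t - b))\<^sup>2 \<le> (1 / c) * y t" if "t \<in> {0..T}" for t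
  proof -
    have "c * ((nm (v t))\<^sup>2 + (norm (a t - b))\<^sup>2) \<le> c * (nm (v t))\<^sup>2 + 1 * (norm (a t - b))\<^sup>2"
      unfolding distrib_left using c by (intro add_left_mono mult_right_mono) auto
    then have "c * ((nm (v t))\<^sup>2 + (norm (a t - b))\<^sup>2) \<le> y t" using cb[OF that] by linarith
    then show ?thesis using c by (simp add: pos_le_divide_eq mult.commute)
  qed
  have Ia': "(norm (I *v a' t))\<^sup>2 \<le> C2 * y t" if t: "t \<in> {0..T}" and reg: "regular t" for t
  proof -
    define d where "d = norm (a t - b)"
    have "norm (I *v a' t) \<le> norm (cross3 b (I *v (a t - b))) + norm (cross3 (a t - b - Om t) (I *v a t))"
      unfolding angular_decomposition[OF reg] norm_minus_cancel by (rule norm_triangle_ineq)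
    also have "\<dots> \<le> norm b * (KI * d) + (d + K * nm (v t)) * m"
    proof (rule add_mono)
      show "norm (cross3 b (I *v (a t - b))) \<le> norm b * (KI * d)"
        unfolding d_def by (rule order_trans[OF norm_cross_le]) (intro mult_left_mono KI, simp)
      have "norm (a t - b - Om t) \<le> d + K * nm (v t)"
        using norm_triangle_ineq4[of "a t - b" "Om t"] K(2)[OF v_L2[OF t]] by (simp add: d_def)
      then show "norm (cross3 (a t - b - Om t) (I *v a t)) \<le> (d + K * nm (v t)) * m"
        unfolding m_def momentum_conserved[OF t, symmetric]
        by (intro order_trans[OF norm_cross_le] mult_right_mono) auto
    qed
    also have "\<dots> = C1 * (d + nm (v t)) - (norm b * KI * nm (v t) + K * m * d + m * nm (v t))"
      by (simp add: C1_def algebra_simps)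
    also have "\<dots> \<le> C1 * (d + nm (v t))"
    proof -
      have "0 \<le> norm b * KI * nm (v t)" "0 \<le> K * m * d" "0 \<le> m * nm (v t)"
        using KI(1) K(1) nm_nonneg[of "v t"] by (auto simp: m_def d_def)
      then show ?thesis by linarith
    qed
    finally have "(norm (I *v a' t))\<^sup>2 \<le> (C1 * (d + nm (v t)))\<^sup>2" by (intro power_mono) auto
    also have "\<dots> = C1\<^sup>2 * (d + nm (v t))\<^sup>2" by (simp add: power_mult_distrib)
    also have "\<dots> \<le> C1\<^sup>2 * (2 * ((nm (v t))\<^sup>2 + d\<^sup>2))"
      using sum_squares_bound[of d "nm (v t)"] by (intro mult_left_mono) (auto simp: power2_sum)
    also have "\<dots> \<le> C1\<^sup>2 * (2 * ((1 / c) * y t))" unfolding d_def by (intro mult_left_mono sum t) auto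
    finally show ?thesis by (simp add: C2_def mult_ac)
  qed
  have le: "k * y t \<le> C * y t" if "t \<in> {0..T}" "k \<in> {1 / c, C2, C2 / B\<^sup>2}" for k t
    using that y0[of t] C2 c(1) by (intro mult_right_mono) (auto simp: C_def)
  show thesis
  proof (rule that[of C])
    have "1 \<le> 1 / c" using c(1,2) by simp
    moreover have "0 \<le> C2 / B\<^sup>2" using C2 by simp
    ultimately show "C \<ge> 1" unfolding C_def using C2 by linarith
    fix t assume t: "t \<in> {0..T}"
    show "y t \<ge> 0" by (rule y0[OF t])
    have s: "(nm (v t))\<^sup>2 + (norm (a t - b))\<^sup>2 \<le> C * y t" using sum[OF t] le[OF t, of "1 / c"] by simp
    show "(nm (v t))\<^sup>2 \<le> C * y t" by (rule order_trans[OF _ s]) simp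
    show "(norm (a t - b))\<^sup>2 \<le> C * y t" by (rule order_trans[OF _ s]) simp
    assume reg: "regular t"
    show "(norm (I *v a' t))\<^sup>2 \<le> C * y t" by (rule order_trans[OF Ia'[OF t reg] le[OF t]]) simp
    have "(B * norm (a' t))\<^sup>2 \<le> C2 * y t"
      using KI by (intro order_trans[OF power_mono[OF KI(4)[of "a' t"], of 2] Ia'[OF t reg]]) auto
    then have "(norm (a' t))\<^sup>2 \<le> C2 / B\<^sup>2 * y t"
      using KI by (simp add: power_mult_distrib pos_le_divide_eq mult.commute)
    then show "(norm (a' t))\<^sup>2 \<le> C * y t" using le[OF t, of "C2 / B\<^sup>2"] by simp
  qed
qed

text \<open>Beyond the viscous term, y' consists of 2 (a - b | a') and -2 (I a' | \<omega>). Each is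
  a product of two quantities of the order of the square root of y.\<close>

lemma y'_bound:
  obtains C where "C \<ge> 0" "\<And>t. t \<in> {0..T} \<Longrightarrow> regular t \<Longrightarrow> \<bar>y' t + 2 * \<nu> * grad_sq (v t)\<bar> \<le> C * y t"
proof -
  obtain C where C: "C \<ge> 1" "\<And>t. t \<in> {0..T} \<Longrightarrow> (nm (v t))\<^sup>2 \<le> C * y t" "\<And>t. t \<in> {0..T} \<Longrightarrow> (norm (a t - b))\<^sup>2 \<le> C * y t"
    "\<And>t. t \<in> {0..T} \<Longrightarrow> y t \<ge> 0"
    "\<And>t. t \<in> {0..T} \<Longrightarrow> regular t \<Longrightarrow> (norm (I *v a' t))\<^sup>2 \<le> C * y t"
    "\<And>t. t \<in> {0..T} \<Longrightarrow> regular t \<Longrightarrow> (norm (a' t))\<^sup>2 \<le> C * y t"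
    by (rule y_bounds) (rule that)
  obtain K where K: "K \<ge> 0" "\<And>u. u \<in> L2 \<Omega> \<Longrightarrow> norm (om u) \<le> K * nm u" by (rule om_bound) (rule that)
  show thesis
  proof (rule that[of "2 * (K * C) + 2 * C"])
    show "0 \<le> 2 * (K * C) + 2 * C" using K C by simp
    fix t assume t: "t \<in> {0..T}" and reg: "regular t"
    define q where "q = sqrt (C * y t)"
    have q: "q * q = C * y t" "q \<ge> 0" using C(1) C(4)[OF t] by (simp_all add: q_def)
    have b: "nm (v t) \<le> q" "norm (a t - b) \<le> q" "norm (I *v a' t) \<le> q" "norm (a' t) \<le> q"
      using C t reg by (auto simp: q_def intro!: real_le_rsqrt)
    have "\<bar>(I *v a' t) \<bullet> Om t\<bar> \<le> norm (I *v a' t) * norm (Om t)" by (rule Cauchy_Schwarz_ineq2)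
    also have "\<dots> \<le> q * (K * q)"
      using b K(1) K(2)[OF v_L2[OF t]] mult_left_mono[OF b(1) K(1)] q by (intro mult_mono) auto
    also have "\<dots> = K * C * y t" using q by (simp add: mult_ac)
    finally have 1: "\<bar>(I *v a' t) \<bullet> Om t\<bar> \<le> K * C * y t" .
    have "\<bar>(a t - b) \<bullet> a' t\<bar> \<le> norm (a t - b) * norm (a' t)" by (rule Cauchy_Schwarz_ineq2)
    also have "\<dots> \<le> q * q" using b q by (intro mult_mono) auto
    finally have 2: "\<bar>(a t - b) \<bullet> a' t\<bar> \<le> C * y t" using q by simp
    have "y' t + 2 * \<nu> * grad_sq (v t) = 2 * ((a t - b) \<bullet> a' t) - 2 * ((I *v a' t) \<bullet> Om t)"
      using dissipation(1)[OF reg] by (simp add: y'_def inner_commute[of "a' t"])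
    then show "\<bar>y' t + 2 * \<nu> * grad_sq (v t)\<bar> \<le> (2 * (K * C) + 2 * C) * y t"
      using 1 2 unfolding distrib_right mult.assoc by linarith
  qed
qed

text \<open>The terms of \<open>weak_eq\<close> other than \<open>bil\<close> and viscosity form a
  functional of norm at most g, with g^2 at most an integrable rate times \<nu> |\<nabla>v|^2 + y.
  Convection is estimated by \<open>convection_bound\<close> and Young's inequality, the rotational
  terms by \<open>y_bounds\<close> and the bound \<open>R\<close> on |a - \<omega>|, which rests on
  conserved momentum. The constant 576 is 3 * 192, the 3 coming from the square of a sum of three
  terms.\<close>

lemma forcing_bound:
  obtains C where "C \<ge> 0" "\<And>t r. t \<in> {0..T} \<Longrightarrow> regular t \<Longrightarrow> \<exists>g\<ge>0.
     g\<^sup>2 \<le> C * ((nm (lap (v t)))\<^sup>2 + grad_sq (v t) + 1) * (\<nu> * grad_sq (v t) + y t) \<and>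
     (\<forall>r\<in>L2 \<Omega>. \<bar>convection \<Omega> (v t) \<cdot> r + (I *v a' t) \<bullet> om r + 2 * ((\<lambda>x. cross3 (a t - Om t) (v t x)) \<cdot> r)\<bar> \<le> g * nm r)"
proof -
  obtain C where C: "C \<ge> 1" "\<And>t. t \<in> {0..T} \<Longrightarrow> (nm (v t))\<^sup>2 \<le> C * y t" "\<And>t. t \<in> {0..T} \<Longrightarrow> (norm (a t - b))\<^sup>2 \<le> C * y t"
    "\<And>t. t \<in> {0..T} \<Longrightarrow> y t \<ge> 0"
    "\<And>t. t \<in> {0..T} \<Longrightarrow> regular t \<Longrightarrow> (norm (I *v a' t))\<^sup>2 \<le> C * y t"
    "\<And>t. t \<in> {0..T} \<Longrightarrow> regular t \<Longrightarrow> (norm (a' t))\<^sup>2 \<le> C * y t"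
    by (rule y_bounds) (rule that)
  obtain K where K: "K \<ge> 0" "\<And>u. u \<in> L2 \<Omega> \<Longrightarrow> norm (om u) \<le> K * nm u" by (rule om_bound) (rule that)
  obtain KI B where KI: "KI \<ge> 0" "B > 0" "\<And>x. norm (I *v x) \<le> KI * norm x" "\<And>x. B * norm x \<le> norm (I *v x)"
    by (rule I_bounds) (rule that)
  obtain V where V: "\<And>t. t \<in> {0..T} \<Longrightarrow> nm (v t) \<le> V" by (rule v_bounded) (rule that)
  define R where "R = norm (I *v a 0) / B + K * V"
  have R: "norm (a t - Om t) \<le> R" if t: "t \<in> {0..T}" for t
  proof -
    have "norm (a t) \<le> norm (I *v a 0) / B"
      using KI(4)[of "a t"] KI(2) momentum_conserved[OF t] by (simp add: pos_le_divide_eq mult.commute)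
    moreover have "norm (Om t) \<le> K * V" using K(2)[OF v_L2[OF t]] mult_left_mono[OF V[OF t] K(1)] by linarith
    ultimately show ?thesis unfolding R_def using norm_triangle_ineq4[of "a t" "Om t"] by linarith
  qed
  define C6 where "C6 = 3 * (K\<^sup>2 * C + 4 * R\<^sup>2 * C)"
  have C6: "C6 \<ge> 0" unfolding C6_def using C by simp
  show thesis
  proof (rule that[of "576 / \<nu> + C6"])
    show "0 \<le> 576 / \<nu> + C6" using viscosity C6 by simp
    fix t assume t: "t \<in> {0..T}" and reg: "regular t"
    define l where "l = nm (lap (v t))"
    define G where "G = grad_sq (v t)"
    define h where "h = nm (convection \<Omega> (v t))"
    define g where "g = h + K * norm (I *v a' t) + 2 * (R * nm (v t))"
    have r: "v t \<in> H2 \<Omega>" "v t \<in> H1_0 \<Omega>" using reg by (auto simp: regular_def)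
    have L: "v t \<in> L2 \<Omega>" "convection \<Omega> (v t) \<in> L2 \<Omega>" using v_L2[OF t] convection_bound(1)[OF r] by auto
    have R0: "R \<ge> 0" using R[OF t] norm_ge_zero[of "a t - Om t"] by linarith
    have g0: "g \<ge> 0" unfolding g_def h_def using K R0 by simp
    have G0: "G \<ge> 0" "l \<ge> 0" unfolding G_def l_def by (simp_all add: grad_sq_nonneg)
    have y0: "y t \<ge> 0" by (rule C(4)[OF t])
    have "h\<^sup>2 \<le> 192 * l * sqrt (G ^ 3)" unfolding h_def l_def G_def by (rule convection_bound(2)[OF r])
    also have "sqrt (G ^ 3) = G * sqrt G" using G0 by (simp add: power3_eq_cube real_sqrt_mult)
    also have "192 * l * (G * sqrt G) = 192 * G * (l * sqrt G)" by simp
    also have "\<dots> \<le> 192 * G * (l\<^sup>2 + G)"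
    proof (rule mult_left_mono)
      have "2 * (l * sqrt G) \<le> l\<^sup>2 + (sqrt G)\<^sup>2" using sum_squares_bound[of l "sqrt G"] by (simp add: mult.assoc)
      moreover have "0 \<le> l * sqrt G" using G0 by simp
      moreover have "(sqrt G)\<^sup>2 = G" using G0 by simp
      ultimately show "l * sqrt G \<le> l\<^sup>2 + G" by linarith
    qed (use G0 in simp)
    finally have h2: "h\<^sup>2 \<le> 192 * G * (l\<^sup>2 + G)" .
    have sq3: "(p + q + s)\<^sup>2 \<le> 3 * (p\<^sup>2 + q\<^sup>2 + s\<^sup>2)" for p q s :: real
      using sum_squares_bound[of p q] sum_squares_bound[of p s] sum_squares_bound[of q s]
      by (simp add: power2_eq_square algebra_simps)
    have "g\<^sup>2 \<le> 3 * (h\<^sup>2 + (K * norm (I *v a' t))\<^sup>2 + (2 * (R * nm (v t)))\<^sup>2)" unfolding g_def by (rule sq3)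
    also have "\<dots> = 3 * (h\<^sup>2 + K\<^sup>2 * (norm (I *v a' t))\<^sup>2 + 4 * R\<^sup>2 * (nm (v t))\<^sup>2)" by (simp add: power_mult_distrib)
    also have "\<dots> \<le> 3 * (192 * G * (l\<^sup>2 + G) + K\<^sup>2 * (C * y t) + 4 * R\<^sup>2 * (C * y t))"
      by (intro mult_left_mono add_mono h2 C t reg) auto
    also have "\<dots> = 576 / \<nu> * (l\<^sup>2 + G) * (\<nu> * G) + C6 * 1 * y t"
      using viscosity by (simp add: C6_def field_simps)
    also have "\<dots> \<le> (576 / \<nu> + C6) * (l\<^sup>2 + G + 1) * (\<nu> * G) + (576 / \<nu> + C6) * (l\<^sup>2 + G + 1) * y t"
    proof (intro add_mono mult_right_mono)
      show "576 / \<nu> * (l\<^sup>2 + G) \<le> (576 / \<nu> + C6) * (l\<^sup>2 + G + 1)"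
        using viscosity C6 G0 by (intro mult_mono) auto
      show "C6 * 1 \<le> (576 / \<nu> + C6) * (l\<^sup>2 + G + 1)"
        using viscosity C6 G0 by (intro mult_mono) auto
    qed (use viscosity G0 y0 in auto)
    also have "\<dots> = (576 / \<nu> + C6) * (l\<^sup>2 + G + 1) * (\<nu> * G + y t)" by (simp add: distrib_left)
    finally have g2: "g\<^sup>2 \<le> (576 / \<nu> + C6) * (l\<^sup>2 + G + 1) * (\<nu> * G + y t)" .
    show "\<exists>g\<ge>0. g\<^sup>2 \<le> (576 / \<nu> + C6) * ((nm (lap (v t)))\<^sup>2 + grad_sq (v t) + 1) * (\<nu> * grad_sq (v t) + y t) \<and>
     (\<forall>r\<in>L2 \<Omega>. \<bar>convection \<Omega> (v t) \<cdot> r + (I *v a' t) \<bullet> om r + 2 * ((\<lambda>x. cross3 (a t - Om t) (v t x)) \<cdot> r)\<bar> \<le> g * nm r)"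
    proof (intro exI[of _ g] conjI g0 ballI)
      show "g\<^sup>2 \<le> (576 / \<nu> + C6) * ((nm (lap (v t)))\<^sup>2 + grad_sq (v t) + 1) * (\<nu> * grad_sq (v t) + y t)"
        using g2 unfolding l_def G_def .
      fix r :: "real^3 \<Rightarrow> real^3" assume r: "r \<in> L2 \<Omega>"
      have 1: "\<bar>convection \<Omega> (v t) \<cdot> r\<bar> \<le> h * nm r" unfolding h_def by (rule ip_bound[OF L(2) r])
      have "\<bar>(I *v a' t) \<bullet> om r\<bar> \<le> norm (I *v a' t) * (K * nm r)"
        by (rule order_trans[OF Cauchy_Schwarz_ineq2]) (intro mult_left_mono K r, simp)
      then have 2: "\<bar>(I *v a' t) \<bullet> om r\<bar> \<le> K * norm (I *v a' t) * nm r" by (simp add: mult_ac)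
      have "\<bar>(\<lambda>x. cross3 (a t - Om t) (v t x)) \<cdot> r\<bar> \<le> nm (\<lambda>x. cross3 (a t - Om t) (v t x)) * nm r"
        by (rule ip_bound[OF cross_L2[OF L(1)] r])
      also have "\<dots> \<le> R * nm (v t) * nm r"
        by (intro mult_right_mono order_trans[OF nm_cross_le[OF L(1)]] R t nm_nonneg)
      finally have 3: "\<bar>(\<lambda>x. cross3 (a t - Om t) (v t x)) \<cdot> r\<bar> \<le> R * nm (v t) * nm r" .
      show "\<bar>convection \<Omega> (v t) \<cdot> r + (I *v a' t) \<bullet> om r + 2 * ((\<lambda>x. cross3 (a t - Om t) (v t x)) \<cdot> r)\<bar> \<le> g * nm r"
        using 1 2 3 unfolding g_def distrib_right mult.assoc by linarith
    qed
  qed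
qed

text \<open>With \<open>\<Lambda> = \<nu> |\<nabla>v|\<^sup>2 / y\<close> the equation is tested with \<open>r = v' + \<Lambda> v\<close>; the dangerous terms then
  combine into squares of the favourable sign.\<close>

lemma quotient_inequality:
  obtains C where "C \<ge> 0" "\<And>t. t \<in> {0..T} \<Longrightarrow> regular t \<Longrightarrow> y t > 0 \<Longrightarrow>
     y t * (- (2 * \<nu>) * (lap (v t) \<cdot> v' t)) - \<nu> * grad_sq (v t) * y' t
      \<le> y t * (C * ((nm (lap (v t)))\<^sup>2 + grad_sq (v t) + 1) * (\<nu> * grad_sq (v t) + y t))"
proof -
  obtain C where C: "C \<ge> 1" "\<And>t. t \<in> {0..T} \<Longrightarrow> (nm (v t))\<^sup>2 \<le> C * y t" "\<And>t. t \<in> {0..T} \<Longrightarrow> (norm (a t - b))\<^sup>2 \<le> C * y t"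
    "\<And>t. t \<in> {0..T} \<Longrightarrow> y t \<ge> 0"
    "\<And>t. t \<in> {0..T} \<Longrightarrow> regular t \<Longrightarrow> (norm (I *v a' t))\<^sup>2 \<le> C * y t"
    "\<And>t. t \<in> {0..T} \<Longrightarrow> regular t \<Longrightarrow> (norm (a' t))\<^sup>2 \<le> C * y t"
    by (rule y_bounds) (rule that)
  obtain c where c: "0 < c" "c \<le> 1" "\<And>u. u \<in> L2 \<Omega> \<Longrightarrow> bil u u \<ge> c * (nm u)\<^sup>2" by (rule coercive) (rule that)
  obtain C' where C': "C' \<ge> 0" "\<And>t r. t \<in> {0..T} \<Longrightarrow> regular t \<Longrightarrow> \<exists>g\<ge>0.
     g\<^sup>2 \<le> C' * ((nm (lap (v t)))\<^sup>2 + grad_sq (v t) + 1) * (\<nu> * grad_sq (v t) + y t) \<and>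
     (\<forall>r\<in>L2 \<Omega>. \<bar>convection \<Omega> (v t) \<cdot> r + (I *v a' t) \<bullet> om r + 2 * ((\<lambda>x. cross3 (a t - Om t) (v t x)) \<cdot> r)\<bar> \<le> g * nm r)"
    by (rule forcing_bound) (rule that)
  show thesis
  proof (rule that[of "C' / (2 * c) + C / 2"])
    show "0 \<le> C' / (2 * c) + C / 2" using C C' c by simp
    fix t assume t: "t \<in> {0..T}" and reg: "regular t" and yt: "y t > 0"
    define k where "k = (nm (lap (v t)))\<^sup>2 + grad_sq (v t) + 1"
    define N where "N = \<nu> * grad_sq (v t)"
    define \<Lambda> where "\<Lambda> = N / y t"
    define l where "l = lap (v t) \<cdot> v' t"
    have N: "N = \<Lambda> * y t" "N \<ge> 0" using yt viscosity grad_sq_nonneg[of "v t"] by (auto simp: \<Lambda>_def N_def)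
    have k1: "k \<ge> 1" unfolding k_def using grad_sq_nonneg[of "v t"] by simp
    obtain g where g: "g \<ge> 0" "g\<^sup>2 \<le> C' * k * (N + y t)"
      "\<And>r. r \<in> L2 \<Omega> \<Longrightarrow> \<bar>convection \<Omega> (v t) \<cdot> r + (I *v a' t) \<bullet> om r + 2 * ((\<lambda>x. cross3 (a t - Om t) (v t x)) \<cdot> r)\<bar> \<le> g * nm r"
      using C'(2)[OF t reg] unfolding k_def N_def by blast
    have sg: "v t \<in> L2_sigma \<Omega>" "v' t \<in> L2_sigma \<Omega>" and H: "v t \<in> H2 \<Omega>" "v t \<in> H1_0 \<Omega>" using reg by (auto simp: regular_def)
    note L = L2_sigma_L2[OF sg(1)] L2_sigma_L2[OF sg(2)] laplacian_L2[OF H(1)]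
    define r where "r = (\<lambda>x. v' t x + \<Lambda> *\<^sub>R v t x)"
    have rs: "r \<in> L2_sigma \<Omega>" unfolding r_def by (intro L2_sigma_combine sg)
    have rL: "r \<in> L2 \<Omega>" by (rule L2_sigma_L2[OF rs])
    define F where "F = convection \<Omega> (v t) \<cdot> r + (I *v a' t) \<bullet> om r + 2 * ((\<lambda>x. cross3 (a t - Om t) (v t x)) \<cdot> r)"
    have bl: "bil r w = bil (v' t) w + \<Lambda> * bil (v t) w" if "w \<in> L2 \<Omega>" for w
      unfolding r_def by (simp add: bil_add_left L L2_scaleR that bil_scaleR_left)
    have br: "bil (v' t) r = bil r r - \<Lambda> * (bil (v' t) (v t) + \<Lambda> * bil (v t) (v t))"
      using bl[OF rL] bl[OF L(1)] by (simp add: bil_sym[of "v t" r] algebra_simps)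
    have lap: "lap (v t) \<cdot> r = l - \<Lambda> * grad_sq (v t)"
      unfolding r_def l_def by (simp add: ip_add_right L L2_scaleR ip_scaleR_right grad_sq_eq[OF H])
    have eq: "bil (v' t) r + F = \<nu> * l - \<Lambda> * N"
      using weak_eq[OF reg rs] unfolding F_def[symmetric] lap by (simp add: N_def algebra_simps)
    have y't: "y' t = 2 * bil (v' t) (v t) + 2 * ((a t - b) \<bullet> a' t)"
      using dissipation(2)[OF reg] by (simp add: y'_def inner_commute[of "a' t"])
    \<comment> \<open>The left side is y times the derivative of the quotient N / y. Inserting v' =
      r - \<Lambda> v in the tested equation produces \<Lambda> \<open>bil (v' t) (v t)\<close>,
      which cancels against the same term in \<Lambda> y'. The terms \<Lambda>^2
      \<open>bil (v t) (v t)\<close> and \<Lambda> N = \<Lambda>^2 y combine to \<Lambda>^2 |a -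
      b|^2.\<close>
    have "- (2 * \<nu>) * l - \<Lambda> * y' t = - 2 * bil r r - 2 * F - 2 * \<Lambda>\<^sup>2 * ((a t - b) \<bullet> (a t - b)) - 2 * \<Lambda> * ((a t - b) \<bullet> a' t)"
    proof -
      have "\<nu> * l = bil r r - \<Lambda> * (bil (v' t) (v t) + \<Lambda> * bil (v t) (v t)) + F + \<Lambda> * (\<Lambda> * y t)"
        using eq br N(1) by simp
      then show ?thesis unfolding y't by (simp add: y_def power2_eq_square algebra_simps)
    qed
    also have "\<dots> \<le> g\<^sup>2 / (2 * c) + (norm (a' t))\<^sup>2 / 2"
      by (rule completed_squares[OF c(1) c(3)[OF rL]]) (use g(3)[OF rL] in \<open>simp add: F_def\<close>)
    also have "\<dots> \<le> C' * k * (N + y t) / (2 * c) + C * k * (N + y t) / 2"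
    proof (intro add_mono divide_right_mono g(2))
      have "(norm (a' t))\<^sup>2 \<le> C * y t" by (rule C(6)[OF t reg])
      also have "\<dots> \<le> C * (k * (N + y t))"
        using C(1) k1 N(2) yt mult_mono[of 1 k "y t" "N + y t"] by (intro mult_left_mono) auto
      finally show "(norm (a' t))\<^sup>2 \<le> C * k * (N + y t)" by (simp add: mult.assoc)
    qed (use c in auto)
    finally have "- (2 * \<nu>) * l - \<Lambda> * y' t \<le> (C' / (2 * c) + C / 2) * k * (N + y t)"
      by (simp only: distrib_right times_divide_eq_left)
    then have "y t * (- (2 * \<nu>) * l - \<Lambda> * y' t) \<le> y t * ((C' / (2 * c) + C / 2) * k * (N + y t))"
      using yt by (intro mult_left_mono) auto
    also have "y t * (- (2 * \<nu>) * l - \<Lambda> * y' t) = y t * (- (2 * \<nu>) * l) - N * y' t"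
      by (simp add: N(1) algebra_simps)
    finally show "y t * (- (2 * \<nu>) * (lap (v t) \<cdot> v' t)) - \<nu> * grad_sq (v t) * y' t
      \<le> y t * ((C' / (2 * c) + C / 2) * ((nm (lap (v t)))\<^sup>2 + grad_sq (v t) + 1) * (\<nu> * grad_sq (v t) + y t))"
      unfolding k_def N_def l_def .
  qed
qed

lemma forward_uniqueness:
  assumes s: "0 \<le> s" "s \<le> t" "t \<le> T" and ys: "y s = 0"
  shows "y t = 0"
proof -
  obtain C where C: "C \<ge> 0" "\<And>t. t \<in> {0..T} \<Longrightarrow> regular t \<Longrightarrow> \<bar>y' t + 2 * \<nu> * grad_sq (v t)\<bar> \<le> C * y t"
    by (rule y'_bound) (rule that)
  obtain Z where Z: "negligible Z" "\<And>t. t \<in> {0<..<T} - Z \<Longrightarrow> regular t" by (rule AE_regular) (rule that)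
  have "y t \<le> y s * exp (C * (t - s))"
  proof (rule gronwall_upper[OF ac_on_subset[OF y_ac s(1,3)] Z(1)])
    fix r assume r: "r \<in> {s<..<t} - Z"
    have "0 \<le> 2 * \<nu> * grad_sq (v r)" using viscosity grad_sq_nonneg[of "v r"] by simp
    moreover have "\<bar>y' r + 2 * \<nu> * grad_sq (v r)\<bar> \<le> C * y r" using r s by (intro C(2) Z(2)) auto
    ultimately show "y' r \<le> C * y r" by linarith
  qed (rule s)
  moreover have "y t \<ge> 0" by (rule y_bounds) (use s in auto)
  ultimately show ?thesis using ys by simp
qed

text \<open>Let \<open>s2\<close> be the first zero of y at or after \<open>t1\<close>. On (t0, s2)
  the quotient argument gives y \<ge> \<eta> with a positive \<eta> independent of the endpoint,
  which contradicts continuity of y at \<open>s2\<close>.\<close>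

lemma backward_uniqueness:
  assumes t1: "0 \<le> t1" "t1 \<le> s" "s \<le> T" and ys: "y s = 0"
  shows "y t1 = 0"
proof (rule ccontr)
  assume ne: "y t1 \<noteq> 0"
  have y0: "y t \<ge> 0" if "t \<in> {0..T}" for t by (rule y_bounds) (use that in auto)
  have cy: "continuous_on {0..T} y" by (rule ac_on_continuous[OF y_ac])
  define S where "S = {t1..s} \<inter> y -` {0}"
  have "closed S" unfolding S_def
    by (intro continuous_closed_preimage continuous_on_subset[OF cy]) (use t1 in auto)
  then have "compact S" unfolding compact_eq_bounded_closed
    by (auto simp: S_def intro: bounded_subset[OF bounded_closed_interval])
  moreover have "s \<in> S" using t1 ys by (auto simp: S_def)
  ultimately obtain s2 where s2: "s2 \<in> S" "\<And>t. t \<in> S \<Longrightarrow> s2 \<le> t" using compact_attains_inf[of S] by blast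
  have s2': "t1 \<le> s2" "s2 \<le> s" "y s2 = 0" using s2(1) by (auto simp: S_def)
  have lt: "t1 < s2" using s2' ne by (cases "t1 = s2") auto
  have pos: "y t > 0" if "t1 \<le> t" "t < s2" for t
  proof -
    have "y t \<noteq> 0" using s2(2)[of t] that s2' by (auto simp: S_def)
    then show ?thesis using y0[of t] that t1 s2' by auto
  qed
  obtain Z where Z: "negligible Z" "\<And>t. t \<in> {0<..<T} - Z \<Longrightarrow> regular t" by (rule AE_regular) (rule that)
  obtain Z1 where Z1: "negligible Z1" "\<And>s t. s \<in> {0<..<T} - Z1 \<Longrightarrow> t \<in> {0<..<T} - Z1 \<Longrightarrow> s \<le> t \<Longrightarrow>
      grad_sq (v t) - grad_sq (v s) = integral {s..t} (\<lambda>r. - 2 * (lap (v r) \<cdot> v' r))"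
    by (rule grad_sq_ac) (rule that)
  obtain C where C: "C \<ge> 0" "\<And>t. t \<in> {0..T} \<Longrightarrow> regular t \<Longrightarrow> \<bar>y' t + 2 * \<nu> * grad_sq (v t)\<bar> \<le> C * y t"
    by (rule y'_bound) (rule that)
  obtain C' where C': "C' \<ge> 0" "\<And>t. t \<in> {0..T} \<Longrightarrow> regular t \<Longrightarrow> y t > 0 \<Longrightarrow>
     y t * (- (2 * \<nu>) * (lap (v t) \<cdot> v' t)) - \<nu> * grad_sq (v t) * y' t
      \<le> y t * (C' * ((nm (lap (v t)))\<^sup>2 + grad_sq (v t) + 1) * (\<nu> * grad_sq (v t) + y t))"
    by (rule quotient_inequality) (rule that)
  have nZ: "negligible (Z \<union> Z1)" by (intro negligible_Un Z Z1)
  \<comment> \<open>Taken outside the exceptional sets so that the integral formula of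
    \<open>grad_sq_ac\<close> may be started at \<open>t0\<close>.\<close>
  obtain t0 where t0: "t0 \<in> {t1<..<s2} - (Z \<union> Z1)" by (rule interval_diff_negligible[OF lt nZ]) (rule that)
  have t0': "0 < t0" "t0 < T" "t0 < s2" "t1 < t0" using t0 t1 s2' by auto
  define N' where "N' r = - (2 * \<nu>) * (lap (v r) \<cdot> v' r)" for r
  have N'i: "integrable (lebesgue_on {0..T}) N'" unfolding N'_def using lap_v'_int by simp
  \<comment> \<open>The absolutely continuous representative of \<nu> |\<nabla>v|^2, which agrees
    with it only at almost every time.\<close>
  define N where "N t = \<nu> * grad_sq (v t0) + integral {t0..t} N'" for t
  have Nac: "ac_on t0 T N N'"
    unfolding ac_on_def
  proof (intro conjI allI impI)
    show "integrable (lebesgue_on {t0..T}) N'" using subinterval_integrable(2)[OF N'i, of t0 T] t0' by simp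
    fix p q assume pq: "t0 \<le> p" "p \<le> q" "q \<le> T"
    have "integral {t0..p} N' + integral {p..q} N' = integral {t0..q} N'"
      by (rule HK_combine[OF pq(1,2) subinterval_integrable(1)[OF N'i]]) (use pq t0' in auto)
    then show "N q - N p = integral {p..q} N'" by (simp add: N_def)
  qed
  have Neq: "N t = \<nu> * grad_sq (v t)" if "t \<in> {t0..<T} - Z1" for t
  proof -
    have "grad_sq (v t) - grad_sq (v t0) = integral {t0..t} (\<lambda>r. - 2 * (lap (v r) \<cdot> v' r))"
      by (rule Z1(2)) (use that t0 t0' in auto)
    moreover have "integral {t0..t} N' = \<nu> * integral {t0..t} (\<lambda>r. - 2 * (lap (v r) \<cdot> v' r))"
      unfolding N'_def integral_mult_right by simp
    ultimately have "N t = \<nu> * grad_sq (v t0) + \<nu> * (grad_sq (v t) - grad_sq (v t0))" by (simp only: N_def)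
    then show ?thesis by (simp add: algebra_simps)
  qed
  define k where "k t = C' * ((nm (lap (v t)))\<^sup>2 + grad_sq (v t) + 1)" for t
  have ki: "integrable (lebesgue_on {0..T}) k"
  proof -
    have 1: "integrable (lebesgue_on {0..T}) (\<lambda>t. (nm (lap (v t)))\<^sup>2)"
      using lap_int unfolding Ioo_Icc_integrable .
    have 2: "integrable (lebesgue_on {0..T}) (\<lambda>t. 1::real)" by (intro continuous_integrable_Icc continuous_intros)
    show ?thesis unfolding k_def[abs_def]
      by (intro integrable_mult_right Bochner_Integration.integrable_add 1 2 grad_sq_int)
  qed
  have k0: "k t \<ge> 0" for t unfolding k_def using C' grad_sq_nonneg[of "v t"] by simp
  \<comment> \<open>Integrals and lengths are enlarged to [0, T], so the lower bound no longer
    depends on \<open>s3\<close>.\<close>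
  define L where "L = 2 * ((1 + N t0 / y t0) * exp (integral {0..T} k)) + C"
  have Nt0: "N t0 \<ge> 0" using viscosity grad_sq_nonneg[of "v t0"] by (simp add: N_def)
  have yt0: "y t0 > 0" using t0' by (intro pos) auto
  define \<eta> where "\<eta> = y t0 * exp (- L * T)"
  have \<eta>: "\<eta> > 0" unfolding \<eta>_def using yt0 by simp
  have lower: "y s3 \<ge> \<eta>" if s3: "t0 < s3" "s3 < s2" for s3
  proof -
    have sT: "s3 \<le> T" using s3 s2' t1 by linarith
    have "y s3 \<ge> y t0 * exp (- (2 * ((1 + N t0 / y t0) * exp (integral {t0..s3} k)) + C) * (s3 - t0))"
    proof (rule gronwall_quotient[OF ac_on_subset[OF y_ac _ sT] ac_on_subset[OF Nac order_refl sT] _ nZ _ C(1)])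
      show "integrable (lebesgue_on {t0..s3}) k" using subinterval_integrable(2)[OF ki, of t0 s3] t0' sT by simp
      fix t assume t: "t \<in> {t0<..<s3} - (Z \<union> Z1)"
      have tT: "t \<in> {0..T}" and reg: "regular t" and N: "N t = \<nu> * grad_sq (v t)" and y: "y t > 0"
        using t t0' s3 sT by (auto intro!: Z(2) Neq pos)
      show "N t \<ge> 0" unfolding N using viscosity grad_sq_nonneg[of "v t"] by simp
      show "- (2 * N t) - C * y t \<le> y' t" using C(2)[OF tT reg] unfolding N by linarith
      show "y t * N' t - N t * y' t \<le> y t * (k t * (N t + y t))"
        using C'(2)[OF tT reg y] unfolding N N'_def k_def .
    qed (use t0' s3 k0 Nt0 in \<open>auto intro!: pos\<close>)
    moreover have "\<eta> \<le> y t0 * exp (- (2 * ((1 + N t0 / y t0) * exp (integral {t0..s3} k)) + C) * (s3 - t0))"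
    proof -
      have "integral {t0..s3} k \<le> integral {0..T} k"
        by (intro integral_subset_le subinterval_integrable(1)[OF ki] k0) (use t0' sT k0 in auto)
      then have "2 * ((1 + N t0 / y t0) * exp (integral {t0..s3} k)) + C \<le> L"
        unfolding L_def using Nt0 yt0 by (intro add_mono mult_left_mono) auto
      moreover have "0 \<le> 2 * ((1 + N t0 / y t0) * exp (integral {t0..s3} k)) + C" using Nt0 yt0 C by simp
      ultimately have "(2 * ((1 + N t0 / y t0) * exp (integral {t0..s3} k)) + C) * (s3 - t0) \<le> L * T"
        using s3 t0' sT by (intro mult_mono) auto
      then have "exp (- L * T) \<le> exp (- (2 * ((1 + N t0 / y t0) * exp (integral {t0..s3} k)) + C) * (s3 - t0))"
        by (simp only: exp_le_cancel_iff minus_mult_left[symmetric] neg_le_iff_le)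
      then show ?thesis unfolding \<eta>_def using yt0 by (intro mult_left_mono) auto
    qed
    ultimately show ?thesis by linarith
  qed
  obtain d where d: "d > 0" "\<And>s t. s \<in> {0..T} \<Longrightarrow> t \<in> {0..T} \<Longrightarrow> \<bar>t - s\<bar> < d \<Longrightarrow> norm (y t - y s) < \<eta>"
    by (rule ac_on_uniform[OF y_ac \<eta>]) (rule that)
  define s3 where "s3 = max ((t0 + s2) / 2) (s2 - d / 2)"
  have s3: "t0 < s3" "s3 < s2" "\<bar>s3 - s2\<bar> < d" using t0'(3) d(1) by (auto simp: s3_def max_def field_simps)
  have "norm (y s3 - y s2) < \<eta>" using s3 t0' s2' t1 by (intro d(2)) auto
  then show False using lower[OF s3(1,2)] s2'(3) by simp
qed

end

context fluid_body
begin

lemma zero_L2_iff: "u \<in> zero_L2 \<Omega> \<longleftrightarrow> (AE x in M. u x = 0)"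
  by (simp add: zero_L2_def)

lemma zero_class_omega:
  assumes "AE x in M. u x = 0" shows "om u = 0"
proof -
  have u: "u \<in> L2 \<Omega>" "nm u = 0" using L2_sigma_L2[OF L2_sigma_zero[OF assms]] assms by (simp_all add: nm_eq_0)
  obtain K where "\<And>u. u \<in> L2 \<Omega> \<Longrightarrow> norm (om u) \<le> K * nm u" by (rule om_bound) (rule that)
  then have "norm (om u) \<le> K * nm u" using u(1) by blast
  then show ?thesis using u(2) by simp
qed

lemma zero_class_bil:
  assumes u: "AE x in M. u x = 0" and w: "w \<in> L2 \<Omega>" shows "bil u w = 0"
  using ip_cong_AE[OF u _ L2_sigma_L2[OF L2_sigma_zero[OF u]] w, of w] by (simp add: bil_def zero_class_omega[OF u])

lemma solution_on_imp_fluid_solution: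
  assumes "solution_on \<Omega> \<nu> I T v a p v0 a0" "T > 0"
  obtains v' a' w' where "fluid_solution \<Omega> \<nu> I_B I lam T v v' a a' w' p"
proof -
  obtain v' a' w' where "fluid_solution_axioms \<Omega> \<nu> I T v v' a a' w' p"
    using assms unfolding solution_on_def H1_infinity_time_def fluid_solution_axioms_def by blast
  then show thesis by (intro that[OF fluid_solution.intro] fluid_body_axioms)
qed

end

context fluid_solution
begin

lemma constant_of_constant_energy:
  assumes st: "0 \<le> s" "s < t" "t \<le> T" and E: "En s \<le> En t" and r: "r \<in> {0..T}"
  shows "AE x in M. v r x = 0" "a r = a s"
proof -
  have sT: "s \<in> {0..T}" using st by auto
  have rest: "nm (v q) = 0" if "q \<in> {s..t}" for q using st E that by (rule rest_of_constant_energy)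
  have eq: "cross3 (a s) (I *v a s) = 0" by (rule rest_imp_equilibrium[OF st rest]) auto
  \<comment> \<open>The reference equilibrium is the state at time \<open>s\<close> itself: v(s) = 0
    and b = a(s), so y(s) = 0.\<close>
  interpret fluid_near_equilibrium \<Omega> \<nu> I_B I lam T v v' a a' w' p "a s" by unfold_locales (rule eq)
  have "AE x in M. v s x = 0" using rest[of s] v_L2[OF sT] st by (simp add: nm_eq_0)
  then have "bil (v s) (v s) = 0" by (rule zero_class_bil) (rule v_L2[OF sT])
  then have ys: "y s = 0" by (simp add: y_def)
  have "y r = 0"
  proof (cases "s \<le> r")
    case True then show ?thesis using st r ys by (intro forward_uniqueness[of s r]) auto
  next
    case False then show ?thesis using st r ys by (intro backward_uniqueness[of r s]) auto
  qed
  obtain C where "(nm (v r))\<^sup>2 \<le> C * y r" "(norm (a r - a s))\<^sup>2 \<le> C * y r" by (rule y_bounds) (rule that, use r in auto)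
  then show "AE x in M. v r x = 0" "a r = a s" using \<open>y r = 0\<close> v_L2[OF r] by (auto simp: nm_eq_0[symmetric])
qed

lemma En_energy: "t \<in> {0..T} \<Longrightarrow> energy \<Omega> I (v t) (a t) = 1/2 * En t"
  using v_L2 by (simp add: En_def energy_eq)

lemma energy_strictly_decreasing:
  assumes "\<not> constant_on_time \<Omega> T v a"
  shows "strict_antimono_on {0..T} (\<lambda>t. energy \<Omega> I (v t) (a t))"
proof (rule monotone_onI)
  fix s t assume st: "s \<in> {0..T}" "t \<in> {0..T}" "s < t"
  have "\<not> En s \<le> En t"
  proof
    assume E: "En s \<le> En t"
    have b: "0 \<le> s" "t \<le> T" using st by auto
    have "\<forall>r\<in>{0..T}. (AE x in M. v r x = 0) \<and> a r = a s"
      using constant_of_constant_energy[OF b(1) st(3) b(2) E] by blast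
    then have "constant_on_time \<Omega> T v a"
      unfolding constant_on_time_def by (intro exI[of _ "\<lambda>_. 0"] exI[of _ "a s"])
    with assms show False by contradiction
  qed
  then show "energy \<Omega> I (v s) (a s) > energy \<Omega> I (v t) (a t)" using st by (simp add: En_energy)
qed

end

section \<open>Equilibria\<close>

context bounded_open
begin

lemma zero_class_norms:
  fixes u :: "real^3 \<Rightarrow> 'b::euclidean_space"
  assumes u: "AE x in M. u x = 0" shows "norm_H1 \<Omega> u = 0" "norm_H2 \<Omega> u = 0"
proof -
  have n: "nm w = 0" if "AE x in M. w x = 0" for w :: "real^3 \<Rightarrow> 'b"
    using H1_L2[OF H1_zero_class(1)[OF that]] that by (simp add: nm_eq_0)
  have H1: "norm_H1 \<Omega> w = 0" if "AE x in M. w x = 0" for w :: "real^3 \<Rightarrow> 'b"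
    using n[OF that] n[OF H1_zero_class(2)[OF that]] by (simp add: norm_H1_def)
  show "norm_H1 \<Omega> u = 0" by (rule H1[OF u])
  show "norm_H2 \<Omega> u = 0" using n[OF u] H1[OF H1_zero_class(2)[OF u]] by (simp add: norm_H2_def)
qed

lemma zero_class_H2_0_sigma:
  assumes u: "AE x in M. u x = 0" shows "u \<in> H2_0_sigma \<Omega>"
proof -
  have "u \<in> H2 \<Omega>" unfolding H2_def by (simp add: H1_zero_class[OF u] H1_zero_class(1)[OF H1_zero_class(2)[OF u]])
  moreover have "u \<in> H1_0 \<Omega>"
    unfolding H1_0_def
  proof (intro CollectI conjI exI[of _ "\<lambda>n x. 0"] allI)
    show "test_function \<Omega> (\<lambda>x. 0 :: real^3)" by (rule test_functionI[of _ "{}"]) (auto intro: smooth_const)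
    have "AE x in M. 0 - u x = 0" using u by eventually_elim simp
    from zero_class_norms(1)[OF this] show "(\<lambda>n. norm_H1 \<Omega> (\<lambda>x. 0 - u x)) \<longlonglongrightarrow> 0" by simp
  qed (rule H1_zero_class(1)[OF u])
  ultimately show ?thesis using L2_sigma_zero[OF u] by (simp add: H2_0_sigma_def)
qed

lemma bochner_L2_const:
  assumes "u \<in> X" "N (\<lambda>x. 0) = 0" shows "bochner_L2 T X N (\<lambda>_. u)"
  unfolding bochner_L2_def
proof (intro conjI exI[of _ "\<lambda>_ _. u"])
  show "integrable (lebesgue_on {0<..<T}) (\<lambda>t. (N u)\<^sup>2)"
    unfolding Ioo_Icc_integrable by (intro continuous_integrable_Icc continuous_intros)
qed (use assms in auto)

end

context fluid_body
begin

lemma rest_state_solution: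
  assumes v: "AE x in M. v x = 0" and a: "cross3 a (I *v a) = 0" and T: "T > 0"
  shows "solution_on \<Omega> \<nu> I T (\<lambda>_. v) (\<lambda>_. a) (\<lambda>_ _. 0) v a"
  unfolding solution_on_def
proof (intro conjI exI[of _ "\<lambda>_ _. 0"] exI[of _ "\<lambda>_. 0"])
  have z: "AE x in M. (0::real) = 0" "AE x in M. (0::real^3) = 0" by simp_all
  show "bochner_L2 T (H2_0_sigma \<Omega>) (norm_H2 \<Omega>) (\<lambda>_. v)"
    by (rule bochner_L2_const[where N="norm_H2 \<Omega>", OF zero_class_H2_0_sigma[OF v] zero_class_norms(2)[OF z(2)]])
  show "bochner_L2 T (H1 \<Omega>) (norm_H1 \<Omega>) (\<lambda>_ _. 0 :: real)"
    by (rule bochner_L2_const[where N="norm_H1 \<Omega>", OF H1_zero_class(1)[OF z(1)] zero_class_norms(1)[OF z(1)]])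
  have n0: "nm (\<lambda>x. 0 :: real^3) = 0" by (simp add: norm_L2_def)
  have w0: "has_weak_time_deriv T (\<lambda>_. e) (\<lambda>_. 0)" for e by (simp add: has_weak_time_deriv_def)
  show "H1_time_L2_sigma \<Omega> T (\<lambda>_. v) (\<lambda>_ _. 0)"
    unfolding H1_time_L2_sigma_def
    by (auto intro!: L2_sigma_zero[OF v] L2_sigma_zero[OF z(2)] bochner_L2_const[where N=nm] n0)
  show "H1_infinity_time T (\<lambda>_. a) (\<lambda>_. 0)"
    unfolding H1_infinity_time_def using w0 by (auto intro!: exI[of _ 0])
  show "has_weak_time_deriv T (\<lambda>_. om v) (\<lambda>_. 0)" by (rule w0)
  have "AE x in M. \<forall>i. wp i (\<lambda>x. 0::real) x = 0" by (simp add: AE_all_countable H1_zero_class(2)[OF z(1)])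
  then have "AE x in M. weak_grad \<Omega> (\<lambda>x. 0) x = 0" by eventually_elim (simp add: weak_grad_def vec_eq_iff)
  with v zero_class_operators[OF v] have "AE x in M. 0 + convection \<Omega> v x + cross3 (0 - 0) x
       + 2 *\<^sub>R cross3 (a - om v) (v x) - \<nu> *\<^sub>R lap v x + weak_grad \<Omega> (\<lambda>x. 0) x = 0"
    by eventually_elim simp
  then show "AE t in lebesgue_on {0<..<T}. AE x in M. 0 + convection \<Omega> v x + cross3 (0 - 0) x
       + 2 *\<^sub>R cross3 (a - om v) (v x) - \<nu> *\<^sub>R lap v x + weak_grad \<Omega> (\<lambda>_. 0) x = 0"
    by (rule AE_I2)
  have "AE x in M. \<forall>i. wp i v x = 0" by (simp add: AE_all_countable H1_zero_class(2)[OF v])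
  then have "AE x in M. weak_div \<Omega> v x = 0" by eventually_elim (simp add: weak_div_def)
  then show "AE t in lebesgue_on {0<..<T}. AE x in M. weak_div \<Omega> v x = 0" by (rule AE_I2)
  show "AE t in lebesgue_on {0<..<T}. I *v 0 + cross3 (a - om v) (I *v a) = 0"
    by (simp add: zero_class_omega[OF v] a)
qed simp_all

text \<open>A time-independent solution has equal energies at 0 and T, so dissipation forces rest on
  the whole interval; the other two claims follow from \<open>rest_imp_equilibrium\<close>, the
  pressure being constant by connectedness.\<close>

lemma stationary_solution:
  assumes "solution_on \<Omega> \<nu> I T (\<lambda>_. v) (\<lambda>_. a) p v a" "T > 0"
  shows "AE x in M. v x = 0" "cross3 a (I *v a) = 0"
    "AE t in lebesgue_on {0<..<T}. \<exists>c. AE x in M. p t x = c"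
proof -
  obtain v' a' w' where "fluid_solution \<Omega> \<nu> I_B I lam T (\<lambda>_. v) v' (\<lambda>_. a) a' w' p"
    by (rule solution_on_imp_fluid_solution[OF assms]) (rule that)
  then interpret fluid_solution \<Omega> \<nu> I_B I lam T "\<lambda>_. v" v' "\<lambda>_. a" a' w' p .
  have rest: "nm v = 0" by (rule rest_of_constant_energy[of 0 T 0]) (use assms(2) in \<open>auto simp: En_def\<close>)
  show "AE x in M. v x = 0" using rest v_L2[of 0] assms(2) by (simp add: nm_eq_0)
  obtain Z where Z: "negligible Z" "\<And>r. r \<in> {0<..<T} - Z \<Longrightarrow> AE x in M. weak_grad \<Omega> (p r) x = 0"
    "\<And>r. r \<in> {0<..<T} - Z \<Longrightarrow> p r \<in> H1 \<Omega>" and eq: "cross3 a (I *v a) = 0"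
    by (rule rest_imp_equilibrium[of 0 T]) (use assms(2) rest in auto)
  show "cross3 a (I *v a) = 0" by (rule eq)
  show "AE t in lebesgue_on {0<..<T}. \<exists>c. AE x in M. p t x = c"
    unfolding AE_Ioo_iff using Z by (intro exI[of _ Z]) (auto intro!: pressure_constant[OF conn ne])
qed

text \<open>For necessity one time interval (T = 1) is enough; for sufficiency the zero pressure
  serves on every interval.\<close>

lemma equilibria_iff: "(v, a) \<in> equilibria \<Omega> \<nu> I \<longleftrightarrow> v \<in> zero_L2 \<Omega> \<and> cross3 a (I *v a) = 0"
proof
  assume "(v, a) \<in> equilibria \<Omega> \<nu> I"
  then obtain p where "\<forall>T>0. solution_on \<Omega> \<nu> I T (\<lambda>_. v) (\<lambda>_. a) p v a" by (auto simp: equilibria_def)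
  then have "solution_on \<Omega> \<nu> I 1 (\<lambda>_. v) (\<lambda>_. a) p v a" by simp
  from stationary_solution[OF this] show "v \<in> zero_L2 \<Omega> \<and> cross3 a (I *v a) = 0" by (simp add: zero_L2_iff)
next
  assume "v \<in> zero_L2 \<Omega> \<and> cross3 a (I *v a) = 0"
  then show "(v, a) \<in> equilibria \<Omega> \<nu> I"
    unfolding equilibria_def zero_L2_iff by (auto intro!: exI[of _ "\<lambda>_ _. 0"] rest_state_solution)
qed

lemma null_space_iff: "a \<in> null_space (mat l - I) \<longleftrightarrow> I *v a = l *\<^sub>R a"
proof -
  have "mat l *v a = l *\<^sub>R a"
    by (simp add: vec_eq_iff mat_def matrix_vector_mult_def if_distrib[of "\<lambda>z. z * _"] cong: if_cong)
  then show ?thesis by (auto simp: null_space_def matrix_vector_mult_diff_rdistrib)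
qed

lemma eigenvalue: "I *v a = l *\<^sub>R a \<Longrightarrow> a \<noteq> 0 \<Longrightarrow> \<exists>i. l = lam $ i \<and> a $ i \<noteq> 0"
  by (metis I_nth mult_right_cancel vec_eq_iff vector_scaleR_component real_scaleR_def zero_index)

lemma eigenvector_iff: "cross3 a (I *v a) = 0 \<longleftrightarrow> (\<exists>i. a \<in> null_space (mat (lam $ i) - I))"
proof
  assume c: "cross3 a (I *v a) = 0"
  show "\<exists>i. a \<in> null_space (mat (lam $ i) - I)"
  proof (cases "a = 0")
    case True then show ?thesis by (simp add: null_space_def)
  next
    case False
    then have "I *v a \<noteq> 0" using I_posdef[of a] by auto
    with c False obtain l where l: "I *v a = l *\<^sub>R a" by (auto simp: cross_eq_0 collinear_lemma)
    then show ?thesis using eigenvalue[OF l False] by (auto simp: null_space_iff)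
  qed
qed (auto simp: null_space_iff cross_mult_right)

lemma lam_range: "{lam $ 1, lam $ 2, lam $ 3} = range (\<lambda>i. lam $ i)"
  by (simp add: UNIV_3)

lemma equilibria_eq: "equilibria \<Omega> \<nu> I = (\<Union>i\<in>UNIV. zero_L2 \<Omega> \<times> null_space (mat (lam $ i) - I))"
  using equilibria_iff eigenvector_iff by auto

subsection \<open>Critical points\<close>

lemma bil_le: "u \<in> L2 \<Omega> \<Longrightarrow> bil u u \<le> (nm u)\<^sup>2" "u \<in> L2 \<Omega> \<Longrightarrow> bil u u \<ge> 0"
proof -
  assume u: "u \<in> L2 \<Omega>"
  have "(I *v om u) \<bullet> om u \<ge> 0"
    using I_posdef[of "om u"] by (cases "om u = 0") auto
  then show "bil u u \<le> (nm u)\<^sup>2" by (simp add: bil_def nm_sq)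
  obtain c where "0 < c" "\<And>u. u \<in> L2 \<Omega> \<Longrightarrow> bil u u \<ge> c * (nm u)\<^sup>2" by (rule coercive) (rule that)
  then show "bil u u \<ge> 0" using u by (meson mult_nonneg_nonneg order_trans less_imp_le zero_le_power2)
qed

text \<open>The energy is quadratic, so the remainder is exactly half of bil h h + (I k | k), which
  is at most (1 + K) times the squared norm of (h, k). This explains the radius \<eta> / (1 +
  K).\<close>

lemma energy_has_frechet_deriv:
  assumes v: "v \<in> L2_sigma \<Omega>"
  shows "has_frechet_deriv \<Omega> (energy \<Omega> I) v a (\<lambda>h k. bil v h + (I *v a) \<bullet> k)"
  unfolding has_frechet_deriv_def
proof (intro conjI ballI allI impI)
  note vL = L2_sigma_L2[OF v]
  fix h1 h2 :: "real^3 \<Rightarrow> real^3" and k1 k2 :: "real^3" assume h: "h1 \<in> L2_sigma \<Omega>" "h2 \<in> L2_sigma \<Omega>"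
  show "bil v (\<lambda>x. h1 x + h2 x) + (I *v a) \<bullet> (k1 + k2) = bil v h1 + (I *v a) \<bullet> k1 + (bil v h2 + (I *v a) \<bullet> k2)"
    using bil_add_left[OF L2_sigma_L2[OF h(1)] L2_sigma_L2[OF h(2)] vL] by (simp add: bil_sym[of v] inner_add_right)
next
  fix c :: real and h :: "real^3 \<Rightarrow> real^3" and k :: "real^3" assume h: "h \<in> L2_sigma \<Omega>"
  show "bil v (\<lambda>x. c *\<^sub>R h x) + (I *v a) \<bullet> (c *\<^sub>R k) = c * (bil v h + (I *v a) \<bullet> k)"
    using bil_scaleR_left[OF L2_sigma_L2[OF h]] by (simp add: bil_sym[of v] distrib_left)
next
  note vL = L2_sigma_L2[OF v]
  show "\<exists>C. \<forall>h\<in>L2_sigma \<Omega>. \<forall>k. \<bar>bil v h + (I *v a) \<bullet> k\<bar> \<le> C * norm (nm h, k)"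
  proof (intro exI[of _ "nm (kinetic v) + norm (I *v a)"] ballI allI)
    fix h :: "real^3 \<Rightarrow> real^3" and k :: "real^3" assume h: "h \<in> L2_sigma \<Omega>"
    have "bil v h = kinetic v \<cdot> h"
      using ip_kinetic[OF L2_sigma_L2[OF h] vL] by (simp add: bil_sym[of v] ip_commute[of h])
    then have "\<bar>bil v h\<bar> \<le> nm (kinetic v) * nm h" using ip_bound[OF kinetic_L2[OF vL] L2_sigma_L2[OF h]] by simp
    also have "\<dots> \<le> nm (kinetic v) * norm (nm h, k)"
      using norm_fst_le[of "nm h" k] by (intro mult_left_mono) auto
    finally have 1: "\<bar>bil v h\<bar> \<le> nm (kinetic v) * norm (nm h, k)" .
    have "\<bar>(I *v a) \<bullet> k\<bar> \<le> norm (I *v a) * norm k" by (rule Cauchy_Schwarz_ineq2)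
    also have "\<dots> \<le> norm (I *v a) * norm (nm h, k)"
      using norm_snd_le[of k "nm h"] by (intro mult_left_mono) auto
    finally show "\<bar>bil v h + (I *v a) \<bullet> k\<bar> \<le> (nm (kinetic v) + norm (I *v a)) * norm (nm h, k)"
      using 1 unfolding distrib_right by linarith
  qed
next
  note vL = L2_sigma_L2[OF v]
  fix \<eta> :: real assume \<eta>: "\<eta> > 0"
  obtain K B where K: "K \<ge> 0" "B > 0" "\<And>x. norm (I *v x) \<le> K * norm x" "\<And>x. B * norm x \<le> norm (I *v x)"
    by (rule I_bounds) (rule that)
  have "\<bar>energy \<Omega> I (\<lambda>x. v x + h x) (a + k) - energy \<Omega> I v a - (bil v h + (I *v a) \<bullet> k)\<bar> \<le> \<eta> * norm (nm h, k)"
    if h: "h \<in> L2_sigma \<Omega>" and small: "norm (nm h, k) < \<eta> / (1 + K)" for h k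
  proof -
    note hL = L2_sigma_L2[OF h]
    have e: "energy \<Omega> I (\<lambda>x. v x + h x) (a + k) - energy \<Omega> I v a - (bil v h + (I *v a) \<bullet> k) = 1/2 * (bil h h + (I *v k) \<bullet> k)"
    proof -
      have "bil (\<lambda>x. v x + h x) (\<lambda>x. v x + h x) = bil v v + 2 * bil v h + bil h h"
        unfolding bil_add_left[OF vL hL L2_add[OF vL hL]] bil_sym[of v "\<lambda>x. v x + h x"] bil_sym[of h "\<lambda>x. v x + h x"]
          bil_add_left[OF vL hL vL] bil_add_left[OF vL hL hL] bil_sym[of h v] by simp
      moreover have "(I *v k) \<bullet> a = (I *v a) \<bullet> k" by (simp only: I_sym[of k] inner_commute[of k])
      ultimately show ?thesis
        using vL hL by (simp add: energy_eq L2_add matrix_vector_right_distrib inner_add_left inner_add_right algebra_simps)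
    qed
    have Ik: "0 \<le> (I *v k) \<bullet> k" using I_posdef[of k] by (cases "k = 0") auto
    have "(I *v k) \<bullet> k \<le> norm (I *v k) * norm k" by (rule norm_cauchy_schwarz)
    also have "\<dots> \<le> K * (norm k)\<^sup>2" unfolding power2_eq_square mult.assoc[symmetric] by (intro mult_right_mono K) simp
    also have "\<dots> \<le> K * (norm (nm h, k))\<^sup>2"
      using norm_snd_le[of k "nm h"] K by (intro mult_left_mono power_mono) auto
    finally have 1: "(I *v k) \<bullet> k \<le> K * (norm (nm h, k))\<^sup>2" .
    have "bil h h \<le> (nm h)\<^sup>2" by (rule bil_le(1)[OF hL])
    also have "\<dots> \<le> (norm (nm h, k))\<^sup>2"
      using norm_fst_le[of "nm h" k] by (intro power_mono) auto
    finally have "bil h h + (I *v k) \<bullet> k \<le> (1 + K) * norm (nm h, k) * norm (nm h, k)"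
      using 1 by (simp add: power2_eq_square algebra_simps)
    also have "\<dots> \<le> \<eta> * norm (nm h, k)"
      using small K by (intro mult_right_mono) (auto simp: pos_less_divide_eq mult.commute)
    finally show ?thesis unfolding e using Ik bil_le(2)[OF hL] by simp
  qed
  then show "\<exists>d>0. \<forall>h\<in>L2_sigma \<Omega>. \<forall>k. norm (nm h, k) < d \<longrightarrow>
      \<bar>energy \<Omega> I (\<lambda>x. v x + h x) (a + k) - energy \<Omega> I v a - (bil v h + (I *v a) \<bullet> k)\<bar> \<le> \<eta> * norm (nm h, k)"
    using \<eta> K by (intro exI[of _ "\<eta> / (1 + K)"]) auto
qed

text \<open>Both candidates are homogeneous, so (h, k) can be scaled into a ball where the two
  remainders are small; dividing by the scale bounds the difference by 2 e n for every e.\<close>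

lemma frechet_deriv_unique:
  assumes D: "has_frechet_deriv \<Omega> F v a D" "has_frechet_deriv \<Omega> F v a D'" and h: "h \<in> L2_sigma \<Omega>"
  shows "D h k = D' h k"
proof -
  define n where "n = norm (nm h, k)"
  have "\<bar>D h k - D' h k\<bar> \<le> e * (2 * n + 1)" if e: "e > 0" for e
  proof -
    obtain d where d: "d > 0" "\<And>h k. h \<in> L2_sigma \<Omega> \<Longrightarrow> norm (nm h, k) < d \<Longrightarrow>
        \<bar>F (\<lambda>x. v x + h x) (a + k) - F v a - D h k\<bar> \<le> e * norm (nm h, k)"
      using D(1) e unfolding has_frechet_deriv_def by meson
    obtain d' where d': "d' > 0" "\<And>h k. h \<in> L2_sigma \<Omega> \<Longrightarrow> norm (nm h, k) < d' \<Longrightarrow>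
        \<bar>F (\<lambda>x. v x + h x) (a + k) - F v a - D' h k\<bar> \<le> e * norm (nm h, k)"
      using D(2) e unfolding has_frechet_deriv_def by meson
    \<comment> \<open>The \<open>+ 1\<close> keeps the scale positive and finite when (h, k) has
      norm 0.\<close>
    define t where "t = min d d' / (n + 1)"
    have n0: "n \<ge> 0" by (simp add: n_def)
    have t: "t > 0" unfolding t_def using d(1) d'(1) n0 by simp
    have ht: "(\<lambda>x. t *\<^sub>R h x) \<in> L2_sigma \<Omega>"
      using L2_sigma_combine[OF L2_sigma_zero[of "\<lambda>x. 0"] h, of t] by simp
    have "(nm (\<lambda>x. t *\<^sub>R h x), t *\<^sub>R k) = t *\<^sub>R (nm h, k)" using t by (simp add: nm_scaleR)
    then have nt: "norm (nm (\<lambda>x. t *\<^sub>R h x), t *\<^sub>R k) = t * n" using t by (simp only: n_def norm_scaleR abs_of_pos)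
    have "t * n < t * (n + 1)" using t by simp
    also have "\<dots> = min d d'" unfolding t_def using n0 by simp
    finally have tn: "t * n < d" "t * n < d'" by auto
    have "\<bar>D (\<lambda>x. t *\<^sub>R h x) (t *\<^sub>R k) - D' (\<lambda>x. t *\<^sub>R h x) (t *\<^sub>R k)\<bar> \<le> 2 * (e * (t * n))"
      using d(2)[OF ht, of "t *\<^sub>R k"] d'(2)[OF ht, of "t *\<^sub>R k"] tn unfolding nt by linarith
    moreover have "D (\<lambda>x. t *\<^sub>R h x) (t *\<^sub>R k) = t * D h k" "D' (\<lambda>x. t *\<^sub>R h x) (t *\<^sub>R k) = t * D' h k"
      using D h unfolding has_frechet_deriv_def by blast+
    ultimately have "t * \<bar>D h k - D' h k\<bar> \<le> t * (e * (2 * n))"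
      using t by (simp add: right_diff_distrib[symmetric] abs_mult mult_ac)
    then have "\<bar>D h k - D' h k\<bar> \<le> e * (2 * n)" using t by simp
    also have "\<dots> \<le> e * (2 * n + 1)" using e by simp
    finally show ?thesis .
  qed
  note bound = this
  have n1: "2 * n + 1 > 0" by (simp add: n_def add_nonneg_pos)
  have "\<bar>D h k - D' h k\<bar> \<le> 0 + e" if "e > 0" for e
    using bound[OF divide_pos_pos[OF that n1]] n1 by simp
  then have "\<bar>D h k - D' h k\<bar> \<le> 0" by (rule field_le_epsilon)
  then show ?thesis by simp
qed

lemma momentum_has_derivative: "(momentum I has_derivative (\<lambda>k. (I *v a) \<bullet> (I *v k))) (at a)"
  unfolding momentum_def[abs_def]
  by (auto intro!: derivative_eq_intros bounded_linear.has_derivative[OF matrix_vector_mul_bounded_linear] simp: inner_commute)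

lemma critical_points_iff:
  "(v, a) \<in> critical_points \<Omega> I M0 \<longleftrightarrow> v \<in> L2_sigma \<Omega> \<and> momentum I a = M0 \<and>
    (\<exists>\<mu>. \<forall>h\<in>L2_sigma \<Omega>. \<forall>k. bil v h + (I *v a) \<bullet> k + \<mu> * ((I *v a) \<bullet> (I *v k)) = 0)" (is "_ \<longleftrightarrow> _ \<and> _ \<and> ?R")
proof -
  have "(\<exists>\<mu> DE DM. has_frechet_deriv \<Omega> (energy \<Omega> I) v a DE \<and> (momentum I has_derivative DM) (at a) \<and>
        (\<forall>h\<in>L2_sigma \<Omega>. \<forall>k. DE h k + \<mu> * DM k = 0)) \<longleftrightarrow> ?R" (is "?L \<longleftrightarrow> _") if v: "v \<in> L2_sigma \<Omega>"
  proof
    assume ?L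
    then obtain \<mu> DE DM where D: "has_frechet_deriv \<Omega> (energy \<Omega> I) v a DE" "(momentum I has_derivative DM) (at a)"
      "\<forall>h\<in>L2_sigma \<Omega>. \<forall>k. DE h k + \<mu> * DM k = 0" by blast
    have DM: "DM = (\<lambda>k. (I *v a) \<bullet> (I *v k))" by (rule has_derivative_unique[OF D(2) momentum_has_derivative])
    show ?R
    proof (intro exI[of _ \<mu>] ballI allI)
      fix h :: "real^3 \<Rightarrow> real^3" and k :: "real^3" assume h: "h \<in> L2_sigma \<Omega>"
      have "DE h k = bil v h + (I *v a) \<bullet> k"
        by (rule frechet_deriv_unique[OF D(1) energy_has_frechet_deriv[OF v] h])
      then show "bil v h + (I *v a) \<bullet> k + \<mu> * ((I *v a) \<bullet> (I *v k)) = 0"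
        using D(3)[rule_format, OF h, of k] by (simp add: DM)
    qed
  next
    assume ?R
    then obtain \<mu> where "\<forall>h\<in>L2_sigma \<Omega>. \<forall>k. bil v h + (I *v a) \<bullet> k + \<mu> * ((I *v a) \<bullet> (I *v k)) = 0" ..
    with energy_has_frechet_deriv[OF v] momentum_has_derivative show ?L by blast
  qed
  then show ?thesis by (auto simp: critical_points_def)
qed

text \<open>Variation in direction (v, 0) gives bil v v = 0, hence v = 0 by coercivity; variation in
  k gives I (a + \<mu> I a) = 0, so that a = -\<mu> I a is parallel to I a. Conversely, at an
  eigenvector for the eigenvalue lam_i the multiplier is -1 / lam_i.\<close>

lemma critical_points_eq: "critical_points \<Omega> I M0 = {(v, a) \<in> equilibria \<Omega> \<nu> I. momentum I a = M0}"
proof -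
  have "v \<in> L2_sigma \<Omega> \<and> (\<exists>\<mu>. \<forall>h\<in>L2_sigma \<Omega>. \<forall>k. bil v h + (I *v a) \<bullet> k + \<mu> * ((I *v a) \<bullet> (I *v k)) = 0)
      \<longleftrightarrow> v \<in> zero_L2 \<Omega> \<and> cross3 a (I *v a) = 0" (is "?L \<longleftrightarrow> ?R") for v a
  proof
    assume ?L
    then obtain \<mu> where v: "v \<in> L2_sigma \<Omega>"
      and \<mu>: "\<And>h k. h \<in> L2_sigma \<Omega> \<Longrightarrow> bil v h + (I *v a) \<bullet> k + \<mu> * ((I *v a) \<bullet> (I *v k)) = 0" by blast
    obtain c where c: "0 < c" "\<And>u. u \<in> L2 \<Omega> \<Longrightarrow> bil u u \<ge> c * (nm u)\<^sup>2" by (rule coercive) (rule that)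
    note vL = L2_sigma_L2[OF v]
    have "bil v v = 0" using \<mu>[OF v, of 0] by simp
    then have "c * (nm v)\<^sup>2 \<le> 0" using c(2)[OF vL] by simp
    then have "nm v = 0" using c(1) by (simp add: mult_le_0_iff)
    then have vz: "AE x in M. v x = 0" using vL by (simp add: nm_eq_0)
    have "I *v (a + \<mu> *\<^sub>R (I *v a)) = I *v 0"
    proof (rule vector_eq_rdot[THEN iffD1], rule allI)
      fix k
      have "(I *v a) \<bullet> k + \<mu> * ((I *v a) \<bullet> (I *v k)) = 0"
        using \<mu>[OF v, of k] zero_class_bil[OF vz vL] by simp
      then show "(I *v (a + \<mu> *\<^sub>R (I *v a))) \<bullet> k = (I *v 0) \<bullet> k"
        by (simp add: matrix_vector_right_distrib matrix_vector_mult_scaleR inner_add_left I_sym[of "I *v a"])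
    qed
    then have "a + \<mu> *\<^sub>R (I *v a) = 0" by (rule I_inj)
    then have "a = (- \<mu>) *\<^sub>R (I *v a)" by (simp add: eq_neg_iff_add_eq_0)
    then have "cross3 a (I *v a) = cross3 ((- \<mu>) *\<^sub>R (I *v a)) (I *v a)" by (rule arg_cong)
    also have "\<dots> = 0" by (simp only: cross_mult_left cross_refl scaleR_zero_right)
    finally show ?R using vz by (simp add: zero_L2_iff)
  next
    assume R: ?R
    then have vz: "AE x in M. v x = 0" by (simp add: zero_L2_iff)
    obtain i where i: "I *v a = lam $ i *\<^sub>R a" using R by (auto simp: eigenvector_iff null_space_iff)
    have "bil v h + (I *v a) \<bullet> k + - (1 / lam $ i) * ((I *v a) \<bullet> (I *v k)) = 0" if h: "h \<in> L2_sigma \<Omega>" for h k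
    proof -
      have "(I *v a) \<bullet> (I *v k) = lam $ i * ((I *v a) \<bullet> k)"
        unfolding I_sym[of "I *v a", symmetric] by (simp add: i matrix_vector_mult_scaleR)
      then show ?thesis using zero_class_bil[OF vz L2_sigma_L2[OF h]] lam_pos[of i] by simp
    qed
    then show ?L using L2_sigma_zero[OF vz] by blast
  qed
  then have "(v, a) \<in> critical_points \<Omega> I M0 \<longleftrightarrow> (v, a) \<in> equilibria \<Omega> \<nu> I \<and> momentum I a = M0" for v a
    unfolding critical_points_iff equilibria_iff by blast
  then show ?thesis by auto
qed

text \<open>With v kept fixed, I b(\<theta>) has constant length l |a| along the curve, whereas (I b
  | b) = l |a|^2 (cos^2 \<theta> + (l / lam_m) sin^2 \<theta>). For l < lam_m this is strictly
  smaller than at a whenever sin \<theta> \<noteq> 0, hence at admissible points arbitrarily near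
  a.\<close>

lemma minimum_eigenvalue:
  assumes M0: "M0 \<noteq> 0" and v: "v \<in> zero_L2 \<Omega>" and l: "I *v a = l *\<^sub>R a"
    and min: "constrained_local_min \<Omega> I M0 v a"
  shows "l = Max {lam $ 1, lam $ 2, lam $ 3}"
proof (rule ccontr)
  assume neq: "l \<noteq> Max {lam $ 1, lam $ 2, lam $ 3}"
  have vz: "AE x in M. v x = 0" using v by (simp add: zero_L2_iff)
  have vL: "v \<in> L2_sigma \<Omega>" by (rule L2_sigma_zero[OF vz])
  have mom: "momentum I a = M0" using min by (simp add: constrained_local_min_def)
  have a: "a \<noteq> 0" using M0 mom by (auto simp: momentum_def)
  obtain i where i: "l = lam $ i" using eigenvalue[OF l a] by blast
  obtain m where m: "Max {lam $ 1, lam $ 2, lam $ 3} = lam $ m"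
    using Max_in[of "{lam $ 1, lam $ 2, lam $ 3}"] by auto
  have "lam $ i \<le> lam $ m" unfolding m[symmetric] lam_range by (rule Max_ge) auto
  then have lm: "l < lam $ m" using neq i m by simp
  have l0: "l > 0" using i lam_pos by simp
  \<comment> \<open>Eigenvectors for different eigenvalues are orthogonal, which removes the mixed
    terms along the curve.\<close>
  have am: "a $ m = 0"
  proof -
    have "lam $ m * a $ m = l * a $ m" using I_nth[of a m] unfolding l vector_scaleR_component real_scaleR_def by (rule sym)
    moreover have "lam $ m \<noteq> l" using lm by simp
    ultimately show ?thesis by simp
  qed
  \<comment> \<open>Scaled so that I maps \<open>s\<close> times the unit axis vector to a vector of
    length l |a|, the length of I a.\<close>
  define s where "s = l * norm a / lam $ m"
  define b where "b \<theta> = cos \<theta> *\<^sub>R a + (sin \<theta> * s) *\<^sub>R axis m 1" for \<theta>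
  have Ie: "I *v axis m 1 = lam $ m *\<^sub>R axis m 1"
    by (simp add: vec_eq_iff I_nth axis_def)
  have Ib: "I *v b \<theta> = (cos \<theta> * l) *\<^sub>R a + (sin \<theta> * (l * norm a)) *\<^sub>R axis m 1" for \<theta>
    using lam_pos[of m] by (simp add: b_def matrix_vector_right_distrib matrix_vector_mult_scaleR l Ie s_def)
  have orth: "a \<bullet> axis m 1 = 0" "axis m 1 \<bullet> a = 0" "axis m 1 \<bullet> axis m (1::real) = 1"
    using am by (simp_all add: inner_axis inner_axis' inner_axis_axis)
  have mb: "momentum I (b \<theta>) = M0" for \<theta>
  proof -
    have "(I *v b \<theta>) \<bullet> (I *v b \<theta>) = (cos \<theta> * l)\<^sup>2 * (a \<bullet> a) + (sin \<theta> * (l * norm a))\<^sup>2"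
      unfolding Ib by (simp add: inner_add_left inner_add_right orth power2_eq_square mult_ac)
    also have "\<dots> = l\<^sup>2 * (a \<bullet> a) * ((cos \<theta>)\<^sup>2 + (sin \<theta>)\<^sup>2)"
      by (simp only: power_mult_distrib power2_norm_eq_inner distrib_left mult_ac)
    also have "\<dots> = (I *v a) \<bullet> (I *v a)" by (simp add: l power2_eq_square)
    finally show ?thesis using mom by (simp add: momentum_def)
  qed
  have en: "energy \<Omega> I v c = 1/2 * ((I *v c) \<bullet> c)" for c
    using zero_class_bil[OF vz L2_sigma_L2[OF vL]] by (simp add: energy_eq[OF L2_sigma_L2[OF vL]])
  have lower: "energy \<Omega> I v (b \<theta>) < energy \<Omega> I v a" if \<theta>: "sin \<theta> \<noteq> 0" for \<theta>
  proof -
    have "(I *v b \<theta>) \<bullet> b \<theta> = l * (a \<bullet> a) * (cos \<theta>)\<^sup>2 + l * (norm a)\<^sup>2 * (sin \<theta>)\<^sup>2 * (l / lam $ m)"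
      unfolding Ib unfolding b_def s_def by (simp add: inner_add_left inner_add_right orth power2_eq_square mult_ac)
    also have "\<dots> < l * (a \<bullet> a) * (cos \<theta>)\<^sup>2 + l * (norm a)\<^sup>2 * (sin \<theta>)\<^sup>2 * 1"
      using l0 a \<theta> lm by (intro add_strict_left_mono mult_strict_left_mono) auto
    also have "\<dots> = l * (a \<bullet> a) * ((cos \<theta>)\<^sup>2 + (sin \<theta>)\<^sup>2)"
      by (simp only: power2_norm_eq_inner distrib_left mult_1_right)
    finally show ?thesis unfolding en by (simp add: l)
  qed
  obtain d where d: "d > 0" "\<And>w c. w \<in> L2_sigma \<Omega> \<Longrightarrow> momentum I c = M0 \<Longrightarrow> norm (nm (\<lambda>x. w x - v x), c - a) < d
      \<Longrightarrow> energy \<Omega> I v a \<le> energy \<Omega> I w c"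
    using min unfolding constrained_local_min_def by blast
  have "isCont b 0" unfolding b_def by (intro continuous_intros)
  then have "(b \<longlongrightarrow> b 0) (at_right 0)" by (auto simp: isCont_def intro: tendsto_within_subset)
  then have "\<forall>\<^sub>F \<theta> in at_right 0. dist (b \<theta>) (b 0) < d" using d(1) by (rule tendstoD)
  moreover have "\<forall>\<^sub>F \<theta> in at_right (0::real). 0 < \<theta> \<and> \<theta> < pi"
    unfolding eventually_at_right_field by (intro exI[of _ pi]) auto
  ultimately have "\<forall>\<^sub>F \<theta> in at_right 0. dist (b \<theta>) (b 0) < d \<and> 0 < \<theta> \<and> \<theta> < pi" by eventually_elim simp
  then obtain \<theta> where \<theta>: "dist (b \<theta>) (b 0) < d" "0 < \<theta>" "\<theta> < pi"
    using eventually_happens'[OF trivial_limit_at_right_real] by blast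
  have "sin \<theta> \<noteq> 0" using sin_gt_zero[OF \<theta>(2,3)] by simp
  moreover have "energy \<Omega> I v a \<le> energy \<Omega> I v (b \<theta>)"
    using \<theta>(1) by (intro d(2) vL mb) (simp add: norm_Pair dist_norm b_def norm_L2_def)
  ultimately show False using lower[of \<theta>] by simp
qed

end

theorem proposition2p3:
  fixes \<Omega> :: "(real^3) set" and \<nu> :: real and I_B I :: "real^3^3" and lam :: "real^3"
  assumes domain: "bounded_C3_domain \<Omega>"
    and viscosity: "\<nu> > 0"
    and body_symmetric: "transpose I_B = I_B"
    and body_posdef: "\<And>y. y \<noteq> 0 \<Longrightarrow> (I_B *v y) \<bullet> y > 0"
    and total_inertia: "I = I_B + fluid_inertia \<Omega>"
    and principal_axes: "I = diag_matrix lam"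
  shows
    \<comment> \<open>(a)\<close>
    "(\<forall>T>0. \<forall>v a p v0 a0. solution_on \<Omega> \<nu> I T v a p v0 a0 \<longrightarrow>
        (\<forall>t\<in>{0..T}. norm (I *v a t) = norm (I *v a0)))
    \<and>
    \<comment> \<open>(b)\<close>
    (\<forall>T>0. \<forall>v a p v0 a0. solution_on \<Omega> \<nu> I T v a p v0 a0 \<longrightarrow> \<not> constant_on_time \<Omega> T v a \<longrightarrow>
        strict_antimono_on {0..T} (\<lambda>t. energy \<Omega> I (v t) (a t)))
    \<and>
    \<comment> \<open>(c)\<close>
    (equilibria \<Omega> \<nu> I =
        {(v, a). v \<in> zero_L2 \<Omega> \<and>
           (\<exists>l\<in>{lam $ 1, lam $ 2, lam $ 3}. a \<in> null_space (mat l - I))}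
     \<and> (\<forall>(v, a)\<in>equilibria \<Omega> \<nu> I. \<not> (v \<in> zero_L2 \<Omega> \<and> a = 0) \<longleftrightarrow> a \<noteq> 0)
     \<and> (\<forall>(v, a)\<in>equilibria \<Omega> \<nu> I. \<forall>p. \<forall>T>0.
          solution_on \<Omega> \<nu> I T (\<lambda>_. v) (\<lambda>_. a) p v a \<longrightarrow>
          (AE t in lebesgue_on {0<..<T}. \<exists>c. AE x in lebesgue_on \<Omega>. p t x = c))
     \<and> (lam $ 1 = lam $ 2 \<and> lam $ 2 = lam $ 3 \<longrightarrow> equilibria \<Omega> \<nu> I = zero_L2 \<Omega> \<times> UNIV)
     \<and> (\<forall>i j k. {i, j, k} = (UNIV :: 3 set) \<and> lam $ i \<noteq> lam $ j \<and> lam $ j = lam $ k \<longrightarrow>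
          equilibria \<Omega> \<nu> I = (\<Union>l\<in>{i, j}. zero_L2 \<Omega> \<times> null_space (mat (lam $ l) - I)))
     \<and> (lam $ 1 \<noteq> lam $ 2 \<and> lam $ 2 \<noteq> lam $ 3 \<and> lam $ 1 \<noteq> lam $ 3 \<longrightarrow>
          equilibria \<Omega> \<nu> I = (\<Union>j\<in>UNIV. zero_L2 \<Omega> \<times> null_space (mat (lam $ j) - I))))
    \<and>
    \<comment> \<open>(d)\<close>
    (\<forall>M0. critical_points \<Omega> I M0 = {(v, a) \<in> equilibria \<Omega> \<nu> I. momentum I a = M0})
    \<and>
    \<comment> \<open>(e)\<close>
    (\<forall>M0 v a l. M0 \<noteq> 0 \<longrightarrow> (v, a) \<in> critical_points \<Omega> I M0 \<longrightarrow> v \<in> zero_L2 \<Omega> \<longrightarrow>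
        I *v a = l *\<^sub>R a \<longrightarrow> constrained_local_min \<Omega> I M0 v a \<longrightarrow>
        l = Max {lam $ 1, lam $ 2, lam $ 3})"
proof -
  interpret fluid_body \<Omega> \<nu> I_B I lam
    using domain viscosity body_posdef total_inertia principal_axes
    by unfold_locales (auto simp: bounded_C3_domain_def)
  have a_init: "a 0 = a0" if "solution_on \<Omega> \<nu> I T v a p v0 a0" for T v a p v0 a0
    using that by (simp add: solution_on_def)
  show ?thesis
  proof (intro conjI)
    show "\<forall>T>0. \<forall>v a p v0 a0. solution_on \<Omega> \<nu> I T v a p v0 a0 \<longrightarrow>
        (\<forall>t\<in>{0..T}. norm (I *v a t) = norm (I *v a0))"
    proof (intro allI impI ballI)
      fix T v a p v0 a0 t assume T: "0 < T" and sol: "solution_on \<Omega> \<nu> I T v a p v0 a0" and t: "t \<in> {0..T}"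
      obtain v' a' w' where "fluid_solution \<Omega> \<nu> I_B I lam T v v' a a' w' p"
        by (rule solution_on_imp_fluid_solution[OF sol T]) (rule that)
      from fluid_solution.momentum_conserved[OF this t]
      show "norm (I *v a t) = norm (I *v a0)" by (simp add: a_init[OF sol])
    qed
    show "\<forall>T>0. \<forall>v a p v0 a0. solution_on \<Omega> \<nu> I T v a p v0 a0 \<longrightarrow> \<not> constant_on_time \<Omega> T v a \<longrightarrow>
        strict_antimono_on {0..T} (\<lambda>t. energy \<Omega> I (v t) (a t))"
    proof (intro allI impI)
      fix T v a p v0 a0 assume T: "0 < T" and sol: "solution_on \<Omega> \<nu> I T v a p v0 a0" and nc: "\<not> constant_on_time \<Omega> T v a"
      obtain v' a' w' where "fluid_solution \<Omega> \<nu> I_B I lam T v v' a a' w' p"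
        by (rule solution_on_imp_fluid_solution[OF sol T]) (rule that)
      then show "strict_antimono_on {0..T} (\<lambda>t. energy \<Omega> I (v t) (a t))"
        using nc by (rule fluid_solution.energy_strictly_decreasing)
    qed
    show "equilibria \<Omega> \<nu> I = {(v, a). v \<in> zero_L2 \<Omega> \<and> (\<exists>l\<in>{lam $ 1, lam $ 2, lam $ 3}. a \<in> null_space (mat l - I))}"
      unfolding equilibria_eq lam_range by auto
    show "\<forall>(v, a)\<in>equilibria \<Omega> \<nu> I. \<not> (v \<in> zero_L2 \<Omega> \<and> a = 0) \<longleftrightarrow> a \<noteq> 0"
      by (auto simp: equilibria_iff)
    show "\<forall>(v, a)\<in>equilibria \<Omega> \<nu> I. \<forall>p. \<forall>T>0. solution_on \<Omega> \<nu> I T (\<lambda>_. v) (\<lambda>_. a) p v a \<longrightarrow>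
          (AE t in lebesgue_on {0<..<T}. \<exists>c. AE x in lebesgue_on \<Omega>. p t x = c)"
      using stationary_solution(3) by blast
    show "lam $ 1 = lam $ 2 \<and> lam $ 2 = lam $ 3 \<longrightarrow> equilibria \<Omega> \<nu> I = zero_L2 \<Omega> \<times> UNIV"
    proof
      assume eq: "lam $ 1 = lam $ 2 \<and> lam $ 2 = lam $ 3"
      then have "lam $ i = lam $ 1" for i using exhaust_3[of i] by auto
      then have "a \<in> null_space (mat (lam $ 1) - I)" for a by (simp add: null_space_iff vec_eq_iff I_nth)
      then show "equilibria \<Omega> \<nu> I = zero_L2 \<Omega> \<times> UNIV" unfolding equilibria_eq by auto
    qed
    show "\<forall>i j k. {i, j, k} = (UNIV :: 3 set) \<and> lam $ i \<noteq> lam $ j \<and> lam $ j = lam $ k \<longrightarrow>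
          equilibria \<Omega> \<nu> I = (\<Union>l\<in>{i, j}. zero_L2 \<Omega> \<times> null_space (mat (lam $ l) - I))"
    proof (intro allI impI)
      fix i j k :: 3 assume h: "{i, j, k} = UNIV \<and> lam $ i \<noteq> lam $ j \<and> lam $ j = lam $ k"
      show "equilibria \<Omega> \<nu> I = (\<Union>l\<in>{i, j}. zero_L2 \<Omega> \<times> null_space (mat (lam $ l) - I))"
        \<comment> \<open>The union over all indices is rewritten as one over {i, j, k}, in which
          \<open>k\<close> repeats the null space of \<open>j\<close>.\<close>
        unfolding equilibria_eq conjunct1[OF h, symmetric] using h by auto
    qed
    show "lam $ 1 \<noteq> lam $ 2 \<and> lam $ 2 \<noteq> lam $ 3 \<and> lam $ 1 \<noteq> lam $ 3 \<longrightarrow>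
          equilibria \<Omega> \<nu> I = (\<Union>j\<in>UNIV. zero_L2 \<Omega> \<times> null_space (mat (lam $ j) - I))"
      using equilibria_eq by simp
    show "\<forall>M0. critical_points \<Omega> I M0 = {(v, a) \<in> equilibria \<Omega> \<nu> I. momentum I a = M0}"
      using critical_points_eq by simp
    show "\<forall>M0 v a l. M0 \<noteq> 0 \<longrightarrow> (v, a) \<in> critical_points \<Omega> I M0 \<longrightarrow> v \<in> zero_L2 \<Omega> \<longrightarrow>
        I *v a = l *\<^sub>R a \<longrightarrow> constrained_local_min \<Omega> I M0 v a \<longrightarrow> l = Max {lam $ 1, lam $ 2, lam $ 3}"
      using minimum_eigenvalue by blast
  qed
qed

end
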